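(* Suppose that $Z\subset X$ is a nonempty closed subset with metric given by the restriction of the metric of $X$. Suppose that $X$ is a geodesic metric space such that the Assouad-Nagata dimension $\dim_{\text{AN}}(X)$ of $X$ is finite. Suppose that one of the following is true: (1) $Z$ is Lipschitz $n$--connected. (2) $X$ is Lipschitz $n$--connected, and if $X_p,p\in P$ are the connected components of $X\smallsetminus Z$, then the sets $H_p=\partial X_p$ are Lipschitz $n$--connected with uniformly bounded implicit constant. Then $Z$ is undistorted up to dimension $n+1$.
   Context: A metric space $Y$ is Lipschitz $n$--connected if there is a constant $c$ such that for every $k\le n$, every Lipschitz map $f\colon S^k\to Y$ extends to a Lipschitz map $D^{k+1}\to Y$ whose Lipschitz constant is at most $c$ times the Lipschitz constant of $f$. "$Z$ is undistorted up to dimension $n+1$" means that for every Lipschitz $m$--cycle $\alpha$ in $Z$ with $m\le n$, the filling volume of $\alpha$ in $Z$ is bounded above, up to a uniform multiplicative constant, by its filling volume in $X$. That is, $\mathrm{FV}_Z(\alpha)\lesssim \mathrm{FV}_X(\alpha)$. *)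

theory Defs
  imports "HOL-Analysis.Analysis"
begin

text \<open>Points of R^(k+1) are functions nat => real vanishing at indices > k.\<close>

definition edist :: "nat \<Rightarrow> (nat \<Rightarrow> real) \<Rightarrow> (nat \<Rightarrow> real) \<Rightarrow> real" where
  "edist k x y = sqrt (\<Sum>i\<le>k. (x i - y i)^2)"

definition sphere_k :: "nat \<Rightarrow> (nat \<Rightarrow> real) set" where
  "sphere_k k = {x. (\<forall>i>k. x i = 0) \<and> (\<Sum>i\<le>k. (x i)^2) = 1}"

definition disk_k1 :: "nat \<Rightarrow> (nat \<Rightarrow> real) set" where
  "disk_k1 k = {x. (\<forall>i>k. x i = 0) \<and> (\<Sum>i\<le>k. (x i)^2) \<le> 1}"

definition simplex_k :: "nat \<Rightarrow> (nat \<Rightarrow> real) set" where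
  "simplex_k k = {x. (\<forall>i>k. x i = 0) \<and> (\<forall>i\<le>k. 0 \<le> x i) \<and> (\<Sum>i\<le>k. x i) = 1}"

definition lip_on_k :: "nat \<Rightarrow> real \<Rightarrow> (nat \<Rightarrow> real) set \<Rightarrow> ((nat \<Rightarrow> real) \<Rightarrow> 'a::metric_space) \<Rightarrow> bool" where
  "lip_on_k k L A f \<longleftrightarrow> 0 \<le> L \<and> (\<forall>x\<in>A. \<forall>y\<in>A. dist (f x) (f y) \<le> L * edist k x y)"

definition lip_connected_const :: "'a::metric_space set \<Rightarrow> nat \<Rightarrow> real \<Rightarrow> bool" where
  "lip_connected_const Y n c \<longleftrightarrow>
     (\<forall>k\<le>n. \<forall>f L. f ` sphere_k k \<subseteq> Y \<and> lip_on_k k L (sphere_k k) f \<longrightarrow>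
        (\<exists>g. g ` disk_k1 k \<subseteq> Y \<and> (\<forall>x\<in>sphere_k k. g x = f x) \<and> lip_on_k k (c * L) (disk_k1 k) g))"

definition lip_connected :: "'a::metric_space set \<Rightarrow> nat \<Rightarrow> bool" where
  "lip_connected Y n \<longleftrightarrow> (\<exists>c. lip_connected_const Y n c)"

definition geodesic_space :: "'a::metric_space itself \<Rightarrow> bool" where
  "geodesic_space _ \<longleftrightarrow> (\<forall>x y::'a. \<exists>\<gamma>::real \<Rightarrow> 'a. \<gamma> 0 = x \<and> \<gamma> (dist x y) = y \<and>
      (\<forall>s\<in>{0..dist x y}. \<forall>t\<in>{0..dist x y}. dist (\<gamma> s) (\<gamma> t) = \<bar>s - t\<bar>))"

definition AN_dim_le :: "'a::metric_space itself \<Rightarrow> nat \<Rightarrow> bool" where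
  "AN_dim_le _ n \<longleftrightarrow> (\<exists>c>0. \<forall>s>0. \<exists>\<U>::'a set set. \<Union>\<U> = UNIV \<and>
      (\<forall>U\<in>\<U>. bounded U \<and> diameter U \<le> c * s) \<and>
      (\<forall>B. bounded B \<and> diameter B \<le> s \<longrightarrow>
          finite {U\<in>\<U>. U \<inter> B \<noteq> {}} \<and> card {U\<in>\<U>. U \<inter> B \<noteq> {}} \<le> n + 1))"

definition AN_dim_finite :: "'a::metric_space itself \<Rightarrow> bool" where
  "AN_dim_finite T \<longleftrightarrow> (\<exists>n. AN_dim_le T n)"

definition hausdorff_pre :: "nat \<Rightarrow> real \<Rightarrow> 'a::metric_space set \<Rightarrow> ennreal" where
  "hausdorff_pre k \<delta> A = Inf {(\<Sum>i. if C i = {} then 0 else ennreal (diameter (C i)) ^ k) | C.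
       A \<subseteq> (\<Union>i. C i) \<and> (\<forall>i. bounded (C i) \<and> diameter (C i) \<le> \<delta>)}"

definition hausdorff_outer :: "nat \<Rightarrow> 'a::metric_space set \<Rightarrow> ennreal" where
  "hausdorff_outer k A = (SUP \<delta>\<in>{0<..}. hausdorff_pre k \<delta> A)"

text \<open>k-dimensional Hausdorff measure on the Borel sets (unnormalized; normalizing
  constants are irrelevant for the statement, which is up to multiplicative constants).\<close>
definition hausdorff_measure :: "nat \<Rightarrow> 'a::metric_space measure" where
  "hausdorff_measure k = measure_of UNIV (sets borel) (hausdorff_outer k)"

definition lip_simplex :: "'a::metric_space set \<Rightarrow> nat \<Rightarrow> ((nat \<Rightarrow> real) \<Rightarrow> 'a) \<Rightarrow> bool" where
  "lip_simplex S k \<sigma> \<longleftrightarrow> (\<exists>L. lip_on_k k L (simplex_k k) \<sigma>) \<and> \<sigma> ` simplex_k k \<subseteq> S \<and>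
     (\<forall>x. x \<notin> simplex_k k \<longrightarrow> \<sigma> x = undefined)"

type_synonym 'a chain = "((nat \<Rightarrow> real) \<Rightarrow> 'a) \<Rightarrow> int"

definition supp :: "'a chain \<Rightarrow> ((nat \<Rightarrow> real) \<Rightarrow> 'a) set" where
  "supp c = {\<sigma>. c \<sigma> \<noteq> 0}"

definition lip_chain :: "'a::metric_space set \<Rightarrow> nat \<Rightarrow> 'a chain \<Rightarrow> bool" where
  "lip_chain S k c \<longleftrightarrow> finite (supp c) \<and> (\<forall>\<sigma>\<in>supp c. lip_simplex S k \<sigma>)"

definition face_map :: "nat \<Rightarrow> (nat \<Rightarrow> real) \<Rightarrow> (nat \<Rightarrow> real)" where
  "face_map i x = (\<lambda>j. if j < i then x j else if j = i then 0 else x (j - 1))"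

definition face :: "nat \<Rightarrow> nat \<Rightarrow> ((nat \<Rightarrow> real) \<Rightarrow> 'a) \<Rightarrow> ((nat \<Rightarrow> real) \<Rightarrow> 'a)" where
  "face k i \<sigma> = (\<lambda>x. if x \<in> simplex_k (k - 1) then \<sigma> (face_map i x) else undefined)"

definition boundary :: "nat \<Rightarrow> 'a chain \<Rightarrow> 'a chain" where
  "boundary k c = (\<lambda>\<tau>. \<Sum>\<sigma>\<in>supp c. \<Sum>i\<le>k. if face k i \<sigma> = \<tau> then (-1)^i * c \<sigma> else 0)"

definition lip_cycle :: "'a::metric_space set \<Rightarrow> nat \<Rightarrow> 'a chain \<Rightarrow> bool" where
  "lip_cycle S m c \<longleftrightarrow> lip_chain S m c \<and> (0 < m \<longrightarrow> boundary m c = (\<lambda>_. 0))"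

definition multiplicity :: "nat \<Rightarrow> ((nat \<Rightarrow> real) \<Rightarrow> 'a) \<Rightarrow> 'a \<Rightarrow> ennreal" where
  "multiplicity k \<sigma> y = (let P = {x\<in>simplex_k k. \<sigma> x = y} in
     if finite P then of_nat (card P) else \<infinity>)"

definition simplex_volume :: "nat \<Rightarrow> ((nat \<Rightarrow> real) \<Rightarrow> 'a::metric_space) \<Rightarrow> ennreal" where
  "simplex_volume k \<sigma> = (\<integral>\<^sup>+ y. multiplicity k \<sigma> y \<partial>hausdorff_measure k)"

definition mass :: "nat \<Rightarrow> 'a::metric_space chain \<Rightarrow> ennreal" where
  "mass k c = (\<Sum>\<sigma>\<in>supp c. ennreal (real_of_int \<bar>c \<sigma>\<bar>) * simplex_volume k \<sigma>)"

definition filling_volume :: "'a::metric_space set \<Rightarrow> nat \<Rightarrow> 'a chain \<Rightarrow> ennreal" where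
  "filling_volume S m \<alpha> = Inf {mass (Suc m) \<beta> | \<beta>. lip_chain S (Suc m) \<beta> \<and> boundary (Suc m) \<beta> = \<alpha>}"

text \<open>Z is undistorted (in the whole space X = UNIV) up to dimension n+1.\<close>
definition undistorted_up_to :: "'a::metric_space set \<Rightarrow> nat \<Rightarrow> bool" where
  "undistorted_up_to Z n \<longleftrightarrow> (\<exists>C::real. 0 \<le> C \<and> (\<forall>m\<le>n. \<forall>\<alpha>. lip_cycle Z m \<alpha> \<longrightarrow>
       filling_volume Z m \<alpha> \<le> ennreal C * filling_volume (UNIV::'a set) m \<alpha>))"

end

theory Submission
  imports Defs "HOL-Library.Poly_Mapping"
begin

text \<open>Hypothesis (2) implies (1): a Lipschitz sphere in \<open>Z\<close> bounds a Lipschitz disk in \<open>X\<close>, and the part of the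
  disk lying in a complementary component is replaced by a Lipschitz extension with values in the frontier of
  that component. Under (1), let \<open>\<beta>\<close> fill an \<open>m\<close>-cycle \<open>\<alpha>\<close> of \<open>Z\<close> in \<open>X\<close>, and subdivide \<open>\<alpha>\<close> to mesh \<open>\<epsilon>\<close>. Finite
  Assouad-Nagata dimension yields a partition of unity of bounded multiplicity whose pieces have size
  comparable to \<open>max \<epsilon> (dist x Z)\<close>; it maps \<open>\<beta>\<close> to a simplicial complex whose \<open>(m+1)\<close>-skeleton is sent to \<open>Z\<close> by
  Lipschitz connectivity. Pushing to the skeleton after reweighting the barycentric coordinates by random
  factors in \<open>[1,2]\<close> costs on average a bounded factor of volume, as the inverse distance to the singular set has
  bounded \<open>(m+1)\<close>-st moment. A prism and cones repair the boundary; they cost \<open>O(\<epsilon>^(m+1))\<close> per simplex of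
  the subdivision, which tends to 0 in total.\<close>

text \<open>Volume is Hausdorff measure counted with multiplicity, so there is no Jacobian to work
  with. Areas are compared over small dyadic cells instead, through pointwise bounds
  \<open>dist (g x) (g y) <= lmb * dist (f x) (f y)\<close> with \<open>lmb\<close> fixed on the
  cell; a supremum over cell partitions turns them into bounds of volume.

  All simplices have to be pushed by the same map, otherwise their common faces no longer cancel.
  Hence the weights are not chosen simplex by simplex: one vector is found for the whole chain by
  averaging a total cost over a finite grid. Cancellation also requires that a filled simplex depend
  on its faces alone, so fillings are fixed by Hilbert choice, with bounds valid for all Lipschitz
  constants simultaneously.

  The repair at the boundary vanishes in the limit only if mesh \<open>O(1/M)\<close> is reached
  with \<open>O(M^m)\<close> pieces. Iterated barycentric subdivision does not guarantee this: in
  dimension 2 each step multiplies the pieces by 6 and is only sure to shrink the mesh by the factor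
  2/3. The subdivision used here sweeps the boundary towards a vertex in \<open>M\<close>
  layers.\<close>

type_synonym pt = "nat \<Rightarrow> real"

abbreviation "Sx \<equiv> simplex_k"

section \<open>Lipschitz maps in l1 coordinates\<close>

definition l1 :: "nat => pt => pt => real" where
 "l1 k x y = (SUM i<=k. \<bar>x i - y i\<bar>)"

text \<open>The l1 distance stands in for \<open>edist\<close>: being a sum over coordinates, it
  behaves exactly under projections, reindexing and insertion of zeros. The price is one factor
  \<open>Suc k\<close> when a constant is translated back to the Euclidean distance.\<close>

definition lipl :: "nat => real => pt set => (pt => 'a::metric_space) => bool" where
 "lipl k L A f \<longleftrightarrow> 0 <= L & (ALL x:A. ALL y:A. dist (f x) (f y) <= L * l1 k x y)"

lemma l1_nonneg [simp]: "0 <= l1 k x y"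
 by (simp add: l1_def sum_nonneg)

lemma l1_same [simp]: "l1 k x x = 0"
 by (simp add: l1_def)

lemma l1_commute: "l1 k x y = l1 k y x"
 by (simp add: l1_def abs_minus_commute)

lemma l1_triangle: "l1 k x z <= l1 k x y + l1 k y z"
 unfolding l1_def sum.distrib[symmetric] by (rule sum_mono) linarith

lemma l1_component: "i <= k ==> \<bar>x i - y i\<bar> <= l1 k x y"
 unfolding l1_def by (rule member_le_sum) auto

lemma l1_le_bound:
 assumes "!!i. i <= k ==> \<bar>x i - y i\<bar> <= s"
 shows "l1 k x y <= real (Suc k) * s"
proof -
 have "l1 k x y <= (SUM i<=k. s)" unfolding l1_def using assms by (intro sum_mono) auto
 thus ?thesis by simp
qed

lemma edist_le_l1: "edist k x y <= l1 k x y"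
 using L2_set_le_sum_abs[of "%i. x i - y i" "{..k}"] by (simp add: edist_def l1_def L2_set_def)

lemma l1_le_edist: "l1 k x y <= real (Suc k) * edist k x y"
proof (rule l1_le_bound)
 fix i assume "i <= k"
 hence "(x i - y i)^2 <= (SUM i<=k. (x i - y i)^2)" by (intro member_le_sum) auto
 thus "\<bar>x i - y i\<bar> <= edist k x y" unfolding edist_def by (metis real_sqrt_abs real_sqrt_le_mono)
qed

lemma edist_nonneg [simp]: "0 <= edist k x y"
 by (simp add: edist_def sum_nonneg)

lemma lipl_imp_lip_on: "lipl k L A f ==> lip_on_k k (real (Suc k) * L) A f"
 unfolding lipl_def lip_on_k_def
proof (intro conjI ballI)
 assume a: "0 <= L & (ALL x:A. ALL y:A. dist (f x) (f y) <= L * l1 k x y)"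
 thus "0 <= real (Suc k) * L" by simp
 fix x y assume "x : A" "y : A"
 with a have "dist (f x) (f y) <= L * l1 k x y" by auto
 also have "... <= L*(real (Suc k) * edist k x y)" using a l1_le_edist by (intro mult_left_mono) auto
 finally show "dist (f x) (f y) <= real (Suc k) * L * edist k x y" by (simp add: mult_ac)
qed

lemma lip_on_imp_lipl: "lip_on_k k L A f ==> lipl k L A f"
 unfolding lipl_def lip_on_k_def by (meson edist_le_l1 mult_left_mono order_trans)

lemma lipl_mono: "lipl k L A f ==> B <= A ==> L <= M ==> lipl k M B f"
 unfolding lipl_def by (meson l1_nonneg mult_right_mono order_trans subsetD)

lemma lipl_cong: "(!!x. x : A ==> f x = g x) ==> lipl k L A f = lipl k L A g"
 unfolding lipl_def by auto

text \<open>For each pair of points the Lipschitz inequality is a closed condition on the constant,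
  so it passes to the infimum. Pairs at l1 distance 0 are treated apart because there the difference
  quotient gives no information.\<close>

lemma lipl_Inf:
 assumes "lipl k L A f"
 shows "lipl k (Inf {L. lipl k L A f}) A f"
proof -
 let ?S = "{L. lipl k L A f}"
 have ne: "?S ~= {}" and pos: "!!L. L : ?S ==> 0 <= L" using assms by (auto simp: lipl_def)
 have I0: "0 <= Inf ?S" using ne pos by (meson cInf_greatest)
 have "dist (f x) (f y) <= Inf ?S * l1 k x y" if "x : A" "y : A" for x y
 proof (cases "l1 k x y = 0")
  case True
  have "dist (f x) (f y) <= L * l1 k x y" using assms that by (auto simp: lipl_def)
  thus ?thesis using True by simp
 next
  case False
  hence p: "0 < l1 k x y" using l1_nonneg[of k x y] by linarith
  have "dist (f x) (f y)/l1 k x y <= Inf ?S"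
  proof (rule cInf_greatest[OF ne])
   fix L assume "L : ?S"
   hence "dist (f x) (f y) <= L * l1 k x y" using that by (auto simp: lipl_def)
   thus "dist (f x) (f y)/l1 k x y <= L" using p by (simp add: pos_divide_le_eq)
  qed
  thus ?thesis using p by (simp add: pos_divide_le_eq)
 qed
 thus ?thesis using I0 by (auto simp: lipl_def)
qed

text \<open>Extending with the optimal constant makes a single \<open>g\<close> serve every
  \<open>M\<close> at once. An extension can thus be chosen once per cell, before it is known which
  local constant will matter there.\<close>

lemma uniform_extension:
 assumes "lipl k L A f" and "0 <= C"
  and "!!M. lipl k M A f ==> EX g. P g & lipl k (C * M) B g"
 shows "EX g. P g & (ALL M. lipl k M A f --> lipl k (C * M) B g)"
proof -
 let ?I = "Inf {L. lipl k L A f}"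
 from lipl_Inf[OF assms(1)] assms(3) obtain g where g: "P g" "lipl k (C*?I) B g" by blast
 have "lipl k (C * M) B g" if "lipl k M A f" for M
 proof -
  have "?I <= M" using that by (intro cInf_lower) (auto simp: bdd_below_def lipl_def)
  thus ?thesis using g(2) assms(2) by (intro lipl_mono[OF g(2)]) (auto intro: mult_left_mono)
 qed
 thus ?thesis using g(1) by blast
qed

lemma lip_connected_constD:
 assumes "lip_connected_const Y n c" "k <= n" "f ` sphere_k k <= Y" "lip_on_k k L (sphere_k k) f"
 obtains g where "g ` disk_k1 k <= Y" "ALL x:sphere_k k. g x = f x" "lip_on_k k (c * L) (disk_k1 k) g"
 using assms(1)[unfolded lip_connected_const_def, rule_format, OF assms(2) conjI[OF assms(3,4)]]
 by (elim exE conjE)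

lemma lip_connected_const_nonneg:
 fixes Y :: "'a::metric_space set"
 assumes "lip_connected_const Y n c" and "Y ~= {}"
 shows "0 <= c"
proof -
 obtain y where y: "y : Y" using assms by auto
 have "lip_on_k 0 1 (sphere_k 0) (%_. y)" by (simp add: lip_on_k_def)
 moreover have "(%_. y) ` sphere_k 0 <= Y" using y by auto
 ultimately obtain g :: "pt => 'a" where "lip_on_k 0 (c*1) (disk_k1 0) g"
  using lip_connected_constD[OF assms(1) le0] by metis
 thus ?thesis by (auto simp: lip_on_k_def)
qed

lemma edist_triangle: "edist k x z <= edist k x y + edist k y z"
 using L2_set_triangle_ineq[of "%i. x i - y i" "%i. y i - z i" "{..k}"]
 by (simp add: edist_def L2_set_def)

section \<open>Extension from the boundary of a cube\<close>

definition cube :: "nat => pt set" where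
 "cube k = {x. (ALL i>k. x i = 0) & (ALL i<=k. \<bar>x i\<bar> <= 1)}"

definition cube_bd :: "nat => pt set" where
 "cube_bd k = {x : cube k. EX i<=k. \<bar>x i\<bar> = 1}"

definition supn :: "nat => pt => real" where
 "supn k x = Max ((%i. \<bar>x i\<bar>) ` {..k})"

lemma supn_ge: "i <= k ==> \<bar>x i\<bar> <= supn k x"
 unfolding supn_def by (intro Max_ge) auto

lemma supn_attained: "EX i<=k. \<bar>x i\<bar> = supn k x"
proof -
 have "supn k x : (%i. \<bar>x i\<bar>) ` {..k}" unfolding supn_def by (intro Max_in) auto
 thus ?thesis by auto
qed

lemma supn_lip: "\<bar>supn k x - supn k y\<bar> <= l1 k x y"
proof -
 obtain i where i: "i <= k" "\<bar>x i\<bar> = supn k x" using supn_attained by blast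
 obtain j where j: "j <= k" "\<bar>y j\<bar> = supn k y" using supn_attained by blast
 have "\<bar>y i\<bar> <= supn k y" "\<bar>x j\<bar> <= supn k x" "\<bar>x i - y i\<bar> <= l1 k x y" "\<bar>x j - y j\<bar> <= l1 k x y"
  using i j supn_ge l1_component by auto
 thus ?thesis using i j by linarith
qed

lemma supn_scale: "0 <= t ==> supn k (%i. t * x i) = t * supn k x"
proof -
 assume t: "0 <= t"
 obtain i where i: "i <= k" "\<bar>x i\<bar> = supn k x" using supn_attained by blast
 obtain j where j: "j <= k" "\<bar>t * x j\<bar> = supn k (%i. t * x i)" using supn_attained[of k "%i. t * x i"] by blast
 have "\<bar>t * x i\<bar> <= supn k (%i. t * x i)" by (rule supn_ge[OF i(1), where x="%i. t * x i"])
 moreover have "t*\<bar>x j\<bar> <= t * supn k x" using t j supn_ge by (intro mult_left_mono) auto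
 ultimately show ?thesis using i j t by (simp add: abs_mult)
qed

definition enorm :: "nat => pt => real" where
 "enorm k x = edist k x (%_. 0)"

lemma enorm_sq: "(enorm k x)^2 = (SUM i<=k. (x i)^2)"
 by (simp add: enorm_def edist_def sum_nonneg)

lemma enorm_nonneg [simp]: "0 <= enorm k x"
 by (simp add: enorm_def)

lemma enorm_scale: "0 <= t ==> enorm k (%i. t * x i) = t * enorm k x"
 by (simp add: enorm_def edist_def power_mult_distrib sum_distrib_left[symmetric] real_sqrt_mult)

lemma enorm_lip: "\<bar>enorm k x - enorm k y\<bar> <= l1 k x y"
proof -
 have "edist k y x = edist k x y" by (simp add: edist_def power2_commute)
 thus ?thesis using edist_triangle[of k x "%_. 0" y] edist_triangle[of k y "%_. 0" x] edist_le_l1[of k x y]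
  unfolding enorm_def by linarith
qed

lemma supn_le_enorm: "supn k x <= enorm k x"
proof -
 obtain i where i: "i <= k" "\<bar>x i\<bar> = supn k x" using supn_attained by blast
 have "(x i)^2 <= (SUM i<=k. (x i)^2)" using i by (intro member_le_sum) auto
 hence "sqrt ((x i)^2) <= enorm k x" unfolding enorm_def edist_def by (simp only: diff_zero real_sqrt_le_iff)
 thus ?thesis using i by simp
qed

lemma enorm_le_supn: "enorm k x <= real (Suc k) * supn k x"
proof -
 have "enorm k x <= l1 k x (%_. 0)" unfolding enorm_def by (rule edist_le_l1)
 also have "... <= real (Suc k) * supn k x" by (rule l1_le_bound) (simp add: supn_ge)
 finally show ?thesis .
qed

text \<open>Split x/a - y/b as (x - y)/a + y (b - a)/(a b): dividing by a quantity bounded below by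
  \<open>r\<close> is Lipschitz as soon as \<open>y\<close> is comparable with its own denominator.
  The same estimate serves the radial projections here, the push to the skeleton, and the
  normalisation of the partition of unity.\<close>

lemma l1_normalize:
 assumes g: "0 < r" "r <= a" "r <= b" and ab: "\<bar>a - b\<bar> <= l1 k x y" and y: "l1 k y (%_. 0) <= m * b"
 shows "l1 k (%i. x i/a) (%i. y i/b) <= (1 + m)/r * l1 k x y"
proof -
 have pos: "0 < a" "0 < b" using g by auto
 have m: "0 <= m" using y pos l1_nonneg[of k y "%_. 0"] by (smt (verit) mult_neg_pos)
 have 1: "\<bar>x i/a - y i/b\<bar> <= \<bar>x i - y i\<bar>/r + \<bar>y i\<bar> * l1 k x y/(a * b)" for i
 proof -
  have "x i/a - y i/b = (x i - y i)/a + y i*(b - a)/(a * b)"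
   using pos by (simp add: field_simps)
  also have "\<bar>...\<bar> <= \<bar>x i - y i\<bar>/a + \<bar>y i\<bar>*\<bar>b - a\<bar>/(a * b)"
   using pos by (intro order_trans[OF abs_triangle_ineq]) (simp add: abs_mult)
  also have "\<bar>x i - y i\<bar>/a <= \<bar>x i - y i\<bar>/r" using g pos by (intro divide_left_mono) auto
  also have "\<bar>y i\<bar>*\<bar>b - a\<bar>/(a * b) <= \<bar>y i\<bar> * l1 k x y/(a * b)"
   using pos ab by (intro divide_right_mono mult_left_mono) auto
  finally show ?thesis by simp
 qed
 have "l1 k (%i. x i/a) (%i. y i/b) <= (SUM i<=k. \<bar>x i - y i\<bar>/r + \<bar>y i\<bar> * l1 k x y/(a * b))"
  unfolding l1_def[of k "%i. x i/a"] by (intro sum_mono 1)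
 also have "... = l1 k x y/r + l1 k y (%_. 0) * l1 k x y/(a * b)"
  by (simp add: sum.distrib l1_def sum_divide_distrib sum_distrib_right)
 also have "l1 k y (%_. 0) * l1 k x y/(a * b) <= (m * b) * l1 k x y/(a * b)"
  using pos y by (intro divide_right_mono mult_right_mono) auto
 also have "(m * b) * l1 k x y/(a * b) = m * l1 k x y/a" using pos by simp
 also have "... <= m * l1 k x y/r" using g pos m by (intro divide_left_mono) auto
 finally show ?thesis by (simp add: distrib_right add_divide_distrib)
qed

text \<open>Dividing by the sup norm (\<open>P\<close>) carries the round sphere to the boundary of
  the cube, and \<open>R\<close> retracts the cube radially onto the ball. The part of the cube
  outside the ball lands on the sphere, where the extension equals \<open>f\<close> composed with
  \<open>P\<close>, so it is constant along rays there and keeps the boundary values.\<close>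

lemma cube_extension:
 assumes Y: "lip_connected_const Y n c" and kn: "k <= n" and f: "f ` cube_bd k <= Y"
  and lf: "lipl k L (cube_bd k) f"
 shows "EX g. (g ` cube k <= Y & (ALL x:cube_bd k. g x = f x)) & lipl k (8 * real (Suc k)^4*\<bar>c\<bar> * L) (cube k) g"
proof -
 define d where "d = real (Suc k)"
 have d1: "1 <= d" by (simp add: d_def)
 define P where "P = (%u::nat=>real. (%i. u i/supn k u))"
 define R where "R = (%v::nat=>real. (%i. v i/max (enorm k v) 1))"
 have L0: "0 <= L" using lf by (simp add: lipl_def)
 have en1: "enorm k u = 1" if "u : sphere_k k" for u
  using that enorm_sq[of k u] enorm_nonneg[of k u] by (simp add: sphere_k_def power2_eq_1_iff)
 have sup_low: "1/d <= supn k u" if "u : sphere_k k" for u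
  using en1[OF that] enorm_le_supn[of k u] d1 unfolding d_def[symmetric] by (simp add: field_simps)
 have Pin: "P u : cube_bd k" if u: "u : sphere_k k" for u
 proof -
  have s: "0 < supn k u" using sup_low[OF u] d1 by (meson divide_pos_pos less_le_trans zero_less_one)
  obtain i where i: "i <= k" "\<bar>u i\<bar> = supn k u" using supn_attained by blast
  have "\<bar>P u i\<bar> = 1" using i s by (simp add: P_def)
  moreover have "\<bar>P u j\<bar> <= 1" if "j <= k" for j using supn_ge[OF that, of u] s by (simp add: P_def)
  moreover have "P u j = 0" if "j > k" for j using that u by (simp add: P_def sphere_k_def)
  ultimately show ?thesis using i by (auto simp: cube_bd_def cube_def)
 qed
 have l1n: "l1 k x (%_. 0) <= d * enorm k x" for x unfolding d_def enorm_def by (rule l1_le_edist)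
 have l1s: "l1 k x (%_. 0) <= d * supn k x" for x unfolding d_def by (rule l1_le_bound) (simp add: supn_ge)
 have Plip: "l1 k (P u) (P v) <= (1 + d)/(1/d) * l1 k u v" if "u : sphere_k k" "v : sphere_k k" for u v
  unfolding P_def using sup_low that d1 supn_lip l1s by (intro l1_normalize) auto
 have Rlip: "l1 k (R u) (R v) <= (1 + d)/1 * l1 k u v" for u v
  unfolding R_def
 proof (rule l1_normalize)
  show "\<bar>max (enorm k u) 1 - max (enorm k v) 1\<bar> <= l1 k u v" using enorm_lip[of k u v] by linarith
  show "l1 k v (%_. 0) <= d * max (enorm k v) 1"
   using l1n[of v] d1 by (smt (verit) mult_left_mono)
 qed auto
 have c2: "(1 + d)/(1/d) <= 2 * d^2" using d1 by (simp add: power2_eq_square field_simps)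
 have fP: "lipl k (2 * d^2 * L) (sphere_k k) (f \<circ> P)"
  unfolding lipl_def
 proof (intro conjI ballI)
  show "0 <= 2 * d^2 * L" using L0 by simp
  fix u v assume uv: "u : sphere_k k" "v : sphere_k k"
  have "dist ((f \<circ> P) u) ((f \<circ> P) v) <= L * l1 k (P u) (P v)" using lf Pin uv by (auto simp: lipl_def)
  also have "... <= L*(2 * d^2 * l1 k u v)"
   using Plip[OF uv] mult_right_mono[OF c2 l1_nonneg, of k u v] L0 by (intro mult_left_mono) linarith+
  finally show "dist ((f \<circ> P) u) ((f \<circ> P) v) <= 2 * d^2 * L * l1 k u v" by (simp add: mult_ac)
 qed
 have "lip_on_k k (d*(2 * d^2 * L)) (sphere_k k) (f \<circ> P)" using lipl_imp_lip_on[OF fP] by (simp add: d_def)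
 moreover have "(f \<circ> P) ` sphere_k k <= Y" using Pin f by auto
 ultimately obtain g where g: "g ` disk_k1 k <= Y" "ALL x:sphere_k k. g x = (f \<circ> P) x"
   "lip_on_k k (c*(d*(2 * d^2 * L))) (disk_k1 k) g"
  using lip_connected_constD[OF Y kn] by metis
 have gl: "lipl k (c*(d*(2 * d^2 * L))) (disk_k1 k) g" by (rule lip_on_imp_lipl[OF g(3)])
 have Rin: "R v : disk_k1 k" if "v : cube k" for v
 proof -
  have "enorm k (R v) <= 1"
   using enorm_scale[of "1/max (enorm k v) 1" k v] by (simp add: R_def)
  hence "(enorm k (R v))^2 <= 1" by (simp add: power_le_one)
  thus ?thesis using that by (auto simp: enorm_sq disk_k1_def cube_def R_def)
 qed
 \<comment> \<open>On the boundary of the cube the sup norm is 1, hence the Euclidean norm is at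
   least 1 and \<open>R\<close> is division by it; \<open>P\<close> undoes this division.\<close>
 have PR: "P (R v) = v & R v : sphere_k k" if v: "v : cube_bd k" for v
 proof -
  obtain i where "i <= k" "\<bar>v i\<bar> = 1" using v by (auto simp: cube_bd_def)
  hence "1 <= supn k v" using supn_ge by metis
  moreover have "supn k v <= 1" using v supn_attained[of k v] by (auto simp: cube_bd_def cube_def)
  ultimately have s1: "supn k v = 1" by simp
  hence e1: "1 <= enorm k v" using supn_le_enorm[of k v] by simp
  hence Rv: "R v = (%i. (1/enorm k v) * v i)" by (simp add: R_def max_def)
  have "supn k (R v) = 1/enorm k v" unfolding Rv using supn_scale[of "1/enorm k v" k v] s1 by simp
  hence "P (R v) = v" using e1 by (auto simp: P_def Rv)
  moreover have "enorm k (R v) = 1" unfolding Rv using e1 enorm_scale[of "1/enorm k v" k v] by simp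
  hence "(SUM i<=k. (R v i)^2) = 1" using enorm_sq[of k "R v"] by simp
  hence "R v : sphere_k k" using v by (auto simp: sphere_k_def R_def cube_bd_def cube_def)
  ultimately show ?thesis by simp
 qed
 have "lipl k (8 * d^4*\<bar>c\<bar> * L) (cube k) (g \<circ> R)"
  unfolding lipl_def
 proof (intro conjI ballI)
  show "0 <= 8 * d^4*\<bar>c\<bar> * L" using L0 d1 by simp
  fix u v assume uv: "u : cube k" "v : cube k"
  have "dist ((g \<circ> R) u) ((g \<circ> R) v) <= (c*(d*(2 * d^2 * L))) * l1 k (R u) (R v)"
   using gl Rin uv by (auto simp: lipl_def)
  also have "... <= (\<bar>c\<bar>*(d*(2 * d^2 * L)))*((1 + d) * l1 k u v)"
   using Rlip[of u v] L0 d1 by (intro mult_mono mult_right_mono) auto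
  also have "... <= (\<bar>c\<bar>*(d*(2 * d^2 * L)))*((2 * d) * l1 k u v)"
   using d1 L0 by (intro mult_left_mono mult_right_mono) auto
  also have "... = 4 * d^4*\<bar>c\<bar> * L * l1 k u v" by (simp add: power2_eq_square power4_eq_xxxx)
  also have "... <= 8 * d^4*\<bar>c\<bar> * L * l1 k u v" using d1 L0 by (intro mult_right_mono) auto
  finally show "dist ((g \<circ> R) u) ((g \<circ> R) v) <= 8 * d^4*\<bar>c\<bar> * L * l1 k u v" .
 qed
 moreover have "(g \<circ> R) ` cube k <= Y" using Rin g(1) by auto
 moreover have "ALL x:cube_bd k. (g \<circ> R) x = f x" using PR g(2) by auto
 ultimately show ?thesis unfolding d_def by blast
qed

section \<open>Cells of a cubical grid\<close>

definition free :: "nat => real => pt => nat set" where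
 "free N s x = {i. i <= N & x i/s ~: \<int>}"

text \<open>The smallest closed cell of the grid of mesh \<open>s\<close> that contains
  \<open>x\<close>. Coordinates outside \<open>free\<close> are frozen, so the dimension of the cell
  is \<open>card (free N s x)\<close>, and \<open>x\<close> lies in its relative interior. Cells are
  addressed by interior points instead of by integer data.\<close>

definition car :: "nat => real => pt => pt set" where
 "car N s x = {y. ALL i. if i : free N s x
   then s * of_int \<lfloor>x i/s\<rfloor> <= y i & y i <= s*(of_int \<lfloor>x i/s\<rfloor> + 1) else y i = x i}"

lemma finite_free [simp]: "finite (free N s x)"
 unfolding free_def by (rule finite_subset[of _ "{..N}"]) auto

lemma free_le: "i : free N s x ==> i <= N"
 by (simp add: free_def)

lemma carD1: "y : car N s x ==> i : free N s x ==> s * of_int \<lfloor>x i/s\<rfloor> <= y i & y i <= s*(of_int \<lfloor>x i/s\<rfloor> + 1)"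
 unfolding car_def by (auto split: if_splits)

lemma carD2: "y : car N s x ==> i ~: free N s x ==> y i = x i"
 unfolding car_def by (auto split: if_splits)

lemma carI: "(!!i. i : free N s x ==> s * of_int \<lfloor>x i/s\<rfloor> <= y i & y i <= s*(of_int \<lfloor>x i/s\<rfloor> + 1))
  ==> (!!i. i ~: free N s x ==> y i = x i) ==> y : car N s x"
 unfolding car_def by auto

context
 fixes N :: nat and s :: real
 assumes s: "0 < s"
begin

lemma car_self: "x : car N s x"
proof (rule carI)
 fix i
 have "s * of_int \<lfloor>x i/s\<rfloor> <= s*(x i/s)" "s*(x i/s) <= s*(of_int \<lfloor>x i/s\<rfloor> + 1)"
  using s by (intro mult_left_mono; linarith)+
 thus "s * of_int \<lfloor>x i/s\<rfloor> <= x i & x i <= s*(of_int \<lfloor>x i/s\<rfloor> + 1)"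
  using s by simp
qed simp

lemma car_floor:
 assumes "y : car N s x" "i : free N s x" "i : free N s y"
 shows "\<lfloor>y i/s\<rfloor> = \<lfloor>x i/s\<rfloor>"
proof -
 let ?p = "\<lfloor>x i/s\<rfloor>"
 have "of_int ?p <= y i/s" "y i/s <= of_int ?p + 1" 
  using carD1[OF assms(1,2)] s by (simp_all add: pos_le_divide_eq pos_divide_le_eq mult.commute)
 moreover have "y i/s ~= of_int ?p + 1"
 proof
  assume "y i/s = of_int ?p + 1"
  hence "y i/s = of_int (?p + 1)" by simp
  hence "y i/s : \<int>" by (metis Ints_of_int)
  thus False using assms(3) by (simp add: free_def)
 qed
 ultimately show ?thesis by linarith
qed

lemma free_mono: "y : car N s x ==> free N s y <= free N s x"
proof
 fix i assume y: "y : car N s x" and i: "i : free N s y"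
 show "i : free N s x"
 proof (rule ccontr)
  assume n: "i ~: free N s x"
  thus False using carD2[OF y n] i by (simp add: free_def)
 qed
qed

lemma car_trans: "y : car N s x ==> car N s y <= car N s x"
proof
 fix z assume y: "y : car N s x" and z: "z : car N s y"
 show "z : car N s x"
 proof (rule carI)
  fix i assume i: "i : free N s x"
  show "s * of_int \<lfloor>x i/s\<rfloor> <= z i & z i <= s*(of_int \<lfloor>x i/s\<rfloor> + 1)"
  proof (cases "i : free N s y")
   case True
   thus ?thesis using carD1[OF z True] car_floor[OF y i True] by simp
  next
   case False
   thus ?thesis using carD2[OF z False] carD1[OF y i] by simp
  qed
 next
  fix i assume i: "i ~: free N s x"
  hence "i ~: free N s y" using free_mono[OF y] by auto
  thus "z i = x i" using carD2[OF z] carD2[OF y i] by simp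
 qed
qed

lemma car_eq: 
 assumes "y : car N s x" "free N s y = free N s x"
 shows "car N s y = car N s x"
proof (rule equalityI[OF car_trans[OF assms(1)] car_trans])
 show "x : car N s y"
 proof (rule carI)
  fix i assume i: "i : free N s y"
  thus "s * of_int \<lfloor>y i/s\<rfloor> <= x i & x i <= s*(of_int \<lfloor>y i/s\<rfloor> + 1)"
   using car_floor[OF assms(1) _ i] assms(2) carD1[OF car_self, of i x] by simp
 next
  fix i assume "i ~: free N s y"
  thus "x i = y i" using carD2[OF assms(1)] assms(2) by simp
 qed
qed

lemma car_eq_iff: "y : car N s x ==> car N s y = car N s x \<longleftrightarrow> free N s y = free N s x"
 using car_eq free_mono car_self by blast

text \<open>Passing to a proper face freezes at least one further coordinate; this makes the number
  of free coordinates the induction variable for skeleta.\<close>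

lemma car_card_less:
 assumes "y : car N s x" "car N s y ~= car N s x"
 shows "card (free N s y) < card (free N s x)"
 using assms car_eq_iff free_mono by (metis finite_free psubsetI psubset_card_mono)

lemma car_diam:
 assumes "y : car N s x" "z : car N s x"
 shows "l1 N y z <= real (Suc N) * s"
proof (rule l1_le_bound)
 fix i assume "i <= N"
 show "\<bar>y i - z i\<bar> <= s"
 proof (cases "i : free N s x")
  case True
  thus ?thesis using carD1[OF assms(1) True] carD1[OF assms(2) True] unfolding distrib_left abs_le_iff by linarith
 next
  case False
  thus ?thesis using carD2[OF assms(1) False] carD2[OF assms(2) False] s by simp
 qed
qed

lemma car_update:
 assumes i: "i : free N s x" and y: "y : car N s x" and z: "z : car N s x"
 shows "y(i := z i) : car N s x"
 using assms carD1 carD2 by (intro carI) (auto simp: carD1 carD2)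

text \<open>Changing coordinate \<open>i\<close> of \<open>x\<close> to the integral multiple
  \<open>w i\<close> gives a point in the relative interior of the facet through \<open>w\<close>,
  and this point serves as the address of the facet.\<close>

lemma car_facet:
 assumes i: "i : free N s x" and w: "w : car N s x" "w i/s : \<int>"
 shows "EX v:car N s x. car N s v ~= car N s x & (ALL y:car N s x. y i = w i --> y : car N s v)"
proof -
 let ?v = "x(i := w i)"
 have v: "?v : car N s x" by (rule car_update[OF i car_self w(1)])
 have fr: "free N s ?v = free N s x - {i}" using w(2) by (auto simp: free_def)
 have "car N s ?v ~= car N s x" using car_eq_iff[OF v] fr i by auto
 moreover have "y : car N s ?v" if y: "y : car N s x" "y i = w i" for y
 proof (rule carI)
  fix j assume "j : free N s ?v"
  thus "s * of_int \<lfloor>?v j/s\<rfloor> <= y j & y j <= s*(of_int \<lfloor>?v j/s\<rfloor> + 1)"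
   using fr carD1[OF y(1)] by auto
 next
  fix j assume "j ~: free N s ?v"
  thus "y j = ?v j" using fr y carD2[OF y(1)] by auto
 qed
 ultimately show ?thesis using v by blast
qed

lemma extreme_value:
 assumes "y : car N s x" "i : free N s x" "y i/s : \<int>"
 shows "y i = s * of_int \<lfloor>x i/s\<rfloor> \<or> y i = s*(of_int \<lfloor>x i/s\<rfloor> + 1)"
proof -
 obtain m where m: "y i/s = of_int m" using assms(3) by (auto elim: Ints_cases)
 let ?p = "\<lfloor>x i/s\<rfloor>"
 have "of_int ?p <= y i/s" "y i/s <= of_int ?p + 1" 
  using carD1[OF assms(1,2)] s by (simp_all add: pos_le_divide_eq pos_divide_le_eq mult.commute)
 hence "m = ?p \<or> m = ?p + 1" using m by linarith
 moreover have "y i = s*(y i/s)" using s by simp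
 ultimately show ?thesis using m by (metis of_int_1 of_int_add)
qed

lemma car_vertex:
 assumes i: "i : free N s x" and w: "w : car N s x" "w i/s : \<int>"
 shows "EX v:car N s x. free N s v = {} & v i = w i"
proof -
 let ?v = "%j. if j = i then w i else if j : free N s x then s * of_int \<lfloor>x j/s\<rfloor> else x j"
 have "?v : car N s x" using carD1[OF w(1) i] s i by (intro carI) auto
 moreover have "free N s ?v = {}" using w(2) s i by (auto simp: free_def split: if_splits)
 ultimately show ?thesis by (intro bexI[of _ ?v]) auto
qed

text \<open>Two boundary points lie on a common facet, on crossing facets, or on opposite ones.
  Crossing facets are joined by copying coordinate \<open>j\<close> of \<open>z\<close> into
  \<open>y\<close>, which gives a point on both. Opposite facets are at distance \<open>s\<close>,
  so a detour through vertices is affordable. Vertex values enter as a hypothesis because the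
  boundary of an edge is disconnected.\<close>

lemma cell_boundary_lipschitz:
 fixes F :: "pt => 'a::metric_space"
 assumes m: "0 <= m" and F: "!!y. y : car N s x ==> car N s y ~= car N s x ==> lipl N m (car N s y) F"
  and V: "!!v w. v : car N s x ==> w : car N s x ==> free N s v = {} ==> free N s w = {} ==> dist (F v) (F w) <= m * s"
 shows "lipl N (real (2 * N + 3) * m) {y : car N s x. car N s y ~= car N s x} F"
 unfolding lipl_def
proof (intro conjI ballI)
 show "0 <= real (2 * N + 3) * m" using m by simp
 fix y z assume y: "y : {y : car N s x. car N s y ~= car N s x}" and z: "z : {y : car N s x. car N s y ~= car N s x}"
 obtain i where i: "i : free N s x" "y i/s : \<int>"
  using y car_eq_iff[of y x] free_mono[of y x] by (auto simp: free_def)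
 obtain j where j: "j : free N s x" "z j/s : \<int>"
  using z car_eq_iff[of z x] free_mono[of z x] by (auto simp: free_def)
 have iN: "i <= N" "j <= N" using i j free_le by auto
 have yc: "y : car N s x" and zc: "z : car N s x" using y z by auto
 have same: "dist (F a) (F b) <= m * l1 N a b" if ab: "l : free N s x" "a : car N s x" "a l/s : \<int>" "b : car N s x" "a l = b l" for a b l
 proof -
  obtain v where "v : car N s x" "car N s v ~= car N s x" "ALL y:car N s x. y l = a l --> y : car N s v"
   using car_facet[OF ab(1,2,3)] by blast
  thus ?thesis using F[of v] ab unfolding lipl_def by auto
 qed
 show "dist (F y) (F z) <= real (2 * N + 3) * m * l1 N y z"
 proof (cases "i = j & y i ~= z i")
  case True
  obtain v where v: "v : car N s x" "free N s v = {}" "v i = y i" using car_vertex[OF i(1) yc i(2)] by blast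
  obtain w where w: "w : car N s x" "free N s w = {}" "w j = z j" using car_vertex[OF j(1) zc j(2)] by blast
  have "\<bar>y i - z i\<bar> = s"
   using extreme_value[OF yc i] extreme_value[OF zc _ j(2)] i j True s by (auto simp: distrib_left)
  hence sl: "s <= l1 N y z" using l1_component[OF iN(1)] by metis
  have "dist (F y) (F z) <= dist (F y) (F v) + dist (F v) (F w) + dist (F w) (F z)"
   using dist_triangle[of "F y" "F z" "F v"] dist_triangle[of "F v" "F z" "F w"] by linarith
  also have "dist (F y) (F v) <= m * l1 N y v" using same[OF i(1) yc i(2) v(1)] v by simp
  also have "m * l1 N y v <= m*(real (Suc N) * s)" using car_diam[OF yc v(1)] m by (rule mult_left_mono)
  also have "dist (F v) (F w) <= m * s" using V v w by simp
  also have "dist (F w) (F z) <= m * l1 N z w" using same[OF j(1) zc j(2) w(1)] w by (simp add: dist_commute)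
  also have "m * l1 N z w <= m*(real (Suc N) * s)" using car_diam[OF zc w(1)] m by (rule mult_left_mono)
  \<comment> \<open>The detour through the two vertices has legs of length N + 1, 1 and N + 1 in
    units of \<open>m * s\<close>.\<close>
  finally have "dist (F y) (F z) <= real (2 * N + 3) * m * s" by (simp add: algebra_simps)
  also have "... <= real (2 * N + 3) * m * l1 N y z" using sl m by (intro mult_left_mono) auto
  finally show ?thesis .
 next
  case False
  have m3: "3 * m * l1 N y z <= real (2 * N + 3) * m * l1 N y z" using m by (intro mult_right_mono) auto
  show ?thesis
  proof (cases "i = j")
   case True
   hence "dist (F y) (F z) <= m * l1 N y z" using False same[OF i(1) yc i(2) zc] by auto
   also have "... <= 3 * m * l1 N y z" using m by (intro mult_right_mono) auto
   finally show ?thesis using m3 by linarith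
  next
   case nij: False
   let ?u = "y(j := z j)"
   have u: "?u : car N s x" by (rule car_update[OF j(1) yc zc])
   have 1: "dist (F y) (F ?u) <= m * l1 N y ?u" using same[OF i(1) yc i(2) u] nij by simp
   have 2: "dist (F z) (F ?u) <= m * l1 N z ?u" using same[OF j(1) zc j(2) u] by simp
   have "l1 N y ?u = \<bar>y j - z j\<bar>"
    unfolding l1_def by (subst sum.remove[of _ j]) (use iN in \<open>auto intro!: sum.neutral\<close>)
   hence 3: "l1 N y ?u <= l1 N y z" using l1_component[OF iN(2)] by metis
   have 4: "l1 N z ?u <= l1 N z y + l1 N y ?u" by (rule l1_triangle)
   have "dist (F y) (F z) <= dist (F y) (F ?u) + dist (F z) (F ?u)" by (rule dist_triangle2)
   also have "... <= m*(l1 N y ?u + l1 N z ?u)" using 1 2 by (simp add: distrib_left)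
   also have "... <= m*(3 * l1 N y z)" using 3 4 m by (intro mult_left_mono) (auto simp: l1_commute)
   finally show ?thesis using m3 by simp
  qed
 qed
qed

text \<open>The free coordinates are enumerated by \<open>e\<close> and rescaled affinely about the
  centre \<open>q\<close> to a standard cube with \<open>k + 1\<close> coordinates. The factors
  \<open>s/2\<close> and \<open>2/s\<close> cancel, so the resulting constant does not see the
  mesh.\<close>

lemma cell_extension:
 fixes f :: "pt => 'a::metric_space"
 assumes Y: "lip_connected_const Y n c" and kn: "N <= n" and fr: "free N s x ~= {}"
  and f: "f ` {y : car N s x. car N s y ~= car N s x} <= Y"
  and lf: "lipl N L {y : car N s x. car N s y ~= car N s x} f"
 shows "EX g. (g ` car N s x <= Y & (ALL y:car N s x. car N s y ~= car N s x --> g y = f y)) &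
   lipl N (8 * real (Suc N)^4*\<bar>c\<bar> * L) (car N s x) g"
proof -
 have L0: "0 <= L" using lf by (simp add: lipl_def)
 define k where "k = card (free N s x) - 1"
 have ck: "card (free N s x) = Suc k" using fr by (simp add: k_def card_gt_0_iff)
 have "card (free N s x) <= card {..N}" by (intro card_mono) (auto simp: free_def)
 hence kN: "k <= N" using ck by simp
 obtain e where e: "bij_betw e {..k} (free N s x)"
  using ex_bij_betw_nat_finite[OF finite_free, of N s x] ck by (auto simp: atLeast0LessThan lessThan_Suc_atMost)
 define ei where "ei = the_inv_into {..k} e"
 have ei: "bij_betw ei (free N s x) {..k}" unfolding ei_def by (rule bij_betw_the_inv_into[OF e])
 have eie: "ei (e j) = j" if "j <= k" for j unfolding ei_def using e that by (simp add: bij_betw_def the_inv_into_f_f)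
 have eei: "e (ei i) = i" if "i : free N s x" for i unfolding ei_def using e that by (simp add: bij_betw_def f_the_inv_into_f)
 have ein: "e j : free N s x" if "j <= k" for j using e that by (auto simp: bij_betw_def)
 have eik: "ei i <= k" if "i : free N s x" for i using ei that by (auto simp: bij_betw_def)
 define q where "q = (%i. s*(of_int \<lfloor>x i/s\<rfloor> + 1/2))"
 define \<Phi> where "\<Phi> = (%v::nat=>real. %i. if i : free N s x then q i + s/2 * v (ei i) else x i)"
 define \<Psi> where "\<Psi> = (%y::nat=>real. %j. if j <= k then (y (e j) - q (e j))*(2/s) else 0)"
 have \<Phi>in: "\<Phi> v : car N s x" if "v : cube k" for v
 proof (rule carI)
  fix i assume i: "i : free N s x"
  have "\<bar>v (ei i)\<bar> <= 1" using that eik[OF i] by (auto simp: cube_def)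
  hence "\<bar>s/2 * v (ei i)\<bar> <= s/2*1" using s by (simp add: abs_mult)
  thus "s * of_int \<lfloor>x i/s\<rfloor> <= \<Phi> v i & \<Phi> v i <= s*(of_int \<lfloor>x i/s\<rfloor> + 1)"
   using i unfolding \<Phi>_def q_def by (auto simp: distrib_left)
 qed (simp add: \<Phi>_def)
 have \<Phi>bd: "car N s (\<Phi> v) ~= car N s x" if v: "v : cube_bd k" for v
 proof -
  obtain j where j: "j <= k" "\<bar>v j\<bar> = 1" using v by (auto simp: cube_bd_def)
  have "\<Phi> v (e j)/s = of_int \<lfloor>x (e j)/s\<rfloor> + 1/2 + v j/2"
   using s ein[OF j(1)] eie[OF j(1)] by (simp add: \<Phi>_def q_def field_simps)
  moreover have "v j = 1 \<or> v j = -1" using j by linarith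
  ultimately have "\<Phi> v (e j)/s = of_int (\<lfloor>x (e j)/s\<rfloor> + 1) \<or> \<Phi> v (e j)/s = of_int \<lfloor>x (e j)/s\<rfloor>" by auto
  hence "\<Phi> v (e j)/s : \<int>" by (metis Ints_of_int)
  hence "e j ~: free N s (\<Phi> v)" by (simp add: free_def)
  thus ?thesis using car_eq_iff[OF \<Phi>in[of v]] ein[OF j(1)] v by (auto simp: cube_bd_def)
 qed
 have \<Psi>in: "\<Psi> y : cube k" if y: "y : car N s x" for y
 proof -
  have "\<bar>\<Psi> y j\<bar> <= 1" if "j <= k" for j
  proof -
   have "\<bar>y (e j) - q (e j)\<bar> <= s/2" using carD1[OF y ein[OF that]] unfolding q_def distrib_left abs_le_iff by simp
   hence "\<bar>y (e j) - q (e j)\<bar>*(2/s) <= s/2*(2/s)" using s by (intro mult_right_mono) auto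
   moreover have "\<bar>\<Psi> y j\<bar> = \<bar>y (e j) - q (e j)\<bar>*\<bar>2/s\<bar>" using that by (simp only: \<Psi>_def if_True abs_mult)
   ultimately show ?thesis using s by simp
  qed
  thus ?thesis by (auto simp: cube_def \<Psi>_def)
 qed
 have \<Psi>bd: "\<Psi> y : cube_bd k" if y: "y : car N s x" "car N s y ~= car N s x" for y
 proof -
  obtain i where i: "i : free N s x" "y i/s : \<int>"
   using y car_eq_iff[of y x] free_mono[of y x] by (auto simp: free_def)
  have "\<bar>y i - q i\<bar> = s/2" using extreme_value[OF y(1) i] s by (auto simp: q_def distrib_left)
  moreover have "\<bar>\<Psi> y (ei i)\<bar> = \<bar>y i - q i\<bar>*\<bar>2/s\<bar>"
   using eik[OF i(1)] eei[OF i(1)] by (simp only: \<Psi>_def if_True abs_mult)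
  ultimately have "\<bar>\<Psi> y (ei i)\<bar> = 1" using s by simp
  thus ?thesis using \<Psi>in[OF y(1)] eik[OF i(1)] by (auto simp: cube_bd_def)
 qed
 have \<Phi>\<Psi>: "\<Phi> (\<Psi> y) = y" if "y : car N s x" for y
 proof
  fix i
  show "\<Phi> (\<Psi> y) i = y i"
  proof (cases "i : free N s x")
   case True
   have "s/2*((y i - q i)*(2/s)) = y i - q i" using s by simp
   thus ?thesis using True eik[OF True] eei[OF True] by (simp only: \<Phi>_def \<Psi>_def if_True)
  qed (use carD2[OF that] in \<open>simp add: \<Phi>_def\<close>)
 qed
 have \<Psi>lip: "l1 k (\<Psi> y) (\<Psi> z) <= 2/s * l1 N y z" for y z
 proof -
  have gen: "(a - b) * r - (a' - b) * r = r*(a - a')" for a b a' r :: real by (simp add: algebra_simps)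
  have "\<bar>\<Psi> y j - \<Psi> z j\<bar> = 2/s*\<bar>y (e j) - z (e j)\<bar>" if "j <= k" for j
  proof -
   have "\<Psi> y j - \<Psi> z j = 2/s*(y (e j) - z (e j))" using that by (simp only: \<Psi>_def if_True gen)
   hence "\<bar>\<Psi> y j - \<Psi> z j\<bar> = \<bar>2/s\<bar>*\<bar>y (e j) - z (e j)\<bar>" by (simp only: abs_mult)
   moreover have "\<bar>2/s\<bar> = 2/s" using s by simp
   ultimately show ?thesis by (simp only:)
  qed
  hence "l1 k (\<Psi> y) (\<Psi> z) = (SUM j<=k. 2/s*\<bar>y (e j) - z (e j)\<bar>)"
   unfolding l1_def by (intro sum.cong) auto
  also have "... = 2/s*(SUM i:free N s x. \<bar>y i - z i\<bar>)"
   unfolding sum_distrib_left using sum.reindex_bij_betw[OF e, of "%i. 2/s*\<bar>y i - z i\<bar>"] by simp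
  also have "... <= 2/s * l1 N y z" unfolding l1_def using s
   by (intro mult_left_mono sum_mono2) (auto simp: free_def)
  finally show ?thesis .
 qed
 have \<Phi>lip: "l1 N (\<Phi> u) (\<Phi> v) = s/2 * l1 k u v" for u v
 proof -
  have "l1 N (\<Phi> u) (\<Phi> v) = (SUM i:free N s x. \<bar>\<Phi> u i - \<Phi> v i\<bar>)"
   unfolding l1_def by (rule sum.mono_neutral_right) (auto simp: free_def \<Phi>_def)
  also have "... = (SUM i:free N s x. s/2*\<bar>u (ei i) - v (ei i)\<bar>)"
  proof (rule sum.cong)
   fix i assume i: "i : free N s x"
   have gen: "(a + r * b) - (a + r * b') = r*(b - b')" for a b b' r :: real by (simp add: algebra_simps)
   have "\<Phi> u i - \<Phi> v i = s/2*(u (ei i) - v (ei i))" using i by (simp only: \<Phi>_def if_True gen)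
   hence "\<bar>\<Phi> u i - \<Phi> v i\<bar> = \<bar>s/2\<bar>*\<bar>u (ei i) - v (ei i)\<bar>" by (simp only: abs_mult)
   moreover have "\<bar>s/2\<bar> = s/2" using s by simp
   ultimately show "\<bar>\<Phi> u i - \<Phi> v i\<bar> = s/2*\<bar>u (ei i) - v (ei i)\<bar>" by (simp only:)
  qed simp
  also have "... = (SUM j<=k. s/2*\<bar>u j - v j\<bar>)"
   using sum.reindex_bij_betw[OF ei, of "%j. s/2*\<bar>u j - v j\<bar>"] by simp
  finally show ?thesis by (simp add: l1_def sum_distrib_left)
 qed
 have fl: "lipl k (L*(s/2)) (cube_bd k) (f \<circ> \<Phi>)"
  unfolding lipl_def
 proof (intro conjI ballI)
  show "0 <= L*(s/2)" using L0 s by simp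
  fix u v assume uv: "u : cube_bd k" "v : cube_bd k"
  have "dist (f (\<Phi> u)) (f (\<Phi> v)) <= L * l1 N (\<Phi> u) (\<Phi> v)"
   using lf \<Phi>in[of u] \<Phi>in[of v] \<Phi>bd uv unfolding lipl_def by (auto simp: cube_bd_def)
  thus "dist ((f \<circ> \<Phi>) u) ((f \<circ> \<Phi>) v) <= L*(s/2) * l1 k u v" by (simp add: \<Phi>lip)
 qed
 have fy: "(f \<circ> \<Phi>) ` cube_bd k <= Y"
 proof (rule image_subsetI)
  fix v assume v: "v : cube_bd k"
  hence "v : cube k" by (simp add: cube_bd_def)
  hence "\<Phi> v : {y : car N s x. car N s y ~= car N s x}" using \<Phi>in \<Phi>bd[OF v] by simp
  thus "(f \<circ> \<Phi>) v : Y" using f by auto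
 qed
 obtain g where g: "g ` cube k <= Y" "ALL x:cube_bd k. g x = (f \<circ> \<Phi>) x"
  "lipl k (8 * real (Suc k)^4*\<bar>c\<bar>*(L*(s/2))) (cube k) g"
  using cube_extension[OF Y order_trans[OF kN kn] fy fl] by (elim exE conjE)
 have "lipl N (8 * real (Suc N)^4*\<bar>c\<bar> * L) (car N s x) (g \<circ> \<Psi>)"
  unfolding lipl_def
 proof (intro conjI ballI)
  show "0 <= 8 * real (Suc N)^4*\<bar>c\<bar> * L" using L0 by simp
  fix y z assume yz: "y : car N s x" "z : car N s x"
  have "dist ((g \<circ> \<Psi>) y) ((g \<circ> \<Psi>) z) <= 8 * real (Suc k)^4*\<bar>c\<bar>*(L*(s/2)) * l1 k (\<Psi> y) (\<Psi> z)"
   using g(3) \<Psi>in yz by (auto simp: lipl_def)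
  also have "... <= 8 * real (Suc N)^4*\<bar>c\<bar>*(L*(s/2))*(2/s * l1 N y z)"
   using kN L0 s by (intro mult_mono mult_right_mono mult_left_mono power_mono \<Psi>lip) auto
  also have "... = 8 * real (Suc N)^4*\<bar>c\<bar> * L * l1 N y z" using s by simp
  finally show "dist ((g \<circ> \<Psi>) y) ((g \<circ> \<Psi>) z) <= 8 * real (Suc N)^4*\<bar>c\<bar> * L * l1 N y z" .
 qed
 moreover have "(g \<circ> \<Psi>) ` car N s x <= Y" using g(1) \<Psi>in by auto
 moreover have "ALL y:car N s x. car N s y ~= car N s x --> (g \<circ> \<Psi>) y = f y" using g(2) \<Psi>bd \<Phi>\<Psi> by auto
 ultimately show ?thesis by blast
qed

end

text \<open>One factor for each of the at most N + 1 dimensions: gluing the faces costs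
  \<open>2 * N + 3\<close>, filling the cell costs the constant of the cube, and the added 1 keeps
  the factor at least 1.\<close>

definition skel_const :: "nat => real => real" where
 "skel_const N c = (1 + 8 * real (Suc N)^4*\<bar>c\<bar> * real (2 * N + 3))^Suc N"

text \<open>Cells are filled in order of dimension. The point is the last conclusion: although one
  map is built on all of \<open>K1\<close>, its constant on a cell is governed only by the old map
  and the vertex values within that cell. This locality is what later prevents constants from
  growing with the number of scales. The global constant \<open>m0\<close> gets the construction
  started, by ensuring that some Lipschitz bound is available on every boundary.\<close>

lemma skeleton_extension:
 fixes f0 vf :: "pt => 'a::metric_space"
 assumes s: "0 < s" and Y: "lip_connected_const Y n c" and N: "N <= n"
  and K01: "K0 <= K1" and K0c: "!!x. x : K0 ==> car N s x <= K0" and K1c: "!!x. x : K1 ==> car N s x <= K1"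
  and f0Y: "f0 ` K0 <= Y" and vY: "vf ` K1 <= Y" and V: "V = (%v. if v : K0 then f0 v else vf v)"
  and m0: "0 <= m0" "!!y. y : K0 ==> lipl N m0 (car N s y) f0"
  and m0v: "!!x v w. x : K1 ==> v : car N s x ==> w : car N s x ==> free N s v = {} ==> free N s w = {} ==> dist (V v) (V w) <= m0 * s"
 shows "EX f. f ` K1 <= Y & (ALL x:K0. f x = f0 x) & (ALL x:K1. free N s x = {} --> f x = V x) &
   (ALL x:K1. ALL m>=0. (ALL y:car N s x Int K0. lipl N m (car N s y) f0) &
    (ALL v:car N s x. ALL w:car N s x. free N s v = {} --> free N s w = {} --> dist (V v) (V w) <= m * s) \<longrightarrow>
    lipl N (skel_const N c * m) (car N s x) f)"
proof -
 define E where "E = 8 * real (Suc N)^4*\<bar>c\<bar>"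
 define q where "q = 1 + E * real (2 * N + 3)"
 have E0: "0 <= E" by (simp add: E_def)
 have q1: "1 <= q" using E0 by (simp add: q_def)
 define D where "D = (%i. K0 Un {x : K1. card (free N s x) <= i})"
 define cond where "cond = (%x m. (ALL y:car N s x Int K0. lipl N m (car N s y) f0) &
    (ALL v:car N s x. ALL w:car N s x. free N s v = {} --> free N s w = {} --> dist (V v) (V w) <= m * s))"
 have cond_sub: "cond y m" if "cond x m" "y : car N s x" for x y m
  using that car_trans[OF s that(2)] unfolding cond_def by blast
 have DK: "D i <= K1" for i using K01 by (auto simp: D_def)
 define S where "S = (%i f. (ALL x:D i. f x : Y) & (ALL x:K0. f x = f0 x) & (ALL x:K1. free N s x = {} --> f x = V x) &
   (ALL x:D i. ALL m>=0. cond x m --> lipl N (q^i * m) (car N s x) f))"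
 have K0lip: "lipl N (q^i * m) (car N s x) f" 
  if "x : K0" "cond x m" "0 <= m" "ALL x:K0. f x = f0 x" for i m x f
 proof -
  have "lipl N m (car N s x) f0" using that car_self[OF s] unfolding cond_def by blast
  hence "lipl N m (car N s x) f" using that(4) K0c[OF that(1)] by (subst lipl_cong[of "car N s x" f f0]) auto
  moreover have "m <= q^i * m" using q1 that(3) by (simp add: mult_left_le_one_le mult_le_cancel_right1)
  ultimately show ?thesis by (blast intro: lipl_mono)
 qed
 have "EX f. S i f" for i
 proof (induction i)
  case 0
  have "S 0 V"
   unfolding S_def
  proof (intro conjI ballI allI impI)
   fix x assume x: "x : D 0"
   thus "V x : Y" using f0Y vY by (auto simp: V D_def)
   fix m assume m: "0 <= m" "cond x m"
   show "lipl N (q^0 * m) (car N s x) V"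
   proof (cases "x : K0")
    case True thus ?thesis using K0lip[of x m V 0] m by (auto simp: V)
   next
    case False
    hence "free N s x = {}" using x by (auto simp: D_def)
    hence "car N s x = {x}" by (auto simp: car_def)
    thus ?thesis using m by (simp add: lipl_def)
   qed
  qed (auto simp: V)
  thus ?case by blast
 next
  case (Suc i)
  then obtain F where F: "S i F" by blast
  define ext where "ext = (%C g. g ` C <= Y & (ALL y:C. car N s y ~= C --> g y = F y) &
    (ALL M. lipl N M {y\<in>C. car N s y ~= C} F --> lipl N (E * M) C g))"
  \<comment> \<open>Indexing the choice by the set \<open>car N s x\<close>, not by
    \<open>x\<close>, makes all interior points of a cell use the same extension.\<close>
  define G where "G = (%C. SOME g. ext C g)"
  define F' where "F' = (%x. if x : D i then F x else G (car N s x) x)"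
  have bdD: "y : D i" if "x : D (Suc i) - D i" "y : car N s x" "car N s y ~= car N s x" for x y
  proof -
   have "card (free N s y) < card (free N s x)" using car_card_less[OF s that(2,3)] .
   moreover have "y : K1" using that K1c DK by blast
   ultimately show ?thesis using that(1) by (auto simp: D_def)
  qed
  have bdL: "lipl N (real (2 * N + 3)*(q^i * m)) {y\<in>car N s x. car N s y ~= car N s x} F"
   if x: "x : D (Suc i) - D i" and m: "0 <= m" "cond x m" for x m
  proof (rule cell_boundary_lipschitz[OF s])
   show "0 <= q^i * m" using q1 m by simp
   show "lipl N (q^i * m) (car N s y) F" if "y : car N s x" "car N s y ~= car N s x" for y
    using F bdD[OF x that] cond_sub[OF m(2) that(1)] m(1) unfolding S_def by blast
   show "dist (F v) (F w) <= q^i * m * s"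
    if vw: "v : car N s x" "w : car N s x" "free N s v = {}" "free N s w = {}" for v w
   proof -
    have K: "v : K1" "w : K1" using vw x K1c DK by blast+
    have "dist (F v) (F w) = dist (V v) (V w)" using F K vw unfolding S_def by auto
    also have "... <= m * s" using m(2) vw unfolding cond_def by blast
    also have "... <= q^i * m * s" using q1 m(1) s by (intro mult_right_mono) (simp_all add: mult_le_cancel_right1)
    finally show ?thesis .
   qed
  qed
  have cond0: "cond x m0" if "x : K1" for x
   unfolding cond_def using m0(2) m0v[OF that] by blast
  have ext: "ext (car N s x) (G (car N s x))" if x: "x : D (Suc i) - D i" for x
  proof -
   let ?B = "{y\<in>car N s x. car N s y ~= car N s x}"
   have fr: "free N s x ~= {}" using x by (auto simp: D_def)
   have FB: "F ` ?B <= Y" using bdD[OF x] F unfolding S_def by auto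
   have "x : K1" using x DK by blast
   hence "lipl N (real (2 * N + 3)*(q^i * m0)) ?B F" using bdL[OF x m0(1)] cond0 by blast
   hence "EX g. (g ` car N s x <= Y & (ALL y:car N s x. car N s y ~= car N s x --> g y = F y)) &
     (ALL M. lipl N M ?B F --> lipl N (E * M) (car N s x) g)"
    by (rule uniform_extension[OF _ E0]) (use cell_extension[OF s Y N fr FB] in \<open>simp add: E_def\<close>)
   hence "EX g. ext (car N s x) g" unfolding ext_def by blast
   thus ?thesis unfolding G_def by (rule someI_ex)
  qed
  have F'eq: "F' y = G (car N s x) y" if x: "x : D (Suc i) - D i" and y: "y : car N s x" for x y
  proof (cases "car N s y = car N s x")
   case True
   have "y ~: D i"
   proof
    assume "y : D i"
    hence "x : D i" using True K0c[of y] car_self[OF s, where x=x and N=N] car_eq_iff[OF s y] x DK[of "Suc i"]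
     by (auto simp: D_def)
    thus False using x by simp
   qed
   thus ?thesis by (simp add: F'_def True)
  next
   case False
   hence "F' y = F y" using bdD[OF x y] by (simp add: F'_def)
   thus ?thesis using ext[OF x] y False unfolding ext_def by auto
  qed
  have Dsub: "K0 <= D i" by (auto simp: D_def)
  have "S (Suc i) F'"
   unfolding S_def
  proof (intro conjI ballI allI impI)
   fix x assume x: "x : D (Suc i)"
   show "F' x : Y"
   proof (cases "x : D i")
    case True thus ?thesis using F by (simp add: F'_def S_def)
   next
    case False
    hence "ext (car N s x) (G (car N s x))" using ext x by blast
    thus ?thesis using False car_self[OF s, where x=x and N=N] by (auto simp: F'_def ext_def)
   qed
   fix m :: real assume m: "0 <= m" "cond x m"
   show "lipl N (q^Suc i * m) (car N s x) F'"
   proof (cases "x : D i")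
    case True
    have "car N s x <= D i"
    proof
     fix y assume y: "y : car N s x"
     have "card (free N s y) <= card (free N s x)" using free_mono[OF s y] by (intro card_mono) auto
     thus "y : D i" using True y K0c[of x] K1c[of x] by (auto simp: D_def)
    qed
    hence "lipl N M (car N s x) F' = lipl N M (car N s x) F" for M by (intro lipl_cong) (auto simp: F'_def)
    moreover have "lipl N (q^i * m) (car N s x) F" using F True m unfolding S_def by blast
    moreover have "q^i * m <= q^Suc i * m" using q1 m by (intro mult_right_mono power_increasing) auto
    ultimately show ?thesis by (blast intro: lipl_mono)
   next
    case False
    hence xD: "x : D (Suc i) - D i" using x by simp
    have "lipl N (E*(real (2 * N + 3)*(q^i * m))) (car N s x) (G (car N s x))"
     using ext[OF xD] bdL[OF xD m] unfolding ext_def by blast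
    hence "lipl N (E*(real (2 * N + 3)*(q^i * m))) (car N s x) F'"
     using lipl_cong[of "car N s x" F' "G (car N s x)"] F'eq[OF xD] by blast
    moreover have "E*(real (2 * N + 3)*(q^i * m)) <= q^Suc i * m"
    proof -
     have "E*(real (2 * N + 3)*(q^i * m)) = (E * real (2 * N + 3))*(q^i * m)" by simp
     also have "... <= q*(q^i * m)" using q1 m by (intro mult_right_mono) (auto simp: q_def)
     finally show ?thesis by simp
    qed
    ultimately show ?thesis by (blast intro: lipl_mono)
   qed
  next
   fix x assume "x : K0" thus "F' x = f0 x" using F Dsub by (auto simp: F'_def S_def)
  next
   fix x assume x: "x : K1" "free N s x = {}"
   hence "x : D i" by (simp add: D_def)
   thus "F' x = V x" using F x by (simp add: F'_def S_def)
  qed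
  thus ?case by blast
 qed
 then obtain f where f: "S (Suc N) f" by blast
 have "D (Suc N) = K1"
 proof -
  have "card (free N s x) <= card {..N}" for x by (intro card_mono) (auto simp: free_def)
  thus ?thesis using K01 by (auto simp: D_def)
 qed
 moreover have "skel_const N c = q^Suc N" by (simp add: skel_const_def q_def E_def)
 ultimately show ?thesis using f unfolding S_def cond_def by (intro exI[of _ f]) auto
qed

section \<open>Refining cells and moving along segments\<close>

lemma floor_double:
 fixes u :: real
 shows "2 * of_int \<lfloor>u\<rfloor> <= (of_int \<lfloor>2 * u\<rfloor> :: real)" "of_int \<lfloor>2 * u\<rfloor> + 1 <= (2*(of_int \<lfloor>u\<rfloor> + 1) :: real)"
proof -
 have "2*\<lfloor>u\<rfloor> <= \<lfloor>2 * u\<rfloor>" "\<lfloor>2 * u\<rfloor> < 2*\<lfloor>u\<rfloor> + 2"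
  unfolding le_floor_iff floor_less_iff using floor_correct[of u] by (simp_all, linarith)
 hence "of_int (2*\<lfloor>u\<rfloor>) <= (of_int \<lfloor>2 * u\<rfloor> :: real)" "of_int (\<lfloor>2 * u\<rfloor> + 1) <= (of_int (2*(\<lfloor>u\<rfloor> + 1)) :: real)"
  unfolding of_int_le_iff by simp_all
 thus "2 * of_int \<lfloor>u\<rfloor> <= (of_int \<lfloor>2 * u\<rfloor> :: real)" "of_int \<lfloor>2 * u\<rfloor> + 1 <= (2*(of_int \<lfloor>u\<rfloor> + 1) :: real)"
  by simp_all
qed

lemma not_Ints_between:
 fixes u :: real assumes "of_int m < u" "u < of_int m + 1" shows "u ~: \<int>"
proof
 assume "u : \<int>"
 then obtain l where l: "u = of_int l" by (auto elim: Ints_cases)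
 have "real_of_int m < of_int l" "real_of_int l < of_int (m + 1)" using assms l by simp_all
 thus False unfolding of_int_less_iff by simp
qed

lemma car_refine:
 assumes "0 < s" shows "car N (s/2) x <= car N s x"
proof
 fix y assume y: "y : car N (s/2) x"
 show "y : car N s x"
 proof (rule carI)
  fix i assume i: "i : free N s x"
  show "s * of_int \<lfloor>x i/s\<rfloor> <= y i & y i <= s*(of_int \<lfloor>x i/s\<rfloor> + 1)"
  proof (cases "i : free N (s/2) x")
   case False
   thus ?thesis using carD2[OF y False] carD1[OF car_self[OF assms] i] by simp
  next
   case True
   let ?u = "x i/s"
   have u2: "x i/(s/2) = 2*?u" by simp
   note 1 = floor_double[of ?u]
   have 2: "s/2 * of_int \<lfloor>2*?u\<rfloor> <= y i" "y i <= s/2*(of_int \<lfloor>2*?u\<rfloor> + 1)"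
    using carD1[OF y True] unfolding u2 by auto
   have "s/2*(2 * of_int \<lfloor>?u\<rfloor>) <= s/2 * of_int \<lfloor>2*?u\<rfloor>"
      "s/2*(of_int \<lfloor>2*?u\<rfloor> + 1) <= s/2*(2*(of_int \<lfloor>?u\<rfloor> + 1))"
    using 1 assms by (intro mult_left_mono; simp)+
   thus ?thesis using 2 by (simp add: distrib_left)
  qed
 next
  fix i assume i: "i ~: free N s x"
  have "i ~: free N (s/2) x"
  proof
   assume "i : free N (s/2) x"
   hence "i <= N" "2*(x i/s) ~: \<int>" by (auto simp: free_def mult.commute)
   moreover have "x i/s : \<int>" using i \<open>i <= N\<close> by (simp add: free_def)
   ultimately show False by (metis Ints_mult Ints_numeral)
  qed
  thus "y i = x i" using carD2[OF y] by simp
 qed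
qed

lemma car_cube:
 assumes x: "x : cube N" shows "car N ((1/2)^j) x <= cube N"
proof
 fix y assume y: "y : car N ((1/2)^j) x"
 have s: "(0::real) < (1/2)^j" by simp
 have "\<bar>y i\<bar> <= 1" if iN: "i <= N" for i
 proof (cases "i : free N ((1/2)^j) x")
  case False thus ?thesis using carD2[OF y False] x iN by (simp add: cube_def)
 next
  case True
  let ?u = "x i/(1/2)^j"
  have u: "?u = x i*2^j" by (simp add: power_divide)
  have x1: "\<bar>x i\<bar> <= 1" using x iN by (simp add: cube_def)
  have "x i*2^j <= 1*2^j" "-1*2^j <= x i*2^j" using x1 by (intro mult_right_mono; simp)+
  hence b: "?u <= of_int (2^j)" "of_int (- (2^j)) <= ?u" unfolding u by simp_all
  have ne: "?u ~= of_int (2^j)" using True by (metis (mono_tags, lifting) Ints_of_int free_def mem_Collect_eq)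
  have f1: "\<lfloor>?u\<rfloor> + 1 <= 2^j" using b(1) ne by linarith
  have f2: "- (2^j) <= \<lfloor>?u\<rfloor>" using b(2) by (simp add: le_floor_iff)
  have g1: "(of_int \<lfloor>?u\<rfloor> + 1 :: real) <= 2^j" using f1 by (metis of_int_1 of_int_add of_int_le_iff of_int_numeral of_int_power)
  have g2: "- (2^j) <= (of_int \<lfloor>?u\<rfloor> :: real)" using f2 by (metis of_int_le_iff of_int_minus of_int_numeral of_int_power)
  have "(1/2)^j*(of_int \<lfloor>?u\<rfloor> + 1) <= (1/2::real)^j*2^j" "(1/2::real)^j*(- (2^j)) <= (1/2)^j * of_int \<lfloor>?u\<rfloor>"
   using g1 g2 by (intro mult_left_mono; simp)+
  moreover have "(1/2)^j*2^j = (1::real)" by (simp add: power_divide)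
  ultimately show ?thesis using carD1[OF y True] by (simp add: abs_le_iff)
 qed
 moreover have "y i = 0" if "i > N" for i
  using carD2[OF y, of i] that x by (simp add: free_def cube_def)
 ultimately show "y : cube N" by (simp add: cube_def)
qed

text \<open>One coordinate of the fact that a point lies in the closed cell of every point near it:
  next to an integer, \<open>u0\<close> is an endpoint of the unit interval around \<open>u\<close>;
  elsewhere the floors agree.\<close>

lemma near_integer:
 fixes u0 :: real
 shows "EX e>0. ALL u. \<bar>u - u0\<bar> < e --> u = u0 \<or> (u ~: \<int> & of_int \<lfloor>u\<rfloor> <= u0 & u0 <= of_int \<lfloor>u\<rfloor> + 1)"
proof (cases "u0 : \<int>")
 case True
 then obtain m where m: "u0 = of_int m" by (auto elim: Ints_cases)
 show ?thesis
 proof (intro exI[of _ 1] conjI allI impI)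
  fix u :: real assume u: "\<bar>u - u0\<bar> < 1"
  show "u = u0 \<or> (u ~: \<int> & of_int \<lfloor>u\<rfloor> <= u0 & u0 <= of_int \<lfloor>u\<rfloor> + 1)"
  proof (cases "u = u0")
   case False
   have "u ~: \<int>"
   proof
    assume "u : \<int>"
    then obtain l where "u = of_int l" by (auto elim: Ints_cases)
    moreover from this have "real_of_int \<bar>l - m\<bar> < real_of_int 1" using u m by simp
    hence "\<bar>l - m\<bar> < 1" by (simp only: of_int_less_iff)
    ultimately show False using m False by simp
   qed
   moreover have "\<lfloor>u\<rfloor> <= m" "m <= \<lfloor>u\<rfloor> + 1" using u m by linarith+
   ultimately show ?thesis unfolding m by (metis of_int_1 of_int_add of_int_le_iff)
  qed simp
 qed simp
next
 case False
 have lt: "of_int \<lfloor>u0\<rfloor> < u0" "u0 < of_int \<lfloor>u0\<rfloor> + 1"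
  using False by (metis Ints_of_int floor_correct less_le of_int_floor_le) linarith
 show ?thesis
 proof (intro exI[of _ "min (u0 - of_int \<lfloor>u0\<rfloor>) (of_int \<lfloor>u0\<rfloor> + 1 - u0)"] conjI allI impI)
  fix u :: real assume u: "\<bar>u - u0\<bar> < min (u0 - of_int \<lfloor>u0\<rfloor>) (of_int \<lfloor>u0\<rfloor> + 1 - u0)"
  hence lt2: "of_int \<lfloor>u0\<rfloor> < u" "u < of_int \<lfloor>u0\<rfloor> + 1" by linarith+
  hence fl: "\<lfloor>u\<rfloor> = \<lfloor>u0\<rfloor>" by linarith
  have "u ~: \<int>" by (rule not_Ints_between[OF lt2])
  thus "u = u0 \<or> (u ~: \<int> & of_int \<lfloor>u\<rfloor> <= u0 & u0 <= of_int \<lfloor>u\<rfloor> + 1)" using lt fl by simp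
 qed (use lt in simp)
qed

text \<open>Carriers can only drop to faces in a limit: the point at time \<open>t0\<close> lies in
  the cell of the point at time \<open>t\<close>, but not conversely. A Lipschitz bound on the cell
  of the moving point therefore controls the step to the fixed one.\<close>

lemma segment_carrier:
 fixes x y :: pt
 assumes s: "0 < s" and x: "x : cube N" and y: "y : cube N"
 shows "EX dlt>0. ALL t. \<bar>t - t0\<bar> < dlt --> (%i. (1 - t0) * x i + t0 * y i) : car N s (%i. (1 - t) * x i + t * y i)"
proof -
 let ?g = "%t i. (1 - t) * x i + t * y i"
 have "EX d>0. ALL t. \<bar>t - t0\<bar> < d --> ?g t i/s = ?g t0 i/s \<or>
   (?g t i/s ~: \<int> & of_int \<lfloor>?g t i/s\<rfloor> <= ?g t0 i/s & ?g t0 i/s <= of_int \<lfloor>?g t i/s\<rfloor> + 1)" for i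
 proof -
  obtain e where e: "e > 0" "ALL u. \<bar>u - ?g t0 i/s\<bar> < e --> u = ?g t0 i/s \<or> (u ~: \<int> & of_int \<lfloor>u\<rfloor> <= ?g t0 i/s & ?g t0 i/s <= of_int \<lfloor>u\<rfloor> + 1)"
   using near_integer[of "?g t0 i/s"] by blast
  let ?b = "\<bar>(y i - x i)/s\<bar> + 1"
  have "\<bar>?g t i/s - ?g t0 i/s\<bar> < e" if t: "\<bar>t - t0\<bar> < e/?b" for t
  proof -
   have "?g t i/s - ?g t0 i/s = (t - t0)*((y i - x i)/s)" using s by (simp add: field_simps)
   hence "\<bar>?g t i/s - ?g t0 i/s\<bar> = \<bar>t - t0\<bar>*\<bar>(y i - x i)/s\<bar>" by (simp only: abs_mult)
   also have "... <= \<bar>t - t0\<bar>*?b" by (intro mult_left_mono) auto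
   also have "... < e" using t by (subst (asm) pos_less_divide_eq) (auto intro: add_nonneg_pos)
   finally show ?thesis .
  qed
  moreover have "0 < e/?b" using e(1) by (intro divide_pos_pos add_nonneg_pos) auto
  ultimately show ?thesis using e(2) by blast
 qed
 then obtain d where d: "!!i. d i > 0" "!!i t. \<bar>t - t0\<bar> < d i ==> ?g t i/s = ?g t0 i/s \<or>
   (?g t i/s ~: \<int> & of_int \<lfloor>?g t i/s\<rfloor> <= ?g t0 i/s & ?g t0 i/s <= of_int \<lfloor>?g t i/s\<rfloor> + 1)"
  by metis
 let ?d = "Min (d ` {..N})"
 have "?g t0 : car N s (?g t)" if t: "\<bar>t - t0\<bar> < ?d" for t
 proof (rule carI)
  fix i assume i: "i : free N s (?g t)"
  hence "\<bar>t - t0\<bar> < d i" using t free_le[OF i] by (meson Min_le atMost_iff finite_atMost finite_imageI image_eqI less_le_trans)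
  from d(2)[OF this] have "of_int \<lfloor>?g t i/s\<rfloor> <= ?g t0 i/s & ?g t0 i/s <= of_int \<lfloor>?g t i/s\<rfloor> + 1"
  proof
   assume e: "?g t i/s = ?g t0 i/s"
   show ?thesis unfolding e by linarith
  qed simp
  hence "s * of_int \<lfloor>?g t i/s\<rfloor> <= s*(?g t0 i/s) & s*(?g t0 i/s) <= s*(of_int \<lfloor>?g t i/s\<rfloor> + 1)"
   using s by (simp only: mult_le_cancel_left_pos)
  thus "s * of_int \<lfloor>?g t i/s\<rfloor> <= ?g t0 i & ?g t0 i <= s*(of_int \<lfloor>?g t i/s\<rfloor> + 1)" using s by simp
 next
  fix i assume i: "i ~: free N s (?g t)"
  show "?g t0 i = ?g t i"
  proof (cases "i <= N")
   case True
   hence "\<bar>t - t0\<bar> < d i" using t by (meson Min_le atMost_iff finite_atMost finite_imageI image_eqI less_le_trans)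
   from d(2)[OF this] have "?g t i/s = ?g t0 i/s" using i True by (auto simp: free_def)
   thus ?thesis using s by simp
  next
   case False thus ?thesis using x y by (simp add: cube_def)
  qed
 qed
 moreover have "?d > 0" using d(1) by (subst Min_gr_iff) auto
 ultimately show ?thesis by blast
qed

text \<open>Bisection through \<open>Bolzano\<close>: the estimate adds up over adjacent intervals
  and holds on short intervals around each time. Comparisons with the centre \<open>t0\<close> are
  enough, because an interval around \<open>t0\<close> splits there.\<close>

lemma local_to_global_lipschitz:
 fixes phi :: "real => 'a::metric_space"
 assumes "!!t0. t0 : {0..1} ==> EX dlt>0. ALL t:{0..1}. \<bar>t - t0\<bar> < dlt --> dist (phi t) (phi t0) <= M*\<bar>t - t0\<bar>"
 shows "dist (phi 0) (phi 1) <= M"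
proof -
 have "0 <= (0::real) & (1::real) <= 1 --> dist (phi 0) (phi 1) <= M*(1 - 0)"
 proof (rule Bolzano[where a=0 and b=1 and P="%a b. 0 <= a & b <= 1 --> dist (phi a) (phi b) <= M*(b - a)"])
  show "(0::real) <= 1" by simp
 next
  fix a b c :: real
  assume "0 <= a & b <= 1 --> dist (phi a) (phi b) <= M*(b - a)" "0 <= b & c <= 1 --> dist (phi b) (phi c) <= M*(c - b)" "a <= b" "b <= c"
  thus "0 <= a & c <= 1 --> dist (phi a) (phi c) <= M*(c - a)" using dist_triangle[of "phi a" "phi c" "phi b"] by (auto simp: algebra_simps)
 next
  fix x :: real assume "0 <= x" "x <= 1"
  then obtain d where d: "d > 0" "ALL t:{0..1}. \<bar>t - x\<bar> < d --> dist (phi t) (phi x) <= M*\<bar>t - x\<bar>"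
   using assms[of x] by auto
  have "dist (phi a) (phi b) <= M*(b - a)" if ab: "a <= x" "x <= b" "b - a < d" "0 <= a" "b <= 1" for a b
  proof -
   have "dist (phi a) (phi x) <= M*\<bar>a - x\<bar>" "dist (phi b) (phi x) <= M*\<bar>b - x\<bar>" using d(2)[rule_format, of a] d(2)[rule_format, of b] ab by simp_all
   thus ?thesis using ab dist_triangle2[of "phi a" "phi b" "phi x"] by (auto simp: algebra_simps)
  qed
  thus "EX d>0. ALL a b. a <= x & x <= b & b - a < d --> 0 <= a & b <= 1 --> dist (phi a) (phi b) <= M*(b - a)"
   using d(1) by blast
 qed
 thus ?thesis by simp
qed

section \<open>Whitney extension from closed subsets of a cube\<close>

lemma l1_segment: "l1 N (%i. (1 - t) * x i + t * y i) (%i. (1 - u) * x i + u * y i) = \<bar>t - u\<bar> * l1 N x y"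
proof -
 have "((1 - t) * x i + t * y i) - ((1 - u) * x i + u * y i) = (u - t)*(x i - y i)" for i by (simp add: algebra_simps)
 thus ?thesis by (simp add: l1_def abs_mult sum_distrib_left abs_minus_commute)
qed

text \<open>\<open>G1\<close> is the constant on cells close to \<open>A\<close>, where all vertices
  take nearest-point values, and \<open>G2\<close> the one on arbitrary cells. \<open>G4\<close>
  compares the map with the values on \<open>A\<close> close to \<open>A\<close>. The final constant
  is \<open>G2 + G3\<close>, where \<open>G3 = G2 + 2 * G4\<close> does this comparison
  everywhere.\<close>

definition ext_const :: "nat => real => real" where
 "ext_const N c = (let d = real (Suc N); S = skel_const N c; G1 = S*(29 * d); G4 = G1 + 6;
   G2 = S*(24 * d * G4) in 2 * G2 + 2 * G4)"

lemma skel_const_ge1: "1 <= skel_const N c"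
 unfolding skel_const_def by (rule one_le_power) simp

text \<open>Whitney's scheme: \<open>K j\<close> is filled at mesh \<open>sc j\<close> and keeps
  more than \<open>4 * d * sc j\<close> away from \<open>A\<close>; a new vertex takes the value of
  \<open>f\<close> at an almost nearest point. The danger is that every scale multiplies the
  constant. It does not, because an old cell that touches a new one is close to \<open>A\<close> on
  its own scale, and such cells were built without contact to older ones, with the fixed constant
  \<open>G1\<close>. So \<open>G2\<close> is computed from \<open>G1\<close> and never from
  itself.\<close>

theorem lipschitz_extension:
 fixes f :: "pt => 'a::metric_space"
 assumes Y: "lip_connected_const Y n c" and N: "N <= n"
  and A\<Omega>: "A <= \<Omega>" and \<Omega>: "\<Omega> <= cube N"
  and conv: "!!x y t. x : \<Omega> ==> y : \<Omega> ==> 0 <= t ==> t <= 1 ==> (%i. (1 - t) * x i + t * y i) : \<Omega>"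
  and cl: "!!x. x : \<Omega> - A ==> EX r>0. ALL a:A. r <= l1 N x a"
  and ne: "A ~= {}" and fY: "f ` A <= Y" and fL: "lipl N L A f"
 shows "EX g. (g ` \<Omega> <= Y & (ALL x:A. g x = f x)) & lipl N (ext_const N c * L) \<Omega> g"
proof -
 define d where "d = real (Suc N)"
 define S where "S = skel_const N c"
 define G1 where "G1 = S*(29 * d)"
 define G4 where "G4 = G1 + 6"
 define G2 where "G2 = S*(24 * d * G4)"
 define G3 where "G3 = G2 + 2 * G4"
 define sc where "sc = (%j::nat. (1/2::real)^j)"
 have sc0: "0 < sc j" for j by (simp add: sc_def)
 have scS: "sc j = 2 * sc (Suc j)" for j by (simp add: sc_def)
 have d1: "1 <= d" by (simp add: d_def)
 have S1: "1 <= S" unfolding S_def by (rule skel_const_ge1)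
 have G1p: "1 <= G1" unfolding G1_def using S1 d1 mult_mono[of 1 S 1 "29 * d"] by auto
 have G4p: "7 <= G4" using G1p by (simp add: G4_def)
 have dG4: "7 <= d * G4" using d1 G4p mult_mono[of 1 d 7 G4] by auto
 have G2b: "24 * d * G4 <= G2" 
 proof -
  have "0 <= 24 * d * G4" using dG4 by linarith
  from mult_right_mono[OF S1 this] show ?thesis unfolding G2_def by linarith
 qed
 have G12: "G1 <= 24 * d * G4"
 proof -
  have "1 * G4 <= d * G4" using d1 G4p by (intro mult_right_mono) auto
  moreover have "G1 <= G4" by (simp add: G4_def)
  ultimately show ?thesis using dG4 by linarith
 qed
 have G2p: "1 <= G2" using G2b dG4 by linarith
 have L0: "0 <= L" using fL by (simp add: lipl_def)
 have fLd: "dist (f a) (f b) <= L * l1 N a b" if "a : A" "b : A" for a b using fL that by (auto simp: lipl_def)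
 define K where "K = (%j. {x : cube N. ALL y:car N (sc j) x. ALL a:A. 4 * d * sc j < l1 N y a})"
 have car_d: "l1 N y z <= d * sc j" if "y : car N (sc j) x" "z : car N (sc j) x" for x y z j
  using car_diam[OF sc0 that] by (simp add: d_def)
 have self: "x : car N (sc j) x" for x j by (rule car_self[OF sc0])
 have Kcar: "car N (sc j) x <= K j" if "x : K j" for x j
  using that car_trans[OF sc0, of _ N j x] car_cube[of x N j] unfolding K_def sc_def by blast
 have refine: "car N (sc (Suc j)) x <= car N (sc j) x" for j x
  using car_refine[OF sc0, of N j x] scS[of j] by simp
 have Kd: "4 * d * sc j < l1 N x a" if "x : K j" "a : A" for x a j using that self unfolding K_def by blast
 have Kmono: "K j <= K (Suc j)" for j
 proof
  fix x assume x: "x : K j"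
  have "4 * d * sc (Suc j) < l1 N y a" if "y : car N (sc (Suc j)) x" "a : A" for y a
  proof -
   have "4 * d * sc j < l1 N y a" using x that refine unfolding K_def by blast
   moreover have "4 * d * sc (Suc j) <= 4 * d * sc j" unfolding scS[of j] using d1 sc0[of "Suc j"] by (intro mult_left_mono) auto
   ultimately show ?thesis by linarith
  qed
  thus "x : K (Suc j)" using x unfolding K_def by blast
 qed
 have KA: "x ~: A" if "x : K j" for x j
  using Kd[OF that, of x] d1 sc0[of j] by (auto simp: mult_less_0_iff)
 \<comment> \<open>The cube has l1 diameter at most \<open>2 * d\<close>, less than the required
   \<open>4 * d * sc 0\<close>; the induction over scales starts from the empty map.\<close>
 have K0: "K 0 = {}"
 proof -
  obtain a where a: "a : A" using ne by auto
  have "x ~: K 0" for x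
  proof
   assume x: "x : K 0"
   hence "x : cube N" by (simp add: K_def)
   moreover have "a : cube N" using a A\<Omega> \<Omega> by auto
   ultimately have "l1 N x a <= real (Suc N)*2" by (intro l1_le_bound) (auto simp: cube_def abs_le_iff, smt+)
   hence "l1 N x a <= 2 * d" by (simp add: d_def)
   moreover have "4 * d < l1 N x a" using Kd[OF x a] by (simp add: sc_def)
   ultimately show False using d1 by linarith
  qed
  thus ?thesis by auto
 qed
 have notK: "EX a:A. l1 N x a <= 5 * d * sc j" if xK: "x : cube N" "x ~: K j" for x j
 proof -
  obtain y a where ya: "y : car N (sc j) x" "a : A" "l1 N y a <= 4 * d * sc j" using xK unfolding K_def by force
  have "l1 N x a <= l1 N x y + l1 N y a" by (rule l1_triangle)
  also have "l1 N x y <= d * sc j" by (rule car_d[OF self ya(1)])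
  finally show ?thesis using ya by (intro bexI[of _ a]) auto
 qed
 have inK: "x : K j" if "x : cube N" "ALL a:A. 5 * d * sc j < l1 N x a" for x j
  using notK[OF that(1)] that(2) by force
 \<comment> \<open>Nearest points need not exist. As the distance to \<open>A\<close> is positive on
   \<open>K j\<close>, a point within twice the infimum does.\<close>
 define na where "na = (%v. SOME a. a : A & (ALL b:A. l1 N v a <= 2 * l1 N v b))"
 have na: "na v : A & (ALL b:A. l1 N v (na v) <= 2 * l1 N v b)" if v: "v : K j" for v j
 proof -
  let ?I = "Inf (l1 N v ` A)"
  have bdd: "bdd_below (l1 N v ` A)" by (rule bdd_belowI[of _ 0]) auto
  have "4 * d * sc j <= ?I" using ne Kd[OF v] by (intro cInf_greatest) (auto simp: less_imp_le)
  moreover have "0 < 4 * d * sc j" using d1 sc0[of j] by simp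
  ultimately have "?I < 2*?I" by linarith
  then obtain a where a: "a : A" "l1 N v a < 2*?I" using cInf_lessD[of "l1 N v ` A"] ne by (metis (no_types, lifting) empty_is_image imageE)
  have "l1 N v a <= 2 * l1 N v b" if "b : A" for b using a(2) cInf_lower[OF _ bdd, of "l1 N v b"] that by auto
  thus ?thesis unfolding na_def using a(1) by (intro someI_ex[where P="%a. a : A & (ALL b:A. l1 N v a <= 2 * l1 N v b)"]) blast
 qed
 have naf: "dist (f (na v)) (f a) <= 3 * L * l1 N v a" if "v : K j" "a : A" for v a j
 proof -
  have "dist (f (na v)) (f a) <= L * l1 N (na v) a" using na[OF that(1)] that(2) by (intro fLd) auto
  also have "l1 N (na v) a <= 3 * l1 N v a"
   using l1_triangle[of N "na v" a v] na[OF that(1)] that(2) l1_commute[of N v "na v"] by force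
  hence "L * l1 N (na v) a <= L*(3 * l1 N v a)" using L0 by (rule mult_left_mono)
  finally show ?thesis by simp
 qed
 \<comment> \<open>The 6 leaves room on both sides. A point of a new cell is within
   \<open>6 * d * sc j\<close> of \<open>A\<close>, so old cells meeting it are near. A near cell of
   the next scale stays within \<open>7 * d * sc (Suc j)\<close>, which is less than
   \<open>4 * d * sc j\<close>, so it misses \<open>K j\<close>.\<close>
 define near where "near = (%j x. EX y:car N (sc j) x. EX a:A. l1 N y a <= 6 * d * sc j)"
 define P where "P = (%j F. F ` K j <= Y & (ALL x:K j. lipl N (G2 * L) (car N (sc j) x) F) &
   (ALL x:K j. ALL a:A. dist (F x) (f a) <= G3 * L * l1 N x a) &
   (ALL x:K j. near j x --> lipl N (G1 * L) (car N (sc j) x) F & (ALL a:A. dist (F x) (f a) <= G4 * L * l1 N x a)))"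
 have step: "EX F'. P (Suc j) F' & (ALL x:K j. F' x = F x)" if PF: "P j F" for j F
 proof -
  let ?s = "sc (Suc j)"
  define V where "V = (%v. if v : K j then F v else f (na v))"
  have FY: "F ` K j <= Y" and Fa: "!!x. x : K j ==> lipl N (G2 * L) (car N (sc j) x) F"
   and Fb: "!!x. x : K j ==> near j x ==> lipl N (G1 * L) (car N (sc j) x) F"
   and Fb2: "!!x a. x : K j ==> near j x ==> a : A ==> dist (F x) (f a) <= G4 * L * l1 N x a"
   and Fc: "!!x a. x : K j ==> a : A ==> dist (F x) (f a) <= G3 * L * l1 N x a"
   using PF unfolding P_def by blast+
  have Kc1: "car N ?s x <= K j" if "x : K j" for x using Kcar[OF that] refine by blast
  have Kc2: "car N ?s x <= K (Suc j)" if "x : K (Suc j)" for x using Kcar[OF that] .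
  text \<open>A new cell, its faces and its vertices lie within distance comparable to the mesh from \<open>A\<close>.\<close>
  have newnear: "near j y" if x: "x : K (Suc j)" "x ~: K j" and y: "y : car N ?s x" for x y
  proof -
   obtain a where a: "a : A" "l1 N x a <= 5 * d * sc j" using notK[of x j] x unfolding K_def by blast
   have "l1 N y a <= l1 N y x + l1 N x a" by (rule l1_triangle)
   also have "l1 N y x <= d*?s" by (rule car_d[OF y self])
   also have "d*?s <= d * sc j" unfolding scS[of j] using d1 sc0[of "Suc j"] by (intro mult_left_mono) auto
   finally show ?thesis unfolding near_def using a self[of y j] by (intro bexI[of _ y] bexI[of _ a]) auto
  qed
  have newV: "dist (V v) (f a) <= G4 * L * l1 N v a" if x: "x : K (Suc j)" "x ~: K j" and v: "v : car N ?s x" and a: "a : A" for x v a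
  proof (cases "v : K j")
   case True thus ?thesis using Fb2[OF True newnear[OF x v] a] by (simp add: V_def)
  next
   case False
   have "v : K (Suc j)" using Kc2 x v by blast
   hence "dist (V v) (f a) <= 3 * L * l1 N v a" using naf a False by (simp add: V_def)
   also have "... <= G4 * L * l1 N v a" using G4p L0 by (intro mult_right_mono) auto
   finally show ?thesis .
  qed
  have newVV: "dist (V v) (V w) <= 24 * d * G4 * L*?s"
   if x: "x : K (Suc j)" "x ~: K j" and v: "v : car N ?s x" and w: "w : car N ?s x" for x v w
  proof -
   obtain a where a: "a : A" "l1 N x a <= 5 * d * sc j" using notK[of x j] x unfolding K_def by blast
   have b: "l1 N z a <= 12 * d*?s" if "z : car N ?s x" for z
   proof -
    have "l1 N z a <= l1 N z x + l1 N x a" by (rule l1_triangle)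
    also have "l1 N z x <= d*?s" by (rule car_d[OF that self])
    finally have "l1 N z a <= 11*(d*?s)" using a unfolding scS[of j] by simp
    moreover have "0 <= d*?s" using d1 sc0[of "Suc j"] by simp
    ultimately show ?thesis by linarith
   qed
   have GL: "0 <= G4 * L" using G4p L0 by simp
   have "dist (V v) (V w) <= dist (V v) (f a) + dist (V w) (f a)" by (rule dist_triangle2)
   also have "dist (V v) (f a) <= G4 * L * l1 N v a" by (rule newV[OF x v a(1)])
   also have "G4 * L * l1 N v a <= G4 * L*(12 * d*?s)" using b[OF v] GL by (rule mult_left_mono)
   also have "dist (V w) (f a) <= G4 * L * l1 N w a" by (rule newV[OF x w a(1)])
   also have "G4 * L * l1 N w a <= G4 * L*(12 * d*?s)" using b[OF w] GL by (rule mult_left_mono)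
   finally show ?thesis by (simp add: mult_ac)
  qed
  have G2L: "0 <= G2 * L" "0 <= 24 * d * G4 * L" using G2p G4p d1 L0 by auto
  define m0 where "m0 = G2 * L * d + G2 * L + 24 * d * G4 * L"
  have m00: "0 <= m0" unfolding m0_def using G2L d1 by simp
  obtain F' where F': "F' ` K (Suc j) <= Y" "!!x. x : K j ==> F' x = F x"
    "!!x. x : K (Suc j) ==> free N ?s x = {} ==> F' x = V x"
   and lip': "!!x m. x : K (Suc j) ==> 0 <= m ==> (!!y. y : car N ?s x Int K j ==> lipl N m (car N ?s y) F) ==>
     (!!v w. v : car N ?s x ==> w : car N ?s x ==> free N ?s v = {} ==> free N ?s w = {} ==> dist (V v) (V w) <= m*?s) ==>
     lipl N (S * m) (car N ?s x) F'"
  proof -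
   have "EX F'. F' ` K (Suc j) <= Y & (ALL x:K j. F' x = F x) & (ALL x:K (Suc j). free N ?s x = {} --> F' x = V x) &
    (ALL x:K (Suc j). ALL m>=0. (ALL y:car N ?s x Int K j. lipl N m (car N ?s y) F) &
    (ALL v:car N ?s x. ALL w:car N ?s x. free N ?s v = {} --> free N ?s w = {} --> dist (V v) (V w) <= m*?s) \<longrightarrow>
    lipl N (skel_const N c * m) (car N ?s x) F')"
   proof (rule skeleton_extension[OF sc0 Y N Kmono Kc1 Kc2 FY _ V_def m00])
    show "(%v. f (na v)) ` K (Suc j) <= Y" using na fY by blast
    show "lipl N m0 (car N ?s y) F" if "y : K j" for y
     by (rule lipl_mono[OF Fa[OF that] refine]) (use G2L d1 in \<open>simp add: m0_def\<close>)
    fix x v w assume x: "x : K (Suc j)" and vw: "v : car N ?s x" "w : car N ?s x"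
    show "dist (V v) (V w) <= m0*?s"
    proof (cases "x : K j")
     case True
     have vw': "v : car N (sc j) x" "w : car N (sc j) x" "v : K j" "w : K j" using vw refine Kc1[OF True] by blast+
     have "dist (V v) (V w) <= G2 * L * l1 N v w" using Fa[OF True] vw' unfolding lipl_def V_def by auto
     also have "... <= G2 * L*(d*?s)" using car_d[OF vw] G2L(1) by (rule mult_left_mono)
     also have "... = G2 * L * d*?s" by simp
     also have "... <= m0*?s" using G2L sc0[of "Suc j"] by (intro mult_right_mono) (auto simp: m0_def)
     finally show ?thesis .
    next
     case False
     have "dist (V v) (V w) <= 24 * d * G4 * L*?s" by (rule newVV[OF x False vw])
     also have "... <= m0*?s" using G2L d1 sc0[of "Suc j"] by (intro mult_right_mono) (auto simp: m0_def)
     finally show ?thesis .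
    qed
   qed
   then obtain F0 where F0: "F0 ` K (Suc j) <= Y" "ALL x:K j. F0 x = F x" "ALL x:K (Suc j). free N ?s x = {} --> F0 x = V x"
    "ALL x:K (Suc j). ALL m>=0. (ALL y:car N ?s x Int K j. lipl N m (car N ?s y) F) &
    (ALL v:car N ?s x. ALL w:car N ?s x. free N ?s v = {} --> free N ?s w = {} --> dist (V v) (V w) <= m*?s) \<longrightarrow>
    lipl N (skel_const N c * m) (car N ?s x) F0" by (elim exE conjE)
   show ?thesis
   proof (rule that[OF F0(1) F0(2)[rule_format] F0(3)[rule_format]])
    fix x m assume "x : K (Suc j)" "0 <= m" "!!y. y : car N ?s x Int K j ==> lipl N m (car N ?s y) F"
     "!!v w. v : car N ?s x ==> w : car N ?s x ==> free N ?s v = {} ==> free N ?s w = {} ==> dist (V v) (V w) <= m*?s"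
    thus "lipl N (S * m) (car N ?s x) F0" unfolding S_def by (intro F0(4)[rule_format] conjI ballI impI)
   qed
  qed
  have new_lip: "lipl N (G2 * L) (car N ?s x) F'" if x: "x : K (Suc j)" "x ~: K j" for x
  proof -
   have "lipl N (S*(24 * d * G4 * L)) (car N ?s x) F'"
   proof (rule lip'[OF x(1) G2L(2)])
    fix y assume y: "y : car N ?s x Int K j"
    have "lipl N (G1 * L) (car N (sc j) y) F" using Fb newnear[OF x] y by blast
    thus "lipl N (24 * d * G4 * L) (car N ?s y) F"
     by (rule lipl_mono[OF _ refine]) (use G12 L0 in \<open>rule mult_right_mono\<close>)
   qed (use newVV[OF x] in blast)
   thus ?thesis by (simp add: G2_def mult_ac)
  qed
  have vertex: "EX v:car N ?s x. free N ?s v = {}" for x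
  proof (cases "free N ?s x = {}")
   case True thus ?thesis using self by blast
  next
   case False
   then obtain i where i: "i : free N ?s x" by blast
   let ?w = "x(i := ?s * of_int \<lfloor>x i/?s\<rfloor>)"
   have "?w : car N ?s x" using i sc0[of "Suc j"] carD1[OF self i] carD1[OF self] by (intro carI) auto
   moreover have "?w i/?s : \<int>" using sc0[of "Suc j"] by simp
   ultimately show ?thesis using car_vertex[OF sc0 i] by blast
  qed
  have small: "d*?s <= l1 N x a" if "x : K (Suc j)" "a : A" for x a
  proof -
   have "0 <= d*?s" using d1 sc0[of "Suc j"] by simp
   thus ?thesis using Kd[OF that] by linarith
  qed
  \<comment> \<open>One step to a vertex of the cell, where the value is prescribed. The step is no
    longer than \<open>l1 N x a\<close>, and the vertex is at most twice as far from
    \<open>a\<close> as \<open>x\<close> is; hence \<open>g + 2 * h\<close>.\<close>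
  have val: "dist (F' x) (f a) <= (g + 2 * h) * L * l1 N x a"
   if x: "x : K (Suc j)" "a : A" and g: "lipl N (g * L) (car N ?s x) F'" "0 <= g" "0 <= h"
    and h: "!!v. v : car N ?s x ==> dist (V v) (f a) <= h * L * l1 N v a" for x a g h
  proof -
   obtain v where v: "v : car N ?s x" "free N ?s v = {}" using vertex by blast
   have vK: "v : K (Suc j)" using v Kc2[OF x(1)] by blast
   have "dist (F' x) (F' v) <= g * L * l1 N x v" using g(1) v self unfolding lipl_def by blast
   also have "... <= g * L * l1 N x a" using car_d[OF self v(1)] small[OF x] g(2) L0 by (intro mult_left_mono) auto
   finally have 1: "dist (F' x) (F' v) <= g * L * l1 N x a" .
   have "l1 N v a <= l1 N v x + l1 N x a" by (rule l1_triangle)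
   also have "... <= 2 * l1 N x a" using car_d[OF v(1) self] small[OF x] by simp
   finally have "h * L * l1 N v a <= h * L*(2 * l1 N x a)" using g(3) L0 by (intro mult_left_mono) auto
   hence 2: "dist (F' v) (f a) <= 2 * h * L * l1 N x a" using h[OF v(1)] F'(3)[OF vK v(2)] by simp
   show ?thesis using dist_triangle[of "F' x" "f a" "F' v"] 1 2 by (simp add: algebra_simps)
  qed
  have "P (Suc j) F'"
   unfolding P_def
  proof (intro conjI ballI impI)
   show "F' ` K (Suc j) <= Y" by (rule F'(1))
  next
   fix x assume x: "x : K (Suc j)"
   have oldeq: "lipl N M (car N ?s x) F'" if "x : K j" "lipl N M (car N (sc j) x) F" for M
   proof -
    have "lipl N M (car N ?s x) F" using lipl_mono[OF that(2) refine order_refl] .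
    thus ?thesis using F'(2) Kc1[OF that(1)] by (subst lipl_cong[of _ F' F]) auto
   qed
   show xl: "lipl N (G2 * L) (car N ?s x) F'"
   proof (cases "x : K j")
    case True thus ?thesis using oldeq Fa by blast
   next
    case False thus ?thesis using new_lip x by blast
   qed
   fix a assume a: "a : A"
   show "dist (F' x) (f a) <= G3 * L * l1 N x a"
   proof (cases "x : K j")
    case True thus ?thesis using F'(2) Fc a by simp
   next
    case False
    show ?thesis unfolding G3_def using G2p G4p newV[OF x False _ a] by (intro val[OF x a xl]) auto
   qed
  next
   fix x assume x: "x : K (Suc j)" and n: "near (Suc j) x"
   obtain y b where yb: "y : car N ?s x" "b : A" "l1 N y b <= 6 * d*?s" using n unfolding near_def by blast
   have zb: "l1 N z b <= 7 * d*?s" if "z : car N ?s x" for z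
    using l1_triangle[of N z b y] car_d[OF that yb(1)] yb(3) by linarith
   have fresh: "z ~: K j" if "z : car N ?s x" for z
   proof
    assume "z : K j"
    hence "4 * d * sc j < l1 N z b" using Kd yb(2) by blast
    moreover have "0 < d*?s" using d1 sc0[of "Suc j"] by simp
    ultimately show False using zb[OF that] unfolding scS[of j] by simp
   qed
   have VV: "dist (V v) (V w) <= 29 * d * L*?s" if v: "v : car N ?s x" and w: "w : car N ?s x" for v w
   proof -
    have vw: "v : K (Suc j)" "w : K (Suc j)" using Kc2[OF x] v w by auto
    have nn: "l1 N z (na z) <= 14 * d*?s" if "z : car N ?s x" "z : K (Suc j)" for z
     using na[OF that(2)] zb[OF that(1)] yb(2) by force
    have "dist (V v) (V w) <= L * l1 N (na v) (na w)" using fresh[OF v] fresh[OF w] na[OF vw(1)] na[OF vw(2)] by (simp add: V_def fLd)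
    \<comment> \<open>Two legs to almost nearest points, each at most twice \<open>7 * d*?s\<close>,
      and one cell diameter between them.\<close>
    also have "l1 N (na v) (na w) <= 29 * d*?s"
     using l1_triangle[of N "na v" "na w" v] l1_triangle[of N v "na w" w] nn[OF v vw(1)] nn[OF w vw(2)] car_d[OF v w]
      l1_commute[of N v "na v"] by linarith
    hence "L * l1 N (na v) (na w) <= L*(29 * d*?s)" using L0 by (rule mult_left_mono)
    finally show ?thesis by (simp add: mult_ac)
   qed
   have xl: "lipl N (G1 * L) (car N ?s x) F'"
   proof -
    have "lipl N (S*(29 * d * L)) (car N ?s x) F'"
     using L0 d1 fresh VV by (intro lip'[OF x]) auto
    thus ?thesis by (simp add: G1_def mult_ac)
   qed
   show "lipl N (G1 * L) (car N ?s x) F'" by (rule xl)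
   fix a assume a: "a : A"
   have "dist (V v) (f a) <= 3 * L * l1 N v a" if "v : car N ?s x" for v
    using naf[of v "Suc j" a] that Kc2[OF x] fresh[OF that] a by (auto simp: V_def)
   hence "dist (F' x) (f a) <= (G1 + 2*3) * L * l1 N x a" using G1p by (intro val[OF x a xl]) auto
   thus "dist (F' x) (f a) <= G4 * L * l1 N x a" by (simp add: G4_def)
  qed
  thus ?thesis using F'(2) by blast
 qed
 have "EX fs. ALL j. P j (fs j) & (ALL x:K j. fs (Suc j) x = fs j x)"
  by (rule dependent_nat_choice) (use K0 step in \<open>auto simp: P_def\<close>)
 then obtain fs where fsP: "!!j. P j (fs j)" and fsS: "!!j x. x : K j ==> fs (Suc j) x = fs j x" by blast
 define g where "g = (%x. if x : A then f x else fs (LEAST j. x : K j) x)"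
 have fs_le: "x : K (i + j) & fs (i + j) x = fs i x" if "x : K i" for x i j
  using that fsS Kmono by (induction j) auto
 have gK: "g x = fs j x" if x: "x : K j" for x j
 proof -
  let ?i = "LEAST j. x : K j"
  have "x : K ?i" "?i <= j" using x by (auto intro: LeastI Least_le)
  hence "fs j x = fs ?i x" using fs_le[of x ?i "j - ?i"] by simp
  thus ?thesis using KA[OF x] by (simp add: g_def)
 qed
 have exK: "EX j. x : K j" if xA: "x : \<Omega> - A" for x
 proof -
  obtain r where r: "r > 0" "ALL a:A. r <= l1 N x a" using cl[OF xA] by blast
  obtain j where "sc j < r/(5 * d)" unfolding sc_def using real_arch_pow_inv[of "r/(5 * d)" "1/2"] r(1) d1 by auto
  hence "5 * d * sc j < r" using d1 by (simp add: pos_less_divide_eq mult.commute)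
  thus ?thesis using inK[of x j] that \<Omega> r(2) by force
 qed
 define M where "M = (G2 + G3) * L"
 have M0: "0 <= M" unfolding M_def G3_def using G2p G4p L0 by simp
 have gval: "dist (g x) (f a) <= M * l1 N x a" if x: "x : \<Omega>" and a: "a : A" for x a
 proof (cases "x : A")
  case True
  have "dist (g x) (f a) <= L * l1 N x a" using True a fLd by (simp add: g_def)
  also have "L <= M" using G2p G4p L0 unfolding M_def G3_def by (simp add: mult_le_cancel_right1)
  hence "L * l1 N x a <= M * l1 N x a" by (intro mult_right_mono) auto
  finally show ?thesis .
 next
  case False
  then obtain j where j: "x : K j" using exK x by blast
  have "dist (g x) (f a) <= G3 * L * l1 N x a" using fsP[of j] j a unfolding P_def gK[OF j] by blast
  also have "... <= M * l1 N x a" unfolding M_def using G2p L0 by (intro mult_right_mono) auto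
  finally show ?thesis .
 qed
 have "dist (g x) (g y) <= M * l1 N x y" if x: "x : \<Omega>" and y: "y : \<Omega>" for x y
 proof -
  define gam where "gam = (%t i. (1 - t) * x i + t * y i)"
  have gam\<Omega>: "gam t : \<Omega>" if "t : {0..1}" for t using conv[OF x y] that by (simp add: gam_def)
  have gamd: "l1 N (gam t) (gam u) = \<bar>t - u\<bar> * l1 N x y" for t u unfolding gam_def by (rule l1_segment)
  have "dist (g (gam 0)) (g (gam 1)) <= M * l1 N x y"
  proof (rule local_to_global_lipschitz)
   fix t0 :: real assume t0: "t0 : {0..1}"
   show "EX dlt>0. ALL t:{0..1}. \<bar>t - t0\<bar> < dlt --> dist (g (gam t)) (g (gam t0)) <= M * l1 N x y*\<bar>t - t0\<bar>"
   proof (cases "gam t0 : A")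
    case True
    hence "g (gam t0) = f (gam t0)" by (simp add: g_def)
    hence "dist (g (gam t)) (g (gam t0)) <= M * l1 N x y*\<bar>t - t0\<bar>" if "t : {0..1}" for t
     using gval[OF gam\<Omega>[OF that] True] by (simp add: gamd mult_ac)
    thus ?thesis by (intro exI[of _ 1]) auto
   next
    case False
    then obtain r where r: "r > 0" "ALL a:A. r <= l1 N (gam t0) a" using cl[of "gam t0"] gam\<Omega>[OF t0] by blast
    obtain J where "sc J < (r/2)/(5 * d)" unfolding sc_def using real_arch_pow_inv[of "(r/2)/(5 * d)" "1/2"] r(1) d1 by auto
    hence J: "5 * d * sc J < r/2" using d1 by (simp add: pos_less_divide_eq mult.commute mult.left_commute)
    have "EX e>0. ALL t. \<bar>t - t0\<bar> < e --> gam t0 : car N (sc j) (gam t)" for j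
     unfolding gam_def using segment_carrier[OF sc0] x y \<Omega> by blast
    then obtain e where e: "!!j. e j > 0" "!!j t. \<bar>t - t0\<bar> < e j ==> gam t0 : car N (sc j) (gam t)" by metis
    \<comment> \<open>The second entry keeps the nearby points at distance at least
      \<open>r/2\<close> from \<open>A\<close>, so they all lie in \<open>K J\<close>. Then only the
      scales up to \<open>J\<close> occur, and the first entry makes their finitely many carriers
      contain the fixed point.\<close>
    define dlt where "dlt = min (Min (e ` {..J})) (r/(2*(l1 N x y + 1)))"
    have pos: "0 < dlt" unfolding dlt_def using e(1) r(1) by (simp add: add_nonneg_pos)
    have "dist (g (gam t)) (g (gam t0)) <= M * l1 N x y*\<bar>t - t0\<bar>" if t: "t : {0..1}" "\<bar>t - t0\<bar> < dlt" for t
    proof -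
     have "\<bar>t - t0\<bar> < r/(2*(l1 N x y + 1))" using t(2) by (simp add: dlt_def)
     moreover have lp: "0 < 2*(l1 N x y + 1)" by (simp add: add_nonneg_pos)
     ultimately have "\<bar>t - t0\<bar>*(2*(l1 N x y + 1)) < r" by (simp only: pos_less_divide_eq)
     hence "2*\<bar>t - t0\<bar> + 2*(\<bar>t - t0\<bar> * l1 N x y) < r" by (simp add: algebra_simps)
     moreover have "0 <= \<bar>t - t0\<bar>" by (rule abs_ge_zero)
     ultimately have "\<bar>t - t0\<bar> * l1 N x y < r/2" by argo
     hence tt: "l1 N (gam t0) (gam t) < r/2" by (simp add: gamd abs_minus_commute)
     have "5 * d * sc J < l1 N (gam t) a" if "a : A" for a
      using l1_triangle[of N "gam t0" a "gam t"] r(2) that tt J by force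
     hence KJ: "gam t : K J" using inK gam\<Omega>[OF t(1)] \<Omega> by blast
     define j where "j = (LEAST j. gam t : K j)"
     have j: "gam t : K j" "j <= J" unfolding j_def using KJ by (auto intro: LeastI Least_le)
     have "\<bar>t - t0\<bar> < e j" using t(2) j(2) unfolding dlt_def
      by (meson Min_le atMost_iff finite_atMost finite_imageI image_eqI less_le_trans min_less_iff_conj)
     hence c: "gam t0 : car N (sc j) (gam t)" by (rule e(2))
     hence "gam t0 : K j" using Kcar[OF j(1)] by blast
     hence "dist (g (gam t)) (g (gam t0)) = dist (fs j (gam t)) (fs j (gam t0))" using gK j(1) by simp
     also have "... <= G2 * L * l1 N (gam t) (gam t0)" using fsP[of j] j(1) c self unfolding P_def lipl_def by blast
     also have "... <= M * l1 N (gam t) (gam t0)" unfolding M_def G3_def using G2p G4p L0 by (intro mult_right_mono) auto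
     finally show ?thesis by (simp add: gamd mult_ac)
    qed
    thus ?thesis using pos by blast
   qed
  qed
  thus ?thesis by (simp add: gam_def)
 qed
 hence "lipl N M \<Omega> g" using M0 by (simp add: lipl_def)
 moreover have "M = ext_const N c * L"
  unfolding M_def ext_const_def G3_def Let_def d_def S_def G1_def G4_def G2_def by (simp add: algebra_simps)
 moreover have "g ` \<Omega> <= Y"
 proof
  fix z assume "z : g ` \<Omega>"
  then obtain x where x: "x : \<Omega>" "z = g x" by blast
  show "z : Y"
  proof (cases "x : A")
   case True thus ?thesis using x fY by (auto simp: g_def)
  next
   case False
   then obtain j where "x : K j" using exK x by blast
   thus ?thesis using fsP[of j] gK[of x j] x unfolding P_def by auto
  qed
 qed
 ultimately show ?thesis by (intro exI[of _ g]) (auto simp: g_def)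
qed

lemma lipl_dist: "lipl k L A f ==> x : A ==> y : A ==> dist (f x) (f y) <= L * l1 k x y"
 by (simp add: lipl_def)

lemma ext_const_nonneg: "0 <= ext_const N c"
 using skel_const_ge1[of N c] unfolding ext_const_def Let_def by (intro add_nonneg_nonneg mult_nonneg_nonneg) auto

lemma lip_on_k_mono: "lip_on_k k L A f ==> L <= M ==> lip_on_k k M A f"
 unfolding lip_on_k_def by (meson edist_nonneg mult_right_mono order_trans)

section \<open>From the complementary components to Lipschitz connectedness of Z\<close>

lemma disk_iff: "x : disk_k1 k \<longleftrightarrow> (ALL i>k. x i = 0) & enorm k x <= 1"
proof -
 have "(enorm k x)\<^sup>2 <= 1 \<longleftrightarrow> enorm k x <= 1"
  using enorm_nonneg[of k x] by (metis abs_of_nonneg abs_square_le_1)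
 thus ?thesis unfolding disk_k1_def by (simp add: enorm_sq)
qed

lemma disk_convex:
 assumes "x : disk_k1 k" "y : disk_k1 k" "0 <= t" "t <= 1"
 shows "(%i. (1 - t) * x i + t * y i) : disk_k1 k"
proof -
 have "enorm k (%i. (1 - t) * x i + t * y i) <= enorm k (%i. (1 - t) * x i) + enorm k (%i. t * y i)"
  using L2_set_triangle_ineq[of "%i. (1 - t) * x i" "%i. t * y i" "{..k}"] by (simp add: enorm_def edist_def L2_set_def)
 also have "... = (1 - t) * enorm k x + t * enorm k y" using assms by (simp add: enorm_scale)
 also have "... <= 1" using assms by (intro convex_bound_le) (auto simp: disk_iff)
 finally show ?thesis using assms by (auto simp: disk_iff)
qed

lemma disk_subset_cube: "disk_k1 k <= cube k"
 using supn_ge supn_le_enorm by (fastforce simp: disk_iff cube_def intro: order_trans)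

text \<open>A point of a small ball in \<open>U\<close> is joined to the centre by a geodesic, whose
  points are no farther from the centre than its end; so the ball lies in one component.\<close>

lemma geodesic_open_component:
 fixes U :: "'a::metric_space set"
 assumes "geodesic_space TYPE('a)" "open U"
 shows "open (connected_component_set U p)"
proof (rule openI)
 fix q assume q: "q : connected_component_set U p"
 hence qU: "q : U" by (meson connected_component_in mem_Collect_eq)
 then obtain r where r: "r > 0" "ball q r <= U" using assms(2) by (meson openE)
 have "y : connected_component_set U p" if y: "y : ball q r" for y
 proof -
  obtain gam where g: "gam 0 = q" "gam (dist q y) = y"
   "ALL s:{0..dist q y}. ALL t:{0..dist q y}. dist (gam s) (gam t) = \<bar>s - t\<bar>"
   using assms(1) unfolding geodesic_space_def by blast
  have "continuous_on {0..dist q y} gam"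
   unfolding continuous_on_iff
  proof (intro ballI allI impI)
   fix s e :: real assume "s : {0..dist q y}" "0 < e"
   thus "EX d>0. ALL t:{0..dist q y}. dist t s < d --> dist (gam t) (gam s) < e"
    using g(3) by (intro exI[of _ e]) (auto simp: dist_real_def)
  qed
  hence "connected (gam ` {0..dist q y})" by (intro connected_continuous_image) auto
  moreover have "gam ` {0..dist q y} <= U"
  proof
   fix z assume "z : gam ` {0..dist q y}"
   then obtain s where s: "s : {0..dist q y}" "z = gam s" by blast
   have "dist q z = \<bar>0 - s\<bar>" using g(1,3) s by (metis atLeastAtMost_iff order_refl zero_le_dist)
   hence "z : ball q r" using s y by auto
   thus "z : U" using r(2) by blast
  qed
  moreover have "q : gam ` {0..dist q y}" "y : gam ` {0..dist q y}"
   using g(1,2) by (force intro: image_eqI[of _ _ 0], force intro: image_eqI[of _ _ "dist q y"])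
  ultimately have "connected_component U q y" unfolding connected_component_def by blast
  thus ?thesis using q connected_component_trans[of U p q y] by simp
 qed
 thus "EX e>0. ball q e <= connected_component_set U p" using r(1) by blast
qed

text \<open>A frontier point outside \<open>Z\<close> would have an open component of its own that
  meets the given one. Components that meet coincide, and the point would be interior.\<close>

lemma geodesic_frontier_component:
 fixes Z :: "'a::metric_space set"
 assumes g: "geodesic_space TYPE('a)" and Z: "closed Z"
 shows "frontier (connected_component_set (- Z) p) <= Z"
proof
 fix q assume q: "q : frontier (connected_component_set (- Z) p)"
 let ?C = "%p. connected_component_set (- Z) p"
 have op: "open (?C r)" for r using geodesic_open_component[OF g, of "- Z"] Z by auto
 show "q : Z"
 proof (rule ccontr)
  assume "q ~: Z"
  hence qq: "q : ?C q" by simp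
  have "q : closure (?C p)" using q by (simp add: frontier_def)
  hence "?C q Int ?C p ~= {}" using op[of q] qq by (meson closure_iff_nhds_not_empty disjoint_iff open_contains_ball inf_commute order_refl)
  hence "?C q = ?C p" by (meson connected_component_nonoverlap)
  hence "q : interior (?C p)" using qq op[of p] by (simp add: interior_open)
  thus False using q by (simp add: frontier_def)
 qed
qed

text \<open>Over each component the disk is redefined by extending, with values in the frontier, the
  restriction of \<open>g\<close> to the preimage of that frontier. This preimage can be any closed
  subset of the disk, which is why the Whitney extension had to be proved for arbitrary closed sets
  and not only for boundaries of cells.\<close>

theorem lip_connected_of_complement:
 fixes Z :: "'a::metric_space set"
 assumes Z: "closed Z" and geo: "geodesic_space TYPE('a)"
  and X: "lip_connected (UNIV :: 'a set) n"
  and H: "ALL p:- Z. lip_connected_const (frontier (connected_component_set (- Z) p)) n c2"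
 shows "lip_connected Z n"
proof -
 obtain c1 where c1: "lip_connected_const (UNIV :: 'a set) n c1" using X by (auto simp: lip_connected_def)
 have c10: "0 <= c1" by (rule lip_connected_const_nonneg[OF c1]) simp
 let ?C = "%p. connected_component_set (- Z) p"
 define cc where "cc = (%k. real (Suc k)*((1 + ext_const k c2) * c1))"
 have cc0: "0 <= cc k" for k unfolding cc_def using c10 ext_const_nonneg[of k c2] by simp
 have frZ: "frontier (?C p) <= Z" for p by (rule geodesic_frontier_component[OF geo Z])
 have opC: "open (?C p)" for p using geodesic_open_component[OF geo, of "- Z"] Z by auto
 have notC: "q ~: ?C p" if "q : Z" for p q
  using that connected_component_in[of "- Z" p q] by auto
 have main: "EX G. G ` disk_k1 k <= Z & (ALL x:sphere_k k. G x = f x) & lip_on_k k (cc k * L) (disk_k1 k) G"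
  if k: "k <= n" and fZ: "f ` sphere_k k <= Z" and fL: "lip_on_k k L (sphere_k k) f" for k f L
 proof -
  have L0: "0 <= L" using fL by (simp add: lip_on_k_def)
  obtain g where g: "ALL x:sphere_k k. g x = f x" and gl: "lip_on_k k (c1 * L) (disk_k1 k) g"
   using lip_connected_constD[OF c1 k _ fL] by (metis top_greatest)
  have gL: "lipl k (c1 * L) (disk_k1 k) g" by (rule lip_on_imp_lipl[OF gl])
  have cL0: "0 <= c1 * L" using c10 L0 by simp
  define E where "E = ext_const k c2*(c1 * L)"
  have E0: "0 <= E" unfolding E_def using cL0 ext_const_nonneg by simp
  have gLd: "dist (g x) (g y) <= c1 * L * l1 k x y" if "x : disk_k1 k" "y : disk_k1 k" for x y
   using gL that by (auto simp: lipl_def)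
  let ?s = "%x y t i. (1 - t) * x i + t*(y i :: real)"
  \<comment> \<open>A path that leaves \<open>S\<close> meets its frontier at a time between the two
    given ones, so estimates before and after the crossing add up without loss.\<close>
  have cross: "EX t1:{min t t0..max t t0}. g (?s x y t1) : frontier S"
   if xy: "x : disk_k1 k" "y : disk_k1 k" and t: "t : {0..1}" "t0 : {0..1}" and S: "g (?s x y t) : S" "g (?s x y t0) ~: S" for x y t t0 S
  proof -
   let ?I = "{min t t0..max t t0}"
   have I: "?I <= {0..1}" using t by auto
   have "continuous_on ?I (%t. g (?s x y t))"
    unfolding continuous_on_iff
   proof (intro ballI allI impI)
    fix u e :: real assume u: "u : ?I" and e: "0 < e"
    let ?m = "c1 * L * l1 k x y + 1"
    have m: "0 < ?m" using cL0 by (simp add: add_nonneg_pos)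
    have "dist (g (?s x y v)) (g (?s x y u)) < e" if v: "v : ?I" "dist v u < e/?m" for v
    proof -
     have "dist (g (?s x y v)) (g (?s x y u)) <= c1 * L*(\<bar>v - u\<bar> * l1 k x y)"
      using gLd[OF disk_convex[OF xy, of v] disk_convex[OF xy, of u]] v u I unfolding l1_segment by auto
     also have "... = c1 * L * l1 k x y*\<bar>v - u\<bar>" by simp
     also have "... <= ?m*\<bar>v - u\<bar>" by (intro mult_right_mono) auto
     also have "... < e" using v(2) m by (simp add: dist_real_def pos_less_divide_eq mult.commute)
     finally show ?thesis .
    qed
    thus "EX d>0. ALL v:?I. dist v u < d --> dist (g (?s x y v)) (g (?s x y u)) < e"
     using m e by (intro exI[of _ "e/?m"]) auto
   qed
   hence "connected ((%t. g (?s x y t)) ` ?I)" by (intro connected_continuous_image) auto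
   hence "(%t. g (?s x y t)) ` ?I Int frontier S ~= {}"
   proof (rule connected_Int_frontier)
    have "g (?s x y t) : (%t. g (?s x y t)) ` ?I" by (rule image_eqI[of _ _ t]) auto
    thus "(%t. g (?s x y t)) ` ?I Int S ~= {}" using S(1) by blast
    have "g (?s x y t0) : (%t. g (?s x y t)) ` ?I" by (rule image_eqI[of _ _ t0]) auto
    thus "(%t. g (?s x y t)) ` ?I - S ~= {}" using S(2) by blast
   qed
   thus ?thesis by auto
  qed
  define Q where "Q = (%S h. h ` disk_k1 k <= frontier S & (ALL a:disk_k1 k. g a : frontier S --> h a = g a) & lipl k E (disk_k1 k) h)"
  have exQ: "EX h. Q (?C (g x)) h" if x: "x : disk_k1 k" "g x ~: Z" for x
  proof -
   let ?S = "?C (g x)"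
   let ?A = "{a : disk_k1 k. g a : frontier ?S}"
   \<comment> \<open>A point of the sphere, hence sent to \<open>Z\<close>. The segment from
     \<open>x\<close> to it has to leave the component, which shows that the set to extend from is
     nonempty.\<close>
   define e where "e = (%i::nat. if i = 0 then 1 else 0 :: real)"
   have "(SUM i<=k. (e i)\<^sup>2) = (SUM i:{0::nat}. 1)" unfolding e_def by (rule sum.mono_neutral_cong_right) auto
   hence e: "e : sphere_k k" "e : disk_k1 k" by (auto simp: sphere_k_def disk_k1_def e_def)
   have "g e : Z" using g e(1) fZ by auto
   hence ge: "g e ~: ?S" by (rule notC)
   have gx: "g x : ?S" using x(2) by simp
   have "EX t1:{min 0 1..max 0 1}. g (?s x e t1) : frontier ?S" using gx ge by (intro cross[OF x(1) e(2)]) simp_all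
   then obtain t1 :: real where "0 <= t1" "t1 <= 1" "g (?s x e t1) : frontier ?S" by auto
   hence "?s x e t1 : ?A" using disk_convex[OF x(1) e(2)] by simp
   hence ne: "?A ~= {}" by blast
   have "EX h. (h ` disk_k1 k <= frontier ?S & (ALL a:?A. h a = g a)) & lipl k (ext_const k c2*(c1 * L)) (disk_k1 k) h"
   proof (rule lipschitz_extension[OF _ k _ disk_subset_cube disk_convex _ ne])
    show "lip_connected_const (frontier ?S) n c2" using H x(2) by simp
    show "lipl k (c1 * L) ?A g" by (rule lipl_mono[OF gL]) auto
    show "EX r>0. ALL a:?A. r <= l1 k y a" if y: "y : disk_k1 k - ?A" for y
    proof -
     have "g y : - frontier ?S" using y by auto
     moreover have "open (- frontier ?S)" unfolding frontier_def by (intro open_Compl closed_Diff closed_closure open_interior)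
     ultimately obtain r where r: "r > 0" "ball (g y) r <= - frontier ?S" by (meson openE)
     have "r/(c1 * L + 1) <= l1 k y a" if a: "a : ?A" for a
     proof -
      have "a : disk_k1 k" "g a ~: ball (g y) r" using a r(2) by auto
      hence "r <= c1 * L * l1 k y a" using gLd[of y a] y by auto
      also have "... <= l1 k y a*(c1 * L + 1)" by (simp add: algebra_simps)
      finally show ?thesis using cL0 by (simp add: pos_divide_le_eq)
     qed
     thus ?thesis using r(1) cL0 by (intro exI[of _ "r/(c1 * L + 1)"]) auto
    qed
   qed auto
   thus ?thesis unfolding Q_def E_def by auto
  qed
  \<comment> \<open>Indexed by the component, so that all points sent into one component use the
    same extension.\<close>
  define h where "h = (%S. SOME h. Q S h)"
  have hQ: "Q (?C (g x)) (h (?C (g x)))" if "x : disk_k1 k" "g x ~: Z" for x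
   unfolding h_def using exQ[OF that] by (rule someI_ex)
  define G where "G = (%x. if g x : Z then g x else h (?C (g x)) x)"
  define M where "M = E + c1 * L"
  have M0: "0 <= M" unfolding M_def using E0 cL0 by simp
  have GZ: "G x : Z" if "x : disk_k1 k" for x
   using hQ[OF that] that frZ[of "g x"] unfolding G_def Q_def by auto
  have "dist (G x) (G y) <= M * l1 k x y" if xy: "x : disk_k1 k" "y : disk_k1 k" for x y
  proof -
   define gam where "gam = ?s x y"
   have gam\<Omega>: "gam t : disk_k1 k" if "t : {0..1}" for t using disk_convex[OF xy] that by (simp add: gam_def)
   have gamd: "l1 k (gam t) (gam u) = \<bar>t - u\<bar> * l1 k x y" for t u unfolding gam_def by (rule l1_segment)
   have gd: "dist (g (gam t)) (g (gam u)) <= c1 * L * l1 k x y*\<bar>t - u\<bar>" if "t : {0..1}" "u : {0..1}" for t u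
    using gLd[OF gam\<Omega>[OF that(1)] gam\<Omega>[OF that(2)]] by (simp add: gamd mult_ac)
   have hd: "dist (h (?C p) (gam t)) (h (?C p) (gam u)) <= E * l1 k x y*\<bar>t - u\<bar>"
    if "t : {0..1}" "u : {0..1}" "z : disk_k1 k" "g z ~: Z" "?C p = ?C (g z)" for t u p z
   proof -
    have "lipl k E (disk_k1 k) (h (?C p))" using hQ[OF that(3,4)] unfolding that(5) Q_def by (elim conjE)
    hence "dist (h (?C p) (gam t)) (h (?C p) (gam u)) <= E * l1 k (gam t) (gam u)"
     using gam\<Omega>[OF that(1)] gam\<Omega>[OF that(2)] by (rule lipl_dist)
    thus ?thesis by (simp add: gamd mult_ac)
   qed
   have ml: "c1 * L * l1 k x y*\<bar>t - u\<bar> <= M * l1 k x y*\<bar>t - u\<bar>" "E * l1 k x y*\<bar>t - u\<bar> <= M * l1 k x y*\<bar>t - u\<bar>" for t u :: real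
    unfolding M_def using E0 cL0 by (intro mult_right_mono; simp)+
   have "dist (G (gam 0)) (G (gam 1)) <= M * l1 k x y"
   proof (rule local_to_global_lipschitz)
    fix t0 :: real assume t0: "t0 : {0..1}"
    show "EX dlt>0. ALL t:{0..1}. \<bar>t - t0\<bar> < dlt --> dist (G (gam t)) (G (gam t0)) <= M * l1 k x y*\<bar>t - t0\<bar>"
    proof (cases "g (gam t0) : Z")
     case True
     have "dist (G (gam t)) (G (gam t0)) <= M * l1 k x y*\<bar>t - t0\<bar>" if t: "t : {0..1}" for t
     proof (cases "g (gam t) : Z")
      case gt: True
      thus ?thesis using True gd[OF t t0] ml(1)[of t t0] by (simp add: G_def)
     next
      case gt: False
      let ?S = "?C (g (gam t))"
      have S: "g (?s x y t) : ?S" "g (?s x y t0) ~: ?S"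
       using gt notC[OF True] by (simp_all add: gam_def)
      from cross[OF xy t t0 S] obtain t1 where t1: "t1 : {min t t0..max t t0}" "g (gam t1) : frontier ?S"
       unfolding gam_def by blast
      have t101: "t1 : {0..1}" using t1 t t0 by auto
      \<comment> \<open>At the crossing the new and the old map agree; from there on the bound for
        \<open>g\<close> takes over.\<close>
      have "h ?S (gam t1) = g (gam t1)" using hQ[OF gam\<Omega>[OF t] gt] t1(2) gam\<Omega>[OF t101] unfolding Q_def by blast
      hence "dist (G (gam t)) (G (gam t0)) <= dist (h ?S (gam t)) (h ?S (gam t1)) + dist (g (gam t1)) (g (gam t0))"
       using gt True dist_triangle by (simp add: G_def)
      also have "... <= M * l1 k x y*\<bar>t - t1\<bar> + M * l1 k x y*\<bar>t1 - t0\<bar>"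
       using hd[OF t t101 gam\<Omega>[OF t] gt refl] gd[OF t101 t0] ml(2)[of t t1] ml(1)[of t1 t0] by linarith
      also have "... = M * l1 k x y*(\<bar>t - t1\<bar> + \<bar>t1 - t0\<bar>)" by (simp add: distrib_left)
      also have "\<bar>t - t1\<bar> + \<bar>t1 - t0\<bar> = \<bar>t - t0\<bar>" using t1(1) by (auto simp: min_def max_def split: if_splits)
      finally show ?thesis .
     qed
     thus ?thesis by (intro exI[of _ 1]) auto
    next
     case False
     let ?S = "?C (g (gam t0))"
     have "g (gam t0) : ?S" using False by simp
     then obtain r where r: "r > 0" "ball (g (gam t0)) r <= ?S" using opC by (meson openE)
     let ?m = "c1 * L * l1 k x y + 1"
     have m: "0 < ?m" using cL0 by (simp add: add_nonneg_pos)
     have "dist (G (gam t)) (G (gam t0)) <= M * l1 k x y*\<bar>t - t0\<bar>" if t: "t : {0..1}" "\<bar>t - t0\<bar> < r/?m" for t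
     proof -
      have "dist (g (gam t)) (g (gam t0)) <= ?m*\<bar>t - t0\<bar>"
       by (rule order_trans[OF gd[OF t(1) t0]]) (intro mult_right_mono, auto)
      also have "... < r" using t(2) m by (simp add: pos_less_divide_eq mult.commute)
      finally have "g (gam t) : ball (g (gam t0)) r" by (simp add: dist_commute)
      hence "g (gam t) : ?S" using r(2) by (rule subsetD[rotated])
      hence "?C (g (gam t)) = ?S" "g (gam t) ~: Z" using notC connected_component_eq by fast+
      thus ?thesis using False hd[OF t(1) t0 gam\<Omega>[OF t0] False refl] ml(2)[of t t0] by (simp add: G_def)
     qed
     thus ?thesis using r(1) m by (intro exI[of _ "r/?m"]) auto
    qed
   qed
   thus ?thesis by (simp add: gam_def)
  qed
  hence "lipl k M (disk_k1 k) G" using M0 by (simp add: lipl_def)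
  hence "lip_on_k k (cc k * L) (disk_k1 k) G"
   using lipl_imp_lip_on[of k M "disk_k1 k" G] by (simp add: cc_def M_def E_def algebra_simps)
  moreover have "ALL x:sphere_k k. G x = f x" using g fZ by (auto simp: G_def)
  ultimately show ?thesis using GZ by blast
 qed
 have "lip_connected_const Z n (SUM k<=n. cc k)"
  unfolding lip_connected_const_def
 proof (intro allI impI)
  fix k f L assume k: "k <= n" and a: "f ` sphere_k k <= Z & lip_on_k k L (sphere_k k) f"
  have "cc k * L <= (SUM k<=n. cc k) * L" using k cc0 a by (intro mult_right_mono member_le_sum) (auto simp: lip_on_k_def)
  thus "EX g. g ` disk_k1 k <= Z & (ALL x:sphere_k k. g x = f x) & lip_on_k k ((SUM k<=n. cc k) * L) (disk_k1 k) g"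
   using main[OF k conjunct1[OF a] conjunct2[OF a]] by (blast intro: lip_on_k_mono)
 qed
 thus ?thesis by (auto simp: lip_connected_def)
qed

section \<open>Filling a simplex with prescribed faces\<close>

definition bdS :: "nat => pt set" where
 "bdS p = {x : Sx p. EX i<=p. x i = 0}"

definition dface :: "nat => pt => pt" where
 "dface i y = (%j. if j < i then y j else y (Suc j))"

lemma simplex_le1: "x : Sx p ==> i <= p ==> x i <= 1"
 using member_le_sum[of i "{..p}" x] by (auto simp: simplex_k_def)

lemma sum_remove_index:
 fixes h :: "nat => 'b::ab_group_add"
 assumes "i <= Suc q"
 shows "(SUM j<=Suc q. h j) = h i + (SUM j<=q. h (if j < i then j else Suc j))"
proof -
 let ?s = "%j. if j < i then j else Suc j"
 have "bij_betw ?s {..q} ({..Suc q} - {i})"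
 proof (rule bij_betwI[where g="%j. if j < i then j else j - 1"])
  show "?s : {..q} \<rightarrow> {..Suc q} - {i}" by auto
  show "(%j. if j < i then j else j - 1) : {..Suc q} - {i} \<rightarrow> {..q}" using assms by (auto split: if_splits)
 qed auto
 hence "(SUM j<=q. h (?s j)) = sum h ({..Suc q} - {i})" by (rule sum.reindex_bij_betw)
 thus ?thesis using sum.remove[of "{..Suc q}" i h] assms by simp
qed

lemma face_map_index: "face_map i x (if j < i then j else Suc j) = x j"
 by (auto simp: face_map_def)

lemma dface_index: "dface i y j = y (if j < i then j else Suc j)"
 by (simp add: dface_def)

lemma face_map_zero [simp]: "face_map i x i = 0"
 by (simp add: face_map_def)

lemma face_map_simplex:
 assumes "x : Sx q" "i <= Suc q"
 shows "face_map i x : Sx (Suc q)"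
proof -
 have "(SUM j<=Suc q. face_map i x j) = 1"
  unfolding sum_remove_index[OF assms(2)] face_map_index using assms(1) by (simp add: simplex_k_def)
 thus ?thesis using assms by (auto simp: simplex_k_def face_map_def)
qed

lemma dface_face_map [simp]: "dface i (face_map i x) = x"
 by (rule ext) (auto simp: dface_def face_map_def)

lemma face_map_dface: "y i = 0 ==> face_map i (dface i y) = y"
 by (rule ext) (auto simp: dface_def face_map_def)

lemma dface_simplex:
 assumes "y : Sx (Suc q)" "i <= Suc q" "y i = 0"
 shows "dface i y : Sx q"
proof -
 have "(SUM j<=q. dface i y j) = 1"
  using sum_remove_index[OF assms(2), of y] assms by (simp add: simplex_k_def dface_index)
 thus ?thesis using assms by (auto simp: simplex_k_def dface_def)
qed

lemma l1_face_map:
 assumes "i <= Suc q" shows "l1 (Suc q) (face_map i x) (face_map i y) = l1 q x y"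
 unfolding l1_def sum_remove_index[OF assms] face_map_index by simp

lemma face_map_commute: "i < l ==> face_map l (face_map i w) = face_map i (face_map (l - 1) w)"
 by (rule ext) (auto simp: face_map_def)

text \<open>Forgetting the last barycentric coordinate turns the simplex of dimension
  \<open>q + 1\<close> into a convex body in a cube with coordinates \<open>0\<close> to
  \<open>q\<close>, and its boundary into a closed subset. Restoring the forgotten coordinate costs
  the factor 2.\<close>

lemma simplex_boundary_extension:
 assumes Y: "lip_connected_const Y n c" and q: "q <= n"
  and fY: "f ` bdS (Suc q) <= Y" and fL: "lipl (Suc q) L (bdS (Suc q)) f"
 shows "EX g. (g ` Sx (Suc q) <= Y & (ALL x:bdS (Suc q). g x = f x)) &
   lipl (Suc q) (2 * ext_const q c * L) (Sx (Suc q)) g"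
proof -
 have L0: "0 <= L" using fL by (simp add: lipl_def)
 define \<pi> where "\<pi> = (%x::nat=>real. x(Suc q := 0))"
 define io where "io = (%y::nat=>real. y(Suc q := 1 - (SUM i<=q. y i)))"
 define \<Omega> where "\<Omega> = {y::nat=>real. (ALL i>q. y i = 0) & (ALL i<=q. 0 <= y i) & (SUM i<=q. y i) <= 1}"
 have ioS: "io y : Sx (Suc q)" if "y : \<Omega>" for y
  using that by (auto simp: io_def \<Omega>_def simplex_k_def le_Suc_eq)
 have \<pi>S: "\<pi> x : \<Omega>" if "x : Sx (Suc q)" for x
  using that by (auto simp: \<pi>_def \<Omega>_def simplex_k_def)
 have io\<pi>: "io (\<pi> x) = x" if "x : Sx (Suc q)" for x
  using that by (auto simp: io_def \<pi>_def simplex_k_def fun_eq_iff)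
 have \<pi>io: "\<pi> (io y) = y" if "y : \<Omega>" for y
  using that by (auto simp: io_def \<pi>_def \<Omega>_def fun_eq_iff)
 have iol: "l1 (Suc q) (io y) (io z) <= 2 * l1 q y z" for y z
 proof -
  have "l1 (Suc q) (io y) (io z) = l1 q y z + \<bar>(SUM i<=q. z i) - (SUM i<=q. y i)\<bar>"
   by (simp add: l1_def io_def)
  also have "(SUM i<=q. z i) - (SUM i<=q. y i) = (SUM i<=q. z i - y i)" by (simp add: sum_subtractf)
  also have "\<bar>...\<bar> <= l1 q z y" unfolding l1_def by (rule sum_abs)
  finally show ?thesis by (simp add: l1_commute)
 qed
 have \<pi>l: "l1 q (\<pi> x) (\<pi> y) <= l1 (Suc q) x y" for x y
  by (simp add: l1_def \<pi>_def)
 let ?A = "\<pi> ` bdS (Suc q)"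
 have bS: "bdS (Suc q) <= Sx (Suc q)" by (auto simp: bdS_def)
 have ioA: "io a : bdS (Suc q)" if "a : ?A" for a using that io\<pi> bS by auto
 have "EX g. (g ` \<Omega> <= Y & (ALL x:?A. g x = (f \<circ> io) x)) & lipl q (ext_const q c*(2 * L)) \<Omega> g"
 proof (rule lipschitz_extension[OF Y q])
  show "?A <= \<Omega>" using \<pi>S bS by auto
  show "\<Omega> <= cube q"
  proof
   fix y assume y: "y : \<Omega>"
   hence "y i <= 1" if "i <= q" for i using member_le_sum[of i "{..q}" y] that by (auto simp: \<Omega>_def)
   thus "y : cube q" using y by (auto simp: \<Omega>_def cube_def abs_le_iff intro: order_trans[of _ 0])
  qed
  show "(%i. (1 - t) * x i + t * y i) : \<Omega>" if "x : \<Omega>" "y : \<Omega>" "0 <= t" "t <= 1" for x y t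
   using that by (auto simp: \<Omega>_def sum.distrib sum_distrib_left[symmetric] intro!: convex_bound_le)
  show "EX r>0. ALL a:?A. r <= l1 q y a" if y: "y : \<Omega> - ?A" for y
  proof -
   have nb: "io y ~: bdS (Suc q)" using y \<pi>io[of y] by (metis DiffE image_eqI)
   have pos: "0 < io y i" if "i <= Suc q" for i
    using nb ioS[of y] y that by (auto simp: bdS_def simplex_k_def le_less)
   let ?m = "Min (io y ` {..Suc q})"
   have "?m/2 <= l1 q y a" if a: "a : ?A" for a
   proof -
    obtain i where i: "i <= Suc q" "io a i = 0" using ioA[OF a] by (auto simp: bdS_def)
    have "?m <= io y i" using i by (intro Min_le) auto
    also have "... <= \<bar>io y i - io a i\<bar>" using i by simp
    also have "... <= l1 (Suc q) (io y) (io a)" by (rule l1_component[OF i(1)])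
    finally show ?thesis using iol[of y a] by simp
   qed
   moreover have "0 < ?m" using pos by (subst Min_gr_iff) auto
   ultimately show ?thesis by (intro exI[of _ "?m/2"]) auto
  qed
  have "(%j. if j = 0 then 1 else 0) : bdS (Suc q)" by (auto simp: bdS_def simplex_k_def intro: exI[of _ "Suc q"])
  thus "?A ~= {}" by blast
  show "(f \<circ> io) ` ?A <= Y" using ioA fY by auto
  show "lipl q (2 * L) ?A (f \<circ> io)"
   unfolding lipl_def
  proof (intro conjI ballI)
   fix a b assume ab: "a : ?A" "b : ?A"
   have "dist ((f \<circ> io) a) ((f \<circ> io) b) <= L * l1 (Suc q) (io a) (io b)" using fL ioA ab by (auto simp: lipl_def)
   also have "... <= L*(2 * l1 q a b)" using iol L0 by (intro mult_left_mono)
   finally show "dist ((f \<circ> io) a) ((f \<circ> io) b) <= 2 * L * l1 q a b" by simp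
  qed (use L0 in simp)
 qed
 then obtain g where g: "g ` \<Omega> <= Y" "ALL x:?A. g x = (f \<circ> io) x" "lipl q (ext_const q c*(2 * L)) \<Omega> g"
  by (elim exE conjE)
 have "lipl (Suc q) (2 * ext_const q c * L) (Sx (Suc q)) (g \<circ> \<pi>)"
  unfolding lipl_def
 proof (intro conjI ballI)
  show E0: "0 <= 2 * ext_const q c * L" using ext_const_nonneg L0 by simp
  fix x y assume xy: "x : Sx (Suc q)" "y : Sx (Suc q)"
  have "dist ((g \<circ> \<pi>) x) ((g \<circ> \<pi>) y) <= 2 * ext_const q c * L * l1 q (\<pi> x) (\<pi> y)"
   using g(3) \<pi>S xy by (auto simp: lipl_def mult_ac)
  also have "... <= 2 * ext_const q c * L * l1 (Suc q) x y" using \<pi>l E0 by (rule mult_left_mono)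
  finally show "dist ((g \<circ> \<pi>) x) ((g \<circ> \<pi>) y) <= 2 * ext_const q c * L * l1 (Suc q) x y" .
 qed
 moreover have "(g \<circ> \<pi>) ` Sx (Suc q) <= Y" using g(1) \<pi>S by auto
 moreover have "ALL x:bdS (Suc q). (g \<circ> \<pi>) x = f x" using g(2) io\<pi> bS by auto
 ultimately show ?thesis by blast
qed

text \<open>The 5 is the loss in gluing the facets: a path through a third facet has legs of length
  2 and 3.\<close>

definition fill_const :: "nat => real => real" where
 "fill_const q c = 2 * ext_const q c*5"

text \<open>The estimate is stated for all \<open>L\<close> at once, in the spirit of
  \<open>uniform_extension\<close>. For \<open>q = 0\<close> the facets are points whose Lipschitz
  constants say nothing, so the distance of the two values has to be bounded separately. Off the
  simplex the map is \<open>undefined\<close>, as \<open>lip_simplex\<close> requires: only then do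
  equal restrictions give equal generators of the chain group.\<close>

definition fills :: "'a::metric_space set => real => nat => (nat => pt => 'a) => (pt => 'a) => bool" where
 "fills Y c q fs g \<longleftrightarrow> g ` Sx (Suc q) <= Y & (ALL x. x ~: Sx (Suc q) --> g x = undefined) &
   (ALL i<=Suc q. ALL x:Sx q. g (face_map i x) = fs i x) &
   (ALL L. (ALL i<=Suc q. lipl q L (Sx q) (fs i)) & (q = 0 --> (ALL x:Sx 0. dist (fs 0 x) (fs 1 x) <= L)) \<longrightarrow>
    lipl (Suc q) (fill_const q c * L) (Sx (Suc q)) g)"

lemma simplex_0: "Sx 0 = {%j. if j = 0 then 1 else 0}"
 by (auto simp: simplex_k_def fun_eq_iff)

text \<open>\<open>compat\<close> is the simplicial identity for faces of faces. It makes the facet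
  maps agree wherever two facets meet, so that they define one map on the boundary; the remaining
  work is the Lipschitz bound across different facets.\<close>

lemma simplex_filling:
 assumes Y: "lip_connected_const Y n c" and q: "q <= n"
  and fY: "!!i. i <= Suc q ==> fs i ` Sx q <= Y"
  and fL: "!!i. i <= Suc q ==> EX L. lipl q L (Sx q) (fs i)"
  and compat: "!!i l w. 1 <= q ==> i < l ==> l <= Suc q ==> w : Sx (q - 1) ==> fs l (face_map i w) = fs i (face_map (l - 1) w)"
 shows "EX g. fills Y c q fs g"
proof -
 define zi where "zi = (%y::nat=>real. LEAST i. y i = 0)"
 define b where "b = (%y. fs (zi y) (dface (zi y) y))"
 have two: "fs i (dface i y) = fs l (dface l y)"
  if il: "i < l" "l <= Suc q" and y: "y : Sx (Suc q)" "y i = 0" "y l = 0" for i l y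
 proof (cases "q = 0")
  case True
  \<comment> \<open>For an edge the two facets never meet: both coordinates would vanish, against
    the sum being 1.\<close>
  hence "i = 0" "l = 1" using il by auto
  hence "(SUM j<=Suc q. y j) = 0" using y True by simp
  thus ?thesis using y(1) by (simp add: simplex_k_def)
 next
  case False
  then obtain p where p: "q = Suc p" by (cases q) auto
  let ?u = "dface l y"
  have u: "?u : Sx q" using dface_simplex[OF y(1) il(2) y(3)] .
  have ui: "?u i = 0" using il y by (simp add: dface_def)
  have w: "dface i ?u : Sx p" using dface_simplex[of ?u p i] u ui il p by simp
  let ?w = "dface i ?u"
  have u': "face_map i ?w = ?u" using ui by (rule face_map_dface)
  have y': "y = face_map i (face_map (l - 1) ?w)" using face_map_dface[of y l] y(3) u' face_map_commute[OF il(1), of ?w] by simp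
  have "dface i y = face_map (l - 1) ?w" using arg_cong[OF y', of "dface i"] by (simp only: dface_face_map)
  thus ?thesis using compat[of i l ?w] False il w p u' by simp
 qed
 have bF: "b y = fs i (dface i y)" if "y : Sx (Suc q)" "i <= Suc q" "y i = 0" for y i
 proof -
  have zy: "y (zi y) = 0" "zi y <= i" unfolding zi_def using that(3) by (auto intro: LeastI Least_le)
  show ?thesis unfolding b_def using two[of "zi y" i y] zy that by (cases "zi y = i") auto
 qed
 have bface: "b (face_map i x) = fs i x" if "i <= Suc q" "x : Sx q" for i x
  using bF[OF face_map_simplex[OF that(2,1)] that(1)] by simp
 have bY: "b ` bdS (Suc q) <= Y"
 proof
  fix z assume "z : b ` bdS (Suc q)"
  then obtain y i where y: "y : Sx (Suc q)" "i <= Suc q" "y i = 0" "z = b y" by (auto simp: bdS_def)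
  thus "z : Y" using bF[OF y(1-3)] fY[OF y(2)] dface_simplex[OF y(1-3)] by auto
 qed
 have bL: "lipl (Suc q) (5 * L) (bdS (Suc q)) b"
  if L: "ALL i<=Suc q. lipl q L (Sx q) (fs i)" and L2: "q = 0 --> (ALL x:Sx 0. dist (fs 0 x) (fs 1 x) <= L)" for L
  unfolding lipl_def
 proof (intro conjI ballI)
  have L0: "0 <= L" using L by (auto simp: lipl_def)
  thus "0 <= 5 * L" by simp
  have face: "dist (b x) (b y) <= L * l1 (Suc q) x y" if "x : Sx (Suc q)" "y : Sx (Suc q)" "i <= Suc q" "x i = 0" "y i = 0" for x y i
  proof -
   have "dist (b x) (b y) = dist (fs i (dface i x)) (fs i (dface i y))" using bF that by simp
   also have "... <= L * l1 q (dface i x) (dface i y)" using L that dface_simplex by (auto simp: lipl_def)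
   also have "l1 q (dface i x) (dface i y) = l1 (Suc q) x y"
    using l1_face_map[OF that(3), of "dface i x" "dface i y"] that by (simp add: face_map_dface)
   finally show ?thesis .
  qed
  fix x y assume "x : bdS (Suc q)" "y : bdS (Suc q)"
  then obtain i j where x: "x : Sx (Suc q)" "i <= Suc q" "x i = 0" and y: "y : Sx (Suc q)" "j <= Suc q" "y j = 0"
   by (auto simp: bdS_def)
  have le5: "L * l1 (Suc q) x y <= 5 * L * l1 (Suc q) x y" using L0 by (intro mult_right_mono) auto
  show "dist (b x) (b y) <= 5 * L * l1 (Suc q) x y"
  proof (cases "i = j")
   case True thus ?thesis using face[OF x(1) y(1) x(2,3)] y le5 by simp
  next
   case False
   show ?thesis
   proof (cases "q = 0")
    case True
    have e: "dist (fs 0 u) (fs 1 v) <= L" if "u : Sx 0" "v : Sx 0" for u v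
     using L2 True that by (auto simp: simplex_0)
    have dx: "dface i x : Sx 0" "dface j y : Sx 0" using dface_simplex[OF x] dface_simplex[OF y] True by auto
    have ij: "i = 0 & j = 1 \<or> i = 1 & j = 0" using False x(2) y(2) True by auto
    have "dist (b x) (b y) = dist (fs i (dface i x)) (fs j (dface j y))" using bF[OF x] bF[OF y] by simp
    also have "... <= L" using ij e[OF dx] e[OF dx(2,1)] by (auto simp: dist_commute)
    also have "L = L*1" by simp
    also have "... <= L * l1 (Suc q) x y"
    proof (rule mult_left_mono[OF _ L0])
     have "x j = 1" using ij x True by (auto simp: simplex_k_def)
     thus "1 <= l1 (Suc q) x y" using l1_component[OF y(2), of x y] y(3) by simp
    qed
    finally show ?thesis using le5 by linarith
   next
    case q0: False
    have "EX k:{0::nat,1,2}. k ~= i & k ~= j" by auto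
    then obtain k where k0: "k : {0::nat,1,2}" "k ~= i & k ~= j" by (elim bexE)
    hence k: "k <= Suc q" "k ~= i" "k ~= j" using q0 by auto
    \<comment> \<open>Shifting the mass at \<open>j\<close> to a third index \<open>k\<close> gives
      a point that shares facet \<open>i\<close> with \<open>x\<close> and facet \<open>j\<close>
      with \<open>y\<close>. It is moved by \<open>2 * x j\<close>, and \<open>x j\<close> is at
      most the distance of \<open>x\<close> and \<open>y\<close> because
      \<open>y j = 0\<close>.\<close>
    let ?z = "x(j := 0, k := x k + x j)"
    have sz: "(SUM l<=Suc q. h (?z l) l) = h (x k + x j) k + (h 0 j + (SUM l:{..Suc q} - {k} - {j}. h (x l) l))" for h :: "real => nat => real"
    proof -
     have "(SUM l<=Suc q. h (?z l) l) = h (?z k) k + (h (?z j) j + (SUM l:{..Suc q} - {k} - {j}. h (?z l) l))"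
      using k y(2) sum.remove[of "{..Suc q}" k "%l. h (?z l) l"] sum.remove[of "{..Suc q} - {k}" j "%l. h (?z l) l"] by simp
     moreover have "(SUM l:{..Suc q} - {k} - {j}. h (?z l) l) = (SUM l:{..Suc q} - {k} - {j}. h (x l) l)" by (rule sum.cong) auto
     ultimately show ?thesis using k by simp
    qed
    have sx: "(SUM l<=Suc q. h (x l) l) = h (x k) k + (h (x j) j + (SUM l:{..Suc q} - {k} - {j}. h (x l) l))" for h :: "real => nat => real"
     using k y(2) sum.remove[of "{..Suc q}" k "%l. h (x l) l"] sum.remove[of "{..Suc q} - {k}" j "%l. h (x l) l"] by simp
    have xj: "0 <= x j" using x(1) y(2) by (simp add: simplex_k_def)
    have "(SUM l<=Suc q. ?z l) = 1" using sz[of "%a l. a"] sx[of "%a l. a"] x(1) by (simp add: simplex_k_def)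
    hence z: "?z : Sx (Suc q)" using x(1) k y(2) xj by (auto simp: simplex_k_def)
    have "l1 (Suc q) ?z x = 2 * x j" unfolding l1_def using sz[of "%a l. \<bar>a - x l\<bar>"] xj by simp
    also have "x j <= l1 (Suc q) x y" using l1_component[OF y(2), of x y] y(3) by simp
    finally have zx: "l1 (Suc q) ?z x <= 2 * l1 (Suc q) x y" by simp
    have zy: "l1 (Suc q) ?z y <= 3 * l1 (Suc q) x y" using l1_triangle[of "Suc q" ?z y x] zx by linarith
    have "dist (b x) (b y) <= dist (b ?z) (b x) + dist (b ?z) (b y)" by (rule dist_triangle3)
    also have "dist (b ?z) (b x) <= L * l1 (Suc q) ?z x" using face[OF z x(1) x(2)] x(3) k False by simp
    also have "dist (b ?z) (b y) <= L * l1 (Suc q) ?z y" using face[OF z y(1) y(2)] y(3) k by simp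
    also have "L * l1 (Suc q) ?z x + L * l1 (Suc q) ?z y <= L*(2 * l1 (Suc q) x y) + L*(3 * l1 (Suc q) x y)"
     using zx zy L0 by (intro add_mono mult_left_mono)
    finally show ?thesis by simp
   qed
  qed
 qed
 obtain LL where LL: "!!i. i <= Suc q ==> lipl q (LL i) (Sx q) (fs i)" using fL by metis
 define L where "L = (SUM i<=Suc q. LL i) + dist (fs 0 (%j. if j = 0 then 1 else 0)) (fs 1 (%j. if j = 0 then 1 else 0))"
 have LL0: "0 <= LL i" if "i <= Suc q" for i using LL[OF that] by (simp add: lipl_def)
 have le: "LL i <= (SUM i<=Suc q. LL i)" if "i <= Suc q" for i using that LL0 by (intro member_le_sum) auto
 have L1: "ALL i<=Suc q. lipl q L (Sx q) (fs i)"
 proof (intro allI impI)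
  fix i assume i: "i <= Suc q"
  show "lipl q L (Sx q) (fs i)" by (rule lipl_mono[OF LL[OF i] order_refl]) (use le[OF i] in \<open>simp add: L_def add_increasing2\<close>)
 qed
 have "0 <= (SUM i<=Suc q. LL i)" using LL0 by (intro sum_nonneg) auto
 hence L2: "q = 0 --> (ALL x:Sx 0. dist (fs 0 x) (fs 1 x) <= L)" by (auto simp: simplex_0 L_def simp del: sum.atMost_Suc)
 have "EX g. (g ` Sx (Suc q) <= Y & (ALL x:bdS (Suc q). g x = b x)) &
   (ALL M. lipl (Suc q) M (bdS (Suc q)) b --> lipl (Suc q) (2 * ext_const q c * M) (Sx (Suc q)) g)"
  by (rule uniform_extension[OF bL[OF L1 L2]]) (use simplex_boundary_extension[OF Y q bY] ext_const_nonneg in auto)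
 then obtain g where g: "g ` Sx (Suc q) <= Y" "ALL x:bdS (Suc q). g x = b x"
   "ALL M. lipl (Suc q) M (bdS (Suc q)) b --> lipl (Suc q) (2 * ext_const q c * M) (Sx (Suc q)) g"
  by (elim exE conjE)
 define g' where "g' = (%x. if x : Sx (Suc q) then g x else undefined)"
 have "fills Y c q fs g'"
  unfolding fills_def
 proof (intro conjI allI impI ballI)
  show "g' ` Sx (Suc q) <= Y" using g(1) by (auto simp: g'_def)
  fix x assume "x ~: Sx (Suc q)" thus "g' x = undefined" by (simp add: g'_def)
 next
  fix i x assume ix: "i <= Suc q" "x : Sx q"
  have m: "face_map i x : Sx (Suc q)" by (rule face_map_simplex[OF ix(2,1)])
  hence "face_map i x : bdS (Suc q)" using ix(1) by (auto simp: bdS_def intro: exI[of _ i])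
  thus "g' (face_map i x) = fs i x" using g(2) bface[OF ix] m by (simp add: g'_def)
 next
  fix L assume L: "(ALL i<=Suc q. lipl q L (Sx q) (fs i)) & (q = 0 --> (ALL x:Sx 0. dist (fs 0 x) (fs 1 x) <= L))"
  have "lipl (Suc q) (2 * ext_const q c*(5 * L)) (Sx (Suc q)) g"
   using g(3) bL[OF conjunct1[OF L] conjunct2[OF L]] by blast
  thus "lipl (Suc q) (fill_const q c * L) (Sx (Suc q)) g'"
   by (subst lipl_cong[of _ g' g]) (auto simp: g'_def fill_const_def mult_ac)
 qed
 thus ?thesis by blast
qed

definition constS :: "'a => pt => 'a" where
 "constS z = (%x. if x : Sx 0 then z else undefined)"

text \<open>Vertex 0 is the apex, face 0 the base, and the other faces are the cones over the faces
  of \<open>tau\<close>. The choice makes the cone a function of \<open>Y\<close>, \<open>c\<close>,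
  \<open>z\<close>, \<open>q\<close> and \<open>tau\<close>; cones over a shared face are then equal
  as maps, which is what cancellation in a chain needs.\<close>

fun coneS :: "'a::metric_space set => real => 'a => nat => (pt => 'a) => (pt => 'a)" where
 "coneS Y c z 0 tau = (SOME g. fills Y c 0 (%i. if i = 0 then tau else constS z) g)"
| "coneS Y c z (Suc q) tau = (SOME g. fills Y c (Suc q) (%i. if i = 0 then tau else coneS Y c z q (face (Suc q) (i - 1) tau)) g)"

definition conefs :: "'a::metric_space set => real => 'a => nat => (pt => 'a) => nat => (pt => 'a)" where
 "conefs Y c z q tau i = (if i = 0 then tau else (case q of 0 => constS z | Suc q' => coneS Y c z q' (face q (i - 1) tau)))"

lemma coneS_unfold: "coneS Y c z q tau = (SOME g. fills Y c q (conefs Y c z q tau) g)"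
proof (cases q)
 case 0
 have "conefs Y c z 0 tau = (%i. if i = 0 then tau else constS z)" by (rule ext) (simp add: conefs_def)
 thus ?thesis using 0 by simp
next
 case (Suc q')
 have "conefs Y c z (Suc q') tau = (%i. if i = 0 then tau else coneS Y c z q' (face (Suc q') (i - 1) tau))"
  by (rule ext) (simp add: conefs_def)
 thus ?thesis using Suc by simp
qed

lemma lip_simplex_iff:
 "lip_simplex S k sig \<longleftrightarrow> (EX L. lipl k L (Sx k) sig) & sig ` Sx k <= S & (ALL x. x ~: Sx k --> sig x = undefined)"
proof -
 have "(EX L. lip_on_k k L (Sx k) sig) \<longleftrightarrow> (EX L. lipl k L (Sx k) sig)"
  using lip_on_imp_lipl[of k _ "Sx k" sig] lipl_imp_lip_on[of k _ "Sx k" sig] by blast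
 thus ?thesis by (simp add: lip_simplex_def)
qed

lemma face_apply: "x : Sx q ==> face (Suc q) i tau x = tau (face_map i x)"
 by (simp add: face_def)

lemma face_outside: "x ~: Sx q ==> face (Suc q) i tau x = undefined"
 by (simp add: face_def)

lemma face_lipl:
 assumes "lipl (Suc q) L (Sx (Suc q)) tau" "i <= Suc q"
 shows "lipl q L (Sx q) (face (Suc q) i tau)"
 using assms face_map_simplex[OF _ assms(2)] l1_face_map[OF assms(2)] unfolding lipl_def by (simp add: face_apply) metis

lemma face_lip_simplex:
 assumes "lip_simplex Y (Suc q) tau" "i <= Suc q"
 shows "lip_simplex Y q (face (Suc q) i tau)"
 using assms face_lipl[OF _ assms(2)] face_map_simplex[OF _ assms(2)]
 unfolding lip_simplex_iff by (auto simp: face_apply face_outside)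

lemma face_face:
 assumes "i < l" "l <= Suc (Suc q)"
 shows "face (Suc q) i (face (Suc (Suc q)) l tau) = face (Suc q) (l - 1) (face (Suc (Suc q)) i tau)"
proof
 fix x
 have "face_map i x : Sx (Suc q)" "face_map (l - 1) x : Sx (Suc q)" if "x : Sx q"
  using face_map_simplex[OF that] assms by auto
 thus "face (Suc q) i (face (Suc (Suc q)) l tau) x = face (Suc q) (l - 1) (face (Suc (Suc q)) i tau) x"
  by (cases "x : Sx q") (simp_all add: face_apply face_outside face_map_commute[OF assms(1)])
qed

lemma constS_lip: "z : Y ==> lip_simplex Y 0 (constS z)"
 unfolding lip_simplex_iff by (auto simp: constS_def lipl_def simplex_0 intro: exI[of _ 0])

lemma fills_lip_simplex:
 assumes f: "fills Y c q fs g" and fs: "!!i. i <= Suc q ==> lip_simplex Y q (fs i)"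
 shows "lip_simplex Y (Suc q) g"
proof -
 obtain LL where LL: "!!i. i <= Suc q ==> lipl q (LL i) (Sx q) (fs i)" using fs unfolding lip_simplex_iff by metis
 let ?e = "%j::nat. if j = 0 then 1 else 0 :: real"
 define L where "L = (SUM i<=Suc q. LL i) + dist (fs 0 ?e) (fs 1 ?e)"
 have LL0: "0 <= LL i" if "i <= Suc q" for i using LL[OF that] by (simp add: lipl_def)
 have le: "LL i <= (SUM i<=Suc q. LL i)" if "i <= Suc q" for i using that LL0 by (intro member_le_sum) auto
 have L1: "ALL i<=Suc q. lipl q L (Sx q) (fs i)"
 proof (intro allI impI)
  fix i assume i: "i <= Suc q"
  show "lipl q L (Sx q) (fs i)" by (rule lipl_mono[OF LL[OF i] order_refl]) (use le[OF i] in \<open>simp add: L_def add_increasing2\<close>)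
 qed
 have "0 <= (SUM i<=Suc q. LL i)" using LL0 by (intro sum_nonneg) auto
 hence L2: "q = 0 --> (ALL x:Sx 0. dist (fs 0 x) (fs 1 x) <= L)" by (auto simp: simplex_0 L_def simp del: sum.atMost_Suc)
 have "lipl (Suc q) (fill_const q c * L) (Sx (Suc q)) g"
  using f L1 L2 unfolding fills_def by (elim conjE) simp
 thus ?thesis using f unfolding fills_def lip_simplex_iff by (elim conjE) (intro conjI exI)
qed

lemma fills_face:
 assumes f: "fills Y c q fs g" and i: "i <= Suc q" and o: "!!x. x ~: Sx q ==> fs i x = undefined"
 shows "face (Suc q) i g = fs i"
proof
 fix x
 show "face (Suc q) i g x = fs i x"
  using f i o by (cases "x : Sx q") (simp_all add: face_apply face_outside fills_def)
qed

text \<open>A filling exists once the prescribed faces are compatible. Between two cone faces this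
  reduces to \<open>face_face\<close> for \<open>tau\<close>, and between a cone face and the base
  to the fact, known by induction, that the smaller cone has the right base.\<close>

lemma cone_fills_lip:
 assumes Y: "lip_connected_const Y n c" and z: "z : Y"
 shows "q <= n ==> lip_simplex Y q tau ==>
  fills Y c q (conefs Y c z q tau) (coneS Y c z q tau) & lip_simplex Y (Suc q) (coneS Y c z q tau)"
proof (induction q arbitrary: tau)
 case 0
 have ls: "lip_simplex Y 0 (conefs Y c z 0 tau i)" for i using 0 constS_lip[OF z] by (simp add: conefs_def)
 have "EX g. fills Y c 0 (conefs Y c z 0 tau) g"
 proof (rule simplex_filling[OF Y])
  fix i :: nat
  show "conefs Y c z 0 tau i ` Sx 0 <= Y" "EX L. lipl 0 L (Sx 0) (conefs Y c z 0 tau i)"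
   using ls[of i] by (simp_all add: lip_simplex_iff)
 qed auto
 hence f: "fills Y c 0 (conefs Y c z 0 tau) (coneS Y c z 0 tau)" unfolding coneS_unfold by (rule someI_ex)
 show ?case using f fills_lip_simplex[OF f] ls by simp
next
 case (Suc q)
 let ?F = "conefs Y c z (Suc q) tau"
 have FS: "?F i = coneS Y c z q (face (Suc q) (i - 1) tau)" if "i ~= 0" for i using that by (simp add: conefs_def)
 have ih: "fills Y c q (conefs Y c z q (face (Suc q) j tau)) (coneS Y c z q (face (Suc q) j tau))"
  "lip_simplex Y (Suc q) (coneS Y c z q (face (Suc q) j tau))" if "j <= Suc q" for j
  using Suc.IH[of "face (Suc q) j tau"] face_lip_simplex[OF Suc.prems(2) that] Suc.prems(1) by simp_all
 have ls: "lip_simplex Y (Suc q) (?F i)" if "i <= Suc (Suc q)" for i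
 proof (cases "i = 0")
  case True thus ?thesis using Suc.prems by (simp add: conefs_def)
 next
  case False thus ?thesis using ih(2)[of "i - 1"] that FS by simp
 qed
 have ap: "coneS Y c z q (face (Suc q) j tau) (face_map i w) = conefs Y c z q (face (Suc q) j tau) i w"
  if "j <= Suc q" "i <= Suc q" "w : Sx q" for i j w
  using ih(1)[OF that(1)] that unfolding fills_def by blast
 have "EX g. fills Y c (Suc q) ?F g"
 proof (rule simplex_filling[OF Y Suc.prems(1)])
  fix i assume "i <= Suc (Suc q)"
  thus "?F i ` Sx (Suc q) <= Y" "EX L. lipl (Suc q) L (Sx (Suc q)) (?F i)"
   using ls[of i] by (simp_all add: lip_simplex_iff)
 next
  fix i l w assume il: "i < l" "l <= Suc (Suc q)" and w': "w : Sx (Suc q - 1)"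
  have w: "w : Sx q" using w' by simp
  have 1: "?F l (face_map i w) = conefs Y c z q (face (Suc q) (l - 1) tau) i w" using FS[of l] ap[of "l - 1" i w] il w by simp
  show "?F l (face_map i w) = ?F i (face_map (l - 1) w)"
  proof (cases "i = 0")
   case True
   thus ?thesis unfolding 1 using w by (simp add: conefs_def face_apply)
  next
   case i0: False
   have 2: "?F i (face_map (l - 1) w) = conefs Y c z q (face (Suc q) (i - 1) tau) (l - 1) w"
    using FS[of i] ap[of "i - 1" "l - 1" w] il w i0 by simp
   show ?thesis
   proof (cases q)
    case 0 thus ?thesis unfolding 1 2 using il i0 by (simp add: conefs_def)
   next
    case (Suc q')
    have "face (Suc q') (i - 1) (face (Suc (Suc q')) (l - 1) tau) = face (Suc q') (l - 1 - 1) (face (Suc (Suc q')) (i - 1) tau)"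
     by (rule face_face) (use il i0 Suc in auto)
    thus ?thesis unfolding 1 2 using il i0 Suc by (simp add: conefs_def)
   qed
  qed
 qed
 hence f: "fills Y c (Suc q) ?F (coneS Y c z (Suc q) tau)" unfolding coneS_unfold by (rule someI_ex)
 show ?case by (intro conjI f fills_lip_simplex[OF f] ls)
qed

primrec cone_const :: "real => nat => real" where
 "cone_const c 0 = fill_const 0 c"
| "cone_const c (Suc q) = fill_const (Suc q) c*(1 + cone_const c q)"

lemma fill_const_nonneg: "0 <= fill_const q c"
 using ext_const_nonneg by (simp add: fill_const_def)

lemma cone_const_nonneg: "0 <= cone_const c q"
 using fill_const_nonneg by (induction q) auto

context
 fixes Y :: "'a::metric_space set" and n :: nat and c :: real
 assumes Y: "lip_connected_const Y n c"
begin

lemma cone_lip_simplex: "z : Y ==> q <= n ==> lip_simplex Y q tau ==> lip_simplex Y (Suc q) (coneS Y c z q tau)"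
 using cone_fills_lip[OF Y] by blast

lemma cone_face_0:
 assumes "z : Y" "q <= n" "lip_simplex Y q tau"
 shows "face (Suc q) 0 (coneS Y c z q tau) = tau"
 using fills_face[OF conjunct1[OF cone_fills_lip[OF Y assms]], of 0] assms(3) by (simp add: conefs_def lip_simplex_iff)

lemma cone_face_const:
 assumes "z : Y" "lip_simplex Y 0 tau"
 shows "face (Suc 0) (Suc 0) (coneS Y c z 0 tau) = constS z"
 using fills_face[OF conjunct1[OF cone_fills_lip[OF Y assms(1) _ assms(2)]], of "Suc 0"] by (simp add: conefs_def constS_def)

lemma cone_face_Suc:
 assumes "z : Y" "Suc q <= n" "lip_simplex Y (Suc q) tau" "i <= Suc q"
 shows "face (Suc (Suc q)) (Suc i) (coneS Y c z (Suc q) tau) = coneS Y c z q (face (Suc q) i tau)"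
proof -
 have "lip_simplex Y (Suc q) (coneS Y c z q (face (Suc q) i tau))"
  using assms by (intro cone_lip_simplex face_lip_simplex) auto
 thus ?thesis using fills_face[OF conjunct1[OF cone_fills_lip[OF Y assms(1-3)]], of "Suc i"] assms(4)
  by (simp add: conefs_def lip_simplex_iff)
qed

text \<open>The bound \<open>L\<close> serves both as Lipschitz constant of the base and as its
  distance from the apex; in dimension 0 only the latter carries information, being the length of
  the edge.\<close>

lemma cone_lipl:
 assumes "z : Y"
 shows "q <= n ==> lip_simplex Y q tau ==> lipl q L (Sx q) tau ==> (!!x. x : Sx q ==> dist (tau x) z <= L) ==>
  lipl (Suc q) (cone_const c q * L) (Sx (Suc q)) (coneS Y c z q tau)"
proof (induction q arbitrary: tau)
 case 0
 have L0: "0 <= L" using 0 by (simp add: lipl_def)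
 have f: "fills Y c 0 (conefs Y c z 0 tau) (coneS Y c z 0 tau)" using cone_fills_lip[OF Y assms] 0 by blast
 have "lipl 0 L (Sx 0) (constS z)" using L0 by (simp add: lipl_def constS_def simplex_0)
 hence "ALL i<=Suc 0. lipl 0 L (Sx 0) (conefs Y c z 0 tau i)" using 0 by (simp add: conefs_def)
 moreover have "ALL x:Sx 0. dist (conefs Y c z 0 tau 0 x) (conefs Y c z 0 tau 1 x) <= L"
  using 0(4) by (simp add: conefs_def constS_def)
 ultimately show ?case using f unfolding fills_def cone_const.simps by (elim conjE) simp
next
 case (Suc q)
 have L0: "0 <= L" using Suc by (simp add: lipl_def)
 have f: "fills Y c (Suc q) (conefs Y c z (Suc q) tau) (coneS Y c z (Suc q) tau)" using cone_fills_lip[OF Y assms] Suc by blast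
 have le: "L <= (1 + cone_const c q) * L" "cone_const c q * L <= (1 + cone_const c q) * L"
  using L0 cone_const_nonneg[of c q] by (simp_all add: distrib_right)
 have "lipl (Suc q) ((1 + cone_const c q) * L) (Sx (Suc q)) (conefs Y c z (Suc q) tau i)" if i: "i <= Suc (Suc q)" for i
 proof (cases "i = 0")
  case True
  have "lipl (Suc q) ((1 + cone_const c q) * L) (Sx (Suc q)) tau" by (rule lipl_mono[OF Suc.prems(3) order_refl le(1)])
  thus ?thesis using True by (simp add: conefs_def)
 next
  case False
  have "lipl (Suc q) (cone_const c q * L) (Sx (Suc q)) (coneS Y c z q (face (Suc q) (i - 1) tau))"
  proof (rule Suc.IH)
   show "q <= n" "lip_simplex Y q (face (Suc q) (i - 1) tau)" "lipl q L (Sx q) (face (Suc q) (i - 1) tau)"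
    using Suc.prems i False by (auto intro!: face_lip_simplex face_lipl)
   show "dist (face (Suc q) (i - 1) tau x) z <= L" if "x : Sx q" for x
    using Suc.prems(4)[OF face_map_simplex[OF that, of "i - 1"]] i False that by (simp add: face_apply)
  qed
  from lipl_mono[OF this order_refl le(2)] show ?thesis using False by (simp add: conefs_def)
 qed
 hence "lipl (Suc (Suc q)) (fill_const (Suc q) c*((1 + cone_const c q) * L)) (Sx (Suc (Suc q))) (coneS Y c z (Suc q) tau)"
  using f unfolding fills_def by (elim conjE) simp
 thus ?case by (simp add: mult_ac)
qed

end

text \<open>Substitute in \<open>Y\<close> for the affine simplex with vertices \<open>z v\<close>:
  an iterated cone over a list of labels. Removing a label is taking a face
  (\<open>hS_face\<close>), so lists with a common sublist give maps that agree on the common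
  face.\<close>

fun hS :: "'a::metric_space set => real => (nat => 'a) => nat list => (pt => 'a)" where
 "hS Y c z [] = undefined"
| "hS Y c z [v] = constS (z v)"
| "hS Y c z (v # w # l) = coneS Y c (z v) (length l) (hS Y c z (w # l))"

primrec h_const :: "real => nat => real" where
 "h_const c 0 = 0"
| "h_const c (Suc p) = cone_const c p*(2 * h_const c p + 1)"

lemma h_const_nonneg: "0 <= h_const c p"
 using cone_const_nonneg by (induction p) auto

definition del :: "nat => 'b list => 'b list" where
 "del i l = take i l @ drop (Suc i) l"

lemma del_0 [simp]: "del 0 (v # l) = l" and del_Suc [simp]: "del (Suc i) (v # l) = v # del i l"
 by (simp_all add: del_def)

lemma length_del: "i < length l ==> length (del i l) = length l - 1"
 by (auto simp: del_def)

lemma set_del: "set (del i l) <= set l"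
 by (auto simp: del_def dest: in_set_takeD in_set_dropD)

lemma simplex_diam: 
 assumes "x : Sx p" "y : Sx p" shows "l1 p x y <= 2"
proof -
 have "l1 p x y <= (SUM i<=p. x i + y i)"
  unfolding l1_def
 proof (rule sum_mono)
  fix i assume "i : {..p}"
  hence "0 <= x i" "0 <= y i" using assms by (auto simp: simplex_k_def)
  thus "\<bar>x i - y i\<bar> <= x i + y i" by linarith
 qed
 also have "... = 2" using assms by (simp add: sum.distrib simplex_k_def)
 finally show ?thesis .
qed

context
 fixes Y :: "'a::metric_space set" and n :: nat and c :: real and z :: "nat => 'a"
 assumes Y: "lip_connected_const Y n c"
begin

lemma hS_lip_simplex:
 "length l = Suc p ==> p <= Suc n ==> z ` set l <= Y ==> lip_simplex Y p (hS Y c z l)"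
proof (induction p arbitrary: l)
 case 0
 then obtain v where "l = [v]" by (auto simp: length_Suc_conv)
 thus ?case using 0 constS_lip by auto
next
 case (Suc p)
 then obtain v w l' where l: "l = v # w # l'" "length l' = p" by (auto simp: length_Suc_conv)
 have "lip_simplex Y p (hS Y c z (w # l'))" using Suc.IH[of "w # l'"] Suc.prems l by auto
 thus ?case using cone_lip_simplex[OF Y, of "z v" p] Suc.prems l by auto
qed

lemma hS_face:
 "length l = Suc (Suc p) ==> p <= n ==> z ` set l <= Y ==> i <= Suc p ==> face (Suc p) i (hS Y c z l) = hS Y c z (del i l)"
proof (induction p arbitrary: l i)
 case 0
 then obtain v w where l: "l = [v, w]" by (auto simp: length_Suc_conv)
 have lw: "lip_simplex Y 0 (constS (z w))" using 0 l constS_lip by auto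
 have "i = 0 \<or> i = Suc 0" using 0 by auto
 thus ?case
 proof
  assume "i = 0" thus ?thesis using cone_face_0[OF Y _ _ lw, of "z v"] 0 l by simp
 next
  assume "i = Suc 0" thus ?thesis using cone_face_const[OF Y _ lw, of "z v"] 0 l by simp
 qed
next
 case (Suc p)
 then obtain v w l' where l: "l = v # w # l'" "length l' = Suc p" by (auto simp: length_Suc_conv)
 have ls: "lip_simplex Y (Suc p) (hS Y c z (w # l'))" using hS_lip_simplex[of "w # l'" "Suc p"] Suc.prems l by auto
 have zv: "z v : Y" using Suc.prems l by auto
 show ?case
 proof (cases i)
  case 0 thus ?thesis using cone_face_0[OF Y zv _ ls] Suc.prems l by simp
 next
  case (Suc j)
  have j: "j <= Suc p" using Suc Suc.prems by simp
  have "face (Suc (Suc p)) i (hS Y c z l) = coneS Y c (z v) p (face (Suc p) j (hS Y c z (w # l')))"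
   using cone_face_Suc[OF Y zv _ ls j] Suc.prems l Suc by simp
  also have "face (Suc p) j (hS Y c z (w # l')) = hS Y c z (del j (w # l'))"
   using Suc.IH[of "w # l'" j] Suc.prems l j by auto
  finally have 1: "face (Suc (Suc p)) i (hS Y c z l) = coneS Y c (z v) p (hS Y c z (del j (w # l')))" .
  have "length (del j (w # l')) = Suc p" using length_del[of j "w # l'"] l j by simp
  then obtain y ys where y: "del j (w # l') = y # ys" "length ys = p" by (auto simp: length_Suc_conv)
  thus ?thesis using 1 l Suc by simp
 qed
qed

text \<open>Every vertex value is attained somewhere on the simplex, so a Lipschitz bound on
  \<open>hS\<close> also bounds distances from the prescribed points \<open>z w\<close>, for
  instance from the base of a cone to its apex.\<close>

lemma hS_value:
 "length l = Suc p ==> p <= Suc n ==> z ` set l <= Y ==> w : set l ==> EX x:Sx p. hS Y c z l x = z w"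
proof (induction p arbitrary: l)
 case 0
 then obtain v where "l = [v]" by (auto simp: length_Suc_conv)
 thus ?case using 0 by (auto simp: constS_def simplex_0)
next
 case (Suc p)
 then obtain v u l' where l: "l = v # u # l'" "length l' = p" by (auto simp: length_Suc_conv)
 define i :: nat where "i = (if w = v then 1 else 0)"
 have d: "length (del i l) = Suc p" "w : set (del i l)" "z ` set (del i l) <= Y"
  using l Suc.prems by (auto simp: i_def)
 obtain x where x: "x : Sx p" "hS Y c z (del i l) x = z w" using Suc.IH[OF d(1) _ d(3,2)] Suc.prems by auto
 have "face (Suc p) i (hS Y c z l) = hS Y c z (del i l)" using Suc.prems by (intro hS_face) (auto simp: i_def)
 hence "hS Y c z l (face_map i x) = z w" using x face_apply[of x p i "hS Y c z l"] by simp
 moreover have "face_map i x : Sx (Suc p)" using x by (intro face_map_simplex) (auto simp: i_def)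
 ultimately show ?case by blast
qed

lemma hS_lipl:
 assumes s: "0 <= s"
 shows "length l = Suc p ==> p <= Suc n ==> z ` set l <= Y ==> (!!v w. v : set l ==> w : set l ==> dist (z v) (z w) <= s) ==>
  lipl p (h_const c p * s) (Sx p) (hS Y c z l)"
proof (induction p arbitrary: l)
 case 0
 then obtain v where "l = [v]" by (auto simp: length_Suc_conv)
 thus ?case by (auto simp: lipl_def constS_def)
next
 case (Suc p)
 then obtain v u l' where l: "l = v # u # l'" "length l' = p" by (auto simp: length_Suc_conv)
 have ih: "lipl p (h_const c p * s) (Sx p) (hS Y c z (u # l'))" using Suc.IH[of "u # l'"] Suc.prems l by auto
 have ls: "lip_simplex Y p (hS Y c z (u # l'))" using hS_lip_simplex[of "u # l'" p] Suc.prems l by auto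
 have d: "dist (hS Y c z (u # l') x) (z v) <= (2 * h_const c p + 1) * s" if x: "x : Sx p" for x
 proof -
  obtain y where y: "y : Sx p" "hS Y c z (u # l') y = z u" using hS_value[of "u # l'" p u] Suc.prems l by auto
  have "dist (hS Y c z (u # l') x) (z u) <= h_const c p * s * l1 p x y" using ih x y unfolding lipl_def by metis
  also have "... <= h_const c p * s*2" using simplex_diam[OF x y(1)] h_const_nonneg s by (intro mult_left_mono) auto
  finally have "dist (hS Y c z (u # l') x) (z u) <= 2 * h_const c p * s" by simp
  moreover have "dist (z u) (z v) <= s" using Suc.prems(4) l by simp
  ultimately show ?thesis using dist_triangle[of "hS Y c z (u # l') x" "z v" "z u"] by (simp add: algebra_simps)
 qed
 have "h_const c p * s <= (2 * h_const c p + 1) * s" using h_const_nonneg[of c p] s by (intro mult_right_mono) auto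
 from lipl_mono[OF ih order_refl this]
 have "lipl (Suc p) (cone_const c p*((2 * h_const c p + 1) * s)) (Sx (Suc p)) (coneS Y c (z v) p (hS Y c z (u # l')))"
  using Suc.prems l ls d by (intro cone_lipl[OF Y]) auto
 thus ?case using l by (simp add: mult_ac)
qed

end

section \<open>The map from the nerve to Z\<close>

definition sup_of :: "pt => nat set" where
 "sup_of p = {i. p i ~= 0}"

text \<open>The point \<open>p\<close> written in the barycentric coordinates of the face with
  vertex list \<open>l\<close>.\<close>

definition cv :: "nat list => pt => pt" where
 "cv l p = (%j. if j < length l then p (l ! j) else 0)"

lemma sup_of_simplex: "p : Sx M ==> sup_of p <= {..M}"
 by (auto simp: sup_of_def simplex_k_def) (meson not_le)

lemma finite_sup_of: "p : Sx M ==> finite (sup_of p)"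
 using sup_of_simplex finite_subset by blast

lemma sup_of_nonempty: "p : Sx M ==> sup_of p ~= {}"
proof
 assume p: "p : Sx M" and e: "sup_of p = {}"
 have "p i = 0" for i using e by (auto simp: sup_of_def)
 thus False using p by (simp add: simplex_k_def)
qed

lemma sum_cv:
 assumes "distinct l" "length l = Suc d"
 shows "(SUM j<=d. h (l ! j)) = (SUM i:set l. h i)"
 using sum.reindex_bij_betw[OF bij_betw_nth[OF assms(1) refl refl], of h] assms(2) by (simp add: lessThan_Suc_atMost)

lemma sum_supset:
 assumes "p : Sx M" "finite I" "sup_of p <= I" shows "(SUM i:I. p i) = 1"
proof -
 have "(SUM i:I. p i) = (SUM i:sup_of p. p i)" using assms by (intro sum.mono_neutral_right) (auto simp: sup_of_def)
 also have "... = (SUM i<=M. p i)" using sup_of_simplex[OF assms(1)] by (intro sum.mono_neutral_left) (auto simp: sup_of_def)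
 finally show ?thesis using assms(1) by (simp add: simplex_k_def)
qed

lemma simplex_nonneg: "p : Sx M ==> 0 <= p i"
 by (cases "i <= M") (auto simp: simplex_k_def)

lemma cv_simplex:
 assumes "p : Sx M" "distinct l" "length l = Suc d" "sup_of p <= set l"
 shows "cv l p : Sx d"
proof -
 have "(SUM j<=d. cv l p j) = (SUM j<=d. p (l ! j))" using assms(3) by (intro sum.cong) (auto simp: cv_def)
 also have "... = 1" using sum_cv[OF assms(2,3), of p] sum_supset[OF assms(1) _ assms(4)] by simp
 finally show ?thesis using assms simplex_nonneg[OF assms(1)] by (auto simp: simplex_k_def cv_def)
qed

lemma cv_del: "i < length l ==> cv (del i l) p = dface i (cv l p)"
 by (rule ext) (auto simp: cv_def dface_def del_def nth_append min_def)

lemma l1_cv: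
 assumes "p : Sx M" "q : Sx M" "distinct l" "length l = Suc d" "sup_of p <= set l" "sup_of q <= set l"
 shows "l1 d (cv l p) (cv l q) = l1 M p q"
proof -
 have "l1 d (cv l p) (cv l q) = (SUM j<=d. \<bar>p (l ! j) - q (l ! j)\<bar>)" unfolding l1_def using assms(4) by (intro sum.cong) (auto simp: cv_def)
 also have "... = (SUM i:set l. \<bar>p i - q i\<bar>)" using sum_cv[OF assms(3,4), of "%i. \<bar>p i - q i\<bar>"] .
 also have "... = (SUM i:sup_of p Un sup_of q. \<bar>p i - q i\<bar>)" using assms(5,6) by (intro sum.mono_neutral_right) (auto simp: sup_of_def)
 also have "... = l1 M p q" unfolding l1_def using sup_of_simplex[OF assms(1)] sup_of_simplex[OF assms(2)]
  by (intro sum.mono_neutral_left) (auto simp: sup_of_def)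
 finally show ?thesis .
qed

definition hh_const :: "real => nat => real" where
 "hh_const c n = (SUM d<=Suc n. h_const c d)"

lemma h_const_le: "d <= Suc n ==> h_const c d <= hh_const c n"
 unfolding hh_const_def by (rule member_le_sum) (auto simp: h_const_nonneg)

lemma hh_const_nonneg: "0 <= hh_const c n"
 unfolding hh_const_def by (intro sum_nonneg h_const_nonneg)

definition hl :: "'a::metric_space set => real => (nat => 'a) => nat list => pt => 'a" where
 "hl Y c z l p = hS Y c z l (cv l p)"

text \<open>Sorting the support fixes one order of the vertices on every face, so that the maps on
  different faces fit together. Points with at most \<open>n + 2\<close> nonzero coordinates are
  admissible, since cones are available up to that number of vertices.\<close>

definition hh :: "'a::metric_space set => real => (nat => 'a) => pt => 'a" where
 "hh Y c z p = hl Y c z (sorted_list_of_set (sup_of p)) p"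

lemma remove1_del:
 assumes "distinct l" "i < length l" shows "remove1 (l ! i) l = del i l"
proof -
 have l: "l = take i l @ l ! i # drop (Suc i) l" using assms(2) by (rule id_take_nth_drop)
 have "distinct (take i l @ l ! i # drop (Suc i) l)" using assms(1) l by simp
 hence n: "l ! i ~: set (take i l)" by auto
 have "remove1 (l ! i) (take i l @ l ! i # drop (Suc i) l) = take i l @ drop (Suc i) l"
  unfolding remove1_append using n by simp
 thus ?thesis unfolding del_def using id_take_nth_drop[OF assms(2)] by simp
qed

context
 fixes Y :: "'a::metric_space set" and n :: nat and c :: real and z :: "nat => 'a"
 assumes Y: "lip_connected_const Y n c" and zY: "!!i. z i : Y"
begin

lemma hl_del:
 assumes "p : Sx M" "distinct l" "length l = Suc (Suc d)" "d <= n" "i <= Suc d" "p (l ! i) = 0" "sup_of p <= set l"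
 shows "hl Y c z l p = hl Y c z (del i l) p"
proof -
 have cs: "cv l p : Sx (Suc d)" by (rule cv_simplex[OF assms(1-3,7)])
 have c0: "cv l p i = 0" using assms by (simp add: cv_def)
 have ds: "dface i (cv l p) : Sx d" by (rule dface_simplex[OF cs assms(5) c0])
 have "hl Y c z l p = hS Y c z l (face_map i (dface i (cv l p)))" unfolding hl_def using face_map_dface[of "cv l p" i] c0 by simp
 also have "... = face (Suc d) i (hS Y c z l) (dface i (cv l p))" by (simp only: face_apply[OF ds])
 also have "face (Suc d) i (hS Y c z l) = hS Y c z (del i l)" using zY by (intro hS_face[OF Y assms(3,4) _ assms(5)]) auto
 finally show ?thesis unfolding hl_def using cv_del[of i l p] assms by simp
qed

text \<open>Labels of weight zero can be removed one by one, each removal being restriction to a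
  face. Points with different supports can thus be evaluated in one common simplex.\<close>

lemma hl_supset:
 assumes p: "p : Sx M"
 shows "finite I ==> sup_of p <= I ==> card I <= Suc (Suc n) ==> hl Y c z (sorted_list_of_set I) p = hh Y c z p"
proof (induction "card (I - sup_of p)" arbitrary: I)
 case 0
 hence "I = sup_of p" by auto
 thus ?case by (simp add: hh_def)
next
 case (Suc r)
 have "I - sup_of p ~= {}" using Suc(2) by (metis card.empty nat.distinct(1))
 then obtain a where a: "a : I" "p a = 0" by (auto simp: sup_of_def)
 let ?l = "sorted_list_of_set I"
 have "sup_of p ~= {}" by (rule sup_of_nonempty[OF p])
 then obtain b where b: "b : sup_of p" by blast
 have "card {a, b} <= card I" using a b Suc.prems by (intro card_mono) auto
 moreover have "a ~= b" using a b by (auto simp: sup_of_def)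
 ultimately have "card I = Suc (Suc (card I - 2))" by simp
 then obtain d where d: "card I = Suc (Suc d)" by blast
 have len: "length ?l = Suc (Suc d)" using d Suc.prems by simp
 have "a : set ?l" using a Suc.prems by simp
 then obtain i where i: "i < length ?l" "?l ! i = a" by (auto simp: in_set_conv_nth)
 have "hl Y c z ?l p = hl Y c z (del i ?l) p"
  using Suc.prems d i a len by (intro hl_del[OF p _ len]) auto
 also have "del i ?l = sorted_list_of_set (I - {a})"
  using remove1_del[of ?l i] i Suc.prems(1) by (simp add: sorted_list_of_set_remove)
 also have "hl Y c z (sorted_list_of_set (I - {a})) p = hh Y c z p"
 proof (rule Suc.hyps(1))
  have "I - {a} - sup_of p = (I - sup_of p) - {a}" by auto
  thus "r = card (I - {a} - sup_of p)" using Suc(2) a by (simp add: sup_of_def)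
  show "sup_of p <= I - {a}" using Suc.prems a by (auto simp: sup_of_def)
  show "card (I - {a}) <= Suc (Suc n)" using Suc.prems by (meson card_Diff1_le le_trans)
 qed (use Suc.prems in auto)
 finally show ?case .
qed

lemma hh_lip_same:
 assumes p: "p : Sx M" and q: "q : Sx M" and I: "finite I" "sup_of p <= I" "sup_of q <= I" "card I <= Suc (Suc n)"
  and s: "0 <= s" "!!i j. i : I ==> j : I ==> dist (z i) (z j) <= s"
 shows "dist (hh Y c z p) (hh Y c z q) <= hh_const c n * s * l1 M p q"
proof -
 let ?l = "sorted_list_of_set I"
 have "I ~= {}" using sup_of_nonempty[OF p] I by auto
 then obtain d where d: "card I = Suc d" using I(1) by (metis card_eq_0_iff not0_implies_Suc)
 have len: "length ?l = Suc d" using d I by simp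
 have ps: "sup_of p <= set ?l" "sup_of q <= set ?l" using I by auto
 have lip: "lipl d (h_const c d * s) (Sx d) (hS Y c z ?l)"
  using s zY I d by (intro hS_lipl[OF Y s(1) len]) auto
 have "dist (hh Y c z p) (hh Y c z q) = dist (hl Y c z ?l p) (hl Y c z ?l q)"
  using hl_supset[OF p I(1,2,4)] hl_supset[OF q I(1,3,4)] by simp
 also have "... <= h_const c d * s * l1 d (cv ?l p) (cv ?l q)"
  unfolding hl_def using lip cv_simplex[OF p _ len ps(1)] cv_simplex[OF q _ len ps(2)] by (simp add: lipl_def)
 also have "l1 d (cv ?l p) (cv ?l q) = l1 M p q" by (rule l1_cv[OF p q _ len ps]) simp
 also have "h_const c d * s * l1 M p q <= hh_const c n * s * l1 M p q"
  using h_const_le[of d n c] d I s by (intro mult_right_mono) auto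
 finally show ?thesis .
qed

lemma hh_in: 
 assumes p: "p : Sx M" and "card (sup_of p) <= Suc (Suc n)" shows "hh Y c z p : Y"
proof -
 let ?l = "sorted_list_of_set (sup_of p)"
 obtain d where d: "card (sup_of p) = Suc d" using finite_sup_of[OF p] sup_of_nonempty[OF p] by (metis card_eq_0_iff not0_implies_Suc)
 have "lip_simplex Y d (hS Y c z ?l)" using d assms zY by (intro hS_lip_simplex[OF Y]) auto
 moreover have "cv ?l p : Sx d" using d finite_sup_of[OF p] by (intro cv_simplex[OF p]) auto
 ultimately show ?thesis unfolding hh_def hl_def lip_simplex_iff by auto
qed

lemma hh_near:
 assumes p: "p : Sx M" and cp: "card (sup_of p) <= Suc (Suc n)" and i: "i : sup_of p"
  and s: "0 <= s" "!!i j. i : sup_of p ==> j : sup_of p ==> dist (z i) (z j) <= s"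
 shows "dist (hh Y c z p) (z i) <= 2 * hh_const c n * s"
proof -
 let ?l = "sorted_list_of_set (sup_of p)"
 obtain d where d: "card (sup_of p) = Suc d" using finite_sup_of[OF p] sup_of_nonempty[OF p] by (metis card_eq_0_iff not0_implies_Suc)
 have len: "length ?l = Suc d" using d by simp
 have cs: "cv ?l p : Sx d" using d finite_sup_of[OF p] by (intro cv_simplex[OF p]) auto
 obtain x where x: "x : Sx d" "hS Y c z ?l x = z i"
  using hS_value[OF Y len, of z i] d cp zY i finite_sup_of[OF p] by auto
 have lip: "lipl d (h_const c d * s) (Sx d) (hS Y c z ?l)"
  using s zY finite_sup_of[OF p] d cp by (intro hS_lipl[OF Y s(1) len]) auto
 have "dist (hh Y c z p) (z i) <= h_const c d * s * l1 d (cv ?l p) x"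
  unfolding hh_def hl_def x(2)[symmetric] using lip cs x(1) by (simp add: lipl_def)
 also have "... <= hh_const c n * s*2"
  using h_const_le[of d n c] d cp s simplex_diam[OF cs x(1)] hh_const_nonneg[of c n] by (intro mult_mono mult_right_mono mult_nonneg_nonneg) auto
 finally show ?thesis by simp
qed

text \<open>The two supports together may have more than \<open>n + 2\<close> labels, so no filled
  simplex need contain both points. For distances below 1 the way leads through the common face,
  with legs 2, 5 and 2, which gives the 9; for larger distances the bound on vertex values is
  enough.\<close>

lemma hh_lip:
 assumes p: "p : Sx M" and q: "q : Sx M"
  and cp: "card (sup_of p) <= Suc (Suc n)" and cq: "card (sup_of q) <= Suc (Suc n)"
  and s: "0 <= s" "!!i j. i : sup_of p Un sup_of q ==> j : sup_of p Un sup_of q ==> dist (z i) (z j) <= s"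
 shows "dist (hh Y c z p) (hh Y c z q) <= (9 * hh_const c n + 1) * s * l1 M p q"
proof -
 have H0: "0 <= hh_const c n" by (rule hh_const_nonneg)
 have fp: "finite (sup_of p)" and fq: "finite (sup_of q)" using finite_sup_of p q by auto
 show ?thesis
 proof (cases "1 <= l1 M p q")
  case True
  obtain i j where ij: "i : sup_of p" "j : sup_of q" using sup_of_nonempty p q by blast
  have "dist (hh Y c z p) (hh Y c z q) <= dist (hh Y c z p) (z i) + dist (z i) (z j) + dist (hh Y c z q) (z j)"
   using dist_triangle[of "hh Y c z p" "hh Y c z q" "z i"] dist_triangle2[of "z i" "hh Y c z q" "z j"] by linarith
  also have "... <= 2 * hh_const c n * s + s + 2 * hh_const c n * s"
   using hh_near[OF p cp ij(1) s(1)] hh_near[OF q cq ij(2) s(1)] s(2) ij by (intro add_mono) auto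
  also have "... <= (9 * hh_const c n + 1) * s*1" using H0 s(1) by (simp add: distrib_right)
  also have "... <= (9 * hh_const c n + 1) * s * l1 M p q" using True H0 s(1) by (intro mult_left_mono) auto
  finally show ?thesis .
 next
  case False
  text \<open>Both points are close to the common face spanned by the labels \<open>I\<close>.\<close>
  let ?I = "sup_of p Int sup_of q"
  have out: "(SUM i:sup_of u - ?I. u i) <= l1 M p q" if "u = p \<or> u = q" for u
  proof -
   have "(SUM i:sup_of u - ?I. u i) <= (SUM i:sup_of u - ?I. \<bar>p i - q i\<bar>)"
    using that simplex_nonneg[OF p] simplex_nonneg[OF q] by (intro sum_mono) (auto simp: sup_of_def)
   also have "... <= l1 M p q" unfolding l1_def using that sup_of_simplex[OF p] sup_of_simplex[OF q] by (intro sum_mono2) auto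
   finally show ?thesis .
  qed
  \<comment> \<open>Restriction to the common labels, renormalised. It makes sense because the mass
    outside the common labels is at most the distance, which is below 1.\<close>
  define R where "R = (%u i. if i : ?I then u i/(SUM i:?I. u i) else 0 :: real)"
  have R: "R u : Sx M & sup_of (R u) <= ?I & l1 M u (R u) <= 2 * l1 M p q" if u: "u = p \<or> u = q" for u
  proof -
   let ?m = "SUM i:?I. u i"
   have us: "u : Sx M" using u p q by auto
   have fu: "finite (sup_of u)" using u fp fq by auto
   have tot: "?m + (SUM i:sup_of u - ?I. u i) = 1"
    using sum_supset[OF us fu order_refl] sum.subset_diff[of ?I "sup_of u" u] fu u by auto
   hence m: "0 < ?m" "1 - ?m <= l1 M p q" using out[OF u] False by linarith+
   have m1: "?m <= 1" using tot sum_nonneg[of "sup_of u - ?I" u] simplex_nonneg[OF us] by (smt (verit))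
   have IM: "?I <= {..M}" using sup_of_simplex[OF p] by auto
   have "(SUM i<=M. R u i) = (SUM i:?I. u i/?m)" unfolding R_def using IM by (intro sum.mono_neutral_cong_right) auto
   also have "... = 1" using m by (simp add: sum_divide_distrib[symmetric])
   finally have 1: "R u : Sx M" using simplex_nonneg[OF us] m IM by (auto simp: simplex_k_def R_def)
   have 2: "sup_of (R u) <= ?I" by (auto simp: sup_of_def R_def)
   have "l1 M u (R u) = (SUM i:sup_of u. \<bar>u i - R u i\<bar>)"
    unfolding l1_def using sup_of_simplex[OF us] u by (intro sum.mono_neutral_right) (auto simp: sup_of_def R_def)
   also have "... = (SUM i:?I. \<bar>u i - R u i\<bar>) + (SUM i:sup_of u - ?I. \<bar>u i - R u i\<bar>)"
    using sum.subset_diff[of ?I "sup_of u" "%i. \<bar>u i - R u i\<bar>"] fu u by auto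
   also have "(SUM i:sup_of u - ?I. \<bar>u i - R u i\<bar>) = (SUM i:sup_of u - ?I. u i)"
    using simplex_nonneg[OF us] by (intro sum.cong) (auto simp: R_def)
   also have "(SUM i:?I. \<bar>u i - R u i\<bar>) = (SUM i:?I. u i/?m*(1 - ?m))"
   proof (rule sum.cong)
    fix i assume i: "i : ?I"
    have "u i/?m - u i = u i/?m*(1 - ?m)" using m by (simp add: field_simps)
    moreover have "0 <= u i/?m*(1 - ?m)" using m m1 simplex_nonneg[OF us, of i] by simp
    ultimately show "\<bar>u i - R u i\<bar> = u i/?m*(1 - ?m)" using i by (simp add: R_def)
   qed simp
   also have "... = 1 - ?m" using m by (simp add: sum_distrib_right[symmetric] sum_divide_distrib[symmetric])
   finally have "l1 M u (R u) <= 2 * l1 M p q" using m(2) out[OF u] by linarith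
   thus ?thesis using 1 2 by blast
  qed
  have Rp: "R p : Sx M" "sup_of (R p) <= ?I" "l1 M p (R p) <= 2 * l1 M p q" using R[of p] by auto
  have Rq: "R q : Sx M" "sup_of (R q) <= ?I" "l1 M q (R q) <= 2 * l1 M p q" using R[of q] by auto
  have cI: "card ?I <= Suc (Suc n)" using cp fp by (meson card_mono inf_le1 le_trans)
  have Hs: "0 <= hh_const c n * s" using H0 s(1) by simp
  have 1: "dist (hh Y c z p) (hh Y c z (R p)) <= hh_const c n * s * l1 M p (R p)"
   using Rp s fp cp by (intro hh_lip_same[OF p _ fp]) auto
  have 2: "dist (hh Y c z q) (hh Y c z (R q)) <= hh_const c n * s * l1 M q (R q)"
   using Rq s fq cq by (intro hh_lip_same[OF q _ fq]) auto
  have 3: "dist (hh Y c z (R p)) (hh Y c z (R q)) <= hh_const c n * s * l1 M (R p) (R q)"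
   using Rp Rq s fp cI by (intro hh_lip_same[of _ M _ ?I]) auto
  have l3: "l1 M (R p) (R q) <= 5 * l1 M p q"
   using l1_triangle[of M "R p" "R q" p] l1_triangle[of M p "R q" q] Rp(3) Rq(3) l1_commute[of M p "R p"] by linarith
  have "dist (hh Y c z p) (hh Y c z q) <= dist (hh Y c z p) (hh Y c z (R p)) + dist (hh Y c z (R p)) (hh Y c z (R q)) + dist (hh Y c z q) (hh Y c z (R q))"
   using dist_triangle[of "hh Y c z p" "hh Y c z q" "hh Y c z (R p)"] dist_triangle2[of "hh Y c z (R p)" "hh Y c z q" "hh Y c z (R q)"] by linarith
  also have "... <= hh_const c n * s*(2 * l1 M p q) + hh_const c n * s*(5 * l1 M p q) + hh_const c n * s*(2 * l1 M p q)"
   using 1 2 3 Rp(3) Rq(3) l3 Hs by (intro add_mono) (meson mult_left_mono order_trans)+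
  also have "... = (9 * hh_const c n) * s * l1 M p q" by simp
  also have "... <= (9 * hh_const c n + 1) * s * l1 M p q" using s(1) by (intro mult_right_mono) auto
  finally show ?thesis .
 qed
qed

end

section \<open>Pushing to the k-skeleton\<close>

definition thr :: "nat => nat => pt => real" where
 "thr k M b = Inf {t. 0 <= t & card {i. i <= M & t < b i} <= Suc k}"

text \<open>\<open>thr\<close> is the (k + 2)-nd largest coordinate, cut off below at 0, so at most
  \<open>k + 1\<close> entries remain positive after subtracting it. Unlike keeping the largest
  entries unchanged, this soft cut-off is Lipschitz.\<close>

definition py :: "nat => nat => pt => nat => real" where
 "py k M b i = (if i <= M then max 0 (b i - thr k M b) else 0)"

text \<open>The denominator of the push. For nonnegative nonzero \<open>b\<close> it vanishes
  exactly where the \<open>k + 2\<close> largest coordinates coincide; this is the singular set, of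
  codimension \<open>k + 1\<close>.\<close>

definition pY :: "nat => nat => pt => real" where
 "pY k M b = (SUM i<=M. py k M b i)"

definition pP :: "nat => nat => pt => nat => real" where
 "pP k M b i = py k M b i/pY k M b"

lemma thr_set:
 fixes b :: pt
 shows "EX t. t : {t. 0 <= t & card {i. i <= M & t < b i} <= Suc k}" "bdd_below {t. 0 <= t & card {i. i <= M & t < b i} <= Suc k}"
proof -
 define m where "m = Max ((%i. \<bar>b i\<bar>) ` {..M})"
 have bm: "\<bar>b i\<bar> <= m" if "i <= M" for i unfolding m_def using that by (intro Max_ge) auto
 hence e: "{i. i <= M & m < b i} = {}" by (force simp: abs_le_iff not_less)
 have "0 <= m" using bm[of 0] by simp
 moreover have "card {i. i <= M & m < b i} <= Suc k" unfolding e by simp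
 ultimately show "EX t. t : {t. 0 <= t & card {i. i <= M & t < b i} <= Suc k}" by blast
 show "bdd_below {t. 0 <= t & card {i. i <= M & t < b i} <= Suc k}" by (rule bdd_belowI[of _ 0]) auto
qed

lemma thr_nonneg: "0 <= thr k M b"
 unfolding thr_def using thr_set(1)[of M b k] by (intro cInf_greatest) auto

lemma thr_card: "card {i. i <= M & thr k M b < b i} <= Suc k"
proof -
 let ?S = "{t. 0 <= t & card {i. i <= M & t < b i} <= Suc k}"
 let ?I = "{i. i <= M & thr k M b < b i}"
 show ?thesis
 proof (cases "?I = {}")
  case True thus ?thesis by (simp only: card.empty)
 next
  case False
  define m where "m = Min (b ` ?I)"
  define S where "S = ?S"
  have "thr k M b < m" unfolding m_def using False by (subst Min_gr_iff) auto
  moreover have "S ~= {}" unfolding S_def using thr_set(1)[of M b k] by auto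
  ultimately have "EX t:S. t < m" using cInf_lessD[of S m] by (simp add: thr_def S_def)
  then obtain t where t: "t : ?S" "t < m" unfolding S_def by (elim bexE)
  have "?I <= {i. i <= M & t < b i}"
  proof
   fix i assume i: "i : ?I"
   hence "m <= b i" unfolding m_def by (intro Min_le) auto
   thus "i : {i. i <= M & t < b i}" using t(2) i by auto
  qed
  hence "card ?I <= card {i. i <= M & t < b i}" by (intro card_mono) auto
  thus ?thesis using t(1) by auto
 qed
qed

lemma thr_le: "0 <= t ==> card {i. i <= M & t < b i} <= Suc k ==> thr k M b <= t"
 unfolding thr_def by (intro cInf_lower thr_set(2)) auto

lemma thr_card_ge:
 assumes "0 < thr k M b"
 shows "Suc (Suc k) <= card {i. i <= M & thr k M b <= b i}"
proof (rule ccontr)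
 assume "\<not> ?thesis"
 hence c: "card {i. i <= M & thr k M b <= b i} <= Suc k" by simp
 define t where "t = Max (insert 0 (b ` {i. i <= M & b i < thr k M b}))"
 have t0: "0 <= t" unfolding t_def by (intro Max_ge) auto
 have tl: "t < thr k M b" unfolding t_def using assms by (subst Max_less_iff) auto
 have "{i. i <= M & t < b i} <= {i. i <= M & thr k M b <= b i}"
 proof
  fix i assume i: "i : {i. i <= M & t < b i}"
  show "i : {i. i <= M & thr k M b <= b i}"
  proof (rule ccontr)
   assume "\<not> ?thesis"
   hence "b i <= t" unfolding t_def using i by (intro Max_ge) auto
   thus False using i by simp
  qed
 qed
 hence "card {i. i <= M & t < b i} <= card {i. i <= M & thr k M b <= b i}" by (intro card_mono) auto
 hence "thr k M b <= t" using c by (intro thr_le[OF t0]) simp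
 thus False using tl by simp
qed

lemma thr_lip: "\<bar>thr k M b - thr k M b'\<bar> <= l1 M b b'"
proof -
 have *: "thr k M b' <= thr k M b + l1 M b b'" for b b'
 proof (rule thr_le)
  show "0 <= thr k M b + l1 M b b'" using thr_nonneg[of k M b] by simp
  have "{i. i <= M & thr k M b + l1 M b b' < b' i} <= {i. i <= M & thr k M b < b i}"
   using l1_component[of _ M b b'] by (force simp: abs_le_iff)
  hence "card {i. i <= M & thr k M b + l1 M b b' < b' i} <= card {i. i <= M & thr k M b < b i}" by (intro card_mono) auto
  thus "card {i. i <= M & thr k M b + l1 M b b' < b' i} <= Suc k" using thr_card[of M k b] by (rule order_trans)
 qed
 show ?thesis using *[of b b'] *[of b' b] by (simp add: l1_commute abs_le_iff)
qed

lemma py_nonneg: "0 <= py k M b i"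
 by (simp add: py_def)

lemma pY_nonneg: "0 <= pY k M b"
 unfolding pY_def by (intro sum_nonneg py_nonneg)

lemma py_pos_iff: "py k M b i ~= 0 \<longleftrightarrow> i <= M & thr k M b < b i"
 by (auto simp: py_def max_def)

text \<open>At most \<open>2 * k + 2\<close> indices have a nonzero entry on either side, and each
  feels the threshold by at most the l1 distance. The number \<open>M\<close> of labels, which is
  beyond control, does not enter.\<close>

lemma py_lip: "l1 M (py k M b) (py k M b') <= real (2 * k + 3) * l1 M b b'"
proof -
 let ?I = "{i. i <= M & thr k M b < b i} Un {i. i <= M & thr k M b' < b' i}"
 have cI: "card ?I <= 2 * Suc k" using card_Un_le[of "{i. i <= M & thr k M b < b i}" "{i. i <= M & thr k M b' < b' i}"] add_mono[OF thr_card[of M k b] thr_card[of M k b']] by simp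
 have "l1 M (py k M b) (py k M b') = (SUM i:?I. \<bar>py k M b i - py k M b' i\<bar>)"
  unfolding l1_def using py_pos_iff[of k M b] py_pos_iff[of k M b'] by (intro sum.mono_neutral_right) (auto, metis)
 also have "... <= (SUM i:?I. \<bar>b i - b' i\<bar> + l1 M b b')"
  using thr_lip[of k M b b'] by (intro sum_mono) (auto simp: py_def max_def abs_le_iff)
 also have "... = (SUM i:?I. \<bar>b i - b' i\<bar>) + real (card ?I) * l1 M b b'" by (simp add: sum.distrib)
 also have "... <= l1 M b b' + real (2 * Suc k) * l1 M b b'"
 proof (rule add_mono)
  show "(SUM i:?I. \<bar>b i - b' i\<bar>) <= l1 M b b'" unfolding l1_def by (intro sum_mono2) auto
  show "real (card ?I) * l1 M b b' <= real (2 * Suc k) * l1 M b b'" using cI by (intro mult_right_mono) (auto simp del: of_nat_Suc of_nat_mult)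
 qed
 finally show ?thesis by (simp add: algebra_simps)
qed

lemma pY_lip: "\<bar>pY k M b - pY k M b'\<bar> <= real (2 * k + 3) * l1 M b b'"
proof -
 have "pY k M b - pY k M b' = (SUM i<=M. py k M b i - py k M b' i)" by (simp add: pY_def sum_subtractf)
 hence "\<bar>pY k M b - pY k M b'\<bar> <= l1 M (py k M b) (py k M b')" unfolding l1_def by (simp only: sum_abs)
 thus ?thesis using py_lip[of M k b b'] by linarith
qed

lemma pP_lip:
 assumes "0 < r" "r <= pY k M b" "r <= pY k M b'"
 shows "l1 M (pP k M b) (pP k M b') <= 2/r * real (2 * k + 3) * l1 M b b'"
proof -
 have e: "pY k M b - pY k M b' = (SUM i<=M. py k M b i - py k M b' i)" by (simp add: pY_def sum_subtractf)
 have "l1 M (%i. py k M b i/pY k M b) (%i. py k M b' i/pY k M b') <= (1 + 1)/r * l1 M (py k M b) (py k M b')"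
 proof (rule l1_normalize[OF assms])
  show "\<bar>pY k M b - pY k M b'\<bar> <= l1 M (py k M b) (py k M b')" unfolding l1_def e by (rule sum_abs)
  show "l1 M (py k M b') (%_. 0) <= 1 * pY k M b'" using py_nonneg by (simp add: l1_def pY_def)
 qed
 also have "... <= (1 + 1)/r*(real (2 * k + 3) * l1 M b b')" using assms(1) by (intro mult_left_mono py_lip) auto
 finally show ?thesis by (simp add: pP_def[abs_def] algebra_simps)
qed

lemma pP_simplex:
 assumes "0 < pY k M b" shows "pP k M b : Sx M"
proof -
 have "(SUM i<=M. pP k M b i) = 1" using assms by (simp add: pP_def sum_divide_distrib[symmetric] pY_def[symmetric])
 thus ?thesis using assms by (auto simp: simplex_k_def pP_def py_def)
qed

lemma pP_support:
 assumes "0 < pY k M b"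
 shows "{i. pP k M b i ~= 0} = {i. i <= M & thr k M b < b i}"
 using assms py_pos_iff[of k M b] by (auto simp: pP_def)

text \<open>A small denominator forces the largest coordinate and \<open>k + 1\<close> further ones
  to agree up to \<open>t\<close>. These are \<open>k + 1\<close> independent conditions on the
  weights, the origin of the exponent \<open>Suc k\<close> in the count below.\<close>

lemma pY_small_imp:
 assumes b0: "!!i. i <= M ==> 0 <= b i" and b1: "t < (SUM i<=M. b i)" and Y: "pY k M b <= t"
 shows "EX i0 T. i0 <= M & T <= {..M} & card T = Suc k & i0 ~: T & (ALL i<=M. b i <= b i0) & (ALL i:T. 0 < b i & b i0 - t <= b i)"
proof -
 let ?th = "thr k M b"
 have th: "0 < ?th"
 proof (rule ccontr)
  assume "\<not> 0 < ?th"
  hence "?th = 0" using thr_nonneg[of k M b] by simp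
  hence "pY k M b = (SUM i<=M. b i)" unfolding pY_def using b0 by (intro sum.cong) (auto simp: py_def)
  thus False using b1 Y by simp
 qed
 have "Max (b ` {..M}) : b ` {..M}" by (intro Max_in) auto
 then obtain i0 where i0: "i0 : {..M}" "Max (b ` {..M}) = b i0" by (elim imageE)
 have mx: "b i <= b i0" if "i <= M" for i unfolding i0(2)[symmetric] using that by (intro Max_ge) auto
 let ?I = "{i. i <= M & ?th <= b i}"
 have "Suc (Suc k) <= card ?I" by (rule thr_card_ge[OF th])
 moreover have "card ?I - 1 <= card (?I - {i0})" by (simp add: card_Diff_singleton_if)
 ultimately have "Suc k <= card (?I - {i0})" by simp
 then obtain T where T: "T <= ?I - {i0}" "card T = Suc k" by (rule obtain_subset_with_card_n)
 have "py k M b i0 <= pY k M b" unfolding pY_def using i0 py_nonneg by (intro member_le_sum) auto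
 hence "b i0 - ?th <= t" using Y i0 by (simp add: py_def)
 hence "0 < b i & b i0 - t <= b i" if "i : T" for i using T(1) that th by fastforce
 thus ?thesis using T i0 mx by (intro exI[of _ i0] exI[of _ T]) auto
qed

section \<open>Counting the bad weights\<close>

definition wts :: "nat => (nat => nat) => nat => real" where
 "wts J g i = 1 + real (g i)/real J"

text \<open>\<open>real N*2^N\<close> bounds the choices of the maximal index and of the set of
  indices close to it; \<open>5 * N * t\<close> bounds the fraction of weights admissible at each of
  the \<open>k + 1\<close> close indices.\<close>

definition cnt_const :: "nat => nat => real" where
 "cnt_const N k = real N*2^N*(5 * real N)^Suc k"

lemma card_real_interval:
 fixes lo len :: real
 assumes "0 <= len"
 shows "real (card {g. g < J & lo <= real g & real g <= lo + len}) <= len + 1"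
proof (cases "{g. g < J & lo <= real g & real g <= lo + len} = {}")
 case True
 show ?thesis unfolding True using assms by simp
next
 case False
 define S where "S = {g. g < J & lo <= real g & real g <= lo + len}"
 have fin: "finite S" by (simp add: S_def)
 have ne: "S ~= {}" using False by (simp add: S_def)
 have "S <= {Min S..Max S}" using fin by auto
 hence "card S <= Suc (Max S) - Min S" using card_mono[of "{Min S..Max S}" S] by simp
 moreover have mm: "Min S : S" "Max S : S" using Min_in[OF fin ne] Max_in[OF fin ne] by auto
 moreover have "Min S <= Max S" using fin mm(1) by (rule Max_ge)
 ultimately have "real (card S) <= real (Max S) + 1 - real (Min S)" by linarith
 moreover have "real (Max S) <= lo + len" "lo <= real (Min S)" using mm unfolding S_def by blast+
 ultimately show ?thesis unfolding S_def by linarith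
qed

text \<open>Discrete form of the statement that nearly singular weights have measure
  \<open>O(t^(k + 1))\<close>, with a constant that depends on the number \<open>N\<close> of
  nonzero coordinates but not on \<open>M\<close>. Once the weight at the maximal index is fixed,
  each of the \<open>k + 1\<close> close weights is confined to an interval of length
  \<open>O(N * t)\<close>; the condition \<open>1/J <= t\<close> absorbs the rounding to the
  grid.\<close>

lemma count_small:
 fixes u :: pt
 assumes u: "u : Sx M" and N: "card {i. u i ~= 0} <= N" and J: "0 < J" and t: "1/real J <= t"
 shows "real (card {g : PiE {..M} (%_. {..<J}). pY k M (%i. wts J g i * u i) <= t}) <= cnt_const N k * t^Suc k * real J^Suc M"
proof -
 let ?G = "PiE {..M} (%_. {..<J})"
 let ?S = "{i. u i ~= 0}"
 have finG: "finite ?G" by (intro finite_PiE) auto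
 have cG: "card ?G = J^Suc M" by (subst card_PiE) auto
 have u0: "0 <= u i" for i using u by (cases "i <= M") (auto simp: simplex_k_def)
 have SM: "?S <= {..M}" using u by (auto simp: simplex_k_def) (meson not_le)
 have finS: "finite ?S" using SM finite_subset by blast
 have sumS: "(SUM i:?S. u i) = 1"
 proof -
  have "(SUM i:?S. u i) = (SUM i<=M. u i)" using SM by (intro sum.mono_neutral_left) auto
  thus ?thesis using u by (simp add: simplex_k_def)
 qed
 have "?S ~= {}"
 proof
  assume e: "?S = {}"
  show False using sumS unfolding e by simp
 qed
 hence N1: "1 <= N" using N finS by (metis One_nat_def Suc_leI card_gt_0_iff le_trans)
 have Jr: "0 < real J" using J by simp
 have t0: "0 < t" using t Jr by (meson divide_pos_pos less_le_trans zero_less_one)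
 have tJ: "1 <= t * real J" using t Jr by (simp add: pos_divide_le_eq)
 have w1: "1 <= wts J g i" for g i by (simp add: wts_def)
 have w2: "wts J g i <= 2" if "g : ?G" "i <= M" for g i
 proof -
  have "g i < J" using that by (auto simp: PiE_iff)
  thus ?thesis by (simp add: wts_def)
 qed
 show ?thesis
 proof (cases "t < 1/(4 * real N)")
  case False
  \<comment> \<open>For large \<open>t\<close> the right-hand side is already at least the number of
    all weights.\<close>
  have "1 <= (5 * real N) * t" using False N1 t0 by (simp add: not_less pos_divide_le_eq mult.commute)
  hence "1 <= ((5 * real N) * t)^Suc k" by (rule one_le_power)
  moreover have "1 <= real N*2^N" using N1 mult_mono[of 1 "real N" 1 "2^N"] by simp
  ultimately have "1*1 <= (real N*2^N)*(((5 * real N) * t)^Suc k)" by (intro mult_mono) auto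
  also have "... = cnt_const N k * t^Suc k" unfolding cnt_const_def by (simp only: power_mult_distrib mult.assoc)
  finally have "1 * real J^Suc M <= cnt_const N k * t^Suc k * real J^Suc M" by (intro mult_right_mono) auto
  moreover have "card {g : ?G. pY k M (%i. wts J g i * u i) <= t} <= J^Suc M" unfolding cG[symmetric] using finG by (intro card_mono) auto
  hence "real (card {g : ?G. pY k M (%i. wts J g i * u i) <= t}) <= real (J^Suc M)" by (rule of_nat_mono)
  hence "real (card {g : ?G. pY k M (%i. wts J g i * u i) <= t}) <= real J^Suc M" by (simp only: of_nat_power)
  ultimately show ?thesis by linarith
 next
  case True
  have tN: "4 * real N * t < 1" using True N1 by (simp add: pos_less_divide_eq mult.commute)
  \<comment> \<open>\<open>i0\<close> carries the maximum, which is at least \<open>1/N\<close>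
    because at most \<open>N\<close> coordinates of \<open>u\<close> share the total 1, and the
    members of \<open>T\<close> come within \<open>t\<close> of this maximum.\<close>
  define E where "E = (%(i0, T). {g : ?G. 1/real N <= wts J g i0 * u i0 & (ALL i:T. wts J g i * u i <= wts J g i0 * u i0 & wts J g i0 * u i0 - t <= wts J g i * u i)})"
  define Q where "Q = {(i0, T). i0 : ?S & T <= ?S & card T = Suc k & i0 ~: T}"
  have Qsub: "Q <= ?S \<times> Pow ?S" by (auto simp: Q_def)
  have finQ: "finite Q" using Qsub finS by (meson finite_Pow_iff finite_SigmaI finite_subset)
  have "card Q <= card ?S*2^card ?S" using card_mono[OF _ Qsub] finS by (simp add: card_cartesian_product card_Pow)
  also have "... <= N*2^N" using N by (intro mult_mono power_increasing) auto
  finally have cQ: "card Q <= N*2^N" .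
  have sub: "{g : ?G. pY k M (%i. wts J g i * u i) <= t} <= (UN q:Q. E q)"
  proof
   fix g assume g: "g : {g : ?G. pY k M (%i. wts J g i * u i) <= t}"
   let ?b = "%i. wts J g i * u i"
   have b0: "0 <= ?b i" for i using w1[of g i] u0[of i] by simp
   have bu: "u i <= ?b i" for i using w1[of g i] u0[of i] by (simp add: mult_le_cancel_right1)
   have "(SUM i<=M. u i) <= (SUM i<=M. ?b i)" by (intro sum_mono bu)
   moreover have "t < 1" using tN t0 N1 by (smt (verit) mult_le_cancel_right1 of_nat_1 of_nat_mono)
   ultimately have "t < (SUM i<=M. ?b i)" using u by (simp add: simplex_k_def)
   then obtain i0 T where iT: "i0 <= M" "T <= {..M}" "card T = Suc k" "i0 ~: T" "ALL i<=M. ?b i <= ?b i0" "ALL i:T. 0 < ?b i & ?b i0 - t <= ?b i"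
    using pY_small_imp[of M ?b t k] b0 g by blast
   have "1/real N <= ?b i0"
   proof (rule ccontr)
    assume "\<not> ?thesis"
    hence "ALL i:?S. u i < 1/real N" using iT(5) bu SM by (meson atMost_iff le_less_trans not_le subsetD)
    hence "(SUM i:?S. u i) < (SUM i:?S. 1/real N)" using finS \<open>?S ~= {}\<close> by (intro sum_strict_mono) auto
    also have "... = real (card ?S)/real N" by simp
    also have "... <= 1" using N N1 by (simp add: divide_le_eq_1)
    finally show False using sumS by simp
   qed
   moreover have "0 < 1/real N" using N1 by simp
   ultimately have "i0 : ?S" by (cases "u i0 = 0") simp_all
   moreover have "T <= ?S" using iT(6) by auto
   ultimately have "(i0, T) : Q" using iT by (simp add: Q_def)
   moreover have "g : E (i0, T)" unfolding E_def using g iT \<open>1/real N <= ?b i0\<close> by auto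
   ultimately show "g : (UN q:Q. E q)" by blast
  qed
  have cE: "real (card (E q)) <= (5 * real N * t)^Suc k * real J^Suc M" if q: "q : Q" for q
  proof -
   obtain i0 T where qq: "q = (i0, T)" by (cases q)
   have iT: "i0 : ?S" "T <= ?S" "card T = Suc k" "i0 ~: T" using q by (auto simp: Q_def qq)
   have finT: "finite T" using iT finS finite_subset by blast
   define B where "B = (%v::nat. (1 + real v/real J) * u i0)"
   \<comment> \<open>With the weight \<open>v\<close> at \<open>i0\<close> fixed, the conditions
     factor over the coordinates and the count becomes a product. The clause
     \<open>1/N <= B v\<close> is kept inside the factor so that a nonempty factor yields the lower
     bound \<open>ulow\<close> for \<open>u i\<close>.\<close>
   define Sv where "Sv = (%v i. if i = i0 then {v} else if i : T then
    {g. g < J & 1/real N <= B v & (1 + real g/real J) * u i <= B v & B v - t <= (1 + real g/real J) * u i} else {..<J})"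
   have sub: "E q <= (UN v<J. PiE {..M} (Sv v))"
   proof
    fix g assume g: "g : E q"
    have gG: "g : ?G" using g by (simp add: E_def qq)
    have "g : PiE {..M} (Sv (g i0))" using g gG iT unfolding E_def qq Sv_def B_def wts_def by (auto simp: PiE_iff)
    moreover have "g i0 < J" using gG iT(1) SM by (auto simp: PiE_iff)
    ultimately show "g : (UN v<J. PiE {..M} (Sv v))" by blast
   qed
   have cS: "real (card (Sv v i)) <= real J*(if i = i0 then 1/real J else if i : T then 5 * real N * t else 1)" for v i
   proof -
    have "real (card (Sv v i)) <= real J*(5 * real N * t)" if i: "i ~= i0" "i : T"
    proof (cases "Sv v i = {}")
     case True
     show ?thesis unfolding True using Jr t0 by simp
    next
     case False
     have ui: "0 < u i" using iT(2) i u0[of i] by (auto simp: less_le)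
     obtain g where g: "g < J" "1/real N <= B v" "B v - t <= (1 + real g/real J) * u i"
      using False i by (auto simp: Sv_def)
     have "(1 + real g/real J) * u i <= 2 * u i" using g(1) ui by (intro mult_right_mono) auto
     moreover have "t <= 1/(4 * real N)" using True by simp
     moreover have "1/real N = 4*(1/(4 * real N))" using N1 by simp
     ultimately have "3*(1/(4 * real N)) <= 2 * u i" using g(2,3) by linarith
     moreover have "0 <= 1/(4 * real N)" by simp
     ultimately have ulow: "1/(4 * real N) <= u i" by linarith
     define lo where "lo = ((B v - t)/u i - 1) * real J"
     define len where "len = t/u i * real J"
     have len0: "0 <= len" unfolding len_def using t0 ui by simp
     have "Sv v i <= {g. g < J & lo <= real g & real g <= lo + len}"
     proof
      fix g assume "g : Sv v i"
      hence g: "g < J" "(1 + real g/real J) * u i <= B v" "B v - t <= (1 + real g/real J) * u i" using i by (auto simp: Sv_def)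
      have "(B v - t)/u i <= 1 + real g/real J" using g(3) ui by (simp add: pos_divide_le_eq)
      hence 1: "lo <= (real g/real J) * real J" unfolding lo_def using Jr by (intro mult_right_mono) auto
      have "1 + real g/real J <= B v/u i" using g(2) ui by (simp add: pos_le_divide_eq)
      hence "(real g/real J) * real J <= (B v/u i - 1) * real J" using Jr by (intro mult_right_mono) auto
      also have "... = lo + len" unfolding lo_def len_def by (simp add: diff_divide_distrib algebra_simps)
      finally show "g : {g. g < J & lo <= real g & real g <= lo + len}" using 1 g(1) Jr by simp
     qed
     hence "card (Sv v i) <= card {g. g < J & lo <= real g & real g <= lo + len}" by (intro card_mono) auto
     hence "real (card (Sv v i)) <= len + 1" using card_real_interval[OF len0, of J lo] by linarith
     also have "len <= 4 * real N * t * real J"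
     proof -
      have "t/u i <= t/(1/(4 * real N))" using ulow t0 ui N1 by (intro divide_left_mono) auto
      hence "t/u i * real J <= (4 * real N * t) * real J" using Jr by (intro mult_right_mono) (auto simp: mult_ac)
      thus ?thesis by (simp add: len_def)
     qed
     also have "1 <= real N * t * real J" using tJ N1 mult_mono[of 1 "real N" 1 "t * real J"] by (simp add: mult_ac)
     finally show ?thesis by (simp add: algebra_simps)
    qed
    thus ?thesis using Jr by (auto simp: Sv_def)
   qed
   have finSv: "finite (Sv v i)" for v i by (auto simp: Sv_def)
   have cP: "real (card (PiE {..M} (Sv v))) <= real J^Suc M*(1/real J*(5 * real N * t)^Suc k)" for v
   proof -
    have "real (card (PiE {..M} (Sv v))) = (\<Prod>i\<le>M. real (card (Sv v i)))" by (subst card_PiE) auto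
    also have "... <= (\<Prod>i\<le>M. real J*(if i = i0 then 1/real J else if i : T then 5 * real N * t else 1))"
     by (intro prod_mono conjI cS) auto
    also have "... = real J^Suc M*(\<Prod>i\<le>M. (if i = i0 then 1/real J else if i : T then 5 * real N * t else 1))"
     by (simp only: prod.distrib prod_constant card_atMost)
    also have "(\<Prod>i\<le>M. (if i = i0 then 1/real J else if i : T then 5 * real N * t else 1)) =
      (\<Prod>i\<in>insert i0 T. (if i = i0 then 1/real J else if i : T then 5 * real N * t else 1))"
     using iT SM finT by (intro prod.mono_neutral_right) auto
    also have "... = 1/real J*(\<Prod>i\<in>T. (if i = i0 then 1/real J else if i : T then 5 * real N * t else 1))" using finT iT(4) by simp
    also have "(\<Prod>i\<in>T. (if i = i0 then 1/real J else if i : T then 5 * real N * t else 1)) = (\<Prod>i\<in>T. 5 * real N * t)" using iT(4) by (intro prod.cong) auto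
    also have "... = (5 * real N * t)^Suc k" using iT(3) by (simp only: prod_constant)
    finally show ?thesis .
   qed
   have "card (E q) <= card (UN v<J. PiE {..M} (Sv v))" by (rule card_mono[OF _ sub]) (auto intro!: finite_PiE finSv)
   also have "... <= (SUM v<J. card (PiE {..M} (Sv v)))" by (rule card_UN_le) auto
   finally have "real (card (E q)) <= real (SUM v<J. card (PiE {..M} (Sv v)))" by (rule of_nat_mono)
   hence "real (card (E q)) <= (SUM v<J. real (card (PiE {..M} (Sv v))))" by (simp only: of_nat_sum)
   also have "... <= (SUM v<J. real J^Suc M*(1/real J*(5 * real N * t)^Suc k))" by (intro sum_mono cP)
   also have "... = (5 * real N * t)^Suc k * real J^Suc M" using Jr by simp
   finally show ?thesis .
  qed
  have finE: "finite (E q)" for q using finG by (cases q) (auto simp: E_def)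
  have "card {g : ?G. pY k M (%i. wts J g i * u i) <= t} <= card (UN q:Q. E q)" using finQ finE by (intro card_mono[OF _ sub]) auto
  also have "... <= (SUM q:Q. card (E q))" by (rule card_UN_le[OF finQ])
  finally have "real (card {g : ?G. pY k M (%i. wts J g i * u i) <= t}) <= real (SUM q:Q. card (E q))" by (rule of_nat_mono)
  hence "real (card {g : ?G. pY k M (%i. wts J g i * u i) <= t}) <= (SUM q:Q. real (card (E q)))" by (simp only: of_nat_sum)
  also have "(SUM q:Q. real (card (E q))) <= (SUM q:Q. (5 * real N * t)^Suc k * real J^Suc M)" by (intro sum_mono cE)
  also have "... = real (card Q)*((5 * real N * t)^Suc k * real J^Suc M)" by simp
  also have "... <= real (N*2^N)*((5 * real N * t)^Suc k * real J^Suc M)" using cQ t0 by (intro mult_right_mono) (auto simp del: of_nat_mult)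
  also have "... = cnt_const N k * t^Suc k * real J^Suc M" unfolding cnt_const_def by (simp add: power_mult_distrib mult_ac)
  finally show ?thesis .
 qed
qed

section \<open>Hausdorff measure of Lipschitz images\<close>

lemma sets_hausdorff [simp]: "sets (hausdorff_measure k) = sets borel"
 unfolding hausdorff_measure_def by (simp add: sets_measure_of_conv) (metis sets.sigma_sets_eq space_borel)

lemma space_hausdorff [simp]: "space (hausdorff_measure k) = UNIV"
 unfolding hausdorff_measure_def by (simp add: space_measure_of_conv)

text \<open>If the outer measure were not additive on Borel sets, the measure would be zero by convention;
 both of the following facts hold either way.\<close>

lemma hausdorff_le_outer: "emeasure (hausdorff_measure k) A <= hausdorff_outer k A"
 unfolding hausdorff_measure_def emeasure_measure_of_conv by auto

lemma hausdorff_scale: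
 fixes A B :: "'a::metric_space set"
 assumes "A : sets borel" "hausdorff_outer k B <= c * hausdorff_outer k A"
 shows "emeasure (hausdorff_measure k) B <= c * emeasure (hausdorff_measure k) A"
proof -
 have s: "sigma_sets UNIV (sets borel) = (sets borel :: 'a set set)" by (metis sets.sigma_sets_eq space_borel)
 show ?thesis using assms unfolding hausdorff_measure_def emeasure_measure_of_conv s by auto
qed

lemma hausdorff_pre_finite:
 assumes I: "finite I" and A: "A <= (UN i:I. D i)"
  and D: "!!i. i : I ==> bounded (D i) & diameter (D i) <= r" and r: "0 <= dlt" "r <= dlt" "0 <= r" and k: "0 < k"
 shows "hausdorff_pre k dlt A <= of_nat (card I) * ennreal (r^k)"
proof -
 obtain e where e: "bij_betw e {..<card I} I" using ex_bij_betw_nat_finite[OF I] by (auto simp: atLeast0LessThan)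
 define C where "C = (%i. if i < card I then D (e i) else {})"
 have eI: "e i : I" if "i < card I" for i using e that by (auto simp: bij_betw_def)
 have cov: "A <= (UN i. C i)"
 proof
  fix x assume "x : A"
  then obtain j where j: "j : I" "x : D j" using A by auto
  have "j : e ` {..<card I}" using e j(1) by (simp add: bij_betw_def)
  then obtain i where i: "i < card I" "j = e i" by auto
  have "x : C i" using i j by (simp add: C_def)
  thus "x : (UN i. C i)" by blast
 qed
 have bd: "ALL i. bounded (C i) & diameter (C i) <= dlt"
 proof
  fix i show "bounded (C i) & diameter (C i) <= dlt"
  proof (cases "i < card I")
   case True thus ?thesis using D[OF eI[OF True]] r by (simp add: C_def)
  qed (use r in \<open>simp add: C_def diameter_def\<close>)
 qed
 have "hausdorff_pre k dlt A <= (suminf (%i. if C i = {} then 0 else ennreal (diameter (C i))^k))"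
  unfolding hausdorff_pre_def using cov bd by (intro Inf_lower) auto
 also have "... = (SUM i<card I. if C i = {} then 0 else ennreal (diameter (C i))^k)"
  by (intro suminf_finite) (auto simp: C_def)
 also have "... <= (SUM i<card I. ennreal (r^k))"
 proof (rule sum_mono)
  fix i assume i: "i : {..<card I}"
  have "ennreal (diameter (C i))^k <= ennreal r^k" using D[OF eI[of i]] i by (intro power_mono ennreal_leI) (auto simp: C_def)
  thus "(if C i = {} then 0 else ennreal (diameter (C i))^k) <= ennreal (r^k)" using r by (simp add: ennreal_power)
 qed
 also have "... = of_nat (card I) * ennreal (r^k)" by simp
 finally show ?thesis .
qed

lemma diameter_le_metric:
 fixes S :: "'a::metric_space set"
 assumes "!!x y. x : S ==> y : S ==> dist x y <= r" "0 <= r"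
 shows "diameter S <= r"
 using assms unfolding diameter_def by (auto intro!: cSUP_least)

lemma bounded_diameter_image:
 fixes g :: "'b => 'a::metric_space"
 assumes "!!x y. x : A ==> y : A ==> dist (g x) (g y) <= r" "0 <= r"
 shows "bounded (g ` A) & diameter (g ` A) <= r"
proof
 show "bounded (g ` A)" unfolding bounded_two_points using assms by blast
 show "diameter (g ` A) <= r" using assms by (intro diameter_le_metric) auto
qed

text \<open>A cover of the image of \<open>f\<close> is pulled back to \<open>A\<close> and pushed
  forward by \<open>g\<close>. Comparing \<open>g\<close> with \<open>f\<close>, and not with the
  parameter, is what replaces an estimate of Jacobians.\<close>

lemma hausdorff_outer_lipschitz:
 fixes f g :: "'b => 'a::metric_space"
 assumes lam: "0 < lmb" and lip: "!!x y. x : A ==> y : A ==> dist (g x) (g y) <= lmb * dist (f x) (f y)"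
 shows "hausdorff_outer k (g ` A) <= ennreal (lmb^k) * hausdorff_outer k (f ` A)"
proof -
 have pre: "hausdorff_pre k (lmb * dlt) (g ` A) <= ennreal (lmb^k) * hausdorff_pre k dlt (f ` A)" for dlt
 proof -
  have one: "ennreal (lmb^k)*(ennreal (1/lmb^k) * X) = X" for X
   using lam by (simp add: mult.assoc[symmetric] ennreal_mult[symmetric])
  have "ennreal (1/lmb^k) * hausdorff_pre k (lmb * dlt) (g ` A) <= hausdorff_pre k dlt (f ` A)"
   unfolding hausdorff_pre_def[of k dlt]
  proof (rule Inf_greatest)
   fix X assume "X : {suminf (%i. if C i = {} then 0 else ennreal (diameter (C i))^k) |C. f ` A <= (UN i. C i) & (ALL i. bounded (C i) & diameter (C i) <= dlt)}"
   then obtain C where X: "X = (suminf (%i. if C i = {} then 0 else ennreal (diameter (C i))^k))"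
    and C: "f ` A <= (UN i. C i)" "!!i. bounded (C i) & diameter (C i) <= dlt" by auto
   define D where "D = (%i. g ` {x : A. f x : C i})"
   have dd: "bounded (D i) & diameter (D i) <= lmb * diameter (C i)" for i
    unfolding D_def
   proof (rule bounded_diameter_image)
    fix x y assume xy: "x : {x : A. f x : C i}" "y : {x : A. f x : C i}"
    have "dist (g x) (g y) <= lmb * dist (f x) (f y)" using lip xy by auto
    also have "... <= lmb * diameter (C i)" using lam C(2)[of i] xy by (intro mult_left_mono diameter_bounded_bound) auto
    finally show "dist (g x) (g y) <= lmb * diameter (C i)" .
   qed (use lam C(2)[of i] in \<open>simp add: diameter_ge_0\<close>)
   have cov: "g ` A <= (UN i. D i)" using C(1) by (fastforce simp: D_def)
   have "diameter (D i) <= lmb * dlt" for i using dd[of i] C(2)[of i] lam by (meson mult_left_mono less_imp_le order_trans)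
   hence "hausdorff_pre k (lmb * dlt) (g ` A) <= (suminf (%i. if D i = {} then 0 else ennreal (diameter (D i))^k))"
    unfolding hausdorff_pre_def using cov dd by (intro Inf_lower) auto
   also have "... <= (suminf (%i. ennreal (lmb^k)*(if C i = {} then 0 else ennreal (diameter (C i))^k)))"
   proof (intro suminf_le allI)
    fix i
    show "(if D i = {} then 0 else ennreal (diameter (D i))^k) <= ennreal (lmb^k)*(if C i = {} then 0 else ennreal (diameter (C i))^k)"
    proof (cases "D i = {}")
     case False
     hence "C i ~= {}" by (auto simp: D_def)
     moreover have "ennreal (diameter (D i))^k <= ennreal (lmb * diameter (C i))^k" using dd[of i] by (intro power_mono ennreal_leI) auto
     moreover have "ennreal (lmb * diameter (C i))^k = ennreal (lmb^k) * ennreal (diameter (C i))^k"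
      using lam C(2)[of i] by (simp add: ennreal_mult power_mult_distrib ennreal_power diameter_ge_0)
     ultimately show ?thesis using False by simp
    qed simp
   qed auto
   also have "... = ennreal (lmb^k) * X" unfolding X by (rule ennreal_suminf_cmult)
   finally have "ennreal (1/lmb^k) * hausdorff_pre k (lmb * dlt) (g ` A) <= ennreal (1/lmb^k)*(ennreal (lmb^k) * X)" by (rule mult_left_mono) simp
   also have "... = X" using one[of X] by (simp add: mult.left_commute)
   finally show "ennreal (1/lmb^k) * hausdorff_pre k (lmb * dlt) (g ` A) <= X" .
  qed
  hence "ennreal (lmb^k)*(ennreal (1/lmb^k) * hausdorff_pre k (lmb * dlt) (g ` A)) <= ennreal (lmb^k) * hausdorff_pre k dlt (f ` A)"
   by (rule mult_left_mono) simp
  thus ?thesis unfolding one .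
 qed
 show ?thesis
  unfolding hausdorff_outer_def[of k "g ` A"]
 proof (rule SUP_least)
  fix dlt :: real assume d: "dlt : {0<..}"
  have "hausdorff_pre k dlt (g ` A) <= ennreal (lmb^k) * hausdorff_pre k (dlt/lmb) (f ` A)" using pre[of "dlt/lmb"] lam by simp
  also have "... <= ennreal (lmb^k) * hausdorff_outer k (f ` A)"
   unfolding hausdorff_outer_def using d lam by (intro mult_left_mono SUP_upper) auto
  finally show "hausdorff_pre k dlt (g ` A) <= ennreal (lmb^k) * hausdorff_outer k (f ` A)" .
 qed
qed

text \<open>Only the first \<open>k\<close> of the \<open>k + 1\<close> barycentric coordinates are
  recorded, the last one being determined by them; so the number of cells of level \<open>j\<close>
  grows like \<open>2^(j k)\<close>. Cells are half open, which makes them a partition, and the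
  value \<open>2^j\<close> occurs when a coordinate equals 1.\<close>

definition idx :: "nat => nat => pt => (nat => nat)" where
 "idx k j x = restrict (%i. nat \<lfloor>2^j * x i\<rfloor>) {..<k}"

definition cel :: "nat => nat => (nat => nat) => pt set" where
 "cel k j q = {x : Sx k. idx k j x = q}"

definition QS :: "nat => nat => (nat => nat) set" where
 "QS k j = PiE {..<k} (%_. {..2^j})"

lemma finite_QS [simp]: "finite (QS k j)"
 unfolding QS_def by (intro finite_PiE) auto

lemma card_QS: "card (QS k j) = (2^j + 1)^k"
 unfolding QS_def by (subst card_PiE) auto

lemma idx_in_QS: "x : Sx k ==> idx k j x : QS k j"
proof -
 assume x: "x : Sx k"
 have "nat \<lfloor>2^j * x i\<rfloor> <= 2^j" if "i < k" for i
 proof -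
  have "x i <= 1" using simplex_le1[OF x, of i] that by simp
  hence "2^j * x i <= 2^j*1" by (intro mult_left_mono) auto
  hence "\<lfloor>2^j * x i\<rfloor> <= \<lfloor>2^j :: real\<rfloor>" by (intro floor_mono) simp
  also have "\<lfloor>2^j :: real\<rfloor> = 2^j" by (metis floor_of_int of_int_numeral of_int_power)
  finally show ?thesis by (simp add: nat_le_iff)
 qed
 thus ?thesis by (auto simp: QS_def idx_def)
qed

lemma simplex_coord: "x : Sx k ==> 0 <= x i"
 by (cases "i <= k") (auto simp: simplex_k_def)

lemma idx_mult:
 assumes x: "x : Sx k" and i: "i < k" and j: "j <= j'"
 shows "idx k j x i = idx k j' x i div 2^(j' - j)"
proof -
 have "2^j * x i = 2^j' * x i/2^(j' - j)" using j by (simp add: power_diff)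
 hence "\<lfloor>2^j * x i\<rfloor> = \<lfloor>2^j' * x i/of_int (2^(j' - j))\<rfloor>" by simp
 also have "... = \<lfloor>2^j' * x i\<rfloor> div 2^(j' - j)" by (rule floor_divide_real_eq_div) simp
 finally show ?thesis using i simplex_coord[OF x, of i] by (simp add: idx_def nat_div_distrib nat_power_eq)
qed

lemma idx_eq_mono:
 assumes "x : Sx k" "y : Sx k" "j <= j'" "idx k j' x = idx k j' y"
 shows "idx k j x = idx k j y"
proof
 fix i show "idx k j x i = idx k j y i"
 proof (cases "i < k")
  case True
  thus ?thesis by (simp only: idx_mult[OF assms(1) True assms(3)] idx_mult[OF assms(2) True assms(3)] assms(4))
 qed (simp add: idx_def)
qed

lemma cel_diam:
 assumes "x : cel k j q" "y : cel k j q"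
 shows "l1 k x y <= 2 * real k/2^j"
proof -
 have xs: "x : Sx k" "y : Sx k" and e: "idx k j x = idx k j y" using assms by (auto simp: cel_def)
 have d: "\<bar>x i - y i\<bar> <= 1/2^j" if i: "i < k" for i
 proof -
  have "nat \<lfloor>2^j * x i\<rfloor> = nat \<lfloor>2^j * y i\<rfloor>" using fun_cong[OF e, of i] i by (simp add: idx_def)
  moreover have "0 <= \<lfloor>2^j * x i\<rfloor>" "0 <= \<lfloor>2^j * y i\<rfloor>" using simplex_coord[OF xs(1), of i] simplex_coord[OF xs(2), of i] by simp_all
  ultimately have "\<lfloor>2^j * x i\<rfloor> = \<lfloor>2^j * y i\<rfloor>" by (metis int_nat_eq)
  hence "\<bar>2^j * x i - 2^j * y i\<bar> <= 1" by linarith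
  hence "2^j*\<bar>x i - y i\<bar> <= 1" by (simp add: abs_mult right_diff_distrib[symmetric])
  thus ?thesis by (simp add: pos_le_divide_eq mult.commute)
 qed
 have s: "(SUM i<k. \<bar>x i - y i\<bar>) <= real k/2^j" using sum_mono[of "{..<k}" "%i. \<bar>x i - y i\<bar>" "%_. 1/2^j"] d by simp
 have l: "x k - y k = - (SUM i<k. x i - y i)" using xs by (simp add: simplex_k_def lessThan_Suc_atMost[symmetric] sum_subtractf)
 have "\<bar>x k - y k\<bar> <= (SUM i<k. \<bar>x i - y i\<bar>)" unfolding l abs_minus_cancel by (rule sum_abs)
 thus ?thesis using s by (simp add: l1_def lessThan_Suc_atMost[symmetric])
qed

lemma card_subcells:
 assumes j: "j <= j'"
 shows "card {q' : QS k j'. cel k j q Int cel k j' q' ~= {}} <= (2^(j' - j))^k"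
proof -
 let ?D = "2^(j' - j) :: nat"
 have "{q' : QS k j'. cel k j q Int cel k j' q' ~= {}} <= PiE {..<k} (%i. {q i*?D..<q i*?D + ?D})"
 proof
  fix q' assume "q' : {q' : QS k j'. cel k j q Int cel k j' q' ~= {}}"
  then obtain x where x: "x : Sx k" "idx k j x = q" "idx k j' x = q'" by (auto simp: cel_def)
  have "q' i : {q i*?D..<q i*?D + ?D}" if "i < k" for i
  proof -
   have "q i = q' i div ?D" using idx_mult[OF x(1) that j] x by simp
   moreover have "q' i < q' i div ?D*?D + ?D" by (metis dividend_less_div_times zero_less_numeral zero_less_power add.commute)
   ultimately show ?thesis by (simp add: div_times_less_eq_dividend)
  qed
  moreover have "q' : extensional {..<k}" using x(3) by (auto simp: idx_def)
  ultimately show "q' : PiE {..<k} (%i. {q i*?D..<q i*?D + ?D})" by (auto simp: PiE_iff)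
 qed
 hence "card {q' : QS k j'. cel k j q Int cel k j' q' ~= {}} <= card (PiE {..<k} (%i. {q i*?D..<q i*?D + ?D}))"
  by (intro card_mono finite_PiE) auto
 also have "... = ?D^k" by (subst card_PiE) auto
 finally show ?thesis .
qed

text \<open>A finer level \<open>j'\<close> covers the image by at most
  \<open>2^((j' - j) k)\<close> pieces of diameter \<open>O(L/2^j')\<close>. In the sum of
  \<open>k\<close>-th powers the dependence on \<open>j'\<close> cancels, so the bound holds for
  every \<open>dlt\<close>.\<close>

lemma hausdorff_cell:
 fixes g :: "pt => 'a::metric_space"
 assumes k: "0 < k" and L: "lipl k L (cel k j q) g"
 shows "hausdorff_outer k (g ` (cel k j q Int A)) <= ennreal ((2 * real k * L/2^j)^k)"
 unfolding hausdorff_outer_def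
proof (rule SUP_least)
 fix dlt :: real assume d: "dlt : {0<..}"
 have L0: "0 <= L" using L by (simp add: lipl_def)
 obtain j0 :: nat where j0: "2 * real k * L/dlt < 2^j0" using real_arch_pow[of 2 "2 * real k * L/dlt"] by auto
 define j' where "j' = max j j0"
 have jj: "j <= j'" by (simp add: j'_def)
 define r where "r = L*(2 * real k/2^j')"
 have r0: "0 <= r" unfolding r_def using L0 by simp
 have "2 * real k * L/dlt < 2^j'" by (rule less_le_trans[OF j0 power_increasing]) (auto simp: j'_def)
 hence rd: "r <= dlt" using d unfolding r_def by (simp add: field_simps)
 let ?I = "{q' : QS k j'. cel k j q Int cel k j' q' ~= {}}"
 have "hausdorff_pre k dlt (g ` (cel k j q Int A)) <= of_nat (card ?I) * ennreal (r^k)"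
 proof (rule hausdorff_pre_finite[where D="%q'. g ` (cel k j q Int A Int cel k j' q')"])
  show "g ` (cel k j q Int A) <= (UN q':?I. g ` (cel k j q Int A Int cel k j' q'))"
  proof
   fix y assume "y : g ` (cel k j q Int A)"
   then obtain x where x: "x : cel k j q" "x : A" "y = g x" by auto
   hence "x : cel k j' (idx k j' x)" "idx k j' x : ?I" using idx_in_QS[of x k j'] by (auto simp: cel_def)
   thus "y : (UN q':?I. g ` (cel k j q Int A Int cel k j' q'))" using x by blast
  qed
  fix q' show "bounded (g ` (cel k j q Int A Int cel k j' q')) & diameter (g ` (cel k j q Int A Int cel k j' q')) <= r"
  proof (rule bounded_diameter_image[OF _ r0])
   fix x y assume xy: "x : cel k j q Int A Int cel k j' q'" "y : cel k j q Int A Int cel k j' q'"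
   have "dist (g x) (g y) <= L * l1 k x y" using L xy by (auto simp: lipl_def)
   also have "... <= r" unfolding r_def using cel_diam[of x k j' q' y] xy L0 by (intro mult_left_mono) auto
   finally show "dist (g x) (g y) <= r" .
  qed
 qed (use d rd r0 k in auto)
 also have "... <= of_nat ((2^(j' - j))^k) * ennreal (r^k)" by (intro mult_right_mono of_nat_mono card_subcells[OF jj]) auto
 also have "... = ennreal (real ((2^(j' - j))^k) * r^k)" using r0 by (simp add: ennreal_mult ennreal_of_nat_eq_real_of_nat)
 also have "real ((2^(j' - j))^k) * r^k = (2^(j' - j) * r)^k" by (simp add: power_mult_distrib)
 also have "2^(j' - j) * r = 2 * real k * L/2^j" unfolding r_def using jj by (simp add: power_diff)
 finally show "hausdorff_pre k dlt (g ` (cel k j q Int A)) <= ennreal ((2 * real k * L/2^j)^k)" .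
qed

text \<open>There are \<open>O(2^(j p))\<close> pieces, each contributing the power
  \<open>p + 1\<close> of \<open>O(2^-j)\<close>; the total is \<open>O(2^-j)\<close>.\<close>

lemma hausdorff_lower_dim:
 fixes f :: "pt => 'a::metric_space"
 assumes L: "lipl p L (Sx p) f"
 shows "hausdorff_outer (Suc p) (f ` Sx p) = 0"
proof -
 have L0: "0 <= L" using L by (simp add: lipl_def)
 define B where "B = 2^p*(2 * real p * L)^Suc p"
 have B0: "0 <= B" unfolding B_def using L0 by simp
 have pre: "hausdorff_pre (Suc p) dlt (f ` Sx p) <= ennreal (B/2^j)" if d: "0 < dlt" and j: "2 * real p * L/dlt < 2^j" for dlt j
 proof -
  define r where "r = L*(2 * real p/2^j)"
  have r0: "0 <= r" unfolding r_def using L0 by simp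
  have rd: "r <= dlt" using d j unfolding r_def by (simp add: field_simps)
  have "hausdorff_pre (Suc p) dlt (f ` Sx p) <= of_nat (card (QS p j)) * ennreal (r^Suc p)"
  proof (rule hausdorff_pre_finite[where D="%q. f ` cel p j q"])
   show "f ` Sx p <= (UN q:QS p j. f ` cel p j q)"
    using idx_in_QS[of _ p j] by (force simp: cel_def)
   fix q show "bounded (f ` cel p j q) & diameter (f ` cel p j q) <= r"
   proof (rule bounded_diameter_image[OF _ r0])
    fix x y assume xy: "x : cel p j q" "y : cel p j q"
    have "dist (f x) (f y) <= L * l1 p x y" using L xy by (auto simp: lipl_def cel_def)
    also have "... <= r" unfolding r_def using cel_diam[OF xy] L0 by (intro mult_left_mono) auto
    finally show "dist (f x) (f y) <= r" .
   qed
  qed (use d rd r0 in auto)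
  also have "... = ennreal (real ((2^j + 1)^p) * r^Suc p)" using r0 by (simp add: card_QS ennreal_mult ennreal_of_nat_eq_real_of_nat del: power_Suc)
  also have "... <= ennreal ((2*2^j)^p * r^Suc p)"
  proof (intro ennreal_leI mult_right_mono)
   have "real (2^j + 1)^p <= (2*2^j)^p" by (intro power_mono) auto
   thus "real ((2^j + 1)^p) <= (2*2^j)^p" by (simp only: of_nat_power)
  qed (use r0 in simp)
  also have "(2*2^j)^p * r^Suc p = B/2^j"
  proof -
   have "r^Suc p = (2 * real p * L)^Suc p/(2^j*(2^j)^p)" unfolding r_def by (simp add: power_divide power_mult_distrib mult_ac)
   thus ?thesis unfolding B_def by (simp add: power_mult_distrib)
  qed
  finally show ?thesis .
 qed
 have "hausdorff_pre (Suc p) dlt (f ` Sx p) <= 0" if d: "0 < dlt" for dlt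
 proof (rule ennreal_le_epsilon)
  fix e :: real assume e: "0 < e"
  obtain j :: nat where j: "max (2 * real p * L/dlt) (B/e) < 2^j" using real_arch_pow[of 2 "max (2 * real p * L/dlt) (B/e)"] by auto
  have "hausdorff_pre (Suc p) dlt (f ` Sx p) <= ennreal (B/2^j)" using pre[OF d, of j] j by simp
  also have "... <= ennreal e" using j e by (intro ennreal_leI) (simp add: field_simps)
  finally show "hausdorff_pre (Suc p) dlt (f ` Sx p) <= 0 + ennreal e" by simp
 qed
 hence "hausdorff_outer (Suc p) (f ` Sx p) <= 0" unfolding hausdorff_outer_def by (intro SUP_least) auto
 thus ?thesis by simp
qed

section \<open>Chains of vertex lists and prisms\<close>

abbreviation "kys \<equiv> Poly_Mapping.keys"

abbreviation "lkp \<equiv> Poly_Mapping.lookup"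

text \<open>The number of simplices of a chain, counted with the absolute values of their
  coefficients.\<close>

definition fn :: "('b \<Rightarrow>\<^sub>0 int) => real" where
 "fn c = (SUM x:kys c. \<bar>real_of_int (lkp c x)\<bar>)"

lemma fn_superset: "finite S ==> kys c <= S ==> fn c = (SUM x:S. \<bar>real_of_int (lkp c x)\<bar>)"
 unfolding fn_def by (rule sum.mono_neutral_left) (auto simp: in_keys_iff)

lemma fn_nonneg [simp]: "0 <= fn c"
 by (simp add: fn_def sum_nonneg)

lemma fn_0 [simp]: "fn 0 = 0"
 by (simp add: fn_def)

lemma fn_of [simp]: "fn (frag_of x) = 1"
 by (simp add: fn_def)

lemma fn_add: "fn (a + b) <= fn a + fn b"
proof -
 let ?S = "kys a Un kys b"
 have "fn (a + b) = (SUM x:?S. \<bar>real_of_int (lkp (a + b) x)\<bar>)" by (rule fn_superset) (auto simp: Poly_Mapping.keys_add)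
 also have "... <= (SUM x:?S. \<bar>real_of_int (lkp a x)\<bar> + \<bar>real_of_int (lkp b x)\<bar>)" by (rule sum_mono) (simp add: lookup_add)
 also have "... = fn a + fn b" using fn_superset[of ?S a] fn_superset[of ?S b] by (simp add: sum.distrib)
 finally show ?thesis .
qed

lemma fn_minus [simp]: "fn (- a) = fn a"
 by (simp add: fn_def)

lemma fn_diff: "fn (a - b) <= fn a + fn b"
 using fn_add[of a "- b"] by simp

lemma fn_cmul: "fn (frag_cmul k a) = \<bar>real_of_int k\<bar> * fn a"
proof (cases "k = 0")
 case False
 hence "kys (frag_cmul k a) = kys a" by auto
 thus ?thesis by (simp add: fn_def abs_mult sum_distrib_left)
qed simp

lemma fn_sum: "fn (sum b I) <= (SUM i:I. fn (b i))"
proof (induction I rule: infinite_finite_induct)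
 case (insert i I)
 thus ?case using fn_add[of "b i" "sum b I"] by simp
qed auto

lemma fn_extend:
 assumes "!!x. x : kys c ==> fn (f x) <= B"
 shows "fn (frag_extend f c) <= B * fn c"
proof -
 have "fn (frag_extend f c) <= (SUM x:kys c. fn (frag_cmul (lkp c x) (f x)))" unfolding frag_extend_def by (rule fn_sum)
 also have "... <= (SUM x:kys c. \<bar>real_of_int (lkp c x)\<bar> * B)" unfolding fn_cmul using assms by (intro sum_mono mult_left_mono) auto
 also have "... = B * fn c" unfolding fn_def sum_distrib_right[symmetric] by (rule mult.commute)
 finally show ?thesis .
qed

lemma frag_extend_extend: "frag_extend f (frag_extend g c) = frag_extend (%x. frag_extend f (g x)) c"
 using subset_UNIV by (induction c rule: frag_induction) (auto simp: frag_extend_diff)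

lemma frag_extend_fun_diff: "frag_extend (%x. f x - g x) c = frag_extend f c - frag_extend g c"
 using subset_UNIV by (induction c rule: frag_induction) (auto simp: frag_extend_diff)

lemma frag_extend_id: "frag_extend frag_of c = c"
 using frag_expansion by metis

definition lcons :: "'v => ('v list \<Rightarrow>\<^sub>0 int) => ('v list \<Rightarrow>\<^sub>0 int)" where
 "lcons v = frag_extend (%l. frag_of (v # l))"

definition lmap :: "('v => 'w) => ('v list \<Rightarrow>\<^sub>0 int) => ('w list \<Rightarrow>\<^sub>0 int)" where
 "lmap f = frag_extend (%l. frag_of (map f l))"

text \<open>Lists stand for ordered affine simplices and may repeat vertices. The complex is
  augmented: \<open>bd [v]\<close> is the empty simplex \<open>frag_of []\<close>, which lets the
  cone formula \<open>BD_lcons\<close> hold in all dimensions.\<close>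

primrec bd :: "'v list => ('v list \<Rightarrow>\<^sub>0 int)" where
 "bd [] = 0"
| "bd (v # l) = frag_of l - lcons v (bd l)"

definition BD :: "('v list \<Rightarrow>\<^sub>0 int) => ('v list \<Rightarrow>\<^sub>0 int)" where
 "BD = frag_extend bd"

lemma lcons_of [simp]: "lcons v (frag_of l) = frag_of (v # l)" and lcons_diff: "lcons v (a - b) = lcons v a - lcons v b"
 and lcons_0 [simp]: "lcons v 0 = 0" and lcons_minus: "lcons v (- a) = - lcons v a" and lcons_add: "lcons v (a + b) = lcons v a + lcons v b"
 by (simp_all add: lcons_def frag_extend_diff frag_extend_minus frag_extend_add)

lemma lmap_of [simp]: "lmap f (frag_of l) = frag_of (map f l)" and lmap_diff: "lmap f (a - b) = lmap f a - lmap f b"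
 and lmap_0 [simp]: "lmap f 0 = 0" and lmap_minus: "lmap f (- a) = - lmap f a" and lmap_add: "lmap f (a + b) = lmap f a + lmap f b"
 by (simp_all add: lmap_def frag_extend_diff frag_extend_minus frag_extend_add)

lemma BD_of [simp]: "BD (frag_of l) = bd l" and BD_diff: "BD (a - b) = BD a - BD b"
 and BD_0 [simp]: "BD 0 = 0" and BD_minus: "BD (- a) = - BD a" and BD_add: "BD (a + b) = BD a + BD b"
 by (simp_all add: BD_def frag_extend_diff frag_extend_minus frag_extend_add)

lemma BD_sum: "finite I ==> BD (sum b I) = (SUM i:I. BD (b i))"
 by (simp add: BD_def frag_extend_sum o_def)

lemma lmap_sum: "finite I ==> lmap f (sum b I) = (SUM i:I. lmap f (b i))"
 by (simp add: lmap_def frag_extend_sum o_def)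

lemma BD_lcons: "BD (lcons v c) = c - lcons v (BD c)"
 using subset_UNIV by (induction c rule: frag_induction) (auto simp: lcons_diff BD_diff)

lemma BD_bd [simp]: "BD (bd l) = 0"
 by (induction l) (simp_all add: BD_diff BD_lcons)

lemma lmap_lcons: "lmap f (lcons v c) = lcons (f v) (lmap f c)"
 using subset_UNIV by (induction c rule: frag_induction) (auto simp: lcons_diff lmap_diff)

lemma bd_map: "bd (map f l) = lmap f (bd l)"
 by (induction l) (simp_all add: lmap_diff lmap_lcons)

lemma BD_lmap: "BD (lmap f c) = lmap f (BD c)"
 using subset_UNIV by (induction c rule: frag_induction) (auto simp: lmap_diff BD_diff bd_map)

lemma lmap_lmap: "lmap f (lmap g c) = lmap (%x. f (g x)) c"
 using subset_UNIV by (induction c rule: frag_induction) (auto simp: lmap_diff comp_def)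

lemma lmap_id: "lmap (%x. x) c = c"
 using subset_UNIV by (induction c rule: frag_induction) (auto simp: lmap_diff)

text \<open>The prism operator: the alternating sum of the simplices f x0, ..., f xi, g xi, ..., g
  xq, written as a recursion on the list.\<close>

primrec pr :: "('v => 'w) => ('v => 'w) => 'v list => ('w list \<Rightarrow>\<^sub>0 int)" where
 "pr f g [] = 0"
| "pr f g (x # l) = frag_of (f x # g x # map g l) - lcons (f x) (pr f g l)"

definition PR :: "('v => 'w) => ('v => 'w) => ('v list \<Rightarrow>\<^sub>0 int) => ('w list \<Rightarrow>\<^sub>0 int)" where
 "PR f g = frag_extend (pr f g)"

lemma PR_of [simp]: "PR f g (frag_of l) = pr f g l" and PR_diff: "PR f g (a - b) = PR f g a - PR f g b" and PR_0 [simp]: "PR f g 0 = 0"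
 by (simp_all add: PR_def frag_extend_diff)

lemma PR_lcons: "PR f g (lcons x c) = lcons (f x) (lcons (g x) (lmap g c)) - lcons (f x) (PR f g c)"
 using subset_UNIV by (induction c rule: frag_induction) (auto simp: lcons_diff PR_diff lmap_diff)

lemma BD_pr: "BD (pr f g l) = frag_of (map g l) - frag_of (map f l) - PR f g (bd l)"
proof (induction l)
 case (Cons x l)
 show ?case
  by (simp add: BD_diff BD_lcons Cons.IH lcons_diff PR_diff PR_lcons bd_map)
qed simp

lemma BD_PR: "BD (PR f g c) = lmap g c - lmap f c - PR f g (BD c)"
 using subset_UNIV by (induction c rule: frag_induction) (auto simp: PR_diff BD_diff lmap_diff BD_pr)

lemma pr_map: "lmap h (pr f g l) = pr (%x. h (f x)) (%x. h (g x)) l"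
 by (induction l) (simp_all add: lmap_diff lmap_lcons o_def)

lemma pr_pre: "pr f g (map h l) = pr (%x. f (h x)) (%x. g (h x)) l"
 by (induction l) (simp_all add: o_def)

lemma lmap_PR: "lmap h (PR f g c) = PR (%x. h (f x)) (%x. h (g x)) c"
 using subset_UNIV by (induction c rule: frag_induction) (auto simp: PR_diff lmap_diff pr_map)

lemma PR_lmap: "PR f g (lmap h c) = PR (%x. f (h x)) (%x. g (h x)) c"
 using subset_UNIV by (induction c rule: frag_induction) (auto simp: PR_diff lmap_diff pr_pre)

lemma kys_lcons: "kys (lcons v c) <= Cons v ` kys c"
 using keys_frag_extend[of "%l. frag_of (v # l)" c] by (auto simp: lcons_def)

lemma kys_lmap: "kys (lmap f c) <= map f ` kys c"
 using keys_frag_extend[of "%l. frag_of (map f l)" c] by (auto simp: lmap_def)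

lemma kys_bd: "kys (bd l) <= {del i l |i. i < length l}"
proof (induction l)
 case (Cons v l)
 have "kys (bd (v # l)) <= {l} Un Cons v ` kys (bd l)"
  using keys_diff[of "frag_of l" "lcons v (bd l)"] kys_lcons[of v "bd l"] by auto
 also have "... <= {del i (v # l) |i. i < length (v # l)}"
 proof
  fix x assume "x : {l} Un Cons v ` kys (bd l)"
  thus "x : {del i (v # l) |i. i < length (v # l)}"
  proof
   assume "x : {l}" thus ?thesis by (auto intro!: exI[of _ 0])
  next
   assume "x : Cons v ` kys (bd l)"
   then obtain i where "i < length l" "x = v # del i l" using Cons by auto
   thus ?thesis by (auto intro!: exI[of _ "Suc i"])
  qed
 qed
 finally show ?case .
qed simp

lemma kys_pr: "m : kys (pr f g l) ==> length m = Suc (length l) & set m <= f ` set l Un g ` set l"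
proof (induction l arbitrary: m)
 case (Cons x l)
 have "m : {f x # g x # map g l} Un Cons (f x) ` kys (pr f g l)"
  using Cons.prems keys_diff[of "frag_of (f x # g x # map g l)" "lcons (f x) (pr f g l)"] kys_lcons[of "f x" "pr f g l"] by auto
 thus ?case using Cons.IH by fastforce
qed simp

lemma fn_lcons: "fn (lcons v c) <= fn c"
 unfolding lcons_def using fn_extend[of c "%l. frag_of (v # l)" 1] by simp

lemma fn_lmap: "fn (lmap f c) <= fn c"
 unfolding lmap_def using fn_extend[of c "%l. frag_of (map f l)" 1] by simp

lemma fn_bd: "fn (bd l) <= real (length l)"
proof (induction l)
 case (Cons v l)
 have "fn (bd (v # l)) <= fn (frag_of l) + fn (lcons v (bd l))" unfolding bd.simps by (rule fn_diff)
 also have "... <= 1 + real (length l)" using fn_lcons[of v "bd l"] Cons by simp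
 finally show ?case by simp
qed simp

lemma fn_pr: "fn (pr f g l) <= real (length l)"
proof (induction l)
 case (Cons x l)
 have "fn (pr f g (x # l)) <= fn (frag_of (f x # g x # map g l)) + fn (lcons (f x) (pr f g l))" unfolding pr.simps by (rule fn_diff)
 also have "... <= 1 + real (length l)" using fn_lcons[of "f x" "pr f g l"] Cons by simp
 finally show ?case by simp
qed simp

section \<open>Subdivision by sweeping towards a vertex\<close>

definition slide :: "nat => pt => nat => pt => pt" where
 "slide M p t x = (%i. (1 - real t/real M) * x i + (real t/real M) * p i)"

lemma slide_0 [simp]: "slide M p 0 x = x"
 by (simp add: slide_def)

text \<open>The subdivided boundary is moved towards \<open>hd l\<close> in steps of
  \<open>1/M\<close>: there are \<open>M - 1\<close> layers of prisms between successive copies, and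
  a cone over the last copy. Each dimension thus contributes one factor \<open>M\<close> to the
  number of pieces. Faces through \<open>hd l\<close> are swept within themselves, which does not
  disturb the boundary formula.\<close>

primrec Sd :: "nat => nat => pt list => (pt list \<Rightarrow>\<^sub>0 int)" where
 "Sd M 0 l = frag_of []"
| "Sd M (Suc q) l = lcons (hd l) (lmap (slide M (hd l) (M - 1)) (frag_extend (Sd M q) (bd l)))
   - (SUM t<M - 1. PR (slide M (hd l) t) (slide M (hd l) (Suc t)) (frag_extend (Sd M q) (bd l)))"

lemma length_kys_bd: "length l = Suc q ==> m : kys (bd l) ==> length m = q"
 using kys_bd[of l] length_del[of _ l] by auto

text \<open>The subdivided boundary is a cycle by induction. Hence the prisms telescope from the
  copy at time 0 to the one at time \<open>M - 1\<close>, and the cone closes off the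
  latter.\<close>

lemma BD_Sd_aux: "length l = Suc q ==> BD (Sd M (Suc q) l) = frag_extend (Sd M q) (bd l)"
proof (induction q arbitrary: l)
 case 0
 then obtain v where l: "l = [v]" by (auto simp: length_Suc_conv)
 have [simp]: "frag_extend (Sd M 0) (bd l) = frag_of []" by (simp add: l)
 show ?case by (simp add: l BD_lcons BD_diff BD_sum)
next
 case (Suc q)
 let ?z = "frag_extend (Sd M (Suc q)) (bd l)"
 have "BD ?z = frag_extend (%m. BD (Sd M (Suc q) m)) (bd l)" unfolding BD_def by (rule frag_extend_extend)
 also have "... = frag_extend (%m. frag_extend (Sd M q) (bd m)) (bd l)"
  by (rule frag_extend_eq) (use Suc.IH length_kys_bd[OF Suc.prems] in blast)
 also have "... = frag_extend (Sd M q) (BD (bd l))" unfolding BD_def by (rule frag_extend_extend[symmetric])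
 finally have z: "BD ?z = 0" by simp
 let ?f = "%t. slide M (hd l) t"
 have "BD (Sd M (Suc (Suc q)) l) = lmap (?f (M - 1)) ?z - (SUM t<M - 1. lmap (?f (Suc t)) ?z - lmap (?f t) ?z)"
  by (simp add: BD_diff BD_lcons BD_lmap BD_sum BD_PR z)
 also have "(SUM t<M - 1. lmap (?f (Suc t)) ?z - lmap (?f t) ?z) = lmap (?f (M - 1)) ?z - lmap (?f 0) ?z"
  by (rule sum_lessThan_telescope)
 also have "lmap (?f 0) ?z = ?z"
 proof -
  have "?f 0 = (%x. x)" by (rule ext) simp
  thus ?thesis by (simp only: lmap_id)
 qed
 finally show ?case by (simp only: diff_diff_eq2 add_diff_cancel_left')
qed

lemma slide_linear_map:
 assumes "!!a b x y. A (%i. a * x i + b * y i) = (%i. a * A x i + b * A y i)"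
 shows "A (slide M p t x) = slide M (A p) t (A x)"
 unfolding slide_def by (rule assms)

text \<open>Only linear combinations of vertices enter the construction, so it commutes with linear
  maps; the case needed is the inclusion of a face.\<close>

lemma Sd_natural:
 assumes A: "!!a b x y. A (%i. a * x i + b * y i) = (%i. a * A x i + b * A y i)"
 shows "length l = q ==> lmap A (Sd M q l) = Sd M q (map A l)"
proof (induction q arbitrary: l)
 case (Suc q)
 have hd: "hd (map A l) = A (hd l)" using Suc.prems by (cases l) auto
 let ?z = "frag_extend (Sd M q) (bd l)"
 have "lmap A ?z = frag_extend (%m. lmap A (Sd M q m)) (bd l)" unfolding lmap_def by (rule frag_extend_extend)
 also have "... = frag_extend (%m. Sd M q (map A m)) (bd l)"
  by (rule frag_extend_eq) (use Suc.IH length_kys_bd[OF Suc.prems] in blast)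
 also have "... = frag_extend (Sd M q) (bd (map A l))" unfolding bd_map lmap_def frag_extend_extend by simp
 finally have z: "frag_extend (Sd M q) (bd (map A l)) = lmap A ?z" by simp
 have "Sd M (Suc q) (map A l) = lcons (A (hd l)) (lmap (slide M (A (hd l)) (M - 1)) (lmap A ?z))
   - (SUM t<M - 1. PR (slide M (A (hd l)) t) (slide M (A (hd l)) (Suc t)) (lmap A ?z))"
  by (simp only: Sd.simps hd z)
 moreover have "lmap A (Sd M (Suc q) l) = lcons (A (hd l)) (lmap A (lmap (slide M (hd l) (M - 1)) ?z))
   - (SUM t<M - 1. lmap A (PR (slide M (hd l) t) (slide M (hd l) (Suc t)) ?z))"
  by (simp only: Sd.simps lmap_diff lmap_lcons lmap_sum[OF finite_lessThan])
 ultimately show ?case by (simp only: lmap_lmap lmap_PR PR_lmap slide_linear_map[of A, OF A])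
qed simp

text \<open>Here \<open>pt\<close> is merely the type of real sequences. One factor
  \<open>q + 1\<close> counts the faces, the other comes from the prisms.\<close>

primrec sd_const :: pt where
 "sd_const 0 = 1"
| "sd_const (Suc q) = real (Suc q)*(real q + 1) * sd_const q"

lemma sd_const_pos: "0 < sd_const q"
 by (induction q) auto

lemma PR_length_fn:
 assumes "!!l. l : kys c ==> length l = q" shows "fn (PR f g c) <= real q * fn c"
 unfolding PR_def using assms fn_pr[of f g] by (intro fn_extend) force

lemma keys_diff_sum: "m : kys (a - (SUM t<n. b t)) ==> m : kys a Un (\<Union>t<(n::nat). kys (b t))"
 using keys_diff[of a "SUM t<n. b t"] keys_sum[of b "{..<n}"] by blast

lemma Sd_length: "length l = q ==> m : kys (Sd M q l) ==> length m = q"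
proof (induction q arbitrary: l m)
 case (Suc q)
 let ?z = "frag_extend (Sd M q) (bd l)"
 have z: "length w = q" if "w : kys ?z" for w
  using that keys_frag_extend[of "Sd M q" "bd l"] Suc.IH length_kys_bd[OF Suc.prems(1)] by blast
 have "m : kys (lcons (hd l) (lmap (slide M (hd l) (M - 1)) ?z)) Un (UN t<M - 1. kys (PR (slide M (hd l) t) (slide M (hd l) (Suc t)) ?z))"
  using Suc.prems(2) unfolding Sd.simps by (rule keys_diff_sum)
 thus ?case
 proof
  assume "m : kys (lcons (hd l) (lmap (slide M (hd l) (M - 1)) ?z))"
  thus ?thesis using kys_lcons kys_lmap z by fastforce
 next
  assume "m : (UN t<M - 1. kys (PR (slide M (hd l) t) (slide M (hd l) (Suc t)) ?z))"
  then obtain t w where "w : kys ?z" "m : kys (pr (slide M (hd l) t) (slide M (hd l) (Suc t)) w)"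
   unfolding PR_def using keys_frag_extend by fast
  thus ?thesis using kys_pr z by metis
 qed
qed simp

lemma Sd_fn: "0 < M ==> length l = Suc q ==> fn (Sd M (Suc q) l) <= sd_const (Suc q) * real M^q"
proof (induction q arbitrary: l)
 case 0
 then obtain v where l: "l = [v]" by (auto simp: length_Suc_conv)
 show ?case by (simp add: l)
next
 case (Suc q)
 let ?z = "frag_extend (Sd M (Suc q)) (bd l)"
 have M1: "1 <= real M" using Suc.prems by simp
 have "fn ?z <= (sd_const (Suc q) * real M^q) * fn (bd l)"
  by (rule fn_extend) (use Suc.IH Suc.prems length_kys_bd in blast)
 also have "... <= (sd_const (Suc q) * real M^q) * real (Suc (Suc q))"
  using fn_bd[of l] Suc.prems(2) sd_const_pos[of "Suc q"] M1 by (intro mult_left_mono) auto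
 finally have z: "fn ?z <= real (Suc (Suc q)) * sd_const (Suc q) * real M^q" by (simp add: mult_ac)
 have zl: "length w = Suc q" if "w : kys ?z" for w
  using that keys_frag_extend[of "Sd M (Suc q)" "bd l"] Sd_length length_kys_bd[OF Suc.prems(2)] by blast
 have "fn (Sd M (Suc (Suc q)) l) <= fn (lcons (hd l) (lmap (slide M (hd l) (M - 1)) ?z)) + fn (SUM t<M - 1. PR (slide M (hd l) t) (slide M (hd l) (Suc t)) ?z)"
  unfolding Sd.simps(2)[of M "Suc q"] by (rule fn_diff)
 also have "... <= fn ?z + (SUM t<M - 1. real (Suc q) * fn ?z)"
 proof (rule add_mono)
  show "fn (lcons (hd l) (lmap (slide M (hd l) (M - 1)) ?z)) <= fn ?z" by (rule order_trans[OF fn_lcons fn_lmap])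
  show "fn (SUM t<M - 1. PR (slide M (hd l) t) (slide M (hd l) (Suc t)) ?z) <= (SUM t<M - 1. real (Suc q) * fn ?z)"
   by (rule order_trans[OF fn_sum]) (intro sum_mono PR_length_fn zl)
 qed
 also have "... = (1 + real (M - 1) * real (Suc q)) * fn ?z" by (simp add: algebra_simps)
 also have "... <= (real M*(real (Suc q) + 1)) * fn ?z"
  using Suc.prems(1) by (intro mult_right_mono) (auto simp: of_nat_diff algebra_simps)
 also have "... <= (real M*(real (Suc q) + 1))*(real (Suc (Suc q)) * sd_const (Suc q) * real M^q)" using z by (intro mult_left_mono) auto
 also have "... = sd_const (Suc (Suc q)) * real M^Suc q" by (simp only: sd_const.simps(2)[of "Suc q"] power_Suc mult_ac)
 finally show ?case .
qed

text \<open>\<open>slide\<close> does not increase distances and one step moves a point by at most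
  \<open>D/M\<close>; so each dimension adds at most \<open>D/M\<close> to the diameter of a
  piece.\<close>

lemma Sd_mesh:
 assumes conv: "!!x y t. x : S ==> y : S ==> 0 <= t ==> t <= 1 ==> (%i. (1 - t) * x i + t * y i) : S"
  and D: "!!x y. x : S ==> y : S ==> l1 K x y <= D" and M: "0 < M"
 shows "length l = q ==> set l <= S ==> m : kys (Sd M q l) ==> set m <= S & (ALL x:set m. ALL y:set m. l1 K x y <= real q * D/real M)"
proof (induction q arbitrary: l m)
 case (Suc q)
 let ?z = "frag_extend (Sd M q) (bd l)"
 let ?p = "hd l"
 have p: "?p : S" using Suc.prems by (cases l) auto
 have D0: "0 <= D" using D[OF p p] by simp
 have z: "set w <= S & (ALL x:set w. ALL y:set w. l1 K x y <= real q * D/real M)" if w: "w : kys ?z" for w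
 proof -
  obtain m' where m': "m' : kys (bd l)" "w : kys (Sd M q m')" using w keys_frag_extend by fast
  have "set m' <= S" using m'(1) kys_bd[of l] set_del[of _ l] Suc.prems(2) by blast
  thus ?thesis using Suc.IH[OF length_kys_bd[OF Suc.prems(1) m'(1)] _ m'(2)] by blast
 qed
 have Mr: "0 < real M" using M by simp
 have sS: "slide M ?p t x : S" if "x : S" "t <= M" for x t
  unfolding slide_def using that p Mr by (intro conv) (auto simp: divide_le_eq)
 have sl: "l1 K (slide M ?p t x) (slide M ?p t y) <= l1 K x y" if "t <= M" for t x y
 proof -
  have "l1 K (slide M ?p t x) (slide M ?p t y) = (1 - real t/real M) * l1 K x y"
   unfolding l1_def sum_distrib_left
  proof (rule sum.cong)
   fix i
   have "slide M ?p t x i - slide M ?p t y i = (1 - real t/real M)*(x i - y i)" by (simp add: slide_def right_diff_distrib)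
   moreover have "0 <= 1 - real t/real M" using that Mr by simp
   ultimately show "\<bar>slide M ?p t x i - slide M ?p t y i\<bar> = (1 - real t/real M)*\<bar>x i - y i\<bar>" by (simp add: abs_mult)
  qed simp
  also have "... <= 1 * l1 K x y" by (intro mult_right_mono) auto
  finally show ?thesis by simp
 qed
 have st: "l1 K (slide M ?p t x) (slide M ?p (Suc t) x) <= D/real M" if "x : S" for t x
 proof -
  have "l1 K (slide M ?p t x) (slide M ?p (Suc t) x) = \<bar>real t/real M - real (Suc t)/real M\<bar> * l1 K x ?p"
   unfolding slide_def by (rule l1_segment)
  also have "\<bar>real t/real M - real (Suc t)/real M\<bar> = 1/real M" by (simp add: diff_divide_distrib[symmetric])
  also have "1/real M * l1 K x ?p <= 1/real M * D" using D[OF that p] by (intro mult_left_mono) auto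
  finally show ?thesis by simp
 qed
 have le1: "real q * D/real M <= real (Suc q) * D/real M" using D0 Mr by (simp add: divide_right_mono distrib_right)
 have le2: "D/real M <= real (Suc q) * D/real M" using D0 Mr by (simp add: divide_right_mono distrib_right)
 have le3: "real q * D/real M + D/real M = real (Suc q) * D/real M" by (simp add: add_divide_distrib distrib_right)
 have "m : kys (lcons ?p (lmap (slide M ?p (M - 1)) ?z)) Un (UN t<M - 1. kys (PR (slide M ?p t) (slide M ?p (Suc t)) ?z))"
  using Suc.prems(3) unfolding Sd.simps by (rule keys_diff_sum)
 thus ?case
 proof
  assume "m : kys (lcons ?p (lmap (slide M ?p (M - 1)) ?z))"
  then obtain w where w: "w : kys ?z" "m = ?p # map (slide M ?p (M - 1)) w" using kys_lcons kys_lmap by fastforce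
  note zw = z[OF w(1)]
  have ps: "l1 K ?p (slide M ?p (M - 1) x) <= D/real M" if "x : S" for x
  proof -
   have "slide M ?p (Suc (M - 1)) x = ?p" using M by (auto simp: slide_def)
   thus ?thesis using st[OF that, of "M - 1"] by (simp add: l1_commute)
  qed
  have "l1 K x y <= real (Suc q) * D/real M" if xy: "x : set m" "y : set m" for x y
  proof -
   have D0': "0 <= real (Suc q) * D/real M" using D0 by simp
   consider "x = ?p" "y = ?p" | x' where "x = ?p" "y = slide M ?p (M - 1) x'" "x' : set w"
    | x' where "y = ?p" "x = slide M ?p (M - 1) x'" "x' : set w"
    | x' y' where "x = slide M ?p (M - 1) x'" "y = slide M ?p (M - 1) y'" "x' : set w" "y' : set w"
    using xy w(2) by auto
   thus ?thesis
   proof cases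
    case 1 thus ?thesis using D0' by simp
   next
    case (2 x') thus ?thesis using ps[of x'] zw le2 by force
   next
    case (3 x') thus ?thesis using ps[of x'] zw le2 by (force simp: l1_commute)
   next
    case (4 x' y') thus ?thesis using sl[of "M - 1" x' y'] zw le1 by force
   qed
  qed
  moreover have "set m <= S" using w zw p sS[of _ "M - 1"] by auto
  ultimately show ?thesis by blast
 next
  assume "m : (UN t<M - 1. kys (PR (slide M ?p t) (slide M ?p (Suc t)) ?z))"
  then obtain t w where w: "w : kys ?z" "m : kys (pr (slide M ?p t) (slide M ?p (Suc t)) w)" and t: "t < M - 1"
   unfolding PR_def using keys_frag_extend by fast
  note zw = z[OF w(1)]
  have mm: "set m <= slide M ?p t ` set w Un slide M ?p (Suc t) ` set w" using kys_pr[OF w(2)] by blast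
  have a: "l1 K (slide M ?p t x') (slide M ?p (Suc t) y') <= real (Suc q) * D/real M" if "x' : set w" "y' : set w" for x' y'
   using l1_triangle[of K "slide M ?p t x'" "slide M ?p (Suc t) y'" "slide M ?p t y'"] sl[of t x' y'] st[of y' t] zw that t le3 by force
  have b: "l1 K (slide M ?p u x') (slide M ?p u y') <= real (Suc q) * D/real M" if "x' : set w" "y' : set w" "u <= Suc t" for x' y' u
   using sl[of u x' y'] zw that t le1 by force
  have "l1 K x y <= real (Suc q) * D/real M" if xy: "x : set m" "y : set m" for x y
  proof -
   have "x : slide M ?p t ` set w Un slide M ?p (Suc t) ` set w" "y : slide M ?p t ` set w Un slide M ?p (Suc t) ` set w" using mm xy by auto
   thus ?thesis using a b[of _ _ t] b[of _ _ "Suc t"] by (auto simp: l1_commute)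
  qed
  moreover have "set m <= S"
  proof
   fix x assume "x : set m"
   hence "x : slide M ?p t ` set w Un slide M ?p (Suc t) ` set w" using mm by blast
   thus "x : S" using zw sS[of _ t] sS[of _ "Suc t"] t by auto
  qed
  ultimately show ?thesis by blast
 qed
qed simp

text \<open>A chain homotopy between the identity and \<open>Sd\<close>, obtained by coning inside
  the same convex simplex with apex \<open>hd l\<close>. After composition with a singular simplex
  its pieces stay in an image of too low dimension, so they have no volume.\<close>

primrec Tl :: "nat => nat => pt list => (pt list \<Rightarrow>\<^sub>0 int)" where
 "Tl M 0 l = 0"
| "Tl M (Suc q) l = lcons (hd l) (frag_of l - Sd M (Suc q) l - frag_extend (Tl M q) (bd l))"

lemma BD_Tl: "length l = Suc q ==> BD (Tl M (Suc q) l) = frag_of l - Sd M (Suc q) l - frag_extend (Tl M q) (bd l)"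
proof (induction q arbitrary: l)
 case 0
 then obtain v where l: "l = [v]" by (auto simp: length_Suc_conv)
 show ?case by (simp add: l)
next
 case (Suc q)
 let ?c = "frag_of l - Sd M (Suc (Suc q)) l - frag_extend (Tl M (Suc q)) (bd l)"
 have "BD (frag_extend (Tl M (Suc q)) (bd l)) = frag_extend (%m. BD (Tl M (Suc q) m)) (bd l)" unfolding BD_def by (rule frag_extend_extend)
 also have "... = frag_extend (%m. frag_of m - Sd M (Suc q) m - frag_extend (Tl M q) (bd m)) (bd l)"
  by (rule frag_extend_eq) (use Suc.IH length_kys_bd[OF Suc.prems] in blast)
 also have "... = bd l - frag_extend (Sd M (Suc q)) (bd l) - frag_extend (Tl M q) (BD (bd l))"
  by (simp only: frag_extend_fun_diff frag_extend_id BD_def frag_extend_extend)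
 finally have "BD ?c = 0" using BD_Sd_aux[OF Suc.prems] by (simp add: BD_diff del: Sd.simps)
 moreover have "BD (Tl M (Suc (Suc q)) l) = ?c - lcons (hd l) (BD ?c)" unfolding Tl.simps(2)[of M "Suc q"] by (rule BD_lcons)
 ultimately show ?case by (simp only: lcons_0 diff_zero)
qed

lemma Tl_natural:
 assumes A: "!!a b x y. A (%i. a * x i + b * y i) = (%i. a * A x i + b * A y i)"
 shows "length l = q ==> lmap A (Tl M q l) = Tl M q (map A l)"
proof (induction q arbitrary: l)
 case (Suc q)
 have hd: "hd (map A l) = A (hd l)" using Suc.prems by (cases l) auto
 have "lmap A (frag_extend (Tl M q) (bd l)) = frag_extend (%m. lmap A (Tl M q m)) (bd l)" unfolding lmap_def by (rule frag_extend_extend)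
 also have "... = frag_extend (%m. Tl M q (map A m)) (bd l)"
  by (rule frag_extend_eq) (use Suc.IH length_kys_bd[OF Suc.prems] in blast)
 also have "... = frag_extend (Tl M q) (bd (map A l))" unfolding bd_map lmap_def frag_extend_extend by simp
 finally have z: "frag_extend (Tl M q) (bd (map A l)) = lmap A (frag_extend (Tl M q) (bd l))" by simp
 show ?case unfolding Tl.simps hd z lmap_lcons lmap_diff Sd_natural[OF A Suc.prems] lmap_of ..
qed simp

lemma Tl_keys:
 assumes conv: "!!x y t. x : S ==> y : S ==> 0 <= t ==> t <= 1 ==> (%i. (1 - t) * x i + t * y i) : S"
  and D: "!!x y. x : S ==> y : S ==> l1 K x y <= D" and M: "0 < M"
 shows "length l = q ==> set l <= S ==> m : kys (Tl M q l) ==> length m = Suc q & set m <= S"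
proof (induction q arbitrary: l m)
 case (Suc q)
 have p: "hd l : S" using Suc.prems by (cases l) auto
 let ?c = "frag_of l - Sd M (Suc q) l - frag_extend (Tl M q) (bd l)"
 obtain w where w: "w : kys ?c" "m = hd l # w" using Suc.prems(3) kys_lcons unfolding Tl.simps by fast
 have "w : {l} Un kys (Sd M (Suc q) l) Un kys (frag_extend (Tl M q) (bd l))"
  using w(1) keys_diff[of "frag_of l - Sd M (Suc q) l" "frag_extend (Tl M q) (bd l)"] keys_diff[of "frag_of l" "Sd M (Suc q) l"] by auto
 hence "length w = Suc q & set w <= S"
 proof (elim UnE)
  assume "w : {l}" thus ?thesis using Suc.prems by simp
 next
  assume "w : kys (Sd M (Suc q) l)"
  thus ?thesis using Sd_length[OF Suc.prems(1)] Sd_mesh[OF conv D M Suc.prems(1,2)] by blast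
 next
  assume "w : kys (frag_extend (Tl M q) (bd l))"
  then obtain m' where m': "m' : kys (bd l)" "w : kys (Tl M q m')" using keys_frag_extend by fast
  have "set m' <= S" using m'(1) kys_bd[of l] set_del[of _ l] Suc.prems(2) by blast
  thus ?thesis using Suc.IH[OF length_kys_bd[OF Suc.prems(1) m'(1)] _ m'(2)] by blast
 qed
 thus ?case using w p by auto
qed simp

section \<open>Area over dyadic cells\<close>

lemma compact_simplex: "compact (Sx k)"
proof -
 have "compactin (product_topology (%i::nat. euclidean) UNIV) (PiE UNIV (%_. {0..1::real}))" by (simp add: compactin_PiE)
 hence c: "compact (PiE UNIV (%_::nat. {0..1::real}))" by (simp add: euclidean_product_topology)
 have co: "continuous_on UNIV (%x::nat=>real. x i)" for i by (rule continuous_on_product_coordinates)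
 have "Sx k = PiE UNIV (%_. {0..1}) Int ((\<Inter>i\<in>{k<..}. {x. x i = 0}) Int {x. (SUM i<=k. x i) = 1})" (is "_ = _ Int ?C")
 proof
  show "Sx k <= PiE UNIV (%_. {0..1}) Int ?C"
  proof
   fix x assume x: "x : Sx k"
   have "x i : {0..1}" for i using simplex_coord[OF x, of i] simplex_le1[OF x, of i] x by (cases "i <= k") (auto simp: simplex_k_def)
   thus "x : PiE UNIV (%_. {0..1}) Int ?C" using x by (auto simp: simplex_k_def)
  qed
  show "PiE UNIV (%_. {0..1}) Int ?C <= Sx k" by (auto simp: simplex_k_def PiE_iff)
 qed
 moreover have "closed ?C"
  by (intro closed_Int closed_INT ballI closed_Collect_eq continuous_on_sum co continuous_on_const)
 ultimately show ?thesis using c by (simp add: compact_Int_closed)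
qed

lemma lipl_continuous:
 assumes "lipl k L S f" shows "continuous_on S f"
proof -
 have L0: "0 <= L" using assms by (simp add: lipl_def)
 have "(f \<longlongrightarrow> f x) (at x within S)" if x: "x : S" for x
 proof -
  have "continuous_on UNIV (%y. L * l1 k y x)" unfolding l1_def
   by (intro continuous_on_mult_left continuous_on_sum continuous_on_rabs continuous_on_diff continuous_on_const continuous_on_product_coordinates)
  hence "((%y. L * l1 k y x) \<longlongrightarrow> L * l1 k x x) (at x within S)"
   unfolding continuous_on_def by (metis UNIV_I tendsto_within_subset top_greatest)
  hence t: "((%y. L * l1 k y x) \<longlongrightarrow> 0) (at x within S)" by simp
  have "((%y. dist (f y) (f x)) \<longlongrightarrow> 0) (at x within S)"
  proof (rule tendsto_sandwich[OF _ _ tendsto_const t])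
   show "\<forall>\<^sub>F y in at x within S. 0 <= dist (f y) (f x)" by simp
   show "\<forall>\<^sub>F y in at x within S. dist (f y) (f x) <= L * l1 k y x"
    unfolding eventually_at_filter using assms x by (intro always_eventually) (auto simp: lipl_def)
  qed
  thus ?thesis by (rule tendsto_dist_iff[THEN iffD2])
 qed
 thus ?thesis by (simp add: continuous_on_def)
qed

text \<open>A half-open cell is a countable union of compact sets, and their images are compact.
  Some such argument is needed because a continuous image of a Borel set need not be Borel.\<close>

lemma cel_image_borel:
 fixes f :: "pt => 'a::metric_space"
 assumes L: "lipl k L (Sx k) f"
 shows "f ` cel k j q : sets borel"
proof (cases "q : extensional {..<k}")
 case False
 hence "cel k j q = {}" by (auto simp: cel_def idx_def)
 thus ?thesis by simp
next
 case True
 define K where "K = (%m::nat. Sx k Int (\<Inter>i\<in>{..<k}. {x. real (q i) <= 2^j * x i} Int {x. 2^j * x i <= real (q i) + 1 - 1/real (Suc m)}))"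
 have "compact (K m)" for m
  unfolding K_def
  by (intro compact_Int_closed compact_simplex closed_INT ballI closed_Int closed_Collect_le continuous_on_const continuous_on_mult_left continuous_on_product_coordinates)
 hence "compact (f ` K m)" for m
  using lipl_continuous[OF L] by (intro compact_continuous_image) (auto simp: K_def intro: continuous_on_subset)
 hence bor: "f ` K m : sets borel" for m by (simp add: borel_compact)
 have "cel k j q = (UN m. K m)"
 proof
  show "cel k j q <= (UN m. K m)"
  proof
   fix x assume x: "x : cel k j q"
   hence xs: "x : Sx k" and xq: "idx k j x = q" by (auto simp: cel_def)
   have e: "real (q i) <= 2^j * x i & 2^j * x i < real (q i) + 1" if "i < k" for i
   proof -
    have "q i = nat \<lfloor>2^j * x i\<rfloor>" using xq that by (auto simp: idx_def)
    moreover have "0 <= 2^j * x i" using simplex_coord[OF xs, of i] by simp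
    ultimately have "real (q i) = of_int \<lfloor>2^j * x i\<rfloor>" by simp
    thus ?thesis using floor_correct[of "2^j * x i"] by linarith
   qed
   have "EX m::nat. ALL i:{..<k}. 2^j * x i <= real (q i) + 1 - 1/real (Suc m)"
   proof -
    have "EX m::nat. 2^j * x i <= real (q i) + 1 - 1/real (Suc m)" if "i < k" for i
    proof -
     have "0 < real (q i) + 1 - 2^j * x i" using e[OF that] by simp
     then obtain m where "inverse (real (Suc m)) < real (q i) + 1 - 2^j * x i" using reals_Archimedean by blast
     thus ?thesis by (intro exI[of _ m]) (simp add: inverse_eq_divide)
    qed
    then obtain m where m: "!!i. i < k ==> 2^j * x i <= real (q i) + 1 - 1/real (Suc (m i))" by metis
    define mm where "mm = Max (insert 0 (m ` {..<k}))"
    have "2^j * x i <= real (q i) + 1 - 1/real (Suc mm)" if i: "i < k" for i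
    proof -
     have "m i <= mm" unfolding mm_def using i by (intro Max_ge) auto
     hence "1/real (Suc mm) <= 1/real (Suc (m i))" by (intro divide_left_mono) auto
     thus ?thesis using m[OF i] by linarith
    qed
    thus ?thesis by (intro exI[of _ mm]) auto
   qed
   then obtain m where "ALL i:{..<k}. 2^j * x i <= real (q i) + 1 - 1/real (Suc m)" by blast
   hence "x : K m" using xs e by (auto simp: K_def)
   thus "x : (UN m. K m)" by blast
  qed
  show "(UN m. K m) <= cel k j q"
  proof
   fix x assume "x : (UN m. K m)"
   then obtain m where x: "x : K m" by blast
   have "nat \<lfloor>2^j * x i\<rfloor> = q i" if i: "i < k" for i
   proof -
    have "real (q i) <= 2^j * x i" "2^j * x i <= real (q i) + 1 - 1/real (Suc m)" using x i by (auto simp: K_def)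
    moreover have "0 < 1/real (Suc m)" by simp
    ultimately have "real (q i) <= 2^j * x i" "2^j * x i < real (q i) + 1" by linarith+
    hence "\<lfloor>2^j * x i\<rfloor> = int (q i)" by (intro floor_unique) auto
    thus ?thesis by simp
   qed
   hence "idx k j x = q" using True by (auto simp: idx_def extensional_def)
   thus "x : cel k j q" using x by (auto simp: cel_def K_def)
  qed
 qed
 hence "f ` cel k j q = (UN m. f ` K m)" by (simp add: image_UN)
 thus ?thesis using bor by auto
qed

lemma cel_Int: "cel k j q Int cel k j' q' = {} \<or> cel k j q Int cel k j' q' = cel k j q \<or> cel k j q Int cel k j' q' = cel k j' q'"
proof (cases "j <= j'")
 case True
 have "cel k j' q' <= cel k j q" if "x : cel k j q Int cel k j' q'" for x
  using that idx_eq_mono[of _ k x j j'] True by (auto simp: cel_def)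
 thus ?thesis by blast
next
 case False
 have "cel k j q <= cel k j' q'" if "x : cel k j q Int cel k j' q'" for x
  using that idx_eq_mono[of _ k x j' j] False by (auto simp: cel_def)
 thus ?thesis by blast
qed

lemma cel_Int_borel:
 fixes f :: "pt => 'a::metric_space"
 assumes "lipl k L (Sx k) f" shows "f ` (cel k j q Int cel k j' q') : sets borel"
 using cel_Int[of k j q j' q'] cel_image_borel[OF assms] by (metis image_empty sets.empty_sets)

text \<open>The multiplicity over an arbitrary parameter set, written through counting measure so
  that additivity over cells comes for free.\<close>

definition cnt :: "pt set => (pt => 'a) => 'a => ennreal" where
 "cnt A f y = emeasure (count_space UNIV) {x : A. f x = y}"

lemma multiplicity_cnt: "multiplicity k sig y = cnt (Sx k) sig y"
 by (simp add: multiplicity_def cnt_def Let_def emeasure_count_space)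

definition wvol :: "nat => (pt => 'a::metric_space) => nat => (nat => nat) => ennreal" where
 "wvol k f j0 q0 = (\<integral>\<^sup>+ y. cnt (cel k j0 q0) f y \<partial>hausdorff_measure k)"

text \<open>The number of cells of level \<open>j\<close> that meet the fibre over \<open>y\<close>
  within \<open>A\<close>: a lower approximation of \<open>cnt\<close>, and a measurable one when
  the image pieces are Borel.\<close>

definition Nj :: "nat => pt set => (pt => 'a) => nat => 'a => ennreal" where
 "Nj k A f j y = (SUM q:QS k j. indicator (f ` (A Int cel k j q)) y)"

lemma Nj_card:
 assumes "A <= Sx k"
 shows "Nj k A f j y = of_nat (card (idx k j ` {x : A. f x = y}))"
proof -
 let ?P = "{x : A. f x = y}"
 have i: "y : f ` (A Int cel k j q) \<longleftrightarrow> q : idx k j ` ?P" for q using assms by (auto simp: cel_def)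
 have "Nj k A f j y = (SUM q:QS k j. if q : idx k j ` ?P then 1 else 0)" unfolding Nj_def by (intro sum.cong) (auto simp: indicator_def i)
 also have "... = of_nat (card (QS k j Int idx k j ` ?P))" by (simp add: sum.If_cases)
 also have "QS k j Int idx k j ` ?P = idx k j ` ?P" using assms idx_in_QS by blast
 finally show ?thesis .
qed

lemma finite_idx_image: "A <= Sx k ==> finite (idx k j ` {x : A. f x = y})"
 by (rule finite_subset[OF _ finite_QS[of k j]]) (use idx_in_QS in blast)

lemma Nj_mono:
 assumes A: "A <= Sx k" and j: "j <= j'" shows "Nj k A f j y <= Nj k A f j' y"
proof -
 let ?P = "{x : A. f x = y}"
 define h where "h = (%q. idx k j (SOME x. x : ?P & idx k j' x = q))"
 have "idx k j ` ?P <= h ` (idx k j' ` ?P)"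
 proof
  fix q assume "q : idx k j ` ?P"
  then obtain x where x: "x : ?P" "q = idx k j x" by blast
  let ?x = "SOME u. u : ?P & idx k j' u = idx k j' x"
  have u: "?x : ?P & idx k j' ?x = idx k j' x" by (rule someI[of _ x]) (use x in simp)
  have "idx k j ?x = idx k j x" using u x A by (intro idx_eq_mono[OF _ _ j]) auto
  hence "q = h (idx k j' x)" unfolding h_def x(2) by simp
  thus "q : h ` (idx k j' ` ?P)" using x(1) by blast
 qed
 hence "card (idx k j ` ?P) <= card (idx k j' ` ?P)" by (rule order_trans[OF card_mono[OF finite_imageI[OF finite_idx_image[OF A]]] card_image_le[OF finite_idx_image[OF A]]])
 thus ?thesis by (simp add: Nj_card[OF A])
qed

lemma idx_separates:
 assumes F: "finite F" "F <= Sx k" shows "EX j. inj_on (idx k j) F"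
proof -
 have "EX j. ALL x:F. ALL y:F. x ~= y --> 2 * real k/2^j < l1 k x y"
 proof -
  have "EX j::nat. x ~= y --> 2 * real k/2^j < l1 k x y" if "x : F" "y : F" for x y
  proof (cases "x = y")
   case False
   then obtain i where i: "x i ~= y i" by auto
   have xs: "x : Sx k" "y : Sx k" using that F by auto
   have "i <= k" using i xs by (auto simp: simplex_k_def) (metis not_le)
   hence p: "0 < l1 k x y" using l1_component[of i k x y] i by linarith
   obtain j :: nat where "2 * real k/l1 k x y < 2^j" using real_arch_pow[of 2] by auto
   thus ?thesis using p by (intro exI[of _ j]) (simp add: field_simps)
  qed auto
  then obtain J where J: "!!x y. x : F ==> y : F ==> x ~= y ==> 2 * real k/2^J x y < l1 k x y" by metis
  define j where "j = Max (insert 0 ((%(x, y). J x y) ` (F \<times> F)))"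
  have "2 * real k/2^j < l1 k x y" if "x : F" "y : F" "x ~= y" for x y
  proof -
   have "J x y <= j" unfolding j_def using that F(1) by (intro Max_ge) auto
   hence "2 * real k/2^j <= 2 * real k/2^J x y" by (intro divide_left_mono power_increasing) auto
   thus ?thesis using J[OF that] by linarith
  qed
  thus ?thesis by blast
 qed
 then obtain j where j: "ALL x:F. ALL y:F. x ~= y --> 2 * real k/2^j < l1 k x y" by blast
 have "x = y" if "x : F" "y : F" "idx k j x = idx k j y" for x y
 proof (rule ccontr)
  assume ne: "x ~= y"
  have "l1 k x y <= 2 * real k/2^j" using that F(2) by (intro cel_diam[of _ k j "idx k j x"]) (auto simp: cel_def)
  thus False using j that ne by force
 qed
 thus ?thesis unfolding inj_on_def by blast
qed

text \<open>Finitely many points of a fibre lie in different cells at a sufficiently fine level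
  (\<open>idx_separates\<close>), and an infinite fibre contains finite sets of every size.\<close>

lemma cnt_SUP:
 assumes A: "A <= Sx k" shows "cnt A f y = (SUP j. Nj k A f j y)"
proof -
 let ?P = "{x : A. f x = y}"
 have PS: "?P <= Sx k" using A by auto
 show ?thesis
 proof (rule antisym)
  show "(SUP j. Nj k A f j y) <= cnt A f y"
  proof (rule SUP_least)
   fix j
   show "Nj k A f j y <= cnt A f y"
   proof (cases "finite ?P")
    case True thus ?thesis using card_image_le[OF True, of "idx k j"] by (simp add: Nj_card[OF A] cnt_def emeasure_count_space)
   next
    case False thus ?thesis by (simp add: cnt_def emeasure_count_space)
   qed
  qed
  have low: "of_nat (card F) <= (SUP j. Nj k A f j y)" if F: "finite F" "F <= ?P" for F
  proof -
   obtain j where j: "inj_on (idx k j) F" using idx_separates[OF F(1)] F(2) PS by blast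
   have "card F = card (idx k j ` F)" using j by (simp add: card_image)
   also have "... <= card (idx k j ` ?P)" using F(2) finite_idx_image[OF A] by (intro card_mono) auto
   finally have "of_nat (card F) <= Nj k A f j y" by (simp add: Nj_card[OF A])
   also have "... <= (SUP j. Nj k A f j y)" by (rule SUP_upper) simp
   finally show ?thesis .
  qed
  show "cnt A f y <= (SUP j. Nj k A f j y)"
  proof (cases "finite ?P")
   case True thus ?thesis using low[OF True] by (simp add: cnt_def emeasure_count_space)
  next
   case False
   have "of_nat n <= (SUP j. Nj k A f j y)" for n
   proof -
    obtain F where "F <= ?P" "finite F" "card F = n" using infinite_arbitrarily_large[OF False] by blast
    thus ?thesis using low by blast
   qed
   hence "(SUP n. of_nat n :: ennreal) <= (SUP j. Nj k A f j y)" by (intro SUP_least)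
   hence "(SUP j. Nj k A f j y) = top" unfolding ennreal_SUP_of_nat_eq_top by (simp add: top_unique)
   thus ?thesis by (simp only: top_greatest)
  qed
 qed
qed

lemma cel_sub: "cel k j q <= Sx k"
 by (auto simp: cel_def)

lemma Nj_measurable:
 fixes f :: "pt => 'a::metric_space"
 assumes "lipl k L (Sx k) f"
 shows "Nj k (cel k j0 q0) f j : borel_measurable (hausdorff_measure k)"
 unfolding Nj_def using cel_Int_borel[OF assms, of j0 q0 j] by (intro borel_measurable_sum borel_measurable_indicator) auto

text \<open>Area as the supremum, over finer and finer partitions, of the summed measures of the
  images. By monotone convergence no differentiability is involved, and area estimates can be made
  term by term.\<close>

lemma wvol_SUP:
 fixes f :: "pt => 'a::metric_space"
 assumes L: "lipl k L (Sx k) f"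
 shows "wvol k f j0 q0 = (SUP j. SUM q:QS k j. emeasure (hausdorff_measure k) (f ` (cel k j0 q0 Int cel k j q)))"
proof -
 have "wvol k f j0 q0 = (\<integral>\<^sup>+ y. (SUP j. Nj k (cel k j0 q0) f j y) \<partial>hausdorff_measure k)"
  unfolding wvol_def by (intro nn_integral_cong cnt_SUP cel_sub)
 also have "... = (SUP j. \<integral>\<^sup>+ y. Nj k (cel k j0 q0) f j y \<partial>hausdorff_measure k)"
  using Nj_measurable[OF L] Nj_mono[OF cel_sub] by (intro nn_integral_monotone_convergence_SUP) (auto simp: incseq_def le_fun_def)
 also have "... = (SUP j. SUM q:QS k j. emeasure (hausdorff_measure k) (f ` (cel k j0 q0 Int cel k j q)))"
 proof (rule SUP_cong)
  fix j
  show "(\<integral>\<^sup>+ y. Nj k (cel k j0 q0) f j y \<partial>hausdorff_measure k) = (SUM q:QS k j. emeasure (hausdorff_measure k) (f ` (cel k j0 q0 Int cel k j q)))"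
   unfolding Nj_def using cel_Int_borel[OF L, of j0 q0 j] by (subst nn_integral_sum) (auto intro!: borel_measurable_indicator)
 qed simp
 finally show ?thesis .
qed

lemma cnt_measurable:
 fixes f :: "pt => 'a::metric_space"
 assumes "lipl k L (Sx k) f"
 shows "cnt (cel k j0 q0) f : borel_measurable (hausdorff_measure k)"
proof -
 have "cnt (cel k j0 q0) f = (%y. SUP j. Nj k (cel k j0 q0) f j y)" by (intro ext cnt_SUP cel_sub)
 thus ?thesis using Nj_measurable[OF assms] by simp
qed

lemma simplex_volume_sum:
 fixes f :: "pt => 'a::metric_space"
 assumes L: "lipl k L (Sx k) f"
 shows "simplex_volume k f = (SUM q:QS k j0. wvol k f j0 q)"
proof -
 have e: "cnt (Sx k) f = (%y. SUM q:QS k j0. cnt (cel k j0 q) f y)"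
 proof
  fix y
  have "{x : Sx k. f x = y} = (UN q:QS k j0. {x : cel k j0 q. f x = y})" using idx_in_QS by (auto simp: cel_def)
  moreover have "disjoint_family_on (%q. {x : cel k j0 q. f x = y}) (QS k j0)" by (auto simp: disjoint_family_on_def cel_def)
  ultimately show "cnt (Sx k) f y = (SUM q:QS k j0. cnt (cel k j0 q) f y)"
   unfolding cnt_def using sum_emeasure[of "%q. {x : cel k j0 q. f x = y}" "QS k j0" "count_space UNIV"] by simp
 qed
 show ?thesis unfolding simplex_volume_def multiplicity_cnt wvol_def e
  by (rule nn_integral_sum) (rule cnt_measurable[OF L])
qed

text \<open>Each term of the supremum is compared by \<open>hausdorff_outer_lipschitz\<close>. The
  factor \<open>lmb\<close> has to be valid on the one cell only, so it may vary from cell to cell;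
  this freedom carries the averaging argument.\<close>

lemma wvol_push:
 fixes f g :: "pt => 'a::metric_space"
 assumes f: "lipl k L (Sx k) f" and g: "lipl k L' (Sx k) g" and lam: "0 < lmb"
  and lip: "!!x y. x : cel k j0 q0 ==> y : cel k j0 q0 ==> dist (g x) (g y) <= lmb * dist (f x) (f y)"
 shows "wvol k g j0 q0 <= ennreal (lmb^k) * wvol k f j0 q0"
 unfolding wvol_SUP[OF g]
proof (rule SUP_least)
 fix j
 have "(SUM q:QS k j. emeasure (hausdorff_measure k) (g ` (cel k j0 q0 Int cel k j q))) <= (SUM q:QS k j. ennreal (lmb^k) * emeasure (hausdorff_measure k) (f ` (cel k j0 q0 Int cel k j q)))"
  using lip by (intro sum_mono hausdorff_scale cel_Int_borel[OF f] hausdorff_outer_lipschitz[OF lam]) auto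
 also have "... = ennreal (lmb^k)*(SUM q:QS k j. emeasure (hausdorff_measure k) (f ` (cel k j0 q0 Int cel k j q)))" by (simp add: sum_distrib_left)
 also have "... <= ennreal (lmb^k) * wvol k f j0 q0" unfolding wvol_SUP[OF f] by (intro mult_left_mono SUP_upper) auto
 finally show "(SUM q:QS k j. emeasure (hausdorff_measure k) (g ` (cel k j0 q0 Int cel k j q))) <= ennreal (lmb^k) * wvol k f j0 q0" .
qed

lemma wvol_lip:
 fixes g :: "pt => 'a::metric_space"
 assumes k: "0 < k" and g: "lipl k L' (Sx k) g" and L: "lipl k L (cel k j0 q0) g"
 shows "wvol k g j0 q0 <= ennreal ((2 * real k * L/2^j0)^k)"
 unfolding wvol_SUP[OF g]
proof (rule SUP_least)
 fix j
 have L0: "0 <= L" using L by (simp add: lipl_def)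
 let ?H = "%q. emeasure (hausdorff_measure k) (g ` (cel k j0 q0 Int cel k j q))"
 let ?I = "{q : QS k j. cel k j0 q0 Int cel k j q ~= {}}"
 have sI: "(SUM q:QS k j. ?H q) = (SUM q:?I. ?H q)" by (rule sum.mono_neutral_right) auto
 have "(SUM q:?I. ?H q) <= ennreal ((2 * real k * L/2^j0)^k)"
 proof (cases "j0 <= j")
  case True
  have "?H q <= ennreal ((2 * real k * L/2^j)^k)" if q: "q : ?I" for q
  proof -
   obtain x where x: "x : cel k j0 q0" "x : cel k j q" using q by blast
   have sub: "cel k j q <= cel k j0 q0"
   proof
    fix y assume "y : cel k j q"
    thus "y : cel k j0 q0" using x idx_eq_mono[of y k x j0 j] True by (simp add: cel_def)
   qed
   have "lipl k L (cel k j q) g" by (rule lipl_mono[OF L sub order_refl])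
   from hausdorff_cell[OF k this, of "cel k j0 q0"] show ?thesis using hausdorff_le_outer[of k] by (metis Int_commute order_trans)
  qed
  hence "(SUM q:?I. ?H q) <= (SUM q:?I. ennreal ((2 * real k * L/2^j)^k))" by (intro sum_mono)
  also have "... = of_nat (card ?I) * ennreal ((2 * real k * L/2^j)^k)" by simp
  also have "... <= of_nat ((2^(j - j0))^k) * ennreal ((2 * real k * L/2^j)^k)" by (intro mult_right_mono of_nat_mono card_subcells[OF True]) auto
  also have "... = ennreal (real ((2^(j - j0))^k)*(2 * real k * L/2^j)^k)" using L0 by (simp add: ennreal_mult ennreal_of_nat_eq_real_of_nat)
  also have "real ((2^(j - j0))^k)*(2 * real k * L/2^j)^k = (2^(j - j0)*(2 * real k * L/2^j))^k" by (simp only: power_mult_distrib[of "2^(j - j0)"] of_nat_power of_nat_numeral)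
  also have "2^(j - j0)*(2 * real k * L/2^j) = 2 * real k * L/2^j0" using True by (simp add: power_diff)
  finally show ?thesis .
 next
  \<comment> \<open>At coarser levels the whole cell lies in a single cell of level
    \<open>j\<close>, so the sum has at most one term.\<close>
  case False
  have "card ?I <= 1"
  proof -
   have "q = q'" if qq: "q : ?I" "q' : ?I" for q q'
   proof -
    obtain x where x: "x : cel k j0 q0" "x : cel k j q" using qq by blast
    obtain y where y: "y : cel k j0 q0" "y : cel k j q'" using qq by blast
    show ?thesis using x y idx_eq_mono[of x k y j j0] False by (simp add: cel_def)
   qed
   moreover have "finite ?I" by simp
   ultimately have "card ?I <= Suc 0" by (subst card_le_Suc0_iff_eq) blast+
   thus ?thesis by simp
  qed
  have "?H q <= ennreal ((2 * real k * L/2^j0)^k)" for q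
   using hausdorff_cell[OF k L, of "cel k j q"] hausdorff_le_outer order_trans by blast
  hence "(SUM q:?I. ?H q) <= of_nat (card ?I) * ennreal ((2 * real k * L/2^j0)^k)" using sum_mono[of ?I ?H "%_. ennreal ((2 * real k * L/2^j0)^k)"] by simp
  also have "... <= 1 * ennreal ((2 * real k * L/2^j0)^k)" using \<open>card ?I <= 1\<close> by (intro mult_right_mono) auto
  finally show ?thesis by simp
 qed
 thus "(SUM q:QS k j. ?H q) <= ennreal ((2 * real k * L/2^j0)^k)" unfolding sI .
qed

text \<open>At level 0 there are \<open>2^k\<close> index vectors, since a coordinate equal to 1 has
  index 1; together with \<open>2 * real k * L\<close> this gives the 4.\<close>

lemma simplex_volume_lip:
 fixes g :: "pt => 'a::metric_space"
 assumes k: "0 < k" and g: "lipl k L (Sx k) g"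
 shows "simplex_volume k g <= ennreal ((4 * real k * L)^k)"
proof -
 have L0: "0 <= L" using g by (simp add: lipl_def)
 have "simplex_volume k g = (SUM q:QS k 0. wvol k g 0 q)" by (rule simplex_volume_sum[OF g])
 also have "... <= (SUM q:QS k 0. ennreal ((2 * real k * L/2^0)^k))"
  by (intro sum_mono wvol_lip[OF k g] lipl_mono[OF g cel_sub order_refl])
 also have "... = ennreal (2^k*(2 * real k * L)^k)" using L0 by (simp add: card_QS ennreal_mult ennreal_of_nat_eq_real_of_nat numeral_2_eq_2)
 also have "2^k*(2 * real k * L)^k = (2*(2 * real k * L))^k" by (rule power_mult_distrib[symmetric])
 also have "2*(2 * real k * L) = 4 * real k * L" by simp
 finally show ?thesis .
qed

text \<open>This makes the subdivision homotopy free of cost: its simplices have their images inside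
  the image of a simplex of one dimension less.\<close>

lemma simplex_volume_degenerate:
 fixes f g :: "pt => 'a::metric_space"
 assumes f: "lipl p L (Sx p) f" and g: "lipl (Suc p) L' (Sx (Suc p)) g" and sub: "g ` Sx (Suc p) <= f ` Sx p"
 shows "simplex_volume (Suc p) g = 0"
proof -
 have "compact (f ` Sx p)" by (intro compact_continuous_image lipl_continuous[OF f] compact_simplex)
 hence b: "f ` Sx p : sets (hausdorff_measure (Suc p))" by (simp add: borel_compact)
 have z: "emeasure (hausdorff_measure (Suc p)) (f ` Sx p) = 0"
  using hausdorff_le_outer[of "Suc p" "f ` Sx p"] hausdorff_lower_dim[OF f] by simp
 have "emeasure (hausdorff_measure (Suc p)) (g ` (cel (Suc p) j0 q0 Int cel (Suc p) j q)) = 0" for j0 q0 j q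
 proof -
  have "g ` (cel (Suc p) j0 q0 Int cel (Suc p) j q) <= f ` Sx p" using sub cel_sub by blast
  from emeasure_mono[OF this b] show ?thesis using z by simp
 qed
 hence "wvol (Suc p) g j0 q0 = 0" for j0 q0 by (simp add: wvol_SUP[OF g])
 thus ?thesis by (simp add: simplex_volume_sum[OF g, of 0])
qed

section \<open>Choosing weights by averaging\<close>

lemma inverse_power_layers:
 fixes Y :: real
 assumes "0 <= Y"
 shows "1/(max Y (1/2^R))^k <= 1 + (SUM l<=R. (2^Suc l)^k * of_bool (Y <= 1/2^l))"
proof (cases "Y <= 1")
 case False
 hence "1 <= max Y (1/2^R)" by simp
 hence "1/(max Y (1/2^R))^k <= 1" by (simp add: divide_le_eq_1 one_le_power)
 moreover have "0 <= (SUM l<=R. (2^Suc l)^k * of_bool (Y <= 1/2^l) :: real)" by (intro sum_nonneg) auto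
 ultimately show ?thesis by linarith
next
 case True
 \<comment> \<open>Layer cake over dyadic scales: the term of the largest \<open>l\<close> with
   \<open>Y <= 1/2^l\<close> alone pays for the left-hand side.\<close>
 define S where "S = {l. l <= R & Y <= 1/2^l}"
 have finS: "finite S" and S0: "0 : S" using True by (auto simp: S_def)
 define l where "l = Max S"
 have l: "l : S" unfolding l_def using finS S0 by (intro Max_in) auto
 have "1/2^Suc l <= max Y (1/2^R)"
 proof (cases "l = R")
  case True
  have "(1::real)/2^Suc R <= 1/2^R" by (intro divide_left_mono) auto
  thus ?thesis using True by simp
 next
  case False
  have "Suc l ~: S"
  proof
   assume "Suc l : S"
   hence "Suc l <= l" unfolding l_def using finS by (intro Max_ge) auto
   thus False by simp
  qed
  moreover have "Suc l <= R" using l False by (auto simp: S_def)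
  ultimately have "1/2^Suc l < Y" by (simp add: S_def)
  thus ?thesis by simp
 qed
 hence "(1/2^Suc l)^k <= (max Y (1/2^R))^k" by (intro power_mono) auto
 moreover have "(0::real) < (1/2^Suc l)^k" by simp
 ultimately have "1/(max Y (1/2^R))^k <= 1/(1/2^Suc l)^k" by (intro divide_left_mono mult_pos_pos) (auto intro!: zero_less_power simp: less_max_iff_disj)
 also have "... = (2^Suc l)^k * of_bool (Y <= 1/2^l)" using l by (simp add: S_def power_divide)
 also have "... <= (SUM l<=R. (2^Suc l)^k * of_bool (Y <= 1/2^l))" using l by (intro member_le_sum) (auto simp: S_def)
 finally show ?thesis by simp
qed

lemma sum_half_powers: "(SUM l<=R. 1/2^l) <= (2::real)"
proof -
 have "(SUM l<=R. 1/2^l) = 2 - (1::real)/2^R" by (induction R) (auto simp: field_simps)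
 thus ?thesis by simp
qed

lemma cnt_const_nonneg: "0 <= cnt_const N k"
 by (simp add: cnt_const_def)

text \<open>The layer at scale \<open>2^-l\<close> has weight \<open>2^((l + 1) k)\<close> and
  proportion \<open>O(2^(-l (k + 1)))\<close>. The product is \<open>2^k\<close> times
  \<open>2^-l\<close>, and the geometric series contributes the last factor 2.\<close>

definition avg_const :: "nat => nat => real" where
 "avg_const N k = 1 + 2^Suc k * cnt_const N k"

lemma avg_const_ge1: "1 <= avg_const N k"
 using cnt_const_nonneg[of N k] by (simp add: avg_const_def)

text \<open>Random weights: on average the pushed vectors stay away from the singular set, with finite inverse moments.\<close>

lemma average_select:
 fixes u :: "'c => nat => real" and w :: "'c => real"
 assumes Ce: "finite Ce" and u: "!!c. c : Ce ==> u c : Sx M" and N: "!!c. c : Ce ==> card {i. u c i ~= 0} <= N"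
  and w: "!!c. c : Ce ==> 0 <= w c" and W: "(SUM c:Ce. w c) <= W" "0 < W" and kap: "1 <= \<kappa>"
  and small: "real (card Ce)*(cnt_const N k*(\<kappa>/2^R)^Suc k) <= 1/4"
 shows "EX a. (ALL i. 1 <= a i & a i <= 2) & (ALL c:Ce. \<kappa>/2^R < pY k M (%i. a i * u c i)) &
   (SUM c:Ce. w c*(1/(pY k M (%i. a i * u c i))^k)) <= 2 * avg_const N k * W"
proof -
 \<comment> \<open>The spacing of the weights matches the finest layer, as
   \<open>count_small\<close> applies only for \<open>1/J <= t\<close>.\<close>
 define J where "J = (2::nat)^R"
 have J0: "0 < J" and Jr: "real J = 2^R" by (auto simp: J_def)
 define G where "G = PiE {..M} (%_. {..<J})"
 have finG: "finite G" unfolding G_def by (intro finite_PiE) auto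
 have cG: "card G = J^Suc M" unfolding G_def by (subst card_PiE) auto
 define Y where "Y = (%g c. pY k M (%i. wts J g i * u c i))"
 define A where "A = avg_const N k"
 have A1: "1 <= A" unfolding A_def by (rule avg_const_ge1)
 define V where "V = real J^Suc M"
 have V0: "0 < V" unfolding V_def using J0 by simp
 have cGr: "real (card G) = V" unfolding cG V_def by simp
 have cs: "(SUM g:G. of_bool (Y g c <= t)) <= cnt_const N k * t^Suc k * V" if c: "c : Ce" and t: "1/real J <= t" for c t
 proof -
  have "(SUM g:G. of_bool (Y g c <= t)) = real (card {g : G. Y g c <= t})" using finG by (simp add: of_bool_def sum.If_cases Int_def)
  also have "... <= cnt_const N k * t^Suc k * V" unfolding G_def Y_def V_def by (rule count_small[OF u[OF c] N[OF c] J0 t])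
  finally show ?thesis .
 qed
 define iv where "iv = (%g c. 1/(max (Y g c) (1/2^R))^k)"
 have avg: "(SUM g:G. iv g c) <= A * V" if c: "c : Ce" for c
 proof -
  have "(SUM g:G. iv g c) <= (SUM g:G. 1 + (SUM l<=R. (2^Suc l)^k * of_bool (Y g c <= 1/2^l)))"
   unfolding iv_def by (intro sum_mono inverse_power_layers) (simp add: Y_def pY_nonneg)
  also have "... = V + (SUM l<=R. (2^Suc l)^k*(SUM g:G. of_bool (Y g c <= 1/2^l)))"
   unfolding sum.distrib sum.swap[of _ "{..R}" G] sum_distrib_left using cGr by simp
  also have "... <= V + (SUM l<=R. (2^Suc l)^k*(cnt_const N k*(1/2^l)^Suc k * V))"
   by (intro add_left_mono sum_mono mult_left_mono cs[OF c]) (auto simp: Jr intro!: divide_left_mono power_increasing)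
  also have "(SUM l<=R. (2^Suc l)^k*(cnt_const N k*(1/2^l)^Suc k * V)) = 2^k * cnt_const N k * V*(SUM l<=R. 1/2^l)"
   unfolding sum_distrib_left by (intro sum.cong) (auto simp: power_mult_distrib power_divide field_simps)
  also have "... <= 2^k * cnt_const N k * V*2" using V0 cnt_const_nonneg[of N k] sum_half_powers[of R] by (intro mult_left_mono) auto
  finally show ?thesis by (simp add: A_def avg_const_def algebra_simps)
 qed
 \<comment> \<open>The weighted moment plus a penalty \<open>4 * A * W\<close> for each bad
   \<open>c\<close>. Both parts have average at most \<open>A * W\<close>, the second by
   \<open>small\<close>. A weight vector of cost at most \<open>2 * A * W\<close> therefore has no
   bad \<open>c\<close> at all.\<close>
 define cost where "cost = (%g. (SUM c:Ce. w c * iv g c) + 4 * A * W*(SUM c:Ce. of_bool (Y g c <= \<kappa>/2^R)))"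
 have tot: "(SUM g:G. cost g) <= (2 * A * W) * V"
 proof -
  have "(SUM g:G. cost g) = (SUM c:Ce. w c*(SUM g:G. iv g c)) + 4 * A * W*(SUM c:Ce. SUM g:G. of_bool (Y g c <= \<kappa>/2^R))"
   unfolding cost_def sum.distrib sum_distrib_left[symmetric] sum.swap[of _ Ce G] by (simp add: sum_distrib_left)
  also have "... <= (SUM c:Ce. w c*(A * V)) + 4 * A * W*(SUM c:Ce. cnt_const N k*(\<kappa>/2^R)^Suc k * V)"
  proof (intro add_mono sum_mono mult_left_mono avg w cs)
   show "1/real J <= \<kappa>/2^R" unfolding Jr using kap by (intro divide_right_mono) auto
  qed (use A1 W in auto)
  also have "(SUM c:Ce. w c*(A * V)) = (SUM c:Ce. w c)*(A * V)" by (simp add: sum_distrib_right)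
  also have "... <= W*(A * V)" using W A1 V0 by (intro mult_right_mono) auto
  also have "(SUM c:Ce. cnt_const N k*(\<kappa>/2^R)^Suc k * V) = real (card Ce)*(cnt_const N k*(\<kappa>/2^R)^Suc k) * V" by simp
  also have "... <= 1/4 * V" using small V0 by (intro mult_right_mono) auto
  finally have "(SUM g:G. cost g) <= W*(A * V) + 4 * A * W*(1/4 * V)" using A1 W by (simp add: mult_left_mono)
  thus ?thesis by (simp add: algebra_simps)
 qed
 have "EX g:G. cost g <= 2 * A * W"
 proof (rule ccontr)
  assume "\<not> ?thesis"
  hence "2 * A * W < cost g" if "g : G" for g using that by force
  moreover have "G ~= {}" using cGr V0 by auto
  ultimately have "(SUM g:G. 2 * A * W) < (SUM g:G. cost g)" using finG by (intro sum_strict_mono) auto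
  thus False using tot cGr by (simp add: mult.commute)
 qed
 then obtain g where g: "g : G" "cost g <= 2 * A * W" by blast
 have ivn: "0 <= iv g c" for c by (auto simp: iv_def le_max_iff_disj intro!: zero_le_power)
 have s1: "0 <= (SUM c:Ce. w c * iv g c)" using w ivn by (intro sum_nonneg) auto
 have AW: "0 < A * W" using A1 W by simp
 have good: "\<kappa>/2^R < Y g c" if c: "c : Ce" for c
 proof (rule ccontr)
  assume "\<not> ?thesis"
  hence "(1::real) = of_bool (Y g c <= \<kappa>/2^R)" by simp
  also have "... <= (SUM c:Ce. of_bool (Y g c <= \<kappa>/2^R))" using c Ce by (intro member_le_sum) auto
  finally have "4 * A * W*1 <= 4 * A * W*(SUM c:Ce. of_bool (Y g c <= \<kappa>/2^R))" using AW by (intro mult_left_mono) auto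
  thus False using g(2) s1 AW unfolding cost_def by linarith
 qed
 have b0: "0 <= (SUM c:Ce. of_bool (Y g c <= \<kappa>/2^R) :: real)" by (intro sum_nonneg) auto
 have le: "(SUM c:Ce. w c * iv g c) <= 2 * A * W"
 proof -
  have "0 <= 4 * A * W*(SUM c:Ce. of_bool (Y g c <= \<kappa>/2^R))" using b0 A1 W by (intro mult_nonneg_nonneg) auto
  thus ?thesis using g(2) unfolding cost_def by linarith
 qed
 define a where "a = (%i. if i <= M then wts J g i else 1)"
 have a12: "1 <= a i & a i <= 2" for i
 proof (cases "i <= M")
  case True
  hence "g i < J" using g(1) by (auto simp: G_def PiE_iff)
  thus ?thesis using True J0 by (simp add: a_def wts_def)
 qed (simp add: a_def)
 have pYa: "pY k M (%i. a i * u c i) = Y g c" if "c : Ce" for c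
 proof -
  have "(%i. a i * u c i) = (%i. wts J g i * u c i)" using u[OF that] by (auto simp: a_def simplex_k_def)
  thus ?thesis by (simp add: Y_def)
 qed
 have "iv g c = 1/(pY k M (%i. a i * u c i))^k" if c: "c : Ce" for c
 proof -
  have "1/2^R <= \<kappa>/2^R" using kap by (intro divide_right_mono) auto
  hence "1/2^R <= Y g c" using good[OF c] by linarith
  thus ?thesis using pYa[OF c] by (simp add: iv_def max_def)
 qed
 hence "(SUM c:Ce. w c*(1/(pY k M (%i. a i * u c i))^k)) = (SUM c:Ce. w c * iv g c)" by (intro sum.cong) auto
 thus ?thesis using a12 good pYa le unfolding A_def by (intro exI[of _ a]) auto
qed

section \<open>A partition adapted to the distance from Z\<close>

definition rad :: "'a::metric_space set => real => 'a => real" where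
 "rad Z eps x = max eps (infdist x Z)"

lemma infdist_lip: "Z ~= {} ==> \<bar>infdist x Z - infdist y Z\<bar> <= dist x (y::'a::metric_space)"
 using infdist_triangle[of x Z y] infdist_triangle[of y Z x] by (simp add: dist_commute abs_le_iff)

lemma rad_lip: "\<bar>rad Z eps x - rad Z eps y\<bar> <= dist x y"
 using infdist_triangle[of x Z y] infdist_triangle[of y Z x] by (simp add: rad_def dist_commute abs_le_iff) linarith

text \<open>Levels 0 and 1 both have size \<open>eps\<close>: level 0 is the region within
  \<open>eps\<close> of \<open>Z\<close>, where the scale stops shrinking, and level 1 is the first
  annulus around it.\<close>

definition lev :: "real => nat => real" where
 "lev eps j = (if j = 0 then eps else 2^(j - 1) * eps)"

definition ann :: "'a::metric_space set => real => nat => 'a set" where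
 "ann Z eps j = (if j = 0 then {x. infdist x Z < eps} else {x. 2^(j - 1) * eps <= infdist x Z & infdist x Z < 2^j * eps})"

lemma lev_ge: "0 < eps ==> eps <= lev eps j"
 by (simp add: lev_def mult_le_cancel_right1)

lemma ann_rad: 
 assumes "0 < eps" "x : ann Z eps j" shows "lev eps j <= rad Z eps x" "rad Z eps x < 2 * lev eps j"
proof -
 have "lev eps j <= rad Z eps x & rad Z eps x < 2 * lev eps j"
 proof (cases j)
  case 0 thus ?thesis using assms by (auto simp: lev_def ann_def rad_def)
 next
  case (Suc i)
  have "eps <= 2^i * eps" using assms by (simp add: mult_le_cancel_right1)
  hence "eps < 2*(2^i * eps)" using assms by linarith
  thus ?thesis using assms(2) Suc by (auto simp: lev_def ann_def rad_def simp del: mult_less_cancel_right1 mult_less_cancel_left1)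
 qed
 thus "lev eps j <= rad Z eps x" "rad Z eps x < 2 * lev eps j" by auto
qed

lemma ann_cover:
 assumes e: "0 < eps" shows "EX j. x : ann Z eps j"
proof (cases "infdist x Z < eps")
 case True thus ?thesis by (intro exI[of _ 0]) (simp add: ann_def)
next
 case False
 obtain i0 :: nat where i0: "infdist x Z/eps < 2^i0" using real_arch_pow[of 2] by auto
 define i where "i = (LEAST i. infdist x Z < 2^i * eps)"
 have ex: "infdist x Z < 2^i0 * eps" using i0 e by (simp add: pos_divide_less_eq)
 have i: "infdist x Z < 2^i * eps" unfolding i_def by (rule LeastI[of _ i0]) (rule ex)
 have "i ~= 0" using i False by (metis mult_1 power_0)
 moreover have "\<not> infdist x Z < 2^(i - 1) * eps" unfolding i_def by (rule not_less_Least) (use \<open>i ~= 0\<close> in \<open>simp add: i_def\<close>)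
 ultimately show ?thesis using i by (intro exI[of _ i]) (simp add: ann_def)
qed

text \<open>A range of ratio 4 with open ends contains at most two consecutive positive levels, and
  level 0 may join them.\<close>

lemma card_levels:
 assumes e: "0 < eps" and r: "!!j. j : S ==> lo < lev eps j & lev eps j < 4 * lo"
 shows "finite S & card S <= 3"
proof (cases "S - {0} = {}")
 case True
 hence "S <= {0}" by auto
 thus ?thesis using card_mono[of "{0::nat}" S] finite_subset by fastforce
next
 case False
 define j0 where "j0 = (LEAST j. j : S - {0})"
 have j0: "j0 : S - {0}" unfolding j0_def using False by (metis LeastI ex_in_conv)
 have "j <= Suc j0" if j: "j : S - {0}" for j
 proof (rule ccontr)
  assume "\<not> ?thesis"
  hence "j0 - 1 + 2 <= j - 1" using j0 by auto
  hence "(2::real)^(j0 - 1 + 2) <= 2^(j - 1)" by (intro power_increasing) auto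
  hence "4*(2::real)^(j0 - 1) <= 2^(j - 1)" by (simp add: power_add)
  hence "4*(2::real)^(j0 - 1) * eps <= 2^(j - 1) * eps" using e by (intro mult_right_mono) auto
  hence "4 * lev eps j0 <= lev eps j" using j0 j by (simp add: lev_def)
  thus False using r[of j] r[of j0] j j0 by auto
 qed
 moreover have "j0 <= j" if "j : S - {0}" for j unfolding j0_def using that by (rule Least_le)
 ultimately have "S <= {0, j0, Suc j0}" by (force simp: le_Suc_eq)
 moreover have "card {0, j0, Suc j0} <= 3" by (simp add: card_insert_if)
 ultimately show ?thesis by (meson card_mono finite.emptyI finite.insertI finite_subset le_trans)
qed

text \<open>On each annulus the Assouad-Nagata cover at scale \<open>lev eps j/2\<close> is cut down
  to the annulus, and \<open>w\<close> consists of tents of height and width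
  \<open>lev eps j/8\<close> over the pieces. The tents are short compared with \<open>rad\<close>,
  so a point sees at most three levels with at most \<open>N0 + 1\<close> pieces each. Multiplicity
  is counted over a ball of radius \<open>eps/16\<close>, so that the same count also bounds
  differences of the weights at nearby points.\<close>

lemma whitney_partition:
 fixes Z :: "'a::metric_space set"
 assumes AN: "AN_dim_finite TYPE('a)" and Z: "Z ~= {}"
 shows "EX N C. 0 < C & (ALL eps>0. EX (w :: nat \<times> 'a set => 'a => real) (z :: nat \<times> 'a set => 'a).
   (ALL v x y. \<bar>w v x - w v y\<bar> <= dist x y) & (ALL v x. 0 <= w v x) & (ALL v. z v : Z) &
   (ALL x. finite {v. EX y. dist x y < eps/16 & 0 < w v y} & card {v. EX y. dist x y < eps/16 & 0 < w v y} <= N) &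
   (ALL x. rad Z eps x/16 <= (SUM v:{v. 0 < w v x}. w v x)) &
   (ALL v x. 0 < w v x --> dist x (z v) <= C * rad Z eps x))"
proof -
 define Q where "Q = (%N0 c0 s (\<U>::'a set set). \<Union>\<U> = UNIV &
   (ALL U:\<U>. bounded U & diameter U <= c0 * s) &
   (ALL B. bounded B & diameter B <= s --> finite {U\<in>\<U>. U Int B ~= {}} & card {U\<in>\<U>. U Int B ~= {}} <= N0 + 1))"
 have "EX N0. EX c0>0. ALL s>0. EX \<U>. Q N0 c0 s \<U>"
  using AN unfolding AN_dim_finite_def AN_dim_le_def Q_def .
 then obtain N0 c0 where c0: "c0 > 0" and Q: "!!s. s > 0 ==> EX \<U>. Q N0 c0 s \<U>" by blast
 define UU where "UU = (%s. SOME \<U>. Q N0 c0 s \<U>)"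
 have QU: "Q N0 c0 s (UU s)" if "s > 0" for s unfolding UU_def by (rule someI_ex[OF Q[OF that]])
 have UU: "!!s. s > 0 ==> \<Union>(UU s) = (UNIV :: 'a set)"
  "!!s U. s > 0 ==> U : UU s ==> bounded U & diameter U <= c0 * s"
  "!!s B. s > 0 ==> bounded B ==> diameter B <= s ==> finite {U\<in>UU s. U Int B ~= {}} & card {U\<in>UU s. U Int B ~= {}} <= N0 + 1"
  using QU unfolding Q_def by simp_all
 define C where "C = 2*(c0 + 4)"
 show ?thesis
 proof (intro exI[of _ "3*(N0 + 1)"] exI[of _ C] conjI allI impI)
  show "0 < C" using c0 by (simp add: C_def)
  fix eps :: real assume e: "0 < eps"
  define cell where "cell = (%(j, U). if U : UU (lev eps j/2) then U Int ann Z eps j else {})"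
  define w where "w = (%v x. if cell v = {} then 0 else max 0 (lev eps (fst v)/8 - infdist x (cell v)))"
  define y0 where "y0 = (%v. SOME y. y : cell v)"
  define z where "z = (%v. SOME z. z : Z & dist (y0 v) z < infdist (y0 v) Z + eps)"
  have l0: "0 < lev eps j" for j using lev_ge[OF e, of j] e by linarith
  have zp: "z v : Z & dist (y0 v) (z v) < infdist (y0 v) Z + eps" for v
  proof -
   obtain z' where "z' : Z" "dist (y0 v) z' < infdist (y0 v) Z + eps"
    using cInf_lessD[of "(dist (y0 v)) ` Z" "infdist (y0 v) Z + eps"] Z e by (auto simp: infdist_def)
   hence "(%u. u : Z & dist (y0 v) u < infdist (y0 v) Z + eps) z'" by simp
   from someI[of "%u. u : Z & dist (y0 v) u < infdist (y0 v) Z + eps", OF this] show ?thesis by (simp only: z_def)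
  qed
  have w1: "\<bar>w v x - w v y\<bar> <= dist x y" for v x y
  proof (cases "cell v = {}")
   case False
   show ?thesis using infdist_lip[OF False, of x y] zero_le_dist[of x y] False unfolding w_def max_def abs_le_iff by (simp split: if_splits)
  qed (simp add: w_def)
  have w0: "0 <= w v x" for v x by (simp add: w_def)
  have wnear: "EX y':cell v. dist y y' < lev eps (fst v)/8" if wv: "0 < w v y" for v y
  proof -
   have ne: "cell v ~= {}" and lt: "infdist y (cell v) < lev eps (fst v)/8" using wv by (auto simp: w_def split: if_splits)
   show ?thesis using cInf_lessD[of "(dist y) ` cell v" "lev eps (fst v)/8"] ne lt by (auto simp: infdist_def)
  qed
  have lf: "finite {v. EX y. dist x y < eps/16 & 0 < w v y} & card {v. EX y. dist x y < eps/16 & 0 < w v y} <= 3*(N0 + 1)" for x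
  proof -
   let ?V = "{v. EX y. dist x y < eps/16 & 0 < w v y}"
   have near: "EX y':cell v. dist x y' < 3 * lev eps (fst v)/16" if v: "v : ?V" for v
   proof -
    obtain y where y: "dist x y < eps/16" "0 < w v y" using v by blast
    obtain y' where y': "y' : cell v" "dist y y' < lev eps (fst v)/8" using wnear[OF y(2)] by blast
    have "dist x y' < 3 * lev eps (fst v)/16" using dist_triangle[of x y' y] y(1) y'(2) lev_ge[OF e, of "fst v"] by linarith
    thus ?thesis using y'(1) by blast
   qed
   let ?S = "fst ` ?V"
   have S: "finite ?S & card ?S <= 3"
   \<comment> \<open>The level satisfies 13/16 lev < rad < 35/16 lev; the ratio 35/13 is below
     4.\<close>
   proof (rule card_levels[OF e, of _ "16 * rad Z eps x/35"])
    fix j assume "j : ?S"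
    then obtain v where v: "v : ?V" "j = fst v" by blast
    obtain y' where y': "y' : cell v" "dist x y' < 3 * lev eps j/16" using near[OF v(1)] v(2) by blast
    have "y' : ann Z eps j" using y'(1) v(2) by (cases v) (auto simp: cell_def split: if_splits)
    note ar = ann_rad[OF e this]
    have "\<bar>rad Z eps x - rad Z eps y'\<bar> <= dist x y'" by (rule rad_lip)
    hence "13 * lev eps j/16 < rad Z eps x" "rad Z eps x < 35 * lev eps j/16" using ar y'(2) by (auto simp: abs_le_iff)
    thus "16 * rad Z eps x/35 < lev eps j & lev eps j < 4*(16 * rad Z eps x/35)" by linarith
   qed
   have sub: "?V <= (UN j:?S. Pair j ` {U : UU (lev eps j/2). U Int ball x (lev eps j/4) ~= {}})"
   proof
    fix v assume v: "v : ?V"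
    obtain y' where y': "y' : cell v" "dist x y' < 3 * lev eps (fst v)/16" using near[OF v] by blast
    have "snd v : UU (lev eps (fst v)/2)" "y' : snd v" using y'(1) by (cases v; auto simp: cell_def split: if_splits)+
    moreover have "y' : ball x (lev eps (fst v)/4)" using y'(2) l0[of "fst v"] by auto
    ultimately have "snd v : {U : UU (lev eps (fst v)/2). U Int ball x (lev eps (fst v)/4) ~= {}}" by blast
    hence "(fst v, snd v) : Pair (fst v) ` {U : UU (lev eps (fst v)/2). U Int ball x (lev eps (fst v)/4) ~= {}}" by (rule imageI)
    hence "v : Pair (fst v) ` {U : UU (lev eps (fst v)/2). U Int ball x (lev eps (fst v)/4) ~= {}}" by (simp only: prod.collapse)
    thus "v : (UN j:?S. Pair j ` {U : UU (lev eps j/2). U Int ball x (lev eps j/4) ~= {}})" using v by blast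
   qed
   have fc: "finite {U : UU (lev eps j/2). U Int ball x (lev eps j/4) ~= {}} & card {U : UU (lev eps j/2). U Int ball x (lev eps j/4) ~= {}} <= N0 + 1" for j
   proof (rule UU(3))
    have "dist a b <= lev eps j/2" if "a : ball x (lev eps j/4)" "b : ball x (lev eps j/4)" for a b
     using dist_triangle3[of a b x] that by auto
    thus "diameter (ball x (lev eps j/4)) <= lev eps j/2" using l0[of j] by (intro diameter_le_metric) auto
   qed (use l0[of j] in auto)
   have fin: "finite (UN j:?S. Pair j ` {U : UU (lev eps j/2). U Int ball x (lev eps j/4) ~= {}})" using S fc by blast
   have "card ?V <= card (UN j:?S. Pair j ` {U : UU (lev eps j/2). U Int ball x (lev eps j/4) ~= {}})" by (rule card_mono[OF fin sub])
   also have "... <= (SUM j:?S. card (Pair j ` {U : UU (lev eps j/2). U Int ball x (lev eps j/4) ~= {}}))" using S by (intro card_UN_le) auto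
   also have "... <= (SUM j:?S. N0 + 1)"
    using fc by (intro sum_mono) (meson card_image_le order_trans)
   also have "... = card ?S*(N0 + 1)" by simp
   also have "... <= 3*(N0 + 1)" by (rule mult_right_mono[OF conjunct2[OF S]]) simp
   finally show ?thesis using finite_subset[OF sub fin] by blast
  qed
  have tot: "rad Z eps x/16 <= (SUM v:{v. 0 < w v x}. w v x)" for x
  proof -
   obtain j where j: "x : ann Z eps j" using ann_cover[OF e] by blast
   have "x : \<Union>(UU (lev eps j/2))" using UU(1)[of "lev eps j/2"] l0[of j] by simp
   then obtain U where U: "U : UU (lev eps j/2)" "x : U" by blast
   have xc: "x : cell (j, U)" using U j by (simp add: cell_def)
   hence wx: "w (j, U) x = lev eps j/8" using l0[of j] by (auto simp: w_def)
   have "finite {v. 0 < w v x}" by (rule finite_subset[OF _ conjunct1[OF lf[of x]]]) (use e in \<open>auto intro!: exI[of _ x]\<close>)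
   hence "w (j, U) x <= (SUM v:{v. 0 < w v x}. w v x)" using wx l0[of j] w0 by (intro member_le_sum) auto
   thus ?thesis using wx ann_rad(2)[OF e j] by linarith
  qed
  have zd: "dist x (z v) <= C * rad Z eps x" if wv: "0 < w v x" for v x
  proof -
   obtain y' where y': "y' : cell v" "dist x y' < lev eps (fst v)/8" using wnear[OF wv] by blast
   let ?l = "lev eps (fst v)"
   have y0c: "y0 v : cell v" unfolding y0_def using y'(1) by (rule someI)
   have U: "snd v : UU (?l/2)" "y' : snd v" "y0 v : snd v" "y' : ann Z eps (fst v)" "y0 v : ann Z eps (fst v)"
    using y'(1) y0c by (cases v; auto simp: cell_def split: if_splits)+
   have "dist y' (y0 v) <= diameter (snd v)" using UU(2)[OF _ U(1)] l0[of "fst v"] U by (intro diameter_bounded_bound) auto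
   hence d1: "dist y' (y0 v) <= c0*(?l/2)" using UU(2)[OF _ U(1)] l0[of "fst v"] by fastforce
   have "infdist (y0 v) Z <= rad Z eps (y0 v)" by (simp add: rad_def)
   hence d2: "dist (y0 v) (z v) < 3*?l" using zp[of v] ann_rad(2)[OF e U(5)] lev_ge[OF e, of "fst v"] by linarith
   have "dist x (z v) <= dist x y' + dist y' (y0 v) + dist (y0 v) (z v)"
    using dist_triangle[of x "z v" y'] dist_triangle[of y' "z v" "y0 v"] by linarith
   also have "... <= ?l/8 + c0*(?l/2) + 3*?l" using y'(2) d1 d2 by linarith
   also have "... <= (c0 + 4)*?l" 
   proof -
    have "0 < c0*?l" using c0 l0[of "fst v"] by simp
    thus ?thesis using l0[of "fst v"] by (simp add: distrib_right)
   qed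
   also have "(c0 + 4)*?l <= (c0 + 4)*(2 * rad Z eps x)"
   proof -
    have "\<bar>rad Z eps x - rad Z eps y'\<bar> <= dist x y'" by (rule rad_lip)
    hence "?l <= 2 * rad Z eps x" using ann_rad(1)[OF e U(4)] y'(2) l0[of "fst v"] by linarith
    thus ?thesis using c0 by (intro mult_left_mono) auto
   qed
   finally show ?thesis by (simp only: C_def mult_ac)
  qed
  show "EX (w :: nat \<times> 'a set => 'a => real) (z :: nat \<times> 'a set => 'a).
   (ALL v x y. \<bar>w v x - w v y\<bar> <= dist x y) & (ALL v x. 0 <= w v x) & (ALL v. z v : Z) &
   (ALL x. finite {v. EX y. dist x y < eps/16 & 0 < w v y} & card {v. EX y. dist x y < eps/16 & 0 < w v y} <= 3*(N0 + 1)) &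
   (ALL x. rad Z eps x/16 <= (SUM v:{v. 0 < w v x}. w v x)) &
   (ALL v x. 0 < w v x --> dist x (z v) <= C * rad Z eps x)"
   by (intro exI[of _ w] exI[of _ z] conjI allI impI w1 w0 lf[THEN conjunct1] lf[THEN conjunct2] tot zd conjunct1[OF zp])
 qed
qed

section \<open>Singular chains from vertex lists\<close>

definition aff :: "pt list => pt => pt" where
 "aff l y = (%i. SUM j<length l. y j*(l ! j) i)"

definition sg :: "(pt => 'a) => pt list => (pt => 'a)" where
 "sg f l = (%y. if y : Sx (length l - 1) then f (aff l y) else undefined)"

text \<open>Carries identities between lists of vertices in the parameter simplex over to singular
  chains; \<open>sbd_SG\<close> matches the two boundaries.\<close>

definition SG :: "(pt => 'a) => (pt list \<Rightarrow>\<^sub>0 int) => ((pt => 'a) \<Rightarrow>\<^sub>0 int)" where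
 "SG f = frag_extend (%l. frag_of (sg f l))"

text \<open>The boundary of a 0-simplex is 0: in contrast to \<open>bd\<close>, the singular complex
  is not augmented, in accordance with \<open>lip_cycle\<close>.\<close>

definition sface :: "nat => (pt => 'a) => ((pt => 'a) \<Rightarrow>\<^sub>0 int)" where
 "sface p sig = (if p = 0 then 0 else SUM i<=p. frag_cmul ((-1)^i) (frag_of (face p i sig)))"

definition sbd :: "nat => ((pt => 'a) \<Rightarrow>\<^sub>0 int) => ((pt => 'a) \<Rightarrow>\<^sub>0 int)" where
 "sbd p = frag_extend (sface p)"

definition vtx :: "nat => nat => real" where
 "vtx i = (%j. if j = i then 1 else 0)"

definition iot :: "nat => pt list" where
 "iot p = map vtx [0..<Suc p]"

lemma SG_of [simp]: "SG f (frag_of l) = frag_of (sg f l)" and SG_diff: "SG f (a - b) = SG f a - SG f b"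
 and SG_0 [simp]: "SG f 0 = 0" and SG_cmul: "SG f (frag_cmul k a) = frag_cmul k (SG f a)"
 by (simp_all add: SG_def frag_extend_diff frag_extend_cmul)

lemma SG_sum: "finite I ==> SG f (sum b I) = (SUM i:I. SG f (b i))"
 by (simp add: SG_def frag_extend_sum o_def)

lemma sbd_of [simp]: "sbd p (frag_of sig) = sface p sig" and sbd_diff: "sbd p (a - b) = sbd p a - sbd p b"
 and sbd_add: "sbd p (a + b) = sbd p a + sbd p b" and sbd_0 [simp]: "sbd p 0 = 0"
 by (simp_all add: sbd_def frag_extend_diff frag_extend_add)

lemma length_iot [simp]: "length (iot p) = Suc p"
 by (simp add: iot_def)

lemma nth_iot: "j <= p ==> iot p ! j = vtx j"
 by (simp add: iot_def del: upt_Suc)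

lemma vtx_simplex: "i <= p ==> vtx i : Sx p"
 by (auto simp: vtx_def simplex_k_def)

lemma set_iot: "set (iot p) <= Sx p"
 using vtx_simplex by (auto simp: iot_def)

lemma del_nth: "i < length l ==> j < length l - 1 ==> del i l ! j = l ! (if j < i then j else Suc j)"
 by (auto simp: del_def nth_append min_def)

lemma aff_face_map:
 assumes "length l = Suc (Suc p)" "i <= Suc p"
 shows "aff l (face_map i y) = aff (del i l) y"
proof
 fix t
 have "aff l (face_map i y) t = (SUM j<=Suc p. face_map i y j*(l ! j) t)" by (simp add: aff_def assms(1) lessThan_Suc_atMost)
 also have "... = (SUM j<=p. y j*(l ! (if j < i then j else Suc j)) t)"
  unfolding sum_remove_index[OF assms(2)] face_map_index by simp
 also have "... = (SUM j<=p. y j*(del i l ! j) t)" using del_nth[of i l] assms by (intro sum.cong) auto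
 also have "... = aff (del i l) y t" using length_del[of i l] assms by (simp add: aff_def lessThan_Suc_atMost)
 finally show "aff l (face_map i y) t = aff (del i l) y t" .
qed

lemma face_sg:
 assumes "length l = Suc (Suc p)" "i <= Suc p"
 shows "face (Suc p) i (sg f l) = sg f (del i l)"
proof
 fix y
 have len: "length (del i l) - 1 = p" using length_del[of i l] assms by simp
 show "face (Suc p) i (sg f l) y = sg f (del i l) y"
 proof (cases "y : Sx p")
  case True
  thus ?thesis using face_map_simplex[OF True assms(2)] aff_face_map[OF assms] len assms(1) by (simp add: face_apply sg_def)
 next
  case False thus ?thesis using len by (simp add: face_outside sg_def)
 qed
qed

lemma bd_sum: "bd l = (SUM i<length l. frag_cmul ((-1)^i) (frag_of (del i l)))"
proof (induction l)
 case (Cons v l)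
 have "lcons v (bd l) = (SUM i<length l. frag_cmul ((-1)^i) (frag_of (v # del i l)))"
  unfolding Cons.IH lcons_def by (simp add: frag_extend_sum frag_extend_cmul o_def)
 hence "bd (v # l) = frag_of l + (SUM i<length l. frag_cmul ((-1)^Suc i) (frag_of (del (Suc i) (v # l))))"
  by (simp add: sum_negf[symmetric])
 also have "... = (SUM i<length (v # l). frag_cmul ((-1)^i) (frag_of (del i (v # l))))"
  by (simp only: list.size(4) add_0_right add_Suc_right sum.lessThan_Suc_shift) simp
 finally show ?case .
qed simp

lemma sface_sg:
 assumes "length l = Suc (Suc p)" shows "sface (Suc p) (sg f l) = SG f (bd l)"
proof -
 have "sface (Suc p) (sg f l) = (SUM i<=Suc p. frag_cmul ((-1)^i) (frag_of (sg f (del i l))))"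
  (is "_ = ?R")
 proof -
  have "sface (Suc p) (sg f l) = (SUM i<=Suc p. frag_cmul ((-1)^i) (frag_of (face (Suc p) i (sg f l))))" by (simp only: sface_def) simp
  also have "... = ?R" by (intro sum.cong refl) (simp add: face_sg[OF assms])
  finally show ?thesis .
 qed
 also have "... = SG f (bd l)" unfolding bd_sum assms lessThan_Suc_atMost by (simp add: SG_sum SG_cmul del: sum.atMost_Suc)
 finally show ?thesis .
qed

lemma sbd_SG:
 assumes "!!l. l : kys c ==> length l = Suc (Suc p)" shows "sbd (Suc p) (SG f c) = SG f (BD c)"
proof -
 have "kys c <= {l. length l = Suc (Suc p)}" using assms by blast
 thus ?thesis by (induction c rule: frag_induction) (auto simp: SG_diff sbd_diff BD_diff sface_sg)
qed

lemma aff_iot: "y : Sx p ==> aff (iot p) y = y"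
proof
 fix i assume y: "y : Sx p"
 have "aff (iot p) y i = (SUM j<Suc p. if j = i then y j else 0)" unfolding aff_def length_iot by (intro sum.cong) (auto simp: nth_iot vtx_def)
 also have "... = (if i < Suc p then y i else 0)" by (subst sum.delta) auto
 also have "... = y i" using y by (auto simp: simplex_k_def)
 finally show "aff (iot p) y i = y i" .
qed

lemma sg_iot: "(!!x. x ~: Sx p ==> sig x = undefined) ==> sg sig (iot p) = sig"
 by (rule ext) (auto simp: sg_def aff_iot)

lemma face_map_vtx: "face_map i (vtx j) = vtx (if j < i then j else Suc j)"
 by (rule ext) (auto simp: face_map_def vtx_def)

lemma del_iot: "i <= Suc p ==> del i (iot (Suc p)) = map (face_map i) (iot p)"
 by (rule nth_equalityI) (auto simp: length_del del_nth nth_iot face_map_vtx)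

lemma face_map_linear: "face_map i (%j. a * x j + b * y j) = (%j. a * face_map i x j + b * face_map i y j)"
 by (rule ext) (simp add: face_map_def)

lemma aff_map_face: "aff (map (face_map i) l) y = face_map i (aff l y)"
proof
 fix t
 have "aff (map (face_map i) l) y t = (SUM j<length l. y j * face_map i (l ! j) t)" by (simp add: aff_def)
 also have "... = face_map i (aff l y) t" by (simp add: face_map_def aff_def)
 finally show "aff (map (face_map i) l) y t = face_map i (aff l y) t" .
qed

lemma sg_face_natural:
 assumes "!!y. y : Sx (length l - 1) ==> f (face_map i (aff l y)) = g (aff l y)"
 shows "sg f (map (face_map i) l) = sg g l"
 using assms by (auto simp: sg_def aff_map_face)

lemma SG_face_natural:
 assumes "!!l y. l : kys c ==> y : Sx (length l - 1) ==> f (face_map i (aff l y)) = g (aff l y)"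
 shows "SG f (lmap (face_map i) c) = SG g c"
proof -
 have "SG f (lmap (face_map i) c) = frag_extend (%l. frag_of (sg f (map (face_map i) l))) c"
  unfolding SG_def lmap_def frag_extend_extend by simp
 also have "... = SG g c" unfolding SG_def
 proof (rule frag_extend_eq)
  fix l assume "l : kys c"
  hence "sg f (map (face_map i) l) = sg g l" by (intro sg_face_natural assms)
  thus "frag_of (sg f (map (face_map i) l)) = frag_of (sg g l)" by simp
 qed
 finally show ?thesis .
qed

text \<open>The pattern common to the subdivision homotopy and the label prism: an operator
  compatible with face inclusions, applied to the boundary of the standard simplex, turns into the
  operator applied to the singular faces.\<close>

lemma SG_bd_natural:
 assumes O: "!!i. i <= Suc p ==> O1 (map (face_map i) (iot p)) = lmap (face_map i) c"
  and f: "!!i l y. i <= Suc p ==> l : kys c ==> y : Sx (length l - 1) ==> f (face_map i (aff l y)) = g i (aff l y)"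
 shows "SG f (frag_extend O1 (bd (iot (Suc p)))) = (SUM i<=Suc p. frag_cmul ((-1)^i) (SG (g i) c))"
proof -
 have "frag_extend O1 (bd (iot (Suc p))) = (SUM i<=Suc p. frag_cmul ((-1)^i) (O1 (del i (iot (Suc p)))))"
  unfolding bd_sum length_iot lessThan_Suc_atMost by (simp add: frag_extend_sum frag_extend_cmul o_def del: sum.atMost_Suc)
 also have "SG f ... = (SUM i<=Suc p. frag_cmul ((-1)^i) (SG f (O1 (del i (iot (Suc p))))))"
  by (simp add: SG_sum SG_cmul del: sum.atMost_Suc)
 also have "... = (SUM i<=Suc p. frag_cmul ((-1)^i) (SG (g i) c))"
  using O f by (intro sum.cong arg_cong[of _ _ "frag_cmul _"]) (auto simp: del_iot intro!: SG_face_natural)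
 finally show ?thesis .
qed

lemma aff_simplex:
 assumes "set l <= Sx p" "length l = Suc q" "y : Sx q"
 shows "aff l y : Sx p"
proof -
 have lj: "l ! j : Sx p" if "j <= q" for j using assms that by (auto intro!: nth_mem[THEN subsetD[rotated]])
 have "(SUM i<=p. aff l y i) = (SUM j<=q. y j*(SUM i<=p. (l ! j) i))"
  unfolding aff_def assms(2) lessThan_Suc_atMost sum_distrib_left by (rule sum.swap)
 also have "... = (SUM j<=q. y j)" using lj by (intro sum.cong) (auto simp: simplex_k_def)
 also have "... = 1" using assms(3) by (simp add: simplex_k_def)
 finally have 1: "(SUM i<=p. aff l y i) = 1" .
 have "0 <= aff l y i" for i unfolding aff_def using assms(2) simplex_coord[OF lj] simplex_coord[OF assms(3)] by (intro sum_nonneg mult_nonneg_nonneg) auto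
 moreover have "aff l y i = 0" if "i > p" for i unfolding aff_def using assms(2) lj that by (intro sum.neutral) (auto simp: simplex_k_def)
 ultimately show ?thesis using 1 by (simp add: simplex_k_def)
qed

lemma aff_lip:
 assumes len: "length l = Suc q" and D: "!!a b. a : set l ==> b : set l ==> l1 p a b <= D" and y: "y : Sx q" "y' : Sx q"
 shows "l1 p (aff l y) (aff l y') <= D * l1 q y y'"
proof -
 have z: "(SUM j<=q. y j - y' j) = 0" using y by (simp add: sum_subtractf simplex_k_def)
 have e: "aff l y i - aff l y' i = (SUM j<=q. (y j - y' j)*((l ! j) i - (l ! 0) i))" for i
 proof -
  have "aff l y i - aff l y' i = (SUM j<=q. (y j - y' j)*(l ! j) i)"
   unfolding aff_def len lessThan_Suc_atMost sum_subtractf[symmetric] by (simp add: left_diff_distrib)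
  moreover have "(SUM j<=q. (y j - y' j)*(l ! 0) i) = 0" using z by (simp add: sum_distrib_right[symmetric])
  ultimately show ?thesis by (simp add: right_diff_distrib sum_subtractf)
 qed
 have "l1 p (aff l y) (aff l y') <= (SUM i<=p. SUM j<=q. \<bar>y j - y' j\<bar>*\<bar>(l ! j) i - (l ! 0) i\<bar>)"
  unfolding l1_def e abs_mult[symmetric] by (intro sum_mono sum_abs)
 also have "... = (SUM j<=q. \<bar>y j - y' j\<bar> * l1 p (l ! j) (l ! 0))" unfolding l1_def sum_distrib_left by (rule sum.swap)
 also have "... <= (SUM j<=q. \<bar>y j - y' j\<bar> * D)" using D len by (intro sum_mono mult_left_mono) auto
 also have "... = D * l1 q y y'" unfolding l1_def sum_distrib_right[symmetric] by (rule mult.commute)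
 finally show ?thesis .
qed

lemma sg_lipl:
 assumes L: "lipl p L W sig" and W: "!!y. y : Sx q ==> aff l y : W" and len: "length l = Suc q"
  and D: "0 <= D" "!!a b. a : set l ==> b : set l ==> l1 p a b <= D"
 shows "lipl q (L * D) (Sx q) (sg sig l)"
 unfolding lipl_def
proof (intro conjI ballI)
 have L0: "0 <= L" using L by (simp add: lipl_def)
 thus "0 <= L * D" using D by simp
 fix y y' assume y: "y : Sx q" "y' : Sx q"
 have "dist (sg sig l y) (sg sig l y') = dist (sig (aff l y)) (sig (aff l y'))" using y len by (simp add: sg_def)
 also have "... <= L * l1 p (aff l y) (aff l y')" using L W[OF y(1)] W[OF y(2)] by (simp add: lipl_def)
 also have "... <= L*(D * l1 q y y')" using aff_lip[OF len D(2) y] L0 by (rule mult_left_mono)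
 finally show "dist (sg sig l y) (sg sig l y') <= L * D * l1 q y y'" by (simp add: mult.assoc)
qed

lemma sg_lip_simplex:
 assumes s: "lip_simplex S p sig" and l: "set l <= Sx p" "length l = Suc q"
 shows "lip_simplex S q (sg sig l)"
proof -
 obtain L where L: "lipl p L (Sx p) sig" using s by (auto simp: lip_simplex_iff)
 have "lipl q (L*2) (Sx q) (sg sig l)"
  
 proof (rule sg_lipl[OF L _ l(2)])
  show "l1 p a b <= 2" if "a : set l" "b : set l" for a b using that l(1) by (intro simplex_diam) auto
 qed (use aff_simplex[OF l] in auto)
 thus ?thesis using s aff_simplex[OF l] l(2) unfolding lip_simplex_iff by (auto simp: sg_def)
qed

lemma simplex_convex:
 assumes "x : Sx p" "y : Sx p" "0 <= t" "t <= 1"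
 shows "(%i. (1 - t) * x i + t * y i) : Sx p"
 using assms by (auto simp: simplex_k_def sum.distrib sum_distrib_left[symmetric])

definition SDs :: "nat => nat => (pt => 'a) => ((pt => 'a) \<Rightarrow>\<^sub>0 int)" where
 "SDs M p sig = SG sig (Sd M (Suc p) (iot p))"

definition Ts :: "nat => nat => (pt => 'a) => ((pt => 'a) \<Rightarrow>\<^sub>0 int)" where
 "Ts M p sig = SG sig (Tl M (Suc p) (iot p))"

lemma Sd_simplex:
 assumes M: "0 < M" and l: "length l = q" "set l <= Sx p" "m : kys (Sd M q l)"
 shows "set m <= Sx p & (ALL x:set m. ALL y:set m. l1 p x y <= real q*2/real M)"
 by (rule Sd_mesh[OF _ _ M l]) (auto intro: simplex_convex simplex_diam)

lemma Tl_simplex: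
 assumes M: "0 < M" and l: "length l = q" "set l <= Sx p" "m : kys (Tl M q l)"
 shows "length m = Suc q & set m <= Sx p"
 by (rule Tl_keys[OF _ _ M l, where K=p and D=2]) (auto intro: simplex_convex simplex_diam)

lemma face_aff:
 assumes "set l <= Sx p" "y : Sx (length l - 1)" "l ~= []"
 shows "sig (face_map i (aff l y)) = face (Suc p) i sig (aff l y)"
 using aff_simplex[OF assms(1), of "length l - 1" y] assms by (simp add: face_apply)

lemma sum_SG_faces:
 "(SUM i<=Suc p. frag_cmul ((-1)^i) (SG (face (Suc p) i sig) c)) = frag_extend (%tau. SG tau c) (sface (Suc p) sig)"
 by (simp add: sface_def frag_extend_sum frag_extend_cmul o_def del: sum.atMost_Suc)

lemma sbd_Ts: 
 assumes M: "0 < M" and ext: "!!x. x ~: Sx p ==> sig x = undefined"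
 shows "sbd (Suc p) (Ts M p sig) = frag_of sig - SDs M p sig - frag_extend (Ts M (p - 1)) (sface p sig)"
proof -
 have "sbd (Suc p) (Ts M p sig) = SG sig (BD (Tl M (Suc p) (iot p)))"
  unfolding Ts_def by (rule sbd_SG) (use Tl_simplex[OF M length_iot set_iot] in blast)
 also have "... = frag_of sig - SDs M p sig - SG sig (frag_extend (Tl M p) (bd (iot p)))"
  using BD_Tl[of "iot p" p M] sg_iot[OF ext] by (simp add: SG_diff SDs_def del: Tl.simps Sd.simps)
 also have "SG sig (frag_extend (Tl M p) (bd (iot p))) = frag_extend (Ts M (p - 1)) (sface p sig)"
 proof (cases p)
  case 0
  have "frag_extend (Tl M 0) (bd (iot 0)) = 0" by (rule frag_extend_eq_0) simp
  thus ?thesis using 0 by (simp add: sface_def)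
 next
  case (Suc q)
  have "SG sig (frag_extend (Tl M (Suc q)) (bd (iot (Suc q)))) = (SUM i<=Suc q. frag_cmul ((-1)^i) (SG (face (Suc q) i sig) (Tl M (Suc q) (iot q))))"
  proof (rule SG_bd_natural)
   fix i assume "i <= Suc q"
   show "Tl M (Suc q) (map (face_map i) (iot q)) = lmap (face_map i) (Tl M (Suc q) (iot q))"
    using Tl_natural[of "face_map i" "iot q" "Suc q" M] face_map_linear by simp
   fix l y assume l: "l : kys (Tl M (Suc q) (iot q))" "y : Sx (length l - 1)"
   have "length l = Suc (Suc q)" "set l <= Sx q" using Tl_simplex[OF M length_iot set_iot l(1)] by auto
   thus "sig (face_map i (aff l y)) = face (Suc q) i sig (aff l y)" by (intro face_aff l(2)) auto
  qed
  also have "... = frag_extend (Ts M q) (sface (Suc q) sig)" unfolding sum_SG_faces Ts_def ..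
  finally show ?thesis using Suc by simp
 qed
 finally show ?thesis .
qed

lemma sbd_sbd:
 assumes ext: "!!sig x. sig : kys c ==> x ~: Sx (Suc (Suc p)) ==> sig x = undefined"
 shows "sbd (Suc p) (sbd (Suc (Suc p)) c) = 0"
proof -
 have "sbd (Suc p) (sface (Suc (Suc p)) sig) = 0" if "sig : kys c" for sig
 proof -
  have s: "sig = sg sig (iot (Suc (Suc p)))" using sg_iot[of "Suc (Suc p)" sig] ext[OF that] by simp
  have "sface (Suc (Suc p)) (sg sig (iot (Suc (Suc p)))) = SG sig (bd (iot (Suc (Suc p))))" by (rule sface_sg) simp
  moreover have "sbd (Suc p) (SG sig (bd (iot (Suc (Suc p))))) = SG sig (BD (bd (iot (Suc (Suc p)))))"
   by (rule sbd_SG) (use length_kys_bd[of "iot (Suc (Suc p))" "Suc (Suc p)"] in simp)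
  ultimately show ?thesis using s by simp
 qed
 moreover have "sbd (Suc p) (sbd (Suc (Suc p)) c) = frag_extend (%sig. sbd (Suc p) (sface (Suc (Suc p)) sig)) c"
  unfolding sbd_def by (rule frag_extend_extend)
 ultimately show ?thesis by (simp add: frag_extend_eq_0)
qed

section \<open>Mass and filling volume in the free abelian group\<close>

definition fmass :: "nat => ((pt => 'a::metric_space) \<Rightarrow>\<^sub>0 int) => ennreal" where
 "fmass k c = (SUM sig:kys c. ennreal \<bar>real_of_int (lkp c sig)\<bar> * simplex_volume k sig)"

lemma fmass_superset: "finite S ==> kys c <= S ==> fmass k c = (SUM sig:S. ennreal \<bar>real_of_int (lkp c sig)\<bar> * simplex_volume k sig)"
 unfolding fmass_def by (rule sum.mono_neutral_left) (auto simp: in_keys_iff)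

lemma fmass_add: "fmass k (a + b) <= fmass k a + fmass k b"
proof -
 let ?S = "kys a Un kys b"
 have "fmass k (a + b) = (SUM sig:?S. ennreal \<bar>real_of_int (lkp (a + b) sig)\<bar> * simplex_volume k sig)"
  by (rule fmass_superset) (auto simp: Poly_Mapping.keys_add)
 also have "... <= (SUM sig:?S. ennreal \<bar>real_of_int (lkp a sig)\<bar> * simplex_volume k sig + ennreal \<bar>real_of_int (lkp b sig)\<bar> * simplex_volume k sig)"
 proof (rule sum_mono)
  fix sig
  have "ennreal \<bar>real_of_int (lkp (a + b) sig)\<bar> <= ennreal (\<bar>real_of_int (lkp a sig)\<bar> + \<bar>real_of_int (lkp b sig)\<bar>)"
   by (intro ennreal_leI) (simp add: lookup_add)
  also have "... = ennreal \<bar>real_of_int (lkp a sig)\<bar> + ennreal \<bar>real_of_int (lkp b sig)\<bar>" by (rule ennreal_plus) auto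
  finally show "ennreal \<bar>real_of_int (lkp (a + b) sig)\<bar> * simplex_volume k sig <= ennreal \<bar>real_of_int (lkp a sig)\<bar> * simplex_volume k sig + ennreal \<bar>real_of_int (lkp b sig)\<bar> * simplex_volume k sig"
   unfolding distrib_right[symmetric] by (rule mult_right_mono) simp
 qed
 also have "... = fmass k a + fmass k b" using fmass_superset[of ?S a] fmass_superset[of ?S b] by (simp add: sum.distrib)
 finally show ?thesis .
qed

lemma fmass_0 [simp]: "fmass k 0 = 0" and fmass_of [simp]: "fmass k (frag_of sig) = simplex_volume k sig"
 by (simp_all add: fmass_def)

lemma fmass_minus [simp]: "fmass k (- a) = fmass k a"
 by (simp add: fmass_def)

lemma fmass_diff: "fmass k (a - b) <= fmass k a + fmass k b"
 using fmass_add[of k a "- b"] by simp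

lemma fmass_sum: "fmass k (sum b I) <= (SUM i:I. fmass k (b i))"
proof (induction I rule: infinite_finite_induct)
 case (insert i I)
 thus ?case using fmass_add[of k "b i" "sum b I"] by (simp add: add_left_mono order_trans)
qed auto

lemma fmass_cmul: "fmass k (frag_cmul t a) <= ennreal \<bar>real_of_int t\<bar> * fmass k a"
proof (cases "t = 0")
 case False
 hence "kys (frag_cmul t a) = kys a" by auto
 hence "fmass k (frag_cmul t a) = (SUM sig:kys a. ennreal \<bar>real_of_int t\<bar>*(ennreal \<bar>real_of_int (lkp a sig)\<bar> * simplex_volume k sig))"
  unfolding fmass_def by (intro sum.cong) (auto simp: abs_mult ennreal_mult mult.assoc)
 thus ?thesis by (simp add: fmass_def sum_distrib_left)
qed simp

lemma fmass_bound:
 assumes "!!sig. sig : kys c ==> simplex_volume k sig <= ennreal B" "0 <= B"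
 shows "fmass k c <= ennreal (B * fn c)"
proof -
 have "fmass k c <= (SUM sig:kys c. ennreal (\<bar>real_of_int (lkp c sig)\<bar> * B))"
  unfolding fmass_def using assms by (intro sum_mono) (simp add: ennreal_mult mult_left_mono)
 also have "... = ennreal (SUM sig:kys c. \<bar>real_of_int (lkp c sig)\<bar> * B)" using assms(2) by (intro sum_ennreal) auto
 also have "(SUM sig:kys c. \<bar>real_of_int (lkp c sig)\<bar> * B) = B * fn c" unfolding fn_def sum_distrib_right[symmetric] by (rule mult.commute)
 finally show ?thesis .
qed

definition toF :: "((pt => 'a) => int) => ((pt => 'a) \<Rightarrow>\<^sub>0 int)" where
 "toF c = Abs_poly_mapping c"

lemma lkp_toF: "finite (supp c) ==> lkp (toF c) = c"
 unfolding toF_def by (rule Abs_poly_mapping_inverse) (simp add: supp_def)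

lemma supp_lkp: "supp (lkp c) = kys c"
 by (auto simp: supp_def in_keys_iff)

lemma boundary_lkp: "boundary (Suc k) (lkp c) = lkp (sbd (Suc k) c)"
proof
 fix tau
 have "lkp (sbd (Suc k) c) tau = (SUM sig:kys c. lkp c sig*(SUM i<=Suc k. (-1)^i*(if tau = face (Suc k) i sig then 1 else 0)))"
  unfolding sbd_def frag_extend_def sface_def by (simp add: lookup_sum del: sum.atMost_Suc)
 also have "... = (SUM sig:kys c. SUM i<=Suc k. if face (Suc k) i sig = tau then (-1)^i * lkp c sig else 0)"
  unfolding sum_distrib_left by (intro sum.cong refl) auto
 finally show "boundary (Suc k) (lkp c) tau = lkp (sbd (Suc k) c) tau" unfolding boundary_def supp_lkp by simp
qed

lemma mass_lkp: "mass k (lkp c) = fmass k c"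
 unfolding mass_def fmass_def supp_lkp by simp

lemma filling_volume_le:
 assumes "!!sig. sig : kys gam ==> lip_simplex S (Suc m) sig" "sbd (Suc m) gam = alp"
 shows "filling_volume S m (lkp alp) <= fmass (Suc m) gam"
 unfolding filling_volume_def
proof (rule Inf_lower, rule CollectI, intro exI conjI)
 show "fmass (Suc m) gam = mass (Suc m) (lkp gam)" by (simp add: mass_lkp)
 show "lip_chain S (Suc m) (lkp gam)" using assms(1) by (simp add: lip_chain_def supp_lkp)
 show "boundary (Suc m) (lkp gam) = lkp alp" using assms(2) by (simp add: boundary_lkp)
qed

section \<open>Pushing many simplices with one choice of weights\<close>

definition restr :: "nat => (pt => 'a) => (pt => 'a)" where
 "restr k f = (%x. if x : Sx k then f x else undefined)"

text \<open>Reweight the coordinates by \<open>a\<close>, push to the \<open>k\<close>-skeleton, and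
  map to \<open>Z\<close>. The same \<open>a\<close> is used for everything, so the map depends on
  the coordinates alone and common faces remain common.\<close>

definition FF :: "'a::metric_space set => real => (nat => 'a) => nat => nat => pt => pt => 'a" where
 "FF Z c z k M a p = hh Z c z (pP k M (%i. a i * p i))"

lemma wvol_empty: "cel k j q = {} ==> wvol k f j q = 0"
 by (simp add: wvol_def cnt_def)

lemma l1_scale:
 assumes "!!i. 1 <= a i & a i <= (2::real)"
 shows "l1 M (%i. a i * p i) (%i. a i * q i) <= 2 * l1 M p q"
proof -
 have "\<bar>a i * p i - a i * q i\<bar> <= 2*\<bar>p i - q i\<bar>" for i
 proof -
  have "\<bar>a i * p i - a i * q i\<bar> = a i*\<bar>p i - q i\<bar>" using assms[of i] by (simp add: right_diff_distrib[symmetric] abs_mult)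
  also have "... <= 2*\<bar>p i - q i\<bar>" using assms[of i] by (intro mult_right_mono) auto
  finally show ?thesis .
 qed
 thus ?thesis unfolding l1_def sum_distrib_left by (intro sum_mono)
qed

lemma sup_of_pP:
 assumes a: "!!i. 1 <= a i & a i <= (2::real)" and Y: "0 < pY k M (%i. a i * p i)"
 shows "sup_of (pP k M (%i. a i * p i)) <= sup_of p" "card (sup_of (pP k M (%i. a i * p i))) <= Suc k"
proof -
 have e: "sup_of (pP k M (%i. a i * p i)) = {i. i <= M & thr k M (%i. a i * p i) < a i * p i}"
  unfolding sup_of_def by (rule pP_support[OF Y])
 show "sup_of (pP k M (%i. a i * p i)) <= sup_of p"
  unfolding e using thr_nonneg[of k M "%i. a i * p i"] by (auto simp: sup_of_def)
 show "card (sup_of (pP k M (%i. a i * p i))) <= Suc k" unfolding e by (rule thr_card)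
qed

lemma FF_in:
 assumes Y: "lip_connected_const Z n c" and zY: "!!i. z i : Z" and k: "k <= Suc n" and a: "!!i. 1 <= a i & a i <= (2::real)"
  and p: "0 < pY k M (%i. a i * p i)"
 shows "FF Z c z k M a p : Z"
 unfolding FF_def using sup_of_pP(2)[OF a p] k by (intro hh_in[OF Y zY pP_simplex[OF p]]) simp

lemma FF_lip:
 assumes Y: "lip_connected_const Z n c" and zY: "!!i. z i : Z" and k: "k <= Suc n" and a: "!!i. 1 <= a i & a i <= (2::real)"
  and r: "0 < r" "r <= pY k M (%i. a i * p i)" "r <= pY k M (%i. a i * q i)"
  and s: "0 <= s" "!!i j. i : sup_of p Un sup_of q ==> j : sup_of p Un sup_of q ==> dist (z i) (z j) <= s"
 shows "dist (FF Z c z k M a p) (FF Z c z k M a q) <= (9 * hh_const c n + 1) * s*(2/r * real (2 * k + 3)*(2 * l1 M p q))"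
proof -
 let ?p = "%i. a i * p i" and ?q = "%i. a i * q i"
 have P: "0 < pY k M ?p" "0 < pY k M ?q" using r by linarith+
 have "dist (FF Z c z k M a p) (FF Z c z k M a q) <= (9 * hh_const c n + 1) * s * l1 M (pP k M ?p) (pP k M ?q)"
  unfolding FF_def
 proof (rule hh_lip[OF Y zY pP_simplex[OF P(1)] pP_simplex[OF P(2)] _ _ s(1)])
  show "card (sup_of (pP k M ?p)) <= Suc (Suc n)" "card (sup_of (pP k M ?q)) <= Suc (Suc n)"
   using sup_of_pP(2)[OF a P(1)] sup_of_pP(2)[OF a P(2)] k by simp_all
  fix i j assume "i : sup_of (pP k M ?p) Un sup_of (pP k M ?q)" "j : sup_of (pP k M ?p) Un sup_of (pP k M ?q)"
  thus "dist (z i) (z j) <= s" using sup_of_pP(1)[OF a P(1)] sup_of_pP(1)[OF a P(2)] by (intro s(2)) blast+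
 qed
 also have "... <= (9 * hh_const c n + 1) * s*(2/r * real (2 * k + 3)*(2 * l1 M p q))"
 proof (rule mult_left_mono)
  have "l1 M (pP k M ?p) (pP k M ?q) <= 2/r * real (2 * k + 3) * l1 M ?p ?q" by (rule pP_lip[OF r])
  also have "... <= 2/r * real (2 * k + 3)*(2 * l1 M p q)" using r l1_scale[OF a] by (intro mult_left_mono) auto
  finally show "l1 M (pP k M ?p) (pP k M ?q) <= 2/r * real (2 * k + 3)*(2 * l1 M p q)" .
 qed (use s hh_const_nonneg[of c n] in auto)
 finally show ?thesis .
qed

text \<open>The Lipschitz factor of \<open>FF\<close> without its denominator, raised to the
  dimension, times the average of the inverse \<open>k\<close>-th power of that denominator.\<close>

definition push_const :: "real => nat => nat => nat => real => real" where
 "push_const c n k N C1 = (8*(9 * hh_const c n + 1) * real (2 * k + 3) * C1)^k*(2 * avg_const N k)"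

lemma half_le:
 fixes y p k :: real
 shows "\<bar>y - p\<bar> <= k/2 ==> k < y ==> y/2 <= p" and "y/2 <= p ==> k < y ==> k/2 <= p"
 by linarith+

text \<open>The simplices of the filling and the pieces of the boundary prism need the same weights,
  so both are treated as abstract items: \<open>u io\<close> are the coordinates,
  \<open>d io\<close> is the distance to compare with, and \<open>V io\<close> the volume of cells
  in that distance. \<open>loc\<close> says that the spread of the labels times the change of
  coordinates is controlled by \<open>d io\<close>; the scale of a Whitney piece cancels in this
  product.\<close>

lemma push_items:
 fixes Z :: "'a::metric_space set" and u :: "'i => pt => nat => real"
  and d :: "'i => pt => pt => real" and V :: "'i => nat => (nat => nat) => ennreal"
  and V0 co :: "'i => real"
 assumes Y: "lip_connected_const Z n c" and zY: "!!i. z i : Z" and k: "0 < k" "k <= Suc n" and I: "finite I"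
  and co: "!!io. io : I ==> 0 <= co io"
  and u: "!!io x. io : I ==> x : Sx k ==> u io x : Sx M"
  and N: "!!io x. io : I ==> x : Sx k ==> card {i. u io x i ~= 0} <= N"
  and Lu: "0 <= Lu" "!!io x y. io : I ==> x : Sx k ==> y : Sx k ==> l1 M (u io x) (u io y) <= Lu * l1 k x y"
  and eta: "0 < \<eta>" and C1: "0 < C1"
  and loc: "!!io x y. io : I ==> x : Sx k ==> y : Sx k ==> l1 k x y <= \<eta> ==>
   EX s>=0. (ALL i:sup_of (u io x) Un sup_of (u io y). ALL j:sup_of (u io x) Un sup_of (u io y). dist (z i) (z j) <= s) &
    s * l1 M (u io x) (u io y) <= C1 * d io x y"
  and V: "!!io j q g L lmb. io : I ==> 0 < lmb ==> lipl k L (Sx k) (g :: pt => 'a) ==>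
   (!!x y. x : cel k j q ==> y : cel k j q ==> dist (g x) (g y) <= lmb * d io x y) ==> wvol k g j q <= ennreal (lmb^k) * V io j q"
  and V0: "!!io. io : I ==> 0 <= V0 io" "!!io j. io : I ==> (SUM q:QS k j. V io j q) <= ennreal (V0 io)"
  and del: "0 < dlt"
 shows "EX a. (ALL i. 1 <= a i & a i <= 2) & (ALL io:I. lip_simplex Z k (restr k (%x. FF Z c z k M a (u io x)))) &
   (SUM io:I. ennreal (co io) * simplex_volume k (restr k (%x. FF Z c z k M a (u io x)))) <= ennreal (push_const c n k N C1*((SUM io:I. co io * V0 io) + dlt))"
proof -
 define B where "B = 9 * hh_const c n + 1"
 define D2 where "D2 = real (2 * k + 3)"
 have B1: "1 <= B" unfolding B_def using hh_const_nonneg[of c n] by simp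
 have D1: "1 <= D2" unfolding D2_def by simp
 \<comment> \<open>\<open>E/2^R\<close> bounds the oscillation of \<open>pY\<close> over a cell of
   level \<open>R\<close>. Since \<open>\<kappa>\<close> is at least \<open>2 * E\<close>, a value
   above \<open>\<kappa>/2^R\<close> at one point of the cell drops by at most half elsewhere in
   it.\<close>
 define E where "E = 4 * real k * D2 * Lu"
 have E0: "0 <= E" unfolding E_def using D1 Lu by simp
 define \<kappa> where "\<kappa> = max 1 (2 * E)"
 have kap: "1 <= \<kappa>" "2 * E <= \<kappa>" unfolding \<kappa>_def by auto
 define cc where "cc = cnt_const N k"
 have cc0: "0 <= cc" unfolding cc_def by (rule cnt_const_nonneg)
 \<comment> \<open>There are \<open>O(2^(R k))\<close> cells, each bad with probability
   \<open>O(2^(-R (k + 1)))\<close>; the expected number of bad cells is at most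
   \<open>X/2^R\<close>, which a large \<open>R\<close> makes at most 1/4.\<close>
 define X where "X = real (card I)*2^k * cc*\<kappa>^Suc k"
 obtain R :: nat where R: "max (2 * real k/\<eta>) (4 * X) < 2^R" using real_arch_pow[of 2 "max (2 * real k/\<eta>) (4 * X)"] by auto
 have R1: "2 * real k/2^R <= \<eta>" using R eta by (simp add: field_simps)
 have R2: "X/2^R <= 1/4" using R by (simp add: field_simps)
 define Q1 where "Q1 = {q : QS k R. cel k R q ~= {}}"
 have Q1: "finite Q1" "Q1 <= QS k R" unfolding Q1_def by auto
 define rep where "rep = (%q. SOME x. x : cel k R q)"
 have rep: "rep q : cel k R q" if qQ: "q : Q1" for q
 proof -
  obtain x where "x : cel k R q" using qQ by (auto simp: Q1_def)
  thus ?thesis unfolding rep_def by (rule someI[where P="%x. x : cel k R q"])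
 qed
 have reps: "rep q : Sx k" if "q : Q1" for q using rep[OF that] cel_sub by blast
 define Ce where "Ce = I \<times> Q1"
 have Ce: "finite Ce" unfolding Ce_def using I Q1 by simp
 \<comment> \<open>Averaging takes place at finitely many points, one representative for each item
   and cell; \<open>half\<close> carries the lower bound to the rest of the cell.\<close>
 define uc where "uc = (%e. u (fst e) (rep (snd e)))"
 define w where "w = (%e. co (fst e) * enn2real (V (fst e) R (snd e)))"
 define W where "W = (SUM io:I. co io * V0 io) + dlt"
 have W0: "0 < W" unfolding W_def using co V0(1) del by (intro add_nonneg_pos sum_nonneg) auto
 have Vfin: "V io R q < top" if "io : I" "q : Q1" for io q
 proof -
  have "V io R q <= (SUM q:QS k R. V io R q)" using that Q1 by (intro member_le_sum) auto
  also have "... <= ennreal (V0 io)" by (rule V0(2)[OF that(1)])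
  finally show ?thesis using ennreal_less_top le_less_trans by blast
 qed
 have Vsum: "(SUM q:Q1. enn2real (V io R q)) <= V0 io" if i: "io : I" for io
 proof -
  have "ennreal (SUM q:Q1. enn2real (V io R q)) = (SUM q:Q1. ennreal (enn2real (V io R q)))" by (rule sum_ennreal[symmetric]) simp
  also have "... = (SUM q:Q1. V io R q)" using Vfin[OF i] by (intro sum.cong) auto
  also have "... <= (SUM q:QS k R. V io R q)" using Q1 by (intro sum_mono2) auto
  also have "... <= ennreal (V0 io)" by (rule V0(2)[OF i])
  finally show ?thesis using V0(1)[OF i] by (simp add: ennreal_le_iff)
 qed
 have cs: "(SUM e:Ce. f (fst e) (snd e)) = (SUM io:I. SUM q:Q1. f io q)" for f :: "'i => (nat => nat) => real"
  unfolding Ce_def by (simp add: sum.cartesian_product split_def)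
 have wW: "(SUM e:Ce. w e) <= W"
 proof -
  have "(SUM e:Ce. w e) = (SUM io:I. SUM q:Q1. co io * enn2real (V io R q))" unfolding w_def by (rule cs)
  also have "... <= (SUM io:I. co io * V0 io)" unfolding sum_distrib_left[symmetric] using co Vsum by (intro sum_mono mult_left_mono) auto
  finally show ?thesis using del by (simp add: W_def)
 qed
 have small: "real (card Ce)*(cnt_const N k*(\<kappa>/2^R)^Suc k) <= 1/4"
 proof -
  have "card Ce <= card (I \<times> QS k R)" unfolding Ce_def using I Q1 by (intro card_mono) auto
  hence "real (card Ce) <= real (card I*(2^R + 1)^k)" by (simp only: card_cartesian_product card_QS of_nat_mono)
  also have "... = real (card I)*(2^R + 1)^k" by (simp add: add.commute)
  also have "... <= real (card I)*(2*2^R)^k" by (intro mult_left_mono power_mono) auto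
  finally have "real (card Ce)*(cc*(\<kappa>/2^R)^Suc k) <= real (card I)*(2*2^R)^k*(cc*(\<kappa>/2^R)^Suc k)"
   using cc0 kap by (intro mult_right_mono) auto
  also have "... = X/2^R" unfolding X_def by (simp add: power_mult_distrib power_divide)
  finally show ?thesis using R2 unfolding cc_def by linarith
 qed
 have "EX a. (ALL i. 1 <= a i & a i <= 2) & (ALL e:Ce. \<kappa>/2^R < pY k M (%i. a i * uc e i)) &
   (SUM e:Ce. w e*(1/(pY k M (%i. a i * uc e i))^k)) <= 2 * avg_const N k * W"
 proof (rule average_select[OF Ce _ _ _ wW W0 kap(1) small])
  fix e assume e: "e : Ce"
  show "uc e : Sx M" "card {i. uc e i ~= 0} <= N" "0 <= w e"
   using e u N co reps by (auto simp: uc_def Ce_def w_def)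
 qed
 then obtain a where a: "!!i. 1 <= a i & a i <= 2" and aY: "!!e. e : Ce ==> \<kappa>/2^R < pY k M (%i. a i * uc e i)"
  and asum: "(SUM e:Ce. w e*(1/(pY k M (%i. a i * uc e i))^k)) <= 2 * avg_const N k * W" by blast
 define Yc where "Yc = (%io q. pY k M (%i. a i * u io (rep q) i))"
 have YcR: "\<kappa>/2^R < Yc io q" if "io : I" "q : Q1" for io q
  using aY[of "(io, q)"] that by (simp add: Ce_def uc_def Yc_def)
 have kR: "0 < \<kappa>/2^R" using kap by simp
 have half: "Yc io q/2 <= pY k M (%i. a i * u io x i)" if i: "io : I" and q: "q : Q1" and x: "x : cel k R q" for io q x
 proof -
  have xs: "x : Sx k" using x cel_sub by blast
  have "\<bar>Yc io q - pY k M (%i. a i * u io x i)\<bar> <= D2 * l1 M (%i. a i * u io (rep q) i) (%i. a i * u io x i)"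
   unfolding Yc_def D2_def by (rule pY_lip)
  also have "... <= D2*(2*(Lu*(2 * real k/2^R)))"
  proof (rule mult_left_mono)
   have "l1 M (%i. a i * u io (rep q) i) (%i. a i * u io x i) <= 2 * l1 M (u io (rep q)) (u io x)" by (rule l1_scale[OF a])
   also have "... <= 2*(Lu * l1 k (rep q) x)" using Lu(2)[OF i reps[OF q] xs] by simp
   also have "... <= 2*(Lu*(2 * real k/2^R))" using cel_diam[OF rep[OF q] x] Lu(1) by (intro mult_left_mono) auto
   finally show "l1 M (%i. a i * u io (rep q) i) (%i. a i * u io x i) <= 2*(Lu*(2 * real k/2^R))" .
  qed (use D1 in simp)
  also have "... = E/2^R" unfolding E_def by simp
  also have "... <= (\<kappa>/2^R)/2" using kap(2) by (simp add: divide_right_mono field_simps)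
  finally show ?thesis by (rule half_le(1)[OF _ YcR[OF i q]])
 qed
 have cell: "EX q:Q1. x : cel k R q" if "x : Sx k" for x
  using that idx_in_QS[OF that, of R] by (intro bexI[of _ "idx k R x"]) (auto simp: Q1_def cel_def)
 define r0 where "r0 = \<kappa>/2^R/2"
 have r00: "0 < r0" unfolding r0_def using kR by simp
 have low: "r0 <= pY k M (%i. a i * u io x i)" if i: "io : I" and x: "x : Sx k" for io x
 proof -
  obtain q where q: "q : Q1" "x : cel k R q" using cell[OF x] by blast
  show ?thesis unfolding r0_def by (rule half_le(2)[OF half[OF i q] YcR[OF i q(1)]])
 qed
 \<comment> \<open>A crude bound for all label distances. It shows only that the pushed maps are
   Lipschitz at all; the volume estimate rests on \<open>loc\<close>.\<close>
 define S where "S = (SUM i<=M. SUM j<=M. dist (z i) (z j))"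
 have S0: "0 <= S" unfolding S_def by (intro sum_nonneg) auto
 have S: "dist (z i) (z j) <= S" if "i <= M" "j <= M" for i j
 proof -
  have "dist (z i) (z j) <= (SUM j<=M. dist (z i) (z j))" using that by (intro member_le_sum) auto
  also have "... <= S" unfolding S_def using that by (intro member_le_sum[of i _ "%i. SUM j<=M. dist (z i) (z j)"] sum_nonneg) auto
  finally show ?thesis .
 qed
 define G where "G = (%io. restr k (%x. FF Z c z k M a (u io x)))"
 have GL: "lipl k (B * S*(2/r0 * D2*2 * Lu)) (Sx k) (G io)" if i: "io : I" for io
  unfolding lipl_def
 proof (intro conjI ballI)
  show "0 <= B * S*(2/r0 * D2*2 * Lu)" using B1 S0 r00 D1 Lu(1) by simp
  fix x y assume xy: "x : Sx k" "y : Sx k"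
  have "dist (G io x) (G io y) = dist (FF Z c z k M a (u io x)) (FF Z c z k M a (u io y))" using xy by (simp add: G_def restr_def)
  also have "... <= (9 * hh_const c n + 1) * S*(2/r0 * real (2 * k + 3)*(2 * l1 M (u io x) (u io y)))"
  proof (rule FF_lip[OF Y zY k(2) a r00 low[OF i xy(1)] low[OF i xy(2)] S0])
   fix i' j assume "i' : sup_of (u io x) Un sup_of (u io y)" "j : sup_of (u io x) Un sup_of (u io y)"
   hence "i' : {..M}" "j : {..M}" using sup_of_simplex[OF u[OF i xy(1)]] sup_of_simplex[OF u[OF i xy(2)]] by blast+
   thus "dist (z i') (z j) <= S" by (intro S) auto
  qed
  also have "... <= (9 * hh_const c n + 1) * S*(2/r0 * real (2 * k + 3)*(2*(Lu * l1 k x y)))"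
   using Lu(2)[OF i xy] S0 r00 hh_const_nonneg[of c n] by (intro mult_left_mono) auto
  also have "... = B * S*(2/r0 * D2*2 * Lu) * l1 k x y" unfolding B_def D2_def by (simp only: mult_ac)
  finally show "dist (G io x) (G io y) <= B * S*(2/r0 * D2*2 * Lu) * l1 k x y" .
 qed
 have Gs: "lip_simplex Z k (G io)" if i: "io : I" for io
  unfolding lip_simplex_iff
 proof (intro conjI exI)
  show "lipl k (B * S*(2/r0 * D2*2 * Lu)) (Sx k) (G io)" by (rule GL[OF i])
  show "G io ` Sx k <= Z"
  proof (rule image_subsetI)
   fix x assume x: "x : Sx k"
   have "0 < pY k M (%i. a i * u io x i)" using low[OF i x] r00 by linarith
   from FF_in[OF Y zY k(2) a this] show "G io x : Z" using x by (simp add: G_def restr_def)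
  qed
 qed (simp add: G_def restr_def)
 \<comment> \<open>Of the 8, one factor 2 comes from halving \<open>Yc\<close>, one from the
   normalisation and one from the weights.\<close>
 define K1 where "K1 = 8 * B * D2 * C1"
 have K10: "0 < K1" unfolding K1_def using B1 D1 C1 by simp
 have wv: "wvol k (G io) R q <= ennreal ((K1/Yc io q)^k) * V io R q" if i: "io : I" and q: "q : Q1" for io q
 proof (rule V[OF i _ GL[OF i]])
  have Yp: "0 < Yc io q" using YcR[OF i q] kR by linarith
  show "0 < K1/Yc io q" using K10 Yp by simp
  fix x y assume xy: "x : cel k R q" "y : cel k R q"
  have xs: "x : Sx k" "y : Sx k" using xy cel_sub by blast+
  have "l1 k x y <= \<eta>" using cel_diam[OF xy] R1 by linarith
  from loc[OF i xs this] obtain s where s: "0 <= s"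
   "!!i' j. i' : sup_of (u io x) Un sup_of (u io y) ==> j : sup_of (u io x) Un sup_of (u io y) ==> dist (z i') (z j) <= s"
   "s * l1 M (u io x) (u io y) <= C1 * d io x y" by blast
  have Y2: "0 < Yc io q/2" using Yp by simp
  have "dist (G io x) (G io y) = dist (FF Z c z k M a (u io x)) (FF Z c z k M a (u io y))" using xs by (simp add: G_def restr_def)
  also have "... <= (9 * hh_const c n + 1) * s*(2/(Yc io q/2) * real (2 * k + 3)*(2 * l1 M (u io x) (u io y)))"
   by (rule FF_lip[OF Y zY k(2) a Y2 half[OF i q xy(1)] half[OF i q xy(2)] s(1) s(2)])
  also have "... = 8 * B * D2/Yc io q*(s * l1 M (u io x) (u io y))" unfolding B_def[symmetric] D2_def[symmetric] by simp
  also have "... <= 8 * B * D2/Yc io q*(C1 * d io x y)" using s(3) B1 D1 Yp by (intro mult_left_mono) auto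
  also have "... = K1/Yc io q * d io x y" unfolding K1_def by simp
  finally show "dist (G io x) (G io y) <= K1/Yc io q * d io x y" .
 qed
 define t where "t = (%io q. K1^k*(enn2real (V io R q)*(1/Yc io q^k)))"
 have Yp: "0 < Yc io q" if "io : I" "q : Q1" for io q using YcR[OF that] kR by linarith
 have t0: "0 <= t io q" if "io : I" "q : Q1" for io q unfolding t_def using K10 Yp[OF that] by simp
 have sv: "simplex_volume k (G io) <= ennreal (SUM q:Q1. t io q)" if i: "io : I" for io
 proof -
  have "simplex_volume k (G io) = (SUM q:QS k R. wvol k (G io) R q)" by (rule simplex_volume_sum[OF GL[OF i]])
  also have "... = (SUM q:Q1. wvol k (G io) R q)" using Q1 by (intro sum.mono_neutral_right) (auto simp: Q1_def wvol_empty)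
  also have "... <= (SUM q:Q1. ennreal (t io q))"
  proof (rule sum_mono)
   fix q assume q: "q : Q1"
   have "wvol k (G io) R q <= ennreal ((K1/Yc io q)^k) * V io R q" by (rule wv[OF i q])
   also have "V io R q = ennreal (enn2real (V io R q))" using Vfin[OF i q] by simp
   also have "ennreal ((K1/Yc io q)^k) * ennreal (enn2real (V io R q)) = ennreal ((K1/Yc io q)^k * enn2real (V io R q))"
    using K10 Yp[OF i q] by (intro ennreal_mult[symmetric]) auto
   also have "(K1/Yc io q)^k * enn2real (V io R q) = t io q" unfolding t_def by (simp add: power_divide)
   finally show "wvol k (G io) R q <= ennreal (t io q)" .
  qed
  also have "... = ennreal (SUM q:Q1. t io q)" using t0[OF i] by (intro sum_ennreal)
  finally show ?thesis .
 qed
 have "(SUM io:I. ennreal (co io) * simplex_volume k (G io)) <= (SUM io:I. ennreal (co io*(SUM q:Q1. t io q)))"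
 proof (rule sum_mono)
  fix io assume i: "io : I"
  have "ennreal (co io) * simplex_volume k (G io) <= ennreal (co io) * ennreal (SUM q:Q1. t io q)" by (rule mult_left_mono[OF sv[OF i]]) simp
  also have "... = ennreal (co io*(SUM q:Q1. t io q))" using co[OF i] t0[OF i] by (intro ennreal_mult[symmetric] sum_nonneg) auto
  finally show "ennreal (co io) * simplex_volume k (G io) <= ennreal (co io*(SUM q:Q1. t io q))" .
 qed
 also have "... = ennreal (SUM io:I. co io*(SUM q:Q1. t io q))" using co t0 by (intro sum_ennreal mult_nonneg_nonneg sum_nonneg) auto
 also have "(SUM io:I. co io*(SUM q:Q1. t io q)) = (SUM io:I. SUM q:Q1. K1^k*(co io * enn2real (V io R q)*(1/Yc io q^k)))"
  unfolding sum_distrib_left t_def by (intro sum.cong refl) (simp only: mult_ac)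
 also have "... = (SUM e:Ce. K1^k*(w e*(1/(pY k M (%i. a i * uc e i))^k)))"
  unfolding w_def uc_def cs[where f="%io q. K1^k*(co io * enn2real (V io R q)*(1/pY k M (%i. a i * u io (rep q) i)^k))"] Yc_def ..
 also have "... = K1^k*(SUM e:Ce. w e*(1/(pY k M (%i. a i * uc e i))^k))" by (rule sum_distrib_left[symmetric])
 also have "ennreal ... <= ennreal (K1^k*(2 * avg_const N k * W))" using asum K10 by (intro ennreal_leI mult_left_mono) auto
 also have "K1^k*(2 * avg_const N k * W) = push_const c n k N C1 * W" unfolding push_const_def K1_def B_def D2_def by simp
 finally have fin: "(SUM io:I. ennreal (co io) * simplex_volume k (G io)) <= ennreal (push_const c n k N C1 * W)" .
 show ?thesis using a Gs fin unfolding G_def W_def by (intro exI[of _ a]) auto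
qed

lemma sum_list_index:
 fixes g :: "'v => real"
 assumes "distinct vs" "length vs <= M"
 shows "(SUM i<=M. if i < length vs then g (vs ! i) else 0) = (SUM v:set vs. g v)"
proof -
 have "(SUM i<=M. if i < length vs then g (vs ! i) else 0) = (SUM i<length vs. if i < length vs then g (vs ! i) else 0)"
  using assms(2) by (intro sum.mono_neutral_right) auto
 also have "... = (SUM i<length vs. g (vs ! i))" by (intro sum.cong) auto
 also have "... = (SUM v:set vs. g v)" using sum.reindex_bij_betw[OF bij_betw_nth[OF assms(1) refl refl], of g] by simp
 finally show ?thesis .
qed

text \<open>Compactness leaves finitely many pieces, which take the first labels. The points of
  \<open>P\<close> get labels of their own behind them, with weight zero in \<open>phi\<close>; they
  are the targets of the prism at the boundary, where a vertex of the cycle is to be labelled by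
  itself.\<close>

lemma partition_coordinates:
 fixes Z K P :: "'a::metric_space set" and w :: "'v => 'a => real"
 assumes e: "0 < eps" and Z: "Z ~= {}" and K: "compact K" and P: "finite P" "P <= Z"
  and w1: "!!v x y. \<bar>w v x - w v y\<bar> <= dist x y" and w0: "!!v x. 0 <= w v x" and zz: "!!v. zz v : Z"
  and lf: "!!x. finite {v. EX y. dist x y < eps/16 & 0 < w v y}" "!!x. card {v. EX y. dist x y < eps/16 & 0 < w v y} <= N"
  and tot: "!!x. rad Z eps x/16 <= (SUM v:{v. 0 < w v x}. w v x)"
  and zd: "!!v x. 0 < w v x ==> dist x (zz v) <= C * rad Z eps x"
 shows "EX M z phi lab. (ALL i. z i : Z) & (ALL p:P. lab p <= M & z (lab p) = p) &
   (ALL x:K. phi x : Sx M & card {i. phi x i ~= 0} <= N & (ALL i. phi x i ~= 0 --> dist x (z i) <= C * rad Z eps x)) &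
   (ALL x:K. ALL y:K. dist x y < eps/16 --> l1 M (phi x) (phi y) <= 64 * real N/rad Z eps x * dist x y)"
proof -
 have rad0: "eps <= rad Z eps x" for x by (simp add: rad_def)
 define NV where "NV = (%x. {v. EX y. dist x y < eps/16 & 0 < w v y})"
 have NV: "finite (NV x)" "card (NV x) <= N" for x unfolding NV_def using lf by auto
 have "K <= (UN x:K. ball x (eps/16))" using e by force
 then obtain T where T: "T <= K" "finite T" "K <= (UN x:T. ball x (eps/16))"
  using compactE_image[OF K, of K "%x. ball x (eps/16)"] by auto
 define V0 where "V0 = (UN x:T. NV x)"
 have V0: "finite V0" unfolding V0_def using T NV by auto
 have inV: "v : V0" if x: "x : K" and v: "0 < w v x" for x v
 proof -
  obtain t where "t : T" "x : ball t (eps/16)" using T(3) x by blast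
  thus ?thesis using v unfolding V0_def NV_def by auto
 qed
 obtain vs where vs: "set vs = V0" "distinct vs" using finite_distinct_list[OF V0] by blast
 obtain ps where ps: "set ps = P" using finite_list[OF P(1)] by blast
 obtain z0 where z0: "z0 : Z" using Z by blast
 define M where "M = length vs + length ps"
 define z where "z = (%i. if i < length vs then zz (vs ! i) else if i < M then ps ! (i - length vs) else z0)"
 define lab where "lab = (%p. length vs + (SOME j. j < length ps & ps ! j = p))"
 have zZ: "z i : Z" for i
 proof -
  have "ps ! (i - length vs) : P" if "\<not> i < length vs" "i < M" using that ps nth_mem[of "i - length vs" ps] by (auto simp: M_def)
  thus ?thesis using zz z0 P(2) by (auto simp: z_def)
 qed
 have lab: "lab p <= M & z (lab p) = p" if pP: "p : P" for p
 proof -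
  obtain j where "j < length ps & ps ! j = p" using pP ps by (auto simp: in_set_conv_nth)
  from someI[of "%j. j < length ps & ps ! j = p", OF this] show ?thesis by (simp add: lab_def z_def M_def)
 qed
 define f where "f = (%x i. if i < length vs then w (vs ! i) x else 0)"
 define S where "S = (%x. SUM v:V0. w v x)"
 define phi where "phi = (%x i. f x i/S x)"
 have lM: "length vs <= M" by (simp add: M_def)
 have S: "rad Z eps x/16 <= S x" if "x : K" for x
 proof -
  have "(SUM v:{v. 0 < w v x}. w v x) = S x" unfolding S_def
   using inV[OF that] V0 w0[of _ x] by (intro sum.mono_neutral_left) (auto simp: not_less antisym)
  thus ?thesis using tot[of x] by simp
 qed
 have S0: "0 < S x" if "x : K" for x using S[OF that] rad0[of x] e by linarith
 have sf: "(SUM i<=M. f x i) = S x" for x unfolding f_def S_def vs(1)[symmetric] by (rule sum_list_index[OF vs(2) lM])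
 have f0: "0 <= f x i" for x i using w0 by (simp add: f_def)
 have simp: "phi x : Sx M" if x: "x : K" for x
  unfolding simplex_k_def
 proof (intro CollectI conjI allI impI)
  show "(SUM i<=M. phi x i) = 1" unfolding phi_def sum_divide_distrib[symmetric] sf using S0[OF x] by simp
  show "phi x i = 0" if "i > M" for i using that lM by (simp add: phi_def f_def)
  show "0 <= phi x i" for i unfolding phi_def using f0[of x i] S0[OF x] by simp
 qed
 have nz: "i < length vs & 0 < w (vs ! i) x" if "phi x i ~= 0" for x i
  using that w0[of "vs ! i" x] by (auto simp: phi_def f_def split: if_splits)
 have cd: "card {i. phi x i ~= 0} <= N" for x
 proof -
  have "card {i. phi x i ~= 0} <= card (NV x)"
  proof (rule card_inj_on_le[of "(!) vs"])
   show "inj_on ((!) vs) {i. phi x i ~= 0}" using nz vs(2) by (auto intro!: inj_onI simp: nth_eq_iff_index_eq)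
   show "(!) vs ` {i. phi x i ~= 0} <= NV x" using nz e by (auto simp: NV_def intro!: exI[of _ x])
  qed (rule NV)
  thus ?thesis using NV(2)[of x] by simp
 qed
 have near: "dist x (z i) <= C * rad Z eps x" if "phi x i ~= 0" for x i
  using nz[OF that] zd[of "vs ! i" x] by (simp add: z_def)
 have lip: "l1 M (phi x) (phi y) <= 64 * real N/rad Z eps x * dist x y" if x: "x : K" and y: "y : K" and d: "dist x y < eps/16" for x y
 proof -
  \<comment> \<open>Half of the lower bound \<open>rad Z eps x/16\<close>, so that it is valid at
    \<open>y\<close> as well; normalising then gives 2 * 32 = 64.\<close>
  define r where "r = rad Z eps x/32"
  have r0: "0 < r" unfolding r_def using rad0[of x] e by linarith
  have rx: "r <= S x" using S[OF x] r0 unfolding r_def by linarith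
  have "\<bar>rad Z eps x - rad Z eps y\<bar> <= dist x y" by (rule rad_lip)
  hence ry: "r <= S y" using S[OF y] d rad0[of x] e unfolding r_def by linarith
  have ab: "\<bar>S x - S y\<bar> <= l1 M (f x) (f y)" unfolding sf[symmetric] l1_def sum_subtractf[symmetric] by (rule sum_abs)
  have y0: "l1 M (f y) (%_. 0) <= 1 * S y" unfolding l1_def sf[symmetric] using f0 by simp
  have "l1 M (phi x) (phi y) <= (1 + 1)/r * l1 M (f x) (f y)" unfolding phi_def by (rule l1_normalize[OF r0 rx ry ab y0])
  also have "l1 M (f x) (f y) <= real N * dist x y"
  proof -
   have "l1 M (f x) (f y) = (SUM i<=M. if i < length vs then \<bar>w (vs ! i) x - w (vs ! i) y\<bar> else 0)"
    unfolding l1_def f_def by (intro sum.cong) auto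
   also have "... = (SUM v:V0. \<bar>w v x - w v y\<bar>)" unfolding vs(1)[symmetric] by (rule sum_list_index[OF vs(2) lM])
   also have "... = (SUM v:V0 Int NV x. \<bar>w v x - w v y\<bar>)"
   proof (rule sum.mono_neutral_right[OF V0])
    show "ALL v:V0 - V0 Int NV x. \<bar>w v x - w v y\<bar> = 0"
    proof
     fix v assume v: "v : V0 - V0 Int NV x"
     have "\<not> 0 < w v y" using v d unfolding NV_def by blast
     moreover have "\<not> 0 < w v x" using v e unfolding NV_def by auto
     ultimately have "w v x = 0" "w v y = 0" using w0[of v x] w0[of v y] by auto
     thus "\<bar>w v x - w v y\<bar> = 0" by simp
    qed
   qed auto
   also have "... <= (SUM v:V0 Int NV x. dist x y)" by (intro sum_mono w1)
   also have "... = real (card (V0 Int NV x)) * dist x y" by simp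
   also have "card (V0 Int NV x) <= N" using card_mono[OF NV(1)[of x], of "V0 Int NV x"] NV(2)[of x] by simp
   finally show ?thesis by (simp add: mult_right_mono)
  qed
  finally have "l1 M (phi x) (phi y) <= (1 + 1)/r*(real N * dist x y)" using r0 by (simp add: divide_right_mono)
  thus ?thesis unfolding r_def by (simp add: mult_ac)
 qed
 show ?thesis
  by (intro exI[of _ M] exI[of _ z] exI[of _ phi] exI[of _ lab] conjI ballI allI impI zZ simp cd near lip conjunct1[OF lab] conjunct2[OF lab])
qed

section \<open>Cones on chains and the homotopy to the labelled cycle\<close>

lemma sbd_zero: "sbd 0 c = 0"
 unfolding sbd_def by (rule frag_extend_eq_0) (simp add: sface_def)

lemma sface_0 [simp]: "sface 0 sig = 0"
 by (simp add: sface_def)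

lemma frag_extend_sface:
 "frag_extend f (sface (Suc p) sig) = (SUM i<=Suc p. frag_cmul ((-1)^i) (f (face (Suc p) i sig)))"
 by (simp add: sface_def frag_extend_sum frag_extend_cmul o_def del: sum.atMost_Suc)

lemma sface_Suc: "sface (Suc p) sig = (SUM i<=Suc p. frag_cmul ((-1)^i) (frag_of (face (Suc p) i sig)))"
 by (simp add: sface_def del: sum.atMost_Suc)

lemma kys_sface: "tau : kys (sface (Suc p) sig) ==> EX i<=Suc p. tau = face (Suc p) i sig"
proof -
 assume "tau : kys (sface (Suc p) sig)"
 hence "tau : (UN i:{..Suc p}. kys (frag_cmul ((-1)^i) (frag_of (face (Suc p) i sig))))"
  unfolding sface_Suc using keys_sum[of "%i. frag_cmul ((-1)^i) (frag_of (face (Suc p) i sig))" "{..Suc p}"] by blast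
 then obtain i where i: "i <= Suc p" "tau : kys (frag_cmul ((-1)^i) (frag_of (face (Suc p) i sig)))" by blast
 hence "tau : kys (frag_of (face (Suc p) i sig))" using keys_cmul by blast
 thus ?thesis using i(1) by auto
qed

lemma fn_sface: "fn (sface p sig) <= real (Suc p)"
proof (cases p)
 case (Suc q)
 have "fn (sface (Suc q) sig) <= (SUM i<=Suc q. fn (frag_cmul ((-1)^i) (frag_of (face (Suc q) i sig))))" unfolding sface_Suc by (rule fn_sum)
 also have "... = real (Suc (Suc q))" by (simp add: fn_cmul del: sum.atMost_Suc)
 finally show ?thesis using Suc by simp
qed simp

lemma sbd_natural:
 assumes "!!sig i. sig : kys c ==> i <= Suc p ==> face (Suc p) i (Q1 sig) = Q0 (face (Suc p) i sig)"
 shows "sbd (Suc p) (frag_extend (%sig. frag_of (Q1 sig)) c) = frag_extend (%sig. frag_of (Q0 sig)) (sbd (Suc p) c)"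
proof -
 have "sbd (Suc p) (frag_extend (%sig. frag_of (Q1 sig)) c) = frag_extend (%sig. sface (Suc p) (Q1 sig)) c"
  unfolding sbd_def frag_extend_extend by simp
 also have "... = frag_extend (%sig. frag_extend (%sig. frag_of (Q0 sig)) (sface (Suc p) sig)) c"
 proof (rule frag_extend_eq)
  fix sig assume "sig : kys c"
  thus "sface (Suc p) (Q1 sig) = frag_extend (%sig. frag_of (Q0 sig)) (sface (Suc p) sig)"
   unfolding frag_extend_sface sface_Suc[of p "Q1 sig"] by (intro sum.cong refl) (simp add: assms)
 qed
 also have "... = frag_extend (%sig. frag_of (Q0 sig)) (sbd (Suc p) c)" unfolding sbd_def frag_extend_extend ..
 finally show ?thesis .
qed

lemma face_restr:
 assumes "i <= Suc p" shows "face (Suc p) i (restr (Suc p) f) = restr p (%x. f (face_map i x))"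
proof
 fix x show "face (Suc p) i (restr (Suc p) f) x = restr p (%x. f (face_map i x)) x"
  using face_map_simplex[OF _ assms, of x] by (cases "x : Sx p") (auto simp: face_apply face_outside restr_def)
qed

definition CC :: "'a::metric_space set => real => 'a => nat => ((pt => 'a) \<Rightarrow>\<^sub>0 int) => ((pt => 'a) \<Rightarrow>\<^sub>0 int)" where
 "CC Z c z p = frag_extend (%tau. frag_of (coneS Z c z p tau))"

lemma fn_CC: "fn (CC Z c z p E) <= fn E"
 unfolding CC_def using fn_extend[of E "%tau. frag_of (coneS Z c z p tau)" 1] by simp

lemma sbd_CC:
 assumes Y: "lip_connected_const Z n c" and z: "z : Z" and p: "Suc q <= n" and E: "!!tau. tau : kys E ==> lip_simplex Z (Suc q) tau"
 shows "sbd (Suc (Suc q)) (CC Z c z (Suc q) E) = E - CC Z c z q (sbd (Suc q) E)"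
proof -
 have s: "sface (Suc (Suc q)) (coneS Z c z (Suc q) tau) = frag_of tau - CC Z c z q (sface (Suc q) tau)" if t: "tau : kys E" for tau
 proof -
  have "sface (Suc (Suc q)) (coneS Z c z (Suc q) tau) = frag_of (face (Suc (Suc q)) 0 (coneS Z c z (Suc q) tau)) +
    (SUM i<=Suc q. frag_cmul ((-1)^Suc i) (frag_of (face (Suc (Suc q)) (Suc i) (coneS Z c z (Suc q) tau))))"
   unfolding sface_Suc by (subst sum.atMost_Suc_shift) simp
  also have "... = frag_of tau + (SUM i<=Suc q. - frag_cmul ((-1)^i) (frag_of (coneS Z c z q (face (Suc q) i tau))))"
   using cone_face_0[OF Y z p E[OF t]] cone_face_Suc[OF Y z p E[OF t]] by (intro arg_cong2[of _ _ _ _ "(+)"] sum.cong refl) simp_all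
  also have "... = frag_of tau - CC Z c z q (sface (Suc q) tau)" unfolding CC_def frag_extend_sface sum_negf by simp
  finally show ?thesis .
 qed
 have "sbd (Suc (Suc q)) (CC Z c z (Suc q) E) = frag_extend (%tau. sface (Suc (Suc q)) (coneS Z c z (Suc q) tau)) E"
  unfolding sbd_def CC_def frag_extend_extend by simp
 also have "... = frag_extend (%tau. frag_of tau - CC Z c z q (sface (Suc q) tau)) E" by (rule frag_extend_eq) (rule s)
 also have "... = E - CC Z c z q (sbd (Suc q) E)" unfolding frag_extend_fun_diff frag_extend_id CC_def sbd_def frag_extend_extend ..
 finally show ?thesis .
qed

lemma CC_keys:
 assumes Y: "lip_connected_const Z n c" and z: "z : Z" and p: "p <= n" and L: "0 <= L"
  and E: "!!tau. tau : kys E ==> lip_simplex Z p tau & lipl p L (Sx p) tau & (ALL x:Sx p. dist (tau x) z <= L)"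
  and t: "tau' : kys (CC Z c z p E)"
 shows "lip_simplex Z (Suc p) tau' & lipl (Suc p) ((2 * cone_const c p + 1) * L) (Sx (Suc p)) tau' &
  (ALL x:Sx (Suc p). dist (tau' x) z <= (2 * cone_const c p + 1) * L)"
proof -
 obtain tau where tau: "tau : kys E" "tau' = coneS Z c z p tau" using t keys_frag_extend[of "%tau. frag_of (coneS Z c z p tau)" E] unfolding CC_def by auto
 note e = E[OF tau(1)]
 have cc: "0 <= cone_const c p" by (rule cone_const_nonneg)
 have ls: "lip_simplex Z (Suc p) tau'" unfolding tau(2) using e by (intro cone_lip_simplex[OF Y z p]) simp
 have l: "lipl (Suc p) (cone_const c p * L) (Sx (Suc p)) tau'" unfolding tau(2) using e by (intro cone_lipl[OF Y z p]) auto
 have "cone_const c p * L <= (2 * cone_const c p + 1) * L" using cc L by (intro mult_right_mono) auto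
 hence l2: "lipl (Suc p) ((2 * cone_const c p + 1) * L) (Sx (Suc p)) tau'" by (rule lipl_mono[OF l order_refl])
 have "dist (tau' x) z <= (2 * cone_const c p + 1) * L" if x: "x : Sx (Suc p)" for x
 proof -
  let ?y = "face_map 0 (vtx 0)"
  have v: "vtx 0 : Sx p" by (simp add: vtx_simplex)
  have y: "?y : Sx (Suc p)" by (rule face_map_simplex[OF v]) simp
  have f0: "face (Suc p) 0 tau' = tau" unfolding tau(2) using e by (intro cone_face_0[OF Y z p]) simp
  have "tau' ?y = face (Suc p) 0 tau' (vtx 0)" by (rule face_apply[OF v, symmetric])
  hence ty: "tau' ?y = tau (vtx 0)" by (simp only: f0)
  have "dist (tau' x) (tau' ?y) <= cone_const c p * L * l1 (Suc p) x ?y" using l x y by (simp add: lipl_def)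
  also have "... <= cone_const c p * L*2" using simplex_diam[OF x y] cc L by (intro mult_left_mono) auto
  finally have d1: "dist (tau' x) (tau (vtx 0)) <= 2 * cone_const c p * L" unfolding ty by simp
  have d2: "dist (tau (vtx 0)) z <= L" using e v by blast
  have "dist (tau' x) z <= 2 * cone_const c p * L + L" using dist_triangle[of "tau' x" z "tau (vtx 0)"] d1 d2 by linarith
  thus ?thesis by (simp add: distrib_right)
 qed
 thus ?thesis using ls l2 by blast
qed

text \<open>Homotopy between \<open>rho\<close> and \<open>Q p rho\<close> in the manner of acyclic
  models: what remains after the faces have been treated is a cycle, and it is coned off from the
  vertex \<open>rho (vtx 0)\<close>. Everything involved has size \<open>O(e)\<close>, so the cones
  are small, and no homotopy between the maps themselves is required.\<close>

primrec DD :: "'a::metric_space set => real => (nat => (pt => 'a) => (pt => 'a)) => nat => (pt => 'a) => ((pt => 'a) \<Rightarrow>\<^sub>0 int)" where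
 "DD Z c Q 0 rho = CC Z c (rho (vtx 0)) 0 (frag_of rho - frag_of (Q 0 rho))"
| "DD Z c Q (Suc p) rho = CC Z c (rho (vtx 0)) (Suc p) (frag_of rho - frag_of (Q (Suc p) rho) - frag_extend (DD Z c Q p) (sface (Suc p) rho))"

primrec dconst :: "real => real => nat => real" where
 "dconst c A 0 = (2 * cone_const c 0 + 1) * A"
| "dconst c A (Suc p) = (2 * cone_const c (Suc p) + 1)*(A + dconst c A p)"

primrec dcount :: pt where
 "dcount 0 = 2"
| "dcount (Suc p) = 2 + dcount p * real (Suc (Suc p))"

lemma dconst_nonneg: "0 <= A ==> 0 <= dconst c A p"
proof (induction p)
 case 0
 thus ?case using cone_const_nonneg[of c 0] unfolding dconst.simps by (intro mult_nonneg_nonneg) linarith+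
next
 case (Suc p)
 thus ?case using cone_const_nonneg[of c "Suc p"] unfolding dconst.simps by (intro mult_nonneg_nonneg) linarith+
qed

lemma dcount_nonneg: "0 <= dcount p"
 by (induction p) auto

text \<open>\<open>Q\<close> enters only through its compatibility with faces and its closeness
  \<open>A * e\<close> to the first vertex; \<open>G\<close> is a class of simplices, closed under
  faces, on which this is known. Each dimension multiplies size and number by constants, collected
  in \<open>dconst\<close> and \<open>dcount\<close>.\<close>

lemma DD_properties:
 fixes Z :: "'a::metric_space set"
 assumes Y: "lip_connected_const Z n c" and e: "0 <= e" and A: "2 <= A"
  and G_lip: "!!p rho. G p rho ==> lip_simplex Z p rho & lipl p e (Sx p) rho"
  and G_face: "!!p rho i. G (Suc p) rho ==> i <= Suc p ==> G p (face (Suc p) i rho)"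
  and Q_lip: "!!p rho. p <= n ==> G p rho ==> lip_simplex Z p (Q p rho) & lipl p (A * e) (Sx p) (Q p rho) & (ALL x:Sx p. dist (Q p rho x) (rho (vtx 0)) <= A * e)"
  and Q_face: "!!p rho i. Suc p <= n ==> G (Suc p) rho ==> i <= Suc p ==> face (Suc p) i (Q (Suc p) rho) = Q p (face (Suc p) i rho)"
 shows "p <= n ==> G p rho ==>
  (ALL tau:kys (DD Z c Q p rho). lip_simplex Z (Suc p) tau & lipl (Suc p) (dconst c A p * e) (Sx (Suc p)) tau & (ALL x:Sx (Suc p). dist (tau x) (rho (vtx 0)) <= dconst c A p * e)) &
  fn (DD Z c Q p rho) <= dcount p &
  sbd (Suc p) (DD Z c Q p rho) = frag_of rho - frag_of (Q p rho) - frag_extend (DD Z c Q (p - 1)) (sface p rho)"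
proof (induction p arbitrary: rho)
 case 0
 let ?z = "rho (vtx 0)"
 have v: "vtx 0 : Sx 0" by (simp add: vtx_simplex)
 have g: "lip_simplex Z 0 rho" "lipl 0 e (Sx 0) rho" using G_lip[OF 0(2)] by auto
 have zZ: "?z : Z" using g(1) v by (auto simp: lip_simplex_def)
 have Ae: "e <= A * e" "2 * e <= A * e" using A e mult_right_mono[of 1 A e] mult_right_mono[of 2 A e] by auto
 note Q0 = Q_lip[OF 0(1) 0(2)]
 have E: "lip_simplex Z 0 tau & lipl 0 (A * e) (Sx 0) tau & (ALL x:Sx 0. dist (tau x) ?z <= A * e)"
  if t: "tau : kys (frag_of rho - frag_of (Q 0 rho))" for tau
 proof -
  have "tau = rho \<or> tau = Q 0 rho" using t keys_diff[of "frag_of rho" "frag_of (Q 0 rho)"] by auto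
  moreover have "lipl 0 (A * e) (Sx 0) rho" by (rule lipl_mono[OF g(2) order_refl Ae(1)])
  moreover have "dist (rho x) ?z <= A * e" if "x : Sx 0" for x using that v Ae e by (simp add: simplex_0)
  ultimately show ?thesis using g(1) Q0 by blast
 qed
 have Ae0: "0 <= A * e" using A e by simp
 have k: "lip_simplex Z (Suc 0) tau & lipl (Suc 0) ((2 * cone_const c 0 + 1)*(A * e)) (Sx (Suc 0)) tau & (ALL x:Sx (Suc 0). dist (tau x) ?z <= (2 * cone_const c 0 + 1)*(A * e))"
  if "tau : kys (DD Z c Q 0 rho)" for tau
  by (rule CC_keys[OF Y zZ 0(1) Ae0 E that[unfolded DD.simps]])
 have f: "fn (DD Z c Q 0 rho) <= 2" unfolding DD.simps using fn_CC[of Z c ?z 0 "frag_of rho - frag_of (Q 0 rho)"] fn_diff[of "frag_of rho" "frag_of (Q 0 rho)"] by simp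
 have s1: "sface (Suc 0) (coneS Z c ?z 0 tau) = frag_of tau - frag_of (constS ?z)" if "lip_simplex Z 0 tau" for tau
  unfolding sface_Suc using cone_face_0[OF Y zZ 0(1) that] cone_face_const[OF Y zZ that] by simp
 have s: "sbd (Suc 0) (DD Z c Q 0 rho) = frag_of rho - frag_of (Q 0 rho)"
  unfolding DD.simps CC_def using s1[OF g(1)] s1[of "Q 0 rho"] Q0 by (simp add: frag_extend_diff sbd_diff)
 show ?case using k f s by (simp add: mult.assoc)
next
 case (Suc p)
 let ?z = "rho (vtx 0)"
 have pn: "p <= n" using Suc.prems by simp
 have v: "vtx 0 : Sx (Suc p)" by (simp add: vtx_simplex)
 have g: "lip_simplex Z (Suc p) rho" "lipl (Suc p) e (Sx (Suc p)) rho" using G_lip[OF Suc.prems(2)] by auto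
 have zZ: "?z : Z" using g(1) v by (auto simp: lip_simplex_def)
 have rz: "dist (rho x) ?z <= 2 * e" if x: "x : Sx (Suc p)" for x
 proof -
  have "dist (rho x) ?z <= e * l1 (Suc p) x (vtx 0)" using g(2) x v by (simp add: lipl_def)
  also have "... <= e*2" using simplex_diam[OF x v] e by (intro mult_left_mono) auto
  finally show ?thesis by simp
 qed
 have Ae: "e <= A * e" "2 * e <= A * e" using A e mult_right_mono[of 1 A e] mult_right_mono[of 2 A e] by auto
 have dc: "0 <= dconst c A p" using A by (intro dconst_nonneg) simp
 define L where "L = (A + dconst c A p) * e"
 have L: "A * e <= L" "dconst c A p * e + 2 * e <= L" "0 <= L"
  unfolding L_def using dc e A Ae by (auto simp: distrib_right)
 note QS = Q_lip[OF Suc.prems]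
 define B where "B = frag_extend (DD Z c Q p) (sface (Suc p) rho)"
 define E where "E = frag_of rho - frag_of (Q (Suc p) rho) - B"
 have DE: "DD Z c Q (Suc p) rho = CC Z c ?z (Suc p) E" by (simp add: E_def B_def)
 have Gf: "G p tau" if "tau : kys (sface (Suc p) rho)" for tau
  using kys_sface[OF that] G_face[OF Suc.prems(2)] by blast
 note IH = Suc.IH[OF pn Gf]
 have EB: "lip_simplex Z (Suc p) tau & lipl (Suc p) L (Sx (Suc p)) tau & (ALL x:Sx (Suc p). dist (tau x) ?z <= L)"
  if t: "tau : kys B" for tau
 proof -
  obtain rho' where r: "rho' : kys (sface (Suc p) rho)" "tau : kys (DD Z c Q p rho')" using t keys_frag_extend[of "DD Z c Q p" "sface (Suc p) rho"] unfolding B_def by blast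
  obtain i where i: "i <= Suc p" "rho' = face (Suc p) i rho" using kys_sface[OF r(1)] by blast
  have v0: "vtx 0 : Sx p" by (simp add: vtx_simplex)
  have "rho' (vtx 0) = rho (face_map i (vtx 0))" unfolding i(2) by (rule face_apply[OF v0])
  hence dz: "dist (rho' (vtx 0)) ?z <= 2 * e" using rz[OF face_map_simplex[OF v0 i(1)]] by simp
  have h: "lip_simplex Z (Suc p) tau" "lipl (Suc p) (dconst c A p * e) (Sx (Suc p)) tau" "!!x. x : Sx (Suc p) ==> dist (tau x) (rho' (vtx 0)) <= dconst c A p * e"
   using IH[OF r(1)] r(2) by blast+
  have "lipl (Suc p) L (Sx (Suc p)) tau" using L e by (intro lipl_mono[OF h(2) order_refl]) linarith
  moreover have "dist (tau x) ?z <= L" if "x : Sx (Suc p)" for x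
   using dist_triangle[of "tau x" ?z "rho' (vtx 0)"] h(3)[OF that] dz L(2) by linarith
  ultimately show ?thesis using h(1) by blast
 qed
 have E: "lip_simplex Z (Suc p) tau & lipl (Suc p) L (Sx (Suc p)) tau & (ALL x:Sx (Suc p). dist (tau x) ?z <= L)"
  if t: "tau : kys E" for tau
 proof -
  have "kys E <= kys (frag_of rho - frag_of (Q (Suc p) rho)) Un kys B" unfolding E_def by (rule keys_diff)
  moreover have "kys (frag_of rho - frag_of (Q (Suc p) rho)) <= {rho, Q (Suc p) rho}" using keys_diff[of "frag_of rho" "frag_of (Q (Suc p) rho)"] by auto
  ultimately consider "tau = rho" | "tau = Q (Suc p) rho" | "tau : kys B" using t by blast
  thus ?thesis
  proof cases
   case 1
   have "lipl (Suc p) L (Sx (Suc p)) rho" using L Ae by (intro lipl_mono[OF g(2) order_refl]) linarith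
   moreover have "dist (rho x) ?z <= L" if "x : Sx (Suc p)" for x using rz[OF that] L Ae by linarith
   ultimately show ?thesis using g(1) 1 by blast
  next
   case 2
   have "lipl (Suc p) L (Sx (Suc p)) (Q (Suc p) rho)" using QS L by (intro lipl_mono[OF _ order_refl L(1)]) auto
   moreover have "dist (Q (Suc p) rho x) ?z <= L" if "x : Sx (Suc p)" for x using QS that L(1) order_trans by blast
   ultimately show ?thesis using QS 2 by blast
  next
   case 3 thus ?thesis by (rule EB)
  qed
 qed
 have k: "lip_simplex Z (Suc (Suc p)) tau & lipl (Suc (Suc p)) ((2 * cone_const c (Suc p) + 1) * L) (Sx (Suc (Suc p))) tau & (ALL x:Sx (Suc (Suc p)). dist (tau x) ?z <= (2 * cone_const c (Suc p) + 1) * L)"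
  if "tau : kys (DD Z c Q (Suc p) rho)" for tau
  by (rule CC_keys[OF Y zZ Suc.prems(1) L(3) E that[unfolded DE]])
 have "fn B <= dcount p * fn (sface (Suc p) rho)" unfolding B_def by (rule fn_extend) (use IH in blast)
 also have "... <= dcount p * real (Suc (Suc p))" by (intro mult_left_mono fn_sface dcount_nonneg)
 finally have fB: "fn B <= dcount p * real (Suc (Suc p))" .
 have f: "fn (DD Z c Q (Suc p) rho) <= dcount (Suc p)"
  unfolding DE dcount.simps using fn_CC[of Z c ?z "Suc p" E] fn_diff[of "frag_of rho - frag_of (Q (Suc p) rho)" B] fn_diff[of "frag_of rho" "frag_of (Q (Suc p) rho)"] fB
  unfolding E_def by (simp del: of_nat_Suc)
 \<comment> \<open>The chain to be coned is a cycle: by induction the boundary of \<open>B\<close>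
   reproduces the first two terms, and what is left of it is applied to a double boundary.\<close>
 have zE: "sbd (Suc p) E = 0"
 proof -
  have "sbd (Suc p) B = frag_extend (%tau. sbd (Suc p) (DD Z c Q p tau)) (sface (Suc p) rho)" unfolding B_def sbd_def by (rule frag_extend_extend)
  also have "... = frag_extend (%tau. frag_of tau - frag_of (Q p tau) - frag_extend (DD Z c Q (p - 1)) (sface p tau)) (sface (Suc p) rho)"
   by (rule frag_extend_eq) (use IH in blast)
  also have "... = sface (Suc p) rho - frag_extend (%tau. frag_of (Q p tau)) (sface (Suc p) rho) - frag_extend (DD Z c Q (p - 1)) (sbd p (sface (Suc p) rho))"
   unfolding frag_extend_fun_diff frag_extend_id sbd_def frag_extend_extend ..
  also have "sbd p (sface (Suc p) rho) = 0"
  proof (cases p)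
   case (Suc q)
   have "sbd (Suc q) (sbd (Suc (Suc q)) (frag_of rho)) = 0"
    by (rule sbd_sbd) (use g(1) Suc in \<open>auto simp: lip_simplex_def\<close>)
   thus ?thesis using Suc by simp
  qed (simp add: sbd_zero)
  also have "frag_extend (%tau. frag_of (Q p tau)) (sface (Suc p) rho) = sface (Suc p) (Q (Suc p) rho)"
   unfolding frag_extend_sface sface_Suc[of p "Q (Suc p) rho"] using Q_face[OF Suc.prems] by (intro sum.cong refl) simp
  finally show ?thesis unfolding E_def by (simp add: sbd_diff)
 qed
 have "sbd (Suc (Suc p)) (DD Z c Q (Suc p) rho) = E" unfolding DE using sbd_CC[OF Y zZ Suc.prems(1), of E] E zE by (simp add: CC_def)
 moreover have "(2 * cone_const c (Suc p) + 1) * L = dconst c A (Suc p) * e" unfolding L_def dconst.simps by (simp only: mult.assoc)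
 ultimately show ?case using k f unfolding E_def B_def by (simp only: diff_Suc_1) blast
qed

section \<open>The prism from coordinates to labels\<close>

definition upd :: "nat => pt => pt" where
 "upd q x = x(q := 1)"

lemma face_map_upd: "i <= q ==> face_map i (upd q x) = upd (Suc q) (face_map i x)"
 by (rule ext) (auto simp: face_map_def upd_def)

text \<open>The affine map from the parameter simplex to the big simplex that sends each vertex to
  the label of its image under \<open>rho\<close>; coinciding labels add up.\<close>

definition psi :: "('a => nat) => nat => (pt => 'a) => pt => pt" where
 "psi lab m rho x = (%i. SUM j<=m. x j * of_bool (lab (rho (vtx j)) = i))"

text \<open>The straight-line homotopy inside the big simplex from the coordinates of
  \<open>rho\<close> to \<open>psi\<close>. Coordinate \<open>Suc m\<close> of \<open>w\<close> is
  the time, the remaining ones are the point of the parameter simplex.\<close>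

definition theta :: "('a => nat => real) => ('a => nat) => nat => (pt => 'a) => pt => pt" where
 "theta phi lab m rho w = (%i. (1 - w (Suc m)) * phi (rho (w(Suc m := 0))) i + w (Suc m) * psi lab m rho (w(Suc m := 0)) i)"

text \<open>The triangulated prism over the standard \<open>m\<close>-simplex. Its upper vertices
  carry a 1 in coordinate \<open>Suc m\<close>, which is free because a point of the
  \<open>m\<close>-simplex vanishes there.\<close>

definition prl :: "nat => (pt list \<Rightarrow>\<^sub>0 int)" where
 "prl m = pr (%x. x) (upd (Suc m)) (iot m)"

definition PP :: "(pt => 'b) => ('a => nat => real) => ('a => nat) => nat => (pt => 'a) => ((pt => 'b) \<Rightarrow>\<^sub>0 int)" where
 "PP F phi lab m rho = SG (%w. F (theta phi lab m rho w)) (prl m)"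

lemma prl_keys:
 assumes "l : kys (prl m)"
 shows "length l = Suc (Suc m)" "e : set l ==> e(Suc m := 0) : Sx m & 0 <= e (Suc m) & e (Suc m) <= 1"
proof -
 have k: "length l = Suc (length (iot m)) & set l <= (%x. x) ` set (iot m) Un upd (Suc m) ` set (iot m)"
  using kys_pr assms unfolding prl_def by blast
 thus "length l = Suc (Suc m)" by simp
 assume "e : set l"
 then obtain x where x: "x : set (iot m)" "e = x \<or> e = upd (Suc m) x" using k by blast
 have xs: "x : Sx m" using x(1) set_iot by blast
 hence "x(Suc m := 0) = x" by (auto simp: simplex_k_def)
 thus "e(Suc m := 0) : Sx m & 0 <= e (Suc m) & e (Suc m) <= 1" using x(2) xs by (auto simp: upd_def simplex_k_def)
qed

lemma aff_upd0: "(aff l y)(q := 0) = aff (map (%e. e(q := 0)) l) y"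
 by (rule ext) (simp add: aff_def)

lemma prl_aff:
 assumes l: "l : kys (prl m)" and y: "y : Sx (Suc m)"
 shows "(aff l y)(Suc m := 0) : Sx m & 0 <= aff l y (Suc m) & aff l y (Suc m) <= 1"
proof -
 note len = prl_keys(1)[OF l] and el = prl_keys(2)[OF l]
 have "aff (map (%e. e(Suc m := 0)) l) y : Sx m" using el len by (intro aff_simplex[OF _ _ y]) auto
 moreover have lj: "0 <= (l ! j) (Suc m) & (l ! j) (Suc m) <= 1" if "j < Suc (Suc m)" for j using el[of "l ! j"] len that by simp
 have y0: "0 <= y j" for j by (rule simplex_coord[OF y])
 have "0 <= aff l y (Suc m)" unfolding aff_def len using lj y0 by (intro sum_nonneg mult_nonneg_nonneg) auto
 moreover have "aff l y (Suc m) <= (SUM j<Suc (Suc m). y j*1)" unfolding aff_def len using lj y0 by (intro sum_mono mult_left_mono) auto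
 moreover have "(SUM j<Suc (Suc m). y j*1) = 1" using y by (simp add: simplex_k_def lessThan_Suc_atMost del: sum.lessThan_Suc sum.atMost_Suc)
 ultimately show ?thesis unfolding aff_upd0 by linarith
qed

lemma prl_diam:
 assumes l: "l : kys (prl m)" and e: "e : set l" "e' : set l"
 shows "l1 (Suc m) e e' <= 3"
proof -
 note p = prl_keys(2)[OF l e(1)] prl_keys(2)[OF l e(2)]
 have "l1 m (e(Suc m := 0)) (e'(Suc m := 0)) <= 2" using p by (intro simplex_diam) auto
 moreover have "l1 m (e(Suc m := 0)) (e'(Suc m := 0)) = l1 m e e'" by (simp add: l1_def)
 moreover have "\<bar>e (Suc m) - e' (Suc m)\<bar> <= 1" using p by auto
 ultimately show ?thesis by (simp add: l1_def)
qed

lemma theta_face: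
 assumes i: "i <= Suc p" and w: "w(Suc p := 0) : Sx p"
 shows "theta phi lab (Suc p) rho (face_map i w) = theta phi lab p (face (Suc p) i rho) w"
proof -
 let ?x = "w(Suc p := 0)"
 have t: "face_map i w (Suc (Suc p)) = w (Suc p)" using i by (simp add: face_map_def)
 have x: "(face_map i w)(Suc (Suc p) := 0) = face_map i ?x" using i by (intro ext) (auto simp: face_map_def)
 have f: "face (Suc p) i rho ?x = rho (face_map i ?x)" by (rule face_apply[OF w])
 have "psi lab (Suc p) rho (face_map i ?x) j = psi lab p (face (Suc p) i rho) ?x j" for j
 proof -
  have "psi lab (Suc p) rho (face_map i ?x) j = face_map i ?x i * of_bool (lab (rho (vtx i)) = j) +
    (SUM j'<=p. face_map i ?x (if j' < i then j' else Suc j') * of_bool (lab (rho (vtx (if j' < i then j' else Suc j'))) = j))"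
   unfolding psi_def by (rule sum_remove_index[OF i])
  also have "... = (SUM j'<=p. ?x j' * of_bool (lab (face (Suc p) i rho (vtx j')) = j))"
   by (simp only: face_map_index face_map_zero mult_zero_left add_0_left)
    (intro sum.cong refl, simp only: face_apply vtx_simplex atMost_iff face_map_vtx)
  finally show ?thesis by (simp only: psi_def)
 qed
 thus ?thesis unfolding theta_def t x f by (simp only:)
qed

lemma sbd_PP:
 assumes "!!x. x ~: Sx m ==> rho x = undefined"
 shows "sbd (Suc m) (PP F phi lab m rho) = frag_of (restr m (%x. F (psi lab m rho x))) - frag_of (restr m (%x. F (phi (rho x)))) - frag_extend (PP F phi lab (m - 1)) (sface m rho)"
proof -
 let ?f = "%w. F (theta phi lab m rho w)"
 have up: "y(Suc m := 0) = y" if "y : Sx m" for y using that by (auto simp: simplex_k_def)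
 have "sbd (Suc m) (PP F phi lab m rho) = SG ?f (BD (prl m))" unfolding PP_def by (rule sbd_SG) (rule prl_keys(1))
 also have "... = frag_of (sg ?f (map (upd (Suc m)) (iot m))) - frag_of (sg ?f (iot m)) - SG ?f (PR (%x. x) (upd (Suc m)) (bd (iot m)))"
  unfolding prl_def BD_pr by (simp add: SG_diff)
 also have "sg ?f (map (upd (Suc m)) (iot m)) = restr m (%x. F (psi lab m rho x))"
 proof
  fix y
  have "theta phi lab m rho (aff (map (upd (Suc m)) (iot m)) y) = psi lab m rho y" if y: "y : Sx m"
  proof -
   have "aff (map (upd (Suc m)) (iot m)) y = y(Suc m := 1)"
   proof
    fix t show "aff (map (upd (Suc m)) (iot m)) y t = (y(Suc m := 1)) t"
    proof (cases "t = Suc m")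
     case True
     have "aff (map (upd (Suc m)) (iot m)) y t = (SUM j<Suc m. y j)" unfolding aff_def using True by (simp add: upd_def del: sum.lessThan_Suc)
     thus ?thesis using y True by (simp add: simplex_k_def lessThan_Suc_atMost del: sum.lessThan_Suc sum.atMost_Suc)
    next
     case False
     have "aff (map (upd (Suc m)) (iot m)) y t = aff (iot m) y t" unfolding aff_def using False by (simp add: upd_def del: sum.lessThan_Suc)
     thus ?thesis using aff_iot[OF y] False by simp
    qed
   qed
   thus ?thesis using up[OF y] by (simp add: theta_def)
  qed
  thus "sg ?f (map (upd (Suc m)) (iot m)) y = restr m (%x. F (psi lab m rho x)) y" by (simp add: sg_def restr_def)
 qed
 also have "sg ?f (iot m) = restr m (%x. F (phi (rho x)))"
 proof
  fix y
  have "theta phi lab m rho (aff (iot m) y) = phi (rho y)" if y: "y : Sx m"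
  proof -
   have "y (Suc m) = 0" using y by (simp add: simplex_k_def)
   thus ?thesis unfolding aff_iot[OF y] theta_def up[OF y] by simp
  qed
  thus "sg ?f (iot m) y = restr m (%x. F (phi (rho x))) y" by (simp add: sg_def restr_def)
 qed
 also have "SG ?f (PR (%x. x) (upd (Suc m)) (bd (iot m))) = frag_extend (PP F phi lab (m - 1)) (sface m rho)"
 proof (cases m)
  case 0
  have "bd (iot 0) = frag_of []" by (simp add: iot_def)
  thus ?thesis using 0 by simp
 next
  case (Suc p)
  have "SG ?f (PR (%x. x) (upd (Suc m)) (bd (iot m))) = (SUM i<=Suc p. frag_cmul ((-1)^i) (SG (%w. F (theta phi lab p (face (Suc p) i rho) w)) (prl p)))"
   unfolding PR_def Suc
  proof (rule SG_bd_natural)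
   fix i assume i: "i <= Suc p"
   show "pr (%x. x) (upd (Suc (Suc p))) (map (face_map i) (iot p)) = lmap (face_map i) (prl p)"
    unfolding prl_def pr_pre pr_map face_map_upd[OF i] ..
   fix l y assume l: "l : kys (prl p)" "y : Sx (length l - 1)"
   have "(aff l y)(Suc p := 0) : Sx p" using prl_aff[OF l(1), of y] l(2) prl_keys(1)[OF l(1)] by simp
   thus "F (theta phi lab (Suc p) rho (face_map i (aff l y))) = F (theta phi lab p (face (Suc p) i rho) (aff l y))"
    by (simp only: theta_face[OF i])
  qed
  thus ?thesis unfolding Suc diff_Suc_1 frag_extend_sface PP_def .
 qed
 finally show ?thesis .
qed

text \<open>With at most \<open>k + 1\<close> nonzero coordinates the threshold is 0, nothing is cut
  off, and the point is far from the singular set for every choice of weights.\<close>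

lemma pY_low:
 assumes a: "!!i. 1 <= a i & a i <= (2::real)" and p: "p : Sx M" and s: "card (sup_of p) <= Suc k"
 shows "1 <= pY k M (%i. a i * p i)"
proof -
 let ?b = "%i. a i * p i"
 have p0: "0 <= p i" for i by (rule simplex_coord[OF p])
 have "{i. i <= M & 0 < ?b i} <= sup_of p" by (auto simp: sup_of_def)
 hence "card {i. i <= M & 0 < ?b i} <= card (sup_of p)" by (intro card_mono finite_sup_of[OF p])
 hence "thr k M ?b <= 0" using s by (intro thr_le) auto
 hence t: "thr k M ?b = 0" using thr_nonneg[of k M ?b] by linarith
 have "p i <= py k M ?b i" if "i <= M" for i
 proof -
  have "1 * p i <= a i * p i" using a[of i] p0[of i] by (intro mult_right_mono) auto
  thus ?thesis using that t by (simp add: py_def)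
 qed
 hence "(SUM i<=M. p i) <= pY k M ?b" unfolding pY_def by (intro sum_mono) auto
 thus ?thesis using p by (simp add: simplex_k_def)
qed

lemma psi_simplex:
 assumes l: "!!j. j <= p ==> lab (rho (vtx j)) <= M" and x: "x : Sx p"
 shows "psi lab p rho x : Sx M"
 unfolding simplex_k_def
proof (intro CollectI conjI allI impI)
 show "psi lab p rho x i = 0" if "i > M" for i
  unfolding psi_def
 proof (intro sum.neutral ballI)
  fix j assume "j : {..p}"
  hence "lab (rho (vtx j)) ~= i" using l[of j] that by auto
  thus "x j * of_bool (lab (rho (vtx j)) = i) = 0" by simp
 qed
 show "0 <= psi lab p rho x i" for i unfolding psi_def using simplex_coord[OF x] by (intro sum_nonneg mult_nonneg_nonneg) auto
 have "(SUM i<=M. psi lab p rho x i) = (SUM j<=p. SUM i<=M. x j * of_bool (lab (rho (vtx j)) = i))" unfolding psi_def by (rule sum.swap)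
 also have "... = (SUM j<=p. x j)"
 proof (rule sum.cong[OF refl])
  fix j assume "j : {..p}"
  hence "lab (rho (vtx j)) : {..M}" using l by auto
  hence "(SUM i<=M. of_bool (lab (rho (vtx j)) = i)) = (1::real)" by (simp add: of_bool_def)
  thus "(SUM i<=M. x j * of_bool (lab (rho (vtx j)) = i)) = x j" by (simp only: sum_distrib_left[symmetric] mult_1_right)
 qed
 also have "... = 1" using x by (simp add: simplex_k_def)
 finally show "(SUM i<=M. psi lab p rho x i) = 1" .
qed

lemma psi_label:
 assumes "psi lab p rho x i ~= 0" shows "EX j<=p. i = lab (rho (vtx j))"
proof (rule ccontr)
 assume "\<not> ?thesis"
 hence "psi lab p rho x i = 0" unfolding psi_def by (intro sum.neutral) auto
 thus False using assms by simp
qed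

lemma psi_card: "finite {i. psi lab p rho x i ~= 0} & card {i. psi lab p rho x i ~= 0} <= Suc p"
proof -
 have sub: "{i. psi lab p rho x i ~= 0} <= (%j. lab (rho (vtx j))) ` {..p}" using psi_label[of lab p rho x] by auto
 have "card {i. psi lab p rho x i ~= 0} <= card ((%j. lab (rho (vtx j))) ` {..p})" by (rule card_mono[OF _ sub]) simp
 also have "... <= card {..p}" by (rule card_image_le) simp
 finally show ?thesis using finite_subset[OF sub] by simp
qed

lemma psi_lip: "l1 M (psi lab p rho x) (psi lab p rho y) <= l1 p x y"
proof -
 have e: "psi lab p rho x i - psi lab p rho y i = (SUM j<=p. (x j - y j) * of_bool (lab (rho (vtx j)) = i))" for i
  unfolding psi_def sum_subtractf[symmetric] by (intro sum.cong refl) (simp add: left_diff_distrib)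
 have "l1 M (psi lab p rho x) (psi lab p rho y) <= (SUM i<=M. SUM j<=p. \<bar>x j - y j\<bar> * of_bool (lab (rho (vtx j)) = i))"
  unfolding l1_def e by (intro sum_mono order_trans[OF sum_abs]) (simp add: abs_mult)
 also have "... = (SUM j<=p. \<bar>x j - y j\<bar>*(SUM i<=M. of_bool (lab (rho (vtx j)) = i)))" unfolding sum_distrib_left by (rule sum.swap)
 also have "... <= (SUM j<=p. \<bar>x j - y j\<bar>*1)"
 proof (intro sum_mono mult_left_mono)
  fix j show "(SUM i<=M. of_bool (lab (rho (vtx j)) = i)) <= (1::real)" by (simp add: of_bool_def)
 qed simp
 finally show ?thesis by (simp add: l1_def)
qed

text \<open>The first summand is the Lipschitz constant of \<open>QQ\<close> when labels are
  \<open>2 * eps\<close> apart; the remaining ones bound its distance from the first vertex.\<close>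

definition aq :: "real => nat => nat => real" where
 "aq c n k = (9 * hh_const c n + 1)*8 * real (2 * k + 3) + 4 * hh_const c n + 2"

lemma aq_ge2: "2 <= aq c n k"
 using hh_const_nonneg[of c n] by (simp add: aq_def)

definition good :: "'a::metric_space set => real => 'a set => nat => (pt => 'a) => bool" where
 "good Z eps P p rho \<longleftrightarrow> lip_simplex Z p rho & lipl p eps (Sx p) rho & (ALL j<=p. rho (vtx j) : P)"

lemma good_face:
 assumes g: "good Z eps P (Suc p) rho" and i: "i <= Suc p" shows "good Z eps P p (face (Suc p) i rho)"
proof -
 have "face (Suc p) i rho (vtx j) : P" if "j <= p" for j
 proof -
  have "face (Suc p) i rho (vtx j) = rho (vtx (if j < i then j else Suc j))" using face_apply[OF vtx_simplex[OF that], of i rho] by (simp only: face_map_vtx)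
  thus ?thesis using g that by (auto simp: good_def)
 qed
 thus ?thesis using g face_lip_simplex[OF _ i, of Z rho] face_lipl[OF _ i, of eps rho] by (simp add: good_def)
qed

lemma lipl_simplex_dist:
 assumes "lipl p eps (Sx p) rho" "x : Sx p" "y : Sx p" shows "dist (rho x) (rho y) <= 2 * eps"
proof -
 have "dist (rho x) (rho y) <= eps * l1 p x y" "0 <= eps" using assms by (auto simp: lipl_def)
 moreover have "eps * l1 p x y <= eps*2" using simplex_diam[OF assms(2,3)] calculation(2) by (intro mult_left_mono) auto
 ultimately show ?thesis by linarith
qed

text \<open>The far end of the prism. Its coordinates have at most \<open>p + 1\<close> nonzero
  entries, so by \<open>pY_low\<close> it is Lipschitz with constant \<open>O(eps)\<close> whatever
  the weights. That is why the cones begin here and not at the pushed boundary, which is controlled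
  in volume only.\<close>

definition QQ :: "(pt => 'b) => ('a => nat) => nat => (pt => 'a) => (pt => 'b)" where
 "QQ F lab p rho = restr p (%x. F (psi lab p rho x))"

lemma QQ_face:
 assumes i: "i <= Suc p" shows "face (Suc p) i (QQ F lab (Suc p) rho) = QQ F lab p (face (Suc p) i rho)"
proof -
 have "psi lab (Suc p) rho (face_map i x) = psi lab p (face (Suc p) i rho) x" for x
 proof
  fix j
  have "psi lab (Suc p) rho (face_map i x) j = face_map i x i * of_bool (lab (rho (vtx i)) = j) +
    (SUM j'<=p. face_map i x (if j' < i then j' else Suc j') * of_bool (lab (rho (vtx (if j' < i then j' else Suc j'))) = j))"
   unfolding psi_def by (rule sum_remove_index[OF i])
  also have "... = (SUM j'<=p. x j' * of_bool (lab (face (Suc p) i rho (vtx j')) = j))"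
   by (simp only: face_map_index face_map_zero mult_zero_left add_0_left)
    (intro sum.cong refl, simp only: face_apply vtx_simplex atMost_iff face_map_vtx)
  finally show "psi lab (Suc p) rho (face_map i x) j = psi lab p (face (Suc p) i rho) x j" by (simp only: psi_def)
 qed
 thus ?thesis unfolding QQ_def face_restr[OF i] by simp
qed

lemma QQ_lip:
 assumes Y: "lip_connected_const Z n c" and zZ: "!!i. z i : Z" and k: "k <= Suc n" and a: "!!i. 1 <= a i & a i <= (2::real)"
  and lab: "!!x. x : P ==> lab x <= M & z (lab x) = x" and g: "good Z eps P p rho" and p: "p <= k" and e: "0 <= eps"
 shows "lip_simplex Z p (QQ (FF Z c z k M a) lab p rho) & lipl p (aq c n k * eps) (Sx p) (QQ (FF Z c z k M a) lab p rho) &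
  (ALL x:Sx p. dist (QQ (FF Z c z k M a) lab p rho x) (rho (vtx 0)) <= aq c n k * eps)"
proof -
 let ?F = "FF Z c z k M a"
 have lv: "lab (rho (vtx j)) <= M" "z (lab (rho (vtx j))) = rho (vtx j)" if "j <= p" for j using g lab that by (auto simp: good_def)
 have s: "psi lab p rho x : Sx M" if "x : Sx p" for x by (rule psi_simplex) (use lv(1) that in auto)
 have cd: "card (sup_of (psi lab p rho x)) <= Suc k" for x using psi_card[of lab p rho x] p unfolding sup_of_def by linarith
 have pY1: "1 <= pY k M (%i. a i * psi lab p rho x i)" if "x : Sx p" for x by (rule pY_low[OF a s[OF that] cd])
 have lip: "lipl p eps (Sx p) rho" using g by (simp add: good_def)
 have zl: "EX j<=p. z i = rho (vtx j)" if "i : sup_of (psi lab p rho x)" for i x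
  using psi_label[of lab p rho x i] that lv(2) by (auto simp: sup_of_def)
 have zd: "dist (z i) (z j) <= 2 * eps" if ij: "i : sup_of (psi lab p rho x) Un sup_of (psi lab p rho y)" "j : sup_of (psi lab p rho x) Un sup_of (psi lab p rho y)" for i j x y
 proof -
  obtain i' where i': "i' <= p" "z i = rho (vtx i')" using zl ij(1) by blast
  obtain j' where j': "j' <= p" "z j = rho (vtx j')" using zl ij(2) by blast
  show ?thesis unfolding i' j' by (rule lipl_simplex_dist[OF lip vtx_simplex[OF i'(1)] vtx_simplex[OF j'(1)]])
 qed
 have hn: "0 <= hh_const c n" by (rule hh_const_nonneg)
 have e2: "0 <= 2 * eps" using e by simp
 have L: "lipl p (aq c n k * eps) (Sx p) (QQ ?F lab p rho)"
  unfolding lipl_def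
 proof (intro conjI ballI)
  show "0 <= aq c n k * eps" using aq_ge2[of c n k] e by simp
  fix x y assume xy: "x : Sx p" "y : Sx p"
  have "dist (QQ ?F lab p rho x) (QQ ?F lab p rho y) = dist (?F (psi lab p rho x)) (?F (psi lab p rho y))" using xy by (simp add: QQ_def restr_def)
  also have "... <= (9 * hh_const c n + 1)*(2 * eps)*(2/1 * real (2 * k + 3)*(2 * l1 M (psi lab p rho x) (psi lab p rho y)))"
   by (rule FF_lip[OF Y zZ k a zero_less_one pY1[OF xy(1)] pY1[OF xy(2)] e2 zd])
  also have "... <= (9 * hh_const c n + 1)*(2 * eps)*(2/1 * real (2 * k + 3)*(2 * l1 p x y))"
   using hn e psi_lip[of M lab p rho x y] by (intro mult_left_mono) auto
  also have "... = (9 * hh_const c n + 1)*8 * real (2 * k + 3) * eps * l1 p x y" by (simp add: algebra_simps)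
  also have "... <= aq c n k * eps * l1 p x y" unfolding aq_def using hn e by (intro mult_right_mono) auto
  finally show "dist (QQ ?F lab p rho x) (QQ ?F lab p rho y) <= aq c n k * eps * l1 p x y" .
 qed
 have dz: "dist (QQ ?F lab p rho x) (rho (vtx 0)) <= aq c n k * eps" if x: "x : Sx p" for x
 proof -
  let ?p = "pP k M (%i. a i * psi lab p rho x i)"
  have P: "0 < pY k M (%i. a i * psi lab p rho x i)" using pY1[OF x] by linarith
  have ps: "?p : Sx M" by (rule pP_simplex[OF P])
  obtain i where i: "i : sup_of ?p" using sup_of_nonempty[OF ps] by blast
  have sub: "sup_of ?p <= sup_of (psi lab p rho x)" by (rule sup_of_pP(1)[OF a P])
  have "card (sup_of ?p) <= Suc (Suc n)" using sup_of_pP(2)[OF a P] k by linarith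
  hence d1: "dist (hh Z c z ?p) (z i) <= 2 * hh_const c n*(2 * eps)"
   by (rule hh_near[OF Y zZ ps _ i e2]) (use sub zd[of _ x x] in blast)
  obtain j where j: "j <= p" "z i = rho (vtx j)" using zl i sub by blast
  have d2: "dist (z i) (rho (vtx 0)) <= 2 * eps" unfolding j(2) by (rule lipl_simplex_dist[OF lip vtx_simplex[OF j(1)] vtx_simplex]) simp
  have "QQ ?F lab p rho x = hh Z c z ?p" using x by (simp add: QQ_def restr_def FF_def)
  hence "dist (QQ ?F lab p rho x) (rho (vtx 0)) <= (4 * hh_const c n + 2) * eps"
   using dist_triangle[of "hh Z c z ?p" "rho (vtx 0)" "z i"] d1 d2 by (simp add: distrib_right)
  also have "... <= aq c n k * eps" unfolding aq_def using hn e by (intro mult_right_mono) auto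
  finally show ?thesis .
 qed
 have "QQ ?F lab p rho x : Z" if x: "x : Sx p" for x
 proof -
  have "0 < pY k M (%i. a i * psi lab p rho x i)" using pY1[OF x] by linarith
  from FF_in[OF Y zZ k a this] show ?thesis using x by (simp add: QQ_def restr_def)
 qed
 moreover have "QQ ?F lab p rho x = undefined" if "x ~: Sx p" for x using that by (simp add: QQ_def restr_def)
 ultimately have "lip_simplex Z p (QQ ?F lab p rho)" unfolding lip_simplex_iff using L by blast
 thus ?thesis using L dz by blast
qed

lemma theta_simplex:
 assumes "phi (rho (w(Suc m := 0))) : Sx M" "psi lab m rho (w(Suc m := 0)) : Sx M" "0 <= w (Suc m)" "w (Suc m) <= 1"
 shows "theta phi lab m rho w : Sx M"
 unfolding theta_def by (rule simplex_convex[OF assms])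

lemma theta_lip:
 assumes b: "phi (rho (w'(Suc m := 0))) : Sx M" "psi lab m rho (w'(Suc m := 0)) : Sx M" and t: "0 <= w (Suc m)" "w (Suc m) <= 1"
  and f: "l1 M (phi (rho (w(Suc m := 0)))) (phi (rho (w'(Suc m := 0)))) <= D * l1 m w w'" and D: "0 <= D"
 shows "l1 M (theta phi lab m rho w) (theta phi lab m rho w') <= (D + 3) * l1 (Suc m) w w'"
proof -
 let ?t = "w (Suc m)" and ?t' = "w' (Suc m)"
 let ?a = "phi (rho (w(Suc m := 0)))" and ?a' = "phi (rho (w'(Suc m := 0)))" and ?b = "psi lab m rho (w(Suc m := 0))" and ?b' = "psi lab m rho (w'(Suc m := 0))"
 have pt: "\<bar>theta phi lab m rho w i - theta phi lab m rho w' i\<bar> <= \<bar>?a i - ?a' i\<bar> + \<bar>?b i - ?b' i\<bar> + \<bar>?t - ?t'\<bar>*\<bar>?a' i - ?b' i\<bar>" for i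
 proof -
  have "theta phi lab m rho w i - theta phi lab m rho w' i = (1 - ?t)*(?a i - ?a' i) + ?t*(?b i - ?b' i) + (?t' - ?t)*(?a' i - ?b' i)"
   unfolding theta_def by (simp add: algebra_simps)
  moreover have "\<bar>(1 - ?t)*(?a i - ?a' i)\<bar> <= \<bar>?a i - ?a' i\<bar>" using t by (simp add: abs_mult mult_left_le_one_le)
  moreover have "\<bar>?t*(?b i - ?b' i)\<bar> <= \<bar>?b i - ?b' i\<bar>" using t by (simp add: abs_mult mult_left_le_one_le)
  moreover have "\<bar>(?t' - ?t)*(?a' i - ?b' i)\<bar> = \<bar>?t - ?t'\<bar>*\<bar>?a' i - ?b' i\<bar>" by (simp add: abs_mult abs_minus_commute)
  ultimately show ?thesis by linarith
 qed
 have "l1 M (theta phi lab m rho w) (theta phi lab m rho w') <= l1 M ?a ?a' + l1 M ?b ?b' + \<bar>?t - ?t'\<bar> * l1 M ?a' ?b'"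
  unfolding l1_def sum_distrib_left sum.distrib[symmetric] by (intro sum_mono pt)
 also have "... <= D * l1 m w w' + l1 m w w' + \<bar>?t - ?t'\<bar>*2"
 proof (intro add_mono f mult_left_mono simplex_diam b)
  have "l1 M ?b ?b' <= l1 m (w(Suc m := 0)) (w'(Suc m := 0))" by (rule psi_lip)
  also have "... = l1 m w w'" by (simp add: l1_def)
  finally show "l1 M ?b ?b' <= l1 m w w'" .
 qed simp
 also have "... <= (D + 3) * l1 (Suc m) w w'"
 proof -
  have e: "l1 (Suc m) w w' = l1 m w w' + \<bar>?t - ?t'\<bar>" by (simp add: l1_def)
  have "0 <= D*\<bar>?t - ?t'\<bar>" using D by simp
  thus ?thesis unfolding e by (simp add: algebra_simps)
 qed
 finally show ?thesis .
qed

text \<open>A common bound for the two products of label spread and coordinate speed required by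
  \<open>loc\<close>: the first summand belongs to simplices of the filling, the second to pieces of
  the prism.\<close>

definition c1c :: "real => real => real" where
 "c1c C C2 = (4 * C + 2) * C2 + 6*(C + 4)*(C2 + 35) + 1"

text \<open>\<open>N + Suc m\<close> because a point of the prism carries the labels of
  \<open>phi\<close>, at most \<open>N\<close>, together with those of \<open>psi\<close>, at most
  \<open>m + 1\<close>.\<close>

definition kA :: "real => nat => nat => nat => real => real => real" where
 "kA c n m N C C2 = push_const c n (Suc m) (N + Suc m) (c1c C C2)"

definition kB :: "real => nat => nat => nat => real => real => real" where
 "kB c n m N C C2 = kA c n m N C C2*(real (Suc m)*(4 * real (Suc m))^Suc m) + dcount m*(4 * real (Suc m) * dconst c (aq c n (Suc m)) m)^Suc m"

lemma push_const_nonneg: "0 <= C1 ==> 0 <= push_const c n k N C1"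
 using hh_const_nonneg[of c n] avg_const_ge1[of N k] unfolding push_const_def by (intro mult_nonneg_nonneg zero_le_power) auto

lemma card_support_convex:
 assumes "finite {i. p i ~= (0::real)}" "finite {i. q i ~= (0::real)}"
 shows "card {i. (1 - t) * p i + t * q i ~= 0} <= card {i. p i ~= 0} + card {i. q i ~= 0}"
proof -
 have "{i. (1 - t) * p i + t * q i ~= 0} <= {i. p i ~= 0} Un {i. q i ~= 0}" by auto
 hence "card {i. (1 - t) * p i + t * q i ~= 0} <= card ({i. p i ~= 0} Un {i. q i ~= 0})" using assms by (intro card_mono) auto
 also have "... <= card {i. p i ~= 0} + card {i. q i ~= 0}" by (rule card_Un_le)
 finally show ?thesis .
qed

lemma fmass_SG_le: "fmass k (SG f c) <= (SUM l:kys c. ennreal \<bar>real_of_int (lkp c l)\<bar> * simplex_volume k (sg f l))"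
proof -
 have "fmass k (SG f c) <= (SUM l:kys c. fmass k (frag_cmul (lkp c l) (frag_of (sg f l))))"
  unfolding SG_def frag_extend_def by (rule fmass_sum)
 also have "... <= (SUM l:kys c. ennreal \<bar>real_of_int (lkp c l)\<bar> * simplex_volume k (sg f l))"
 proof (rule sum_mono)
  fix l
  show "fmass k (frag_cmul (lkp c l) (frag_of (sg f l))) <= ennreal \<bar>real_of_int (lkp c l)\<bar> * simplex_volume k (sg f l)"
   using fmass_cmul[of k "lkp c l" "frag_of (sg f l)"] by simp
 qed
 finally show ?thesis .
qed

lemma fmass_extend_le:
 "fmass k (frag_extend f c) <= (SUM sig:kys c. ennreal \<bar>real_of_int (lkp c sig)\<bar> * fmass k (f sig))"
proof -
 have "fmass k (frag_extend f c) <= (SUM sig:kys c. fmass k (frag_cmul (lkp c sig) (f sig)))"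
  unfolding frag_extend_def by (rule fmass_sum)
 also have "... <= (SUM sig:kys c. ennreal \<bar>real_of_int (lkp c sig)\<bar> * fmass k (f sig))" by (intro sum_mono fmass_cmul)
 finally show ?thesis .
qed

lemma sum_Inl_Inr:
 fixes h :: "'i + 'j \<times> 'k => 'z::comm_monoid_add"
 assumes "finite A" "finite B" "finite D"
 shows "(SUM io:Inl ` A Un Inr ` (B \<times> D). h io) = (SUM sig:A. h (Inl sig)) + (SUM rho:B. SUM l:D. h (Inr (rho, l)))"
proof -
 have "(SUM io:Inl ` A Un Inr ` (B \<times> D). h io) = (SUM io:Inl ` A. h io) + (SUM io:Inr ` (B \<times> D). h io)"
  using assms by (intro sum.union_disjoint) auto
 also have "(SUM io:Inl ` A. h io) = (SUM sig:A. h (Inl sig))" by (subst sum.reindex) (auto simp: o_def)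
 also have "(SUM io:Inr ` (B \<times> D). h io) = (SUM e:B \<times> D. h (Inr e))" by (subst sum.reindex) (auto simp: o_def)
 also have "... = (SUM rho:B. SUM l:D. h (Inr (rho, l)))" by (simp add: sum.cartesian_product split_def)
 finally show ?thesis .
qed

text \<open>The new filling consists of the pushed \<open>bet\<close> (\<open>G1\<close>), the prism
  from its boundary to the labelled cycle (\<open>G2\<close>), and the homotopy from there to
  \<open>alp\<close> (\<open>G3\<close>); the boundaries telescope to \<open>alp\<close>. The mass
  of \<open>G1\<close> is measured against that of \<open>bet\<close>. \<open>G2\<close> and
  \<open>G3\<close> cost \<open>O(eps^(m + 1))\<close> per simplex of \<open>alp\<close>, but
  \<open>G2\<close> shares the weights with \<open>G1\<close> and so takes part in the
  averaging.\<close>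

lemma core_filling:
 fixes Z K P :: "'a::metric_space set" and z :: "nat => 'a" and phi :: "'a => nat => real" and bet :: "(pt => 'a) \<Rightarrow>\<^sub>0 int"
 assumes Y: "lip_connected_const Z n c" and mn: "m <= n" and e: "0 < eps" and C: "0 < C" and C2: "0 <= C2" and zZ: "!!i. z i : Z"
  and lab: "!!p. p : P ==> lab p <= M & z (lab p) = p"
  and ph: "!!x. x : K ==> phi x : Sx M" "!!x. x : K ==> card {i. phi x i ~= 0} <= N"
   "!!x i. x : K ==> phi x i ~= 0 ==> dist x (z i) <= C * rad Z eps x"
  and phl: "!!x y. x : K ==> y : K ==> dist x y < eps/16 ==> l1 M (phi x) (phi y) <= C2/rad Z eps x * dist x y"
  and b: "!!sig. sig : kys bet ==> lip_simplex UNIV (Suc m) sig" "!!sig. sig : kys bet ==> sig ` Sx (Suc m) <= K"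
  and alp: "alp = sbd (Suc m) bet"
  and al: "!!rho. rho : kys alp ==> good Z eps P m rho" "!!rho. rho : kys alp ==> rho ` Sx m <= K"
  and del: "0 < dlt"
 shows "EX gam. (ALL sig:kys gam. lip_simplex Z (Suc m) sig) & sbd (Suc m) gam = alp &
  fmass (Suc m) gam <= ennreal (kA c n m N C C2) * fmass (Suc m) bet + ennreal (kB c n m N C C2 * eps^Suc m * fn alp + dlt)"
proof -
 let ?k = "Suc m"
 define I where "I = Inl ` kys bet Un Inr ` (kys alp \<times> kys (prl m))"
 define u where "u = case_sum (%sig x. phi (sig x)) (%(rho, l) x. theta phi lab m rho (aff l x))"
 define co where "co = case_sum (%sig. \<bar>real_of_int (lkp bet sig)\<bar>) (%(rho, l). \<bar>real_of_int (lkp alp rho)\<bar>*\<bar>real_of_int (lkp (prl m) l)\<bar>)"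
 define d where "d = case_sum (%(sig::pt => 'a) x y. dist (sig x) (sig y)) (%(rho::pt => 'a, l::pt list) x y. eps * l1 ?k x y)"
 \<comment> \<open>A prism piece is compared with the parameter distance scaled by
   \<open>eps\<close>; the volume assigned to a cell is the bound of \<open>wvol_lip\<close> in that
   distance, and \<open>V0\<close> is the sum over all cells.\<close>
 define V where "V = case_sum (%(sig::pt => 'a) j q. wvol ?k sig j q) (%(rho::pt => 'a, l::pt list) j q. ennreal ((2 * real ?k * eps/2^j)^?k))"
 define V0 where "V0 = case_sum (%sig::pt => 'a. enn2real (simplex_volume ?k sig)) (%(rho::pt => 'a, l::pt list). (4 * real ?k * eps)^?k)"
 define C1 where "C1 = c1c C C2"
 define N' where "N' = N + Suc m"
 \<comment> \<open>The slack gets multiplied by \<open>kA\<close> in the end; the added 1 makes the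
   quotient meaningful even for \<open>kA = 0\<close>.\<close>
 define dlt' where "dlt' = dlt/(kA c n m N C C2 + 1)"
 have C11: "(4 * C + 2) * C2 <= C1" "6*(C + 4)*(C2 + 35) <= C1" "0 < C1"
 proof -
  have "0 <= (4 * C + 2) * C2" "0 <= 6*(C + 4)*(C2 + 35)" using C C2 by (auto intro!: mult_nonneg_nonneg)
  thus "(4 * C + 2) * C2 <= C1" "6*(C + 4)*(C2 + 35) <= C1" "0 < C1" unfolding C1_def c1c_def by linarith+
 qed
 have kA0: "0 <= kA c n m N C C2" unfolding kA_def C1_def[symmetric] using C11(3) by (intro push_const_nonneg) simp
 have del': "0 < dlt'" unfolding dlt'_def using del kA0 by simp
 have rad0: "eps <= rad Z eps x" for x by (simp add: rad_def)
 have radZ: "rad Z eps x = eps" if "x : Z" for x using that e by (simp add: rad_def)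
 \<comment> \<open>The local bound covers distances below \<open>eps/16\<close>. Beyond that, two
   points of a simplex are at distance at most 2, which is \<open>32/eps\<close> times
   \<open>eps/16\<close>; hence the added 32.\<close>
 have phg: "l1 M (phi x) (phi y) <= (C2 + 32)/eps * dist x y" if x: "x : K" and y: "y : K" for x y
 proof (cases "dist x y < eps/16")
  case True
  have "l1 M (phi x) (phi y) <= C2/rad Z eps x * dist x y" by (rule phl[OF x y True])
  also have "... <= (C2 + 32)/eps * dist x y" using rad0[of x] e C2 by (intro mult_right_mono frac_le) auto
  finally show ?thesis .
 next
  case False
  have "l1 M (phi x) (phi y) <= 2" by (rule simplex_diam[OF ph(1)[OF x] ph(1)[OF y]])
  also have "2 <= 32/eps * dist x y" using False e by (simp add: field_simps)
  also have "... <= (C2 + 32)/eps * dist x y" using e C2 by (intro mult_right_mono divide_right_mono) auto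
  finally show ?thesis .
 qed
 have "EX L. lipl ?k L (Sx ?k) sig" if "sig : kys bet" for sig using b(1)[OF that] by (auto simp: lip_simplex_iff)
 then obtain Ls where Ls: "!!sig. sig : kys bet ==> lipl ?k (Ls sig) (Sx ?k) sig" by metis
 define Lm where "Lm = (SUM sig:kys bet. Ls sig)"
 have Ls0: "0 <= Ls sig" if "sig : kys bet" for sig using Ls[OF that] by (simp add: lipl_def)
 have Lm0: "0 <= Lm" unfolding Lm_def using Ls0 by (intro sum_nonneg)
 have LsLm: "Ls sig <= Lm" if "sig : kys bet" for sig unfolding Lm_def using that Ls0 by (intro member_le_sum) auto
 have bl: "dist (sig x) (sig y) <= Lm * l1 ?k x y" if s: "sig : kys bet" and x: "x : Sx ?k" and y: "y : Sx ?k" for sig x y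
 proof -
  have "dist (sig x) (sig y) <= Ls sig * l1 ?k x y" using Ls[OF s] x y by (simp add: lipl_def)
  also have "... <= Lm * l1 ?k x y" using LsLm[OF s] by (intro mult_right_mono) auto
  finally show ?thesis .
 qed
 have bK: "sig x : K" if "sig : kys bet" "x : Sx ?k" for sig x using b(2)[OF that(1)] that(2) by blast
 have aK: "rho x : K" if "rho : kys alp" "x : Sx m" for rho x using al(2)[OF that(1)] that(2) by blast
 have aZ: "rho x : Z" if "rho : kys alp" "x : Sx m" for rho x using al(1)[OF that(1)] that(2) by (auto simp: good_def lip_simplex_def)
 have aL: "lipl m eps (Sx m) rho" if "rho : kys alp" for rho using al(1)[OF that] by (simp add: good_def)
 have av: "lab (rho (vtx j)) <= M" "z (lab (rho (vtx j))) = rho (vtx j)" if "rho : kys alp" "j <= m" for rho j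
  using al(1)[OF that(1)] lab that(2) by (auto simp: good_def)
 have ps: "psi lab m rho x : Sx M" if "rho : kys alp" "x : Sx m" for rho x
  by (rule psi_simplex) (use av(1)[OF that(1)] that(2) in auto)
 \<comment> \<open>\<open>C2 + 32\<close> is the speed of the coordinates, \<open>theta_lip\<close>
   adds 3, and the outer 3 is the diameter of a prism piece.\<close>
 define C3 where "C3 = 3*(C2 + 35)"
 have C30: "0 <= C3" unfolding C3_def using C2 by simp
 have thl: "l1 M (theta phi lab m rho (aff l x)) (theta phi lab m rho (aff l y)) <= C3 * l1 ?k x y"
  if r: "rho : kys alp" and l: "l : kys (prl m)" and x: "x : Sx ?k" and y: "y : Sx ?k" for rho l x y
 proof -
  let ?w = "aff l x" and ?w' = "aff l y"
  note pw = prl_aff[OF l x] and pw' = prl_aff[OF l y]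
  let ?x = "?w(Suc m := 0)" and ?y = "?w'(Suc m := 0)"
  have "l1 M (phi (rho ?x)) (phi (rho ?y)) <= (C2 + 32)/eps * dist (rho ?x) (rho ?y)" using pw pw' by (intro phg aK[OF r]) auto
  also have "... <= (C2 + 32)/eps*(eps * l1 m ?x ?y)" using aL[OF r] pw pw' e C2 by (intro mult_left_mono) (auto simp: lipl_def)
  also have "... = (C2 + 32) * l1 m ?w ?w'" using e by (simp add: l1_def)
  finally have f: "l1 M (phi (rho ?x)) (phi (rho ?y)) <= (C2 + 32) * l1 m ?w ?w'" .
  have "l1 M (theta phi lab m rho ?w) (theta phi lab m rho ?w') <= (C2 + 32 + 3) * l1 (Suc m) ?w ?w'"
  proof (rule theta_lip[OF _ _ _ _ f])
   show "phi (rho ?y) : Sx M" by (rule ph(1)[OF aK[OF r conjunct1[OF pw']]])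
   show "psi lab m rho ?y : Sx M" by (rule ps[OF r conjunct1[OF pw']])
  qed (use pw C2 in simp_all)
  also have "... <= (C2 + 32 + 3)*(3 * l1 ?k x y)"
   using C2 by (intro mult_left_mono aff_lip[OF prl_keys(1)[OF l] prl_diam[OF l] x y]) auto
  also have "... = C3 * l1 ?k x y" unfolding C3_def by simp
  finally show ?thesis .
 qed
 have thz: "dist (rho ((aff l x)(Suc m := 0))) (z i) <= (C + 2) * eps"
  if r: "rho : kys alp" and l: "l : kys (prl m)" and x: "x : Sx ?k" and i: "i : sup_of (theta phi lab m rho (aff l x))" for rho l x i
 proof -
  let ?x = "(aff l x)(Suc m := 0)"
  have xs: "?x : Sx m" using prl_aff[OF l x] by blast
  have "phi (rho ?x) i ~= 0 \<or> psi lab m rho ?x i ~= 0" using i by (auto simp: sup_of_def theta_def)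
  thus ?thesis
  proof
   assume "phi (rho ?x) i ~= 0"
   hence "dist (rho ?x) (z i) <= C * rad Z eps (rho ?x)" by (rule ph(3)[OF aK[OF r xs]])
   thus ?thesis using radZ[OF aZ[OF r xs]] e by (simp add: distrib_right)
  next
   assume "psi lab m rho ?x i ~= 0"
   then obtain j where j: "j <= m" "i = lab (rho (vtx j))" using psi_label by blast
   have "dist (rho ?x) (rho (vtx j)) <= 2 * eps" by (rule lipl_simplex_dist[OF aL[OF r] xs vtx_simplex[OF j(1)]])
   moreover have "0 <= C * eps" using C e by simp
   ultimately show ?thesis using av(2)[OF r j(1)] j(2) by (simp add: distrib_right)
  qed
 qed
 define Lu where "Lu = (C2 + 32)/eps * Lm + C3"
 have Lu0: "0 <= Lu" unfolding Lu_def using C2 e Lm0 C30 by (intro add_nonneg_nonneg mult_nonneg_nonneg) auto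
 \<comment> \<open>Parameters within \<open>\<eta>\<close> have images within \<open>eps/16\<close>
   under every simplex of \<open>bet\<close>, the range in which \<open>phl\<close> and the
   multiplicity count are valid.\<close>
 define \<eta> where "\<eta> = eps/(32*(Lm + 1))"
 have eta: "0 < \<eta>" unfolding \<eta>_def using e Lm0 by simp
 have Leta: "Lm*\<eta> < eps/16"
 proof -
  have "Lm*\<eta> <= (Lm + 1)*\<eta>" using eta by (intro mult_right_mono) auto
  also have "(Lm + 1)*\<eta> = eps/32" unfolding \<eta>_def using Lm0 by (simp add: field_simps)
  finally show ?thesis using e by simp
 qed
 have "EX a. (ALL i. 1 <= a i & a i <= 2) & (ALL io:I. lip_simplex Z ?k (restr ?k (%x. FF Z c z ?k M a (u io x)))) &
   (SUM io:I. ennreal (co io) * simplex_volume ?k (restr ?k (%x. FF Z c z ?k M a (u io x)))) <= ennreal (push_const c n ?k N' C1*((SUM io:I. co io * V0 io) + dlt'))"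
 proof (rule push_items[OF Y zZ _ _ _ _ _ _ Lu0 _ eta C11(3) _ _ _ _ del'])
  show "0 < ?k" "?k <= Suc n" "finite I" using mn by (auto simp: I_def)
  fix io assume io: "io : I"
  show "0 <= co io" by (cases io) (auto simp: co_def)
  show "0 <= V0 io" using e by (cases io) (auto simp: V0_def)
  have cases: "(EX sig:kys bet. io = Inl sig) \<or> (EX rho:kys alp. EX l:kys (prl m). io = Inr (rho, l))" using io by (auto simp: I_def)
  show "u io x : Sx M" if x: "x : Sx ?k" for x
   using cases
  proof (elim disjE bexE)
   fix sig assume "sig : kys bet" "io = Inl sig"
   thus ?thesis using ph(1)[OF bK[OF _ x]] by (simp add: u_def)
  next
   fix rho l assume r: "rho : kys alp" and l: "l : kys (prl m)" and i: "io = Inr (rho, l)"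
   note pw = prl_aff[OF l x]
   have "theta phi lab m rho (aff l x) : Sx M" 
   proof (rule theta_simplex)
    show "phi (rho ((aff l x)(Suc m := 0))) : Sx M" by (rule ph(1)[OF aK[OF r conjunct1[OF pw]]])
    show "psi lab m rho ((aff l x)(Suc m := 0)) : Sx M" by (rule ps[OF r conjunct1[OF pw]])
   qed (use pw in simp_all)
   thus ?thesis using i by (simp add: u_def)
  qed
  show "card {i. u io x i ~= 0} <= N'" if x: "x : Sx ?k" for x
   using cases
  proof (elim disjE bexE)
   fix sig assume "sig : kys bet" "io = Inl sig"
   thus ?thesis using ph(2)[OF bK[OF _ x], of sig] by (simp add: u_def N'_def)
  next
   fix rho l assume r: "rho : kys alp" and l: "l : kys (prl m)" and i: "io = Inr (rho, l)"
   let ?x = "(aff l x)(Suc m := 0)"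
   have xs: "?x : Sx m" using prl_aff[OF l x] by blast
   have "card {i. theta phi lab m rho (aff l x) i ~= 0} <= card {i. phi (rho ?x) i ~= 0} + card {i. psi lab m rho ?x i ~= 0}"
    unfolding theta_def
    by (rule card_support_convex) (use finite_sup_of[OF ph(1)[OF aK[OF r xs]]] finite_sup_of[OF ps[OF r xs]] in \<open>simp_all add: sup_of_def\<close>)
   also have "... <= N'" using ph(2)[OF aK[OF r xs]] psi_card[of lab m rho ?x] unfolding N'_def by linarith
   finally show ?thesis using i by (simp add: u_def)
  qed
  show "l1 M (u io x) (u io y) <= Lu * l1 ?k x y" if x: "x : Sx ?k" and y: "y : Sx ?k" for x y
   using cases
  proof (elim disjE bexE)
   fix sig assume s: "sig : kys bet" and i: "io = Inl sig"
   have "l1 M (phi (sig x)) (phi (sig y)) <= (C2 + 32)/eps * dist (sig x) (sig y)" by (rule phg[OF bK[OF s x] bK[OF s y]])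
   also have "... <= (C2 + 32)/eps*(Lm * l1 ?k x y)" using bl[OF s x y] C2 e by (intro mult_left_mono) auto
   also have "... <= Lu * l1 ?k x y" unfolding Lu_def using C30 by (simp add: distrib_right mult.assoc[symmetric])
   finally show ?thesis using i by (simp add: u_def)
  next
   fix rho l assume r: "rho : kys alp" and l: "l : kys (prl m)" and i: "io = Inr (rho, l)"
   have "l1 M (theta phi lab m rho (aff l x)) (theta phi lab m rho (aff l y)) <= C3 * l1 ?k x y" by (rule thl[OF r l x y])
   also have "... <= Lu * l1 ?k x y" unfolding Lu_def using C2 e Lm0 by (intro mult_right_mono) auto
   finally show ?thesis using i by (simp add: u_def)
  qed
  show "EX s>=0. (ALL i:sup_of (u io x) Un sup_of (u io y). ALL j:sup_of (u io x) Un sup_of (u io y). dist (z i) (z j) <= s) & s * l1 M (u io x) (u io y) <= C1 * d io x y"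
   if x: "x : Sx ?k" and y: "y : Sx ?k" and xy: "l1 ?k x y <= \<eta>" for x y
   using cases
  proof (elim disjE bexE)
   fix sig assume s: "sig : kys bet" and i: "io = Inl sig"
   define R where "R = rad Z eps (sig x)"
   have R0: "eps <= R" unfolding R_def by (rule rad0)
   have "Lm * l1 ?k x y <= Lm*\<eta>" using xy Lm0 by (intro mult_left_mono) auto
   hence near: "dist (sig x) (sig y) < eps/16" using bl[OF s x y] Leta by linarith
   have "\<bar>rad Z eps (sig x) - rad Z eps (sig y)\<bar> <= dist (sig x) (sig y)" by (rule rad_lip)
   hence Ry: "rad Z eps (sig y) <= 2 * R" using near R0 e unfolding R_def by linarith
   have "C * rad Z eps (sig y) <= C*(2 * R)" using Ry C by (intro mult_left_mono) auto
   moreover have "0 <= C * R" using C R0 e by simp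
   ultimately have lab1: "dist (sig x) (z i') <= (2 * C + 1) * R" if "i' : sup_of (phi (sig x)) Un sup_of (phi (sig y))" for i'
   proof -
    have "phi (sig x) i' ~= 0 \<or> phi (sig y) i' ~= 0" using that by (auto simp: sup_of_def)
    thus ?thesis
    proof
     assume "phi (sig x) i' ~= 0"
     hence "dist (sig x) (z i') <= C * R" unfolding R_def by (rule ph(3)[OF bK[OF s x]])
     thus ?thesis using \<open>0 <= C * R\<close> R0 e by (simp add: distrib_right)
    next
     assume "phi (sig y) i' ~= 0"
     hence "dist (sig y) (z i') <= C * rad Z eps (sig y)" by (rule ph(3)[OF bK[OF s y]])
     hence "dist (sig x) (z i') <= eps/16 + C*(2 * R)"
      using dist_triangle[of "sig x" "z i'" "sig y"] near \<open>C * rad Z eps (sig y) <= C*(2 * R)\<close> by linarith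
     also have "... <= R + C*(2 * R)" using R0 e by linarith
     also have "... = (2 * C + 1) * R" by (simp add: algebra_simps)
     finally show ?thesis .
    qed
   qed
   have d2: "dist (z i') (z j) <= (4 * C + 2) * R" if "i' : sup_of (phi (sig x)) Un sup_of (phi (sig y))" "j : sup_of (phi (sig x)) Un sup_of (phi (sig y))" for i' j
   proof -
    have "dist (z i') (z j) <= (2 * C + 1) * R + (2 * C + 1) * R" using dist_triangle3[of "z i'" "z j" "sig x"] lab1[OF that(1)] lab1[OF that(2)] by linarith
    thus ?thesis by (simp add: algebra_simps)
   qed
   have R1: "0 < R" using R0 e by linarith
   \<comment> \<open>Scale invariance: the labels spread by \<open>O(R)\<close> while the
     coordinates move at speed \<open>O(1/R)\<close>, so the distance from \<open>Z\<close>
     disappears.\<close>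
   have "(4 * C + 2) * R * l1 M (phi (sig x)) (phi (sig y)) <= (4 * C + 2) * R*(C2/R * dist (sig x) (sig y))"
    using phl[OF bK[OF s x] bK[OF s y] near] C R1 unfolding R_def by (intro mult_left_mono) auto
   also have "... = (4 * C + 2) * C2 * dist (sig x) (sig y)" using R1 by simp
   also have "... <= C1 * dist (sig x) (sig y)" by (rule mult_right_mono[OF C11(1)]) simp
   finally have fin: "(4 * C + 2) * R * l1 M (phi (sig x)) (phi (sig y)) <= C1 * dist (sig x) (sig y)" .
   have s0: "0 <= (4 * C + 2) * R" using C R1 by simp
   have ui: "u io x = phi (sig x)" "u io y = phi (sig y)" "d io x y = dist (sig x) (sig y)" by (simp_all add: i u_def d_def)
   show ?thesis unfolding ui by (intro exI[of _ "(4 * C + 2) * R"] conjI ballI s0 d2 fin)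
  next
   fix rho l assume r: "rho : kys alp" and l: "l : kys (prl m)" and i: "io = Inr (rho, l)"
   define a where "a = rho ((aff l x)(Suc m := 0))"
   define a' where "a' = rho ((aff l y)(Suc m := 0))"
   have aa: "dist a a' <= 2 * eps" unfolding a_def a'_def using prl_aff[OF l x] prl_aff[OF l y] by (intro lipl_simplex_dist[OF aL[OF r]]) auto
   have la: "dist a (z i') <= (C + 4) * eps" if "i' : sup_of (theta phi lab m rho (aff l x)) Un sup_of (theta phi lab m rho (aff l y))" for i'
   proof -
    have "dist a (z i') <= (C + 2) * eps \<or> dist a' (z i') <= (C + 2) * eps"
     using that thz[OF r l x, of i'] thz[OF r l y, of i'] unfolding a_def a'_def by blast
    moreover have "dist a (z i') <= dist a a' + dist a' (z i')" by (rule dist_triangle)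
    moreover have "(C + 4) * eps = (C + 2) * eps + 2 * eps" by (simp add: algebra_simps)
    ultimately show ?thesis using aa e by auto
   qed
   have d2: "dist (z i') (z j) <= 2*(C + 4) * eps" if "i' : sup_of (theta phi lab m rho (aff l x)) Un sup_of (theta phi lab m rho (aff l y))" "j : sup_of (theta phi lab m rho (aff l x)) Un sup_of (theta phi lab m rho (aff l y))" for i' j
   proof -
    have "dist (z i') (z j) <= (C + 4) * eps + (C + 4) * eps" using dist_triangle3[of "z i'" "z j" a] la[OF that(1)] la[OF that(2)] by linarith
    thus ?thesis by (simp add: algebra_simps)
   qed
   have "2*(C + 4) * eps * l1 M (theta phi lab m rho (aff l x)) (theta phi lab m rho (aff l y)) <= 2*(C + 4) * eps*(C3 * l1 ?k x y)"
    using thl[OF r l x y] C e by (intro mult_left_mono) auto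
   also have "... = 6*(C + 4)*(C2 + 35)*(eps * l1 ?k x y)" unfolding C3_def by (simp add: algebra_simps)
   also have "... <= C1*(eps * l1 ?k x y)" using C11(2) e by (intro mult_right_mono) auto
   finally have fin: "2*(C + 4) * eps * l1 M (theta phi lab m rho (aff l x)) (theta phi lab m rho (aff l y)) <= C1*(eps * l1 ?k x y)" .
   have s0: "0 <= 2*(C + 4) * eps" using C e by simp
   have ui: "u io x = theta phi lab m rho (aff l x)" "u io y = theta phi lab m rho (aff l y)" "d io x y = eps * l1 ?k x y" by (simp_all add: i u_def d_def)
   show ?thesis unfolding ui by (intro exI[of _ "2*(C + 4) * eps"] conjI ballI s0 d2 fin)
  qed
  show "wvol ?k g j q <= ennreal (lmb^?k) * V io j q"
   if lmb: "0 < lmb" and g: "lipl ?k L (Sx ?k) g" and gl: "!!x y. x : cel ?k j q ==> y : cel ?k j q ==> dist (g x) (g y) <= lmb * d io x y"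
   for j q L lmb and g :: "pt => 'a"
   using cases
  proof (elim disjE bexE)
   fix sig assume s: "sig : kys bet" and i: "io = Inl sig"
   have "wvol ?k g j q <= ennreal (lmb^?k) * wvol ?k sig j q"
    by (rule wvol_push[OF Ls[OF s] g lmb]) (use gl i in \<open>simp add: d_def\<close>)
   thus ?thesis using i by (simp add: V_def)
  next
   fix rho l assume i: "io = Inr (rho, l)"
   have gc: "lipl ?k (lmb * eps) (cel ?k j q) g" unfolding lipl_def using gl lmb e i by (simp add: d_def mult.assoc)
   have "wvol ?k g j q <= ennreal ((2 * real ?k*(lmb * eps)/2^j)^?k)" by (rule wvol_lip[OF zero_less_Suc g gc])
   also have "(2 * real ?k*(lmb * eps)/2^j)^?k = lmb^?k*(2 * real ?k * eps/2^j)^?k"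
    unfolding power_mult_distrib[symmetric] by (intro arg_cong[of _ _ "%x. x^?k"]) simp
   also have "ennreal ... = ennreal (lmb^?k) * ennreal ((2 * real ?k * eps/2^j)^?k)" using lmb e by (intro ennreal_mult zero_le_power) auto
   finally show ?thesis using i by (simp add: V_def)
  qed
  show "(SUM q:QS ?k j. V io j q) <= ennreal (V0 io)" for j
   using cases
  proof (elim disjE bexE)
   fix sig assume s: "sig : kys bet" and i: "io = Inl sig"
   have "simplex_volume ?k sig <= ennreal ((4 * real ?k * Ls sig)^?k)" by (rule simplex_volume_lip[OF zero_less_Suc Ls[OF s]])
   hence "simplex_volume ?k sig < top" using ennreal_less_top le_less_trans by blast
   thus ?thesis using simplex_volume_sum[OF Ls[OF s], of j] i by (simp add: V_def V0_def)
  next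
   fix rho l assume i: "io = Inr (rho, l)"
   let ?t = "2 * real ?k * eps/2^j"
   have t0: "0 <= ?t" using e by simp
   have "(SUM q:QS ?k j. V io j q) = of_nat (card (QS ?k j)) * ennreal (?t^?k)" using i by (simp add: V_def del: power_Suc)
   also have "... = ennreal (real (card (QS ?k j))*?t^?k)" using t0 by (simp add: ennreal_mult ennreal_of_nat_eq_real_of_nat del: power_Suc)
   also have "... <= ennreal ((4 * real ?k * eps)^?k)"
   proof (rule ennreal_leI)
    have "real (card (QS ?k j)) = real (2^j + 1)^?k" by (simp only: card_QS of_nat_power)
    also have "... <= (2*2^j)^?k" by (intro power_mono) auto
    finally have "real (card (QS ?k j))*?t^?k <= (2*2^j)^?k*?t^?k" using t0 by (intro mult_right_mono zero_le_power) auto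
    also have "... = (4 * real ?k * eps)^?k" unfolding power_mult_distrib[symmetric] by (intro arg_cong[of _ _ "%x. x^?k"]) simp
    finally show "real (card (QS ?k j))*?t^?k <= (4 * real ?k * eps)^?k" .
   qed
   finally show ?thesis using i by (simp add: V0_def)
  qed
 qed
 then obtain a where a: "!!i. 1 <= a i & a i <= 2" and aI: "!!io. io : I ==> lip_simplex Z ?k (restr ?k (%x. FF Z c z ?k M a (u io x)))"
  and av2: "(SUM io:I. ennreal (co io) * simplex_volume ?k (restr ?k (%x. FF Z c z ?k M a (u io x)))) <= ennreal (push_const c n ?k N' C1*((SUM io:I. co io * V0 io) + dlt'))"
  by blast
 define F where "F = FF Z c z ?k M a"
 define Q where "Q = QQ F lab"
 define A where "A = aq c n ?k"
 have cyc: "sbd m alp = 0"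
 proof (cases m)
  case 0 thus ?thesis by (simp add: sbd_zero)
 next
  case (Suc q)
  have "sbd (Suc q) (sbd (Suc (Suc q)) bet) = 0" by (rule sbd_sbd) (use b(1) Suc in \<open>auto simp: lip_simplex_def\<close>)
  thus ?thesis using Suc alp by simp
 qed
 have DDp: "p <= m ==> good Z eps P p rho ==>
  (ALL tau:kys (DD Z c Q p rho). lip_simplex Z (Suc p) tau & lipl (Suc p) (dconst c A p * eps) (Sx (Suc p)) tau & (ALL x:Sx (Suc p). dist (tau x) (rho (vtx 0)) <= dconst c A p * eps)) &
  fn (DD Z c Q p rho) <= dcount p &
  sbd (Suc p) (DD Z c Q p rho) = frag_of rho - frag_of (Q p rho) - frag_extend (DD Z c Q (p - 1)) (sface p rho)" for p rho
 proof (rule DD_properties[where n=m and G="good Z eps P"])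
  show "lip_connected_const Z m c" using Y mn unfolding lip_connected_const_def by auto
  show "2 <= A" unfolding A_def by (rule aq_ge2)
  fix p rho assume "p <= m" "good Z eps P p rho"
  thus "lip_simplex Z p (Q p rho) & lipl p (A * eps) (Sx p) (Q p rho) & (ALL x:Sx p. dist (Q p rho x) (rho (vtx 0)) <= A * eps)"
   unfolding Q_def A_def F_def using mn e by (intro QQ_lip[OF Y zZ _ a lab]) auto
 next
  fix p rho and i :: nat assume "good Z eps P (Suc p) rho" "i <= Suc p"
  thus "good Z eps P p (face (Suc p) i rho)" by (rule good_face)
 next
  fix p rho and i :: nat assume "i <= Suc p"
  thus "face (Suc p) i (Q (Suc p) rho) = Q p (face (Suc p) i rho)" unfolding Q_def by (rule QQ_face)
 qed (use e in \<open>auto simp: good_def\<close>)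
 define G1 where "G1 = frag_extend (%sig. frag_of (restr ?k (%x. F (phi (sig x))))) bet"
 define G2 where "G2 = frag_extend (PP F phi lab m) alp"
 define G3 where "G3 = frag_extend (DD Z c Q m) alp"
 define g where "g = G1 + G2 + G3"
 have s1: "sbd ?k G1 = frag_extend (%rho. frag_of (restr m (%x. F (phi (rho x))))) alp"
  unfolding G1_def alp
 proof (rule sbd_natural)
  fix sig :: "pt => 'a" and i assume i: "i <= Suc m"
  show "face (Suc m) i (restr (Suc m) (%x. F (phi (sig x)))) = restr m (%x. F (phi (face (Suc m) i sig x)))"
  proof -
   have "face (Suc m) i (restr (Suc m) (%x. F (phi (sig x)))) = restr m (%x. F (phi (sig (face_map i x))))" by (rule face_restr[OF i])
   also have "... = restr m (%x. F (phi (face (Suc m) i sig x)))" unfolding restr_def by (rule ext) (simp add: face_apply)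
   finally show ?thesis .
  qed
 qed
 have s2: "sbd ?k G2 = frag_extend (%rho. frag_of (Q m rho)) alp - frag_extend (%rho. frag_of (restr m (%x. F (phi (rho x))))) alp"
 proof -
  have "sbd ?k G2 = frag_extend (%rho. sbd ?k (PP F phi lab m rho)) alp" unfolding G2_def sbd_def by (rule frag_extend_extend)
  also have "... = frag_extend (%rho. frag_of (Q m rho) - frag_of (restr m (%x. F (phi (rho x)))) - frag_extend (PP F phi lab (m - 1)) (sface m rho)) alp"
   unfolding Q_def QQ_def by (intro frag_extend_eq sbd_PP) (use al(1) in \<open>auto simp: good_def lip_simplex_def\<close>)
  also have "... = frag_extend (%rho. frag_of (Q m rho)) alp - frag_extend (%rho. frag_of (restr m (%x. F (phi (rho x))))) alp - frag_extend (PP F phi lab (m - 1)) (sbd m alp)"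
   unfolding frag_extend_fun_diff sbd_def frag_extend_extend ..
  finally show ?thesis by (simp add: cyc)
 qed
 have s3: "sbd ?k G3 = alp - frag_extend (%rho. frag_of (Q m rho)) alp"
 proof -
  have "sbd ?k G3 = frag_extend (%rho. sbd ?k (DD Z c Q m rho)) alp" unfolding G3_def sbd_def by (rule frag_extend_extend)
  also have "... = frag_extend (%rho. frag_of rho - frag_of (Q m rho) - frag_extend (DD Z c Q (m - 1)) (sface m rho)) alp"
   by (rule frag_extend_eq) (use DDp[OF order_refl al(1)] in blast)
  also have "... = alp - frag_extend (%rho. frag_of (Q m rho)) alp - frag_extend (DD Z c Q (m - 1)) (sbd m alp)"
   unfolding frag_extend_fun_diff frag_extend_id sbd_def frag_extend_extend ..
  finally show ?thesis by (simp add: cyc)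
 qed
 have sg: "sbd ?k g = alp" unfolding g_def sbd_add s1 s2 s3 by simp
 have pe: "sg (%w. F (theta phi lab m rho w)) l = restr ?k (%x. FF Z c z ?k M a (u (Inr (rho, l)) x))" if "l : kys (prl m)" for rho l
  using prl_keys(1)[OF that] by (simp add: sg_def restr_def u_def F_def)
 have be: "restr ?k (%x. F (phi (sig x))) = restr ?k (%x. FF Z c z ?k M a (u (Inl sig) x))" for sig
  by (simp add: u_def F_def)
 have keys: "lip_simplex Z ?k tau" if "tau : kys g" for tau
 proof -
  have "tau : kys G1 \<or> tau : kys G2 \<or> tau : kys G3"
   using that Poly_Mapping.keys_add[of "G1 + G2" G3] Poly_Mapping.keys_add[of G1 G2] unfolding g_def by blast
  thus ?thesis
  proof (elim disjE)
   assume "tau : kys G1"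
   then obtain sig where s: "sig : kys bet" "tau = restr ?k (%x. F (phi (sig x)))"
    unfolding G1_def using keys_frag_extend[of "%sig. frag_of (restr ?k (%x. F (phi (sig x))))" bet] by auto
   show ?thesis unfolding s(2) be by (rule aI) (use s(1) in \<open>simp add: I_def\<close>)
  next
   assume "tau : kys G2"
   then obtain rho where r: "rho : kys alp" "tau : kys (PP F phi lab m rho)" unfolding G2_def using keys_frag_extend[of "PP F phi lab m" alp] by blast
   then obtain l where l: "l : kys (prl m)" "tau = sg (%w. F (theta phi lab m rho w)) l"
    unfolding PP_def SG_def using keys_frag_extend[of "%l. frag_of (sg (%w. F (theta phi lab m rho w)) l)" "prl m"] by auto
   show ?thesis unfolding l(2) pe[OF l(1)] by (rule aI) (use r(1) l(1) in \<open>simp add: I_def\<close>)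
  next
   assume "tau : kys G3"
   then obtain rho where "rho : kys alp" "tau : kys (DD Z c Q m rho)" unfolding G3_def using keys_frag_extend[of "DD Z c Q m" alp] by blast
   thus ?thesis using DDp[OF order_refl al(1)] by blast
  qed
 qed
 have m12: "fmass ?k G1 + fmass ?k G2 <= (SUM io:I. ennreal (co io) * simplex_volume ?k (restr ?k (%x. FF Z c z ?k M a (u io x))))"
  unfolding I_def sum_Inl_Inr[OF finite_keys finite_keys finite_keys]
 proof (rule add_mono)
  have "fmass ?k G1 <= (SUM sig:kys bet. ennreal \<bar>real_of_int (lkp bet sig)\<bar> * fmass ?k (frag_of (restr ?k (%x. F (phi (sig x))))))" unfolding G1_def by (rule fmass_extend_le)
  thus "fmass ?k G1 <= (SUM sig:kys bet. ennreal (co (Inl sig)) * simplex_volume ?k (restr ?k (%x. FF Z c z ?k M a (u (Inl sig) x))))"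
   unfolding be[symmetric] by (simp add: co_def)
  have "fmass ?k G2 <= (SUM rho:kys alp. ennreal \<bar>real_of_int (lkp alp rho)\<bar> * fmass ?k (PP F phi lab m rho))" unfolding G2_def by (rule fmass_extend_le)
  also have "... <= (SUM rho:kys alp. SUM l:kys (prl m). ennreal (co (Inr (rho, l))) * simplex_volume ?k (restr ?k (%x. FF Z c z ?k M a (u (Inr (rho, l)) x))))"
  proof (rule sum_mono)
   fix rho
   have "ennreal \<bar>real_of_int (lkp alp rho)\<bar> * fmass ?k (PP F phi lab m rho) \<le>
    ennreal \<bar>real_of_int (lkp alp rho)\<bar>*(SUM l:kys (prl m). ennreal \<bar>real_of_int (lkp (prl m) l)\<bar> * simplex_volume ?k (sg (%w. F (theta phi lab m rho w)) l))"
    unfolding PP_def by (intro mult_left_mono fmass_SG_le) simp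
   also have "... = (SUM l:kys (prl m). ennreal (co (Inr (rho, l))) * simplex_volume ?k (restr ?k (%x. FF Z c z ?k M a (u (Inr (rho, l)) x))))"
    unfolding sum_distrib_left by (intro sum.cong refl) (simp only: pe co_def sum.case prod.case, simp add: ennreal_mult mult.assoc)
   finally show "ennreal \<bar>real_of_int (lkp alp rho)\<bar> * fmass ?k (PP F phi lab m rho) <= (SUM l:kys (prl m). ennreal (co (Inr (rho, l))) * simplex_volume ?k (restr ?k (%x. FF Z c z ?k M a (u (Inr (rho, l)) x))))" .
  qed
  finally show "fmass ?k G2 <= (SUM rho:kys alp. SUM l:kys (prl m). ennreal (co (Inr (rho, l))) * simplex_volume ?k (restr ?k (%x. FF Z c z ?k M a (u (Inr (rho, l)) x))))" .
 qed
 define B where "B = (SUM sig:kys bet. \<bar>real_of_int (lkp bet sig)\<bar> * enn2real (simplex_volume ?k sig))"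
 have B0: "0 <= B" unfolding B_def by (intro sum_nonneg) auto
 have Bf: "fmass ?k bet = ennreal B"
 proof -
  have fin: "simplex_volume ?k sig < top" if "sig : kys bet" for sig
   using simplex_volume_lip[OF zero_less_Suc Ls[OF that]] ennreal_less_top le_less_trans by blast
  have "fmass ?k bet = (SUM sig:kys bet. ennreal (\<bar>real_of_int (lkp bet sig)\<bar> * enn2real (simplex_volume ?k sig)))"
   unfolding fmass_def using fin by (intro sum.cong refl) (simp add: ennreal_mult)
  also have "... = ennreal B" unfolding B_def by (rule sum_ennreal) simp
  finally show ?thesis .
 qed
 define T where "T = (4 * real ?k * eps)^?k"
 have T0: "0 <= T" unfolding T_def using e by simp
 have cV: "(SUM io:I. co io * V0 io) <= B + real ?k * T * fn alp"
 proof -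
  have "(SUM io:I. co io * V0 io) = B + (SUM rho:kys alp. SUM l:kys (prl m). \<bar>real_of_int (lkp alp rho)\<bar>*\<bar>real_of_int (lkp (prl m) l)\<bar> * T)"
   unfolding I_def sum_Inl_Inr[OF finite_keys finite_keys finite_keys] B_def by (simp add: co_def V0_def T_def del: power_Suc)
  also have "(SUM rho:kys alp. SUM l:kys (prl m). \<bar>real_of_int (lkp alp rho)\<bar>*\<bar>real_of_int (lkp (prl m) l)\<bar> * T) = fn alp * fn (prl m) * T"
   unfolding sum_distrib_right[symmetric] sum_distrib_left[symmetric] fn_def ..
  also have "... <= fn alp * real ?k * T"
   using fn_pr[of "%x. x" "upd (Suc m)" "iot m"] T0 unfolding prl_def length_iot by (intro mult_right_mono mult_left_mono) auto
  finally show ?thesis by (simp only: mult_ac)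
 qed
 define X where "X = dcount m*(4 * real ?k * dconst c A m)^?k"
 have dA: "0 <= dconst c A m" unfolding A_def using aq_ge2[of c n ?k] by (intro dconst_nonneg) simp
 have m3: "fmass ?k G3 <= ennreal (X * eps^?k * fn alp)"
 proof -
  define W where "W = (4 * real ?k*(dconst c A m * eps))^?k"
  have W0: "0 <= W" unfolding W_def using dA e by simp
  have one: "fmass ?k (DD Z c Q m rho) <= ennreal (W * dcount m)" if r: "rho : kys alp" for rho
  proof -
   note D = DDp[OF order_refl al(1)[OF r]]
   have "fmass ?k (DD Z c Q m rho) <= ennreal (W * fn (DD Z c Q m rho))"
    unfolding W_def by (rule fmass_bound[OF simplex_volume_lip[OF zero_less_Suc]]) (use D W0 W_def in auto)
   also have "... <= ennreal (W * dcount m)" using D W0 by (intro ennreal_leI mult_left_mono) auto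
   finally show ?thesis .
  qed
  have "fmass ?k G3 <= (SUM rho:kys alp. ennreal \<bar>real_of_int (lkp alp rho)\<bar> * fmass ?k (DD Z c Q m rho))" unfolding G3_def by (rule fmass_extend_le)
  also have "... <= (SUM rho:kys alp. ennreal \<bar>real_of_int (lkp alp rho)\<bar> * ennreal (W * dcount m))" by (intro sum_mono mult_left_mono one) auto
  also have "... = (SUM rho:kys alp. ennreal (\<bar>real_of_int (lkp alp rho)\<bar>*(W * dcount m)))" using W0 dcount_nonneg[of m] by (intro sum.cong refl ennreal_mult[symmetric]) auto
  also have "... = ennreal (SUM rho:kys alp. \<bar>real_of_int (lkp alp rho)\<bar>*(W * dcount m))" using W0 dcount_nonneg[of m] by (intro sum_ennreal) auto
  also have "(SUM rho:kys alp. \<bar>real_of_int (lkp alp rho)\<bar>*(W * dcount m)) = fn alp*(W * dcount m)" unfolding fn_def sum_distrib_right ..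
  also have "W = (4 * real ?k * dconst c A m)^?k * eps^?k" unfolding W_def power_mult_distrib[symmetric] by (simp only: mult.assoc)
  also have "fn alp*((4 * real ?k * dconst c A m)^?k * eps^?k * dcount m) = X * eps^?k * fn alp" unfolding X_def by (simp only: mult_ac)
  finally show ?thesis .
 qed
 define KA where "KA = kA c n m N C C2"
 have KAp: "push_const c n ?k N' C1 = KA" unfolding KA_def kA_def N'_def C1_def ..
 have KA0: "0 <= KA" unfolding KA_def by (rule kA0)
 have kBe: "kB c n m N C C2 = KA*(real ?k*(4 * real ?k)^?k) + X" unfolding kB_def KA_def X_def A_def ..
 have X0: "0 <= X" unfolding X_def using dcount_nonneg[of m] dA by (intro mult_nonneg_nonneg zero_le_power) auto
 have "fmass ?k g <= fmass ?k (G1 + G2) + fmass ?k G3" unfolding g_def by (rule fmass_add)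
 also have "... <= (fmass ?k G1 + fmass ?k G2) + fmass ?k G3" by (intro add_right_mono fmass_add)
 also have "... <= ennreal (KA*((SUM io:I. co io * V0 io) + dlt')) + ennreal (X * eps^?k * fn alp)"
  using order_trans[OF m12 av2] unfolding KAp by (intro add_mono m3)
 also have "... <= ennreal (KA*((B + real ?k * T * fn alp) + dlt')) + ennreal (X * eps^?k * fn alp)"
  using cV KA0 by (intro add_right_mono ennreal_leI mult_left_mono) auto
 also have "... = ennreal (KA*((B + real ?k * T * fn alp) + dlt') + X * eps^?k * fn alp)"
  using KA0 B0 T0 del' X0 e by (intro ennreal_plus[symmetric] mult_nonneg_nonneg add_nonneg_nonneg) auto
 also have "... <= ennreal (KA * B + (kB c n m N C C2 * eps^?k * fn alp + dlt))"
 proof (rule ennreal_leI)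
  have "KA * dlt' <= (KA + 1) * dlt'" using del' by (intro mult_right_mono) auto
  also have "... = dlt" unfolding dlt'_def KA_def[symmetric] using KA0 by simp
  finally have d1: "KA * dlt' <= dlt" .
  have Te: "T = (4 * real ?k)^?k * eps^?k" unfolding T_def by (rule power_mult_distrib)
  have "KA*(real ?k * T * fn alp) + X * eps^?k * fn alp = kB c n m N C C2 * eps^?k * fn alp"
   unfolding kBe Te by (simp only: distrib_right distrib_left mult_ac)
  thus "KA*((B + real ?k * T * fn alp) + dlt') + X * eps^?k * fn alp <= KA * B + (kB c n m N C C2 * eps^?k * fn alp + dlt)"
   using d1 by (simp only: distrib_left)
 qed
 also have "... = ennreal (KA * B) + ennreal (kB c n m N C C2 * eps^?k * fn alp + dlt)"
  unfolding kBe using KA0 B0 X0 e del by (intro ennreal_plus mult_nonneg_nonneg add_nonneg_nonneg zero_le_power) auto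
 also have "ennreal (KA * B) = ennreal KA * fmass ?k bet" unfolding Bf using KA0 B0 by (rule ennreal_mult)
 finally show ?thesis using keys sg unfolding KA_def by blast
qed

section \<open>Assembling the comparison of filling volumes\<close>

definition whitney :: "'a::metric_space set => nat => real => real => ('v => 'a => real) => ('v => 'a) => bool" where
 "whitney Z N C eps w z \<longleftrightarrow> (ALL v x y. \<bar>w v x - w v y\<bar> <= dist x y) & (ALL v x. 0 <= w v x) & (ALL v. z v : Z) &
   (ALL x. finite {v. EX y. dist x y < eps/16 & 0 < w v y} & card {v. EX y. dist x y < eps/16 & 0 < w v y} <= N) &
   (ALL x. rad Z eps x/16 <= (SUM v:{v. 0 < w v x}. w v x)) &
   (ALL v x. 0 < w v x --> dist x (z v) <= C * rad Z eps x)"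

definition coords :: "'a::metric_space set => 'a set => 'a set => nat => real => real => nat => (nat => 'a) => ('a => nat => real) => ('a => nat) => bool" where
 "coords Z K P N C eps M z phi lab \<longleftrightarrow> (ALL i. z i : Z) & (ALL p:P. lab p <= M & z (lab p) = p) &
   (ALL x:K. phi x : Sx M & card {i. phi x i ~= 0} <= N & (ALL i. phi x i ~= 0 --> dist x (z i) <= C * rad Z eps x)) &
   (ALL x:K. ALL y:K. dist x y < eps/16 --> l1 M (phi x) (phi y) <= 64 * real N/rad Z eps x * dist x y)"

lemma coordsD:
 assumes "coords Z K P N C eps M z phi lab"
 shows "!!i. z i : Z" "!!p. p : P ==> lab p <= M & z (lab p) = p"
  "!!x. x : K ==> phi x : Sx M" "!!x. x : K ==> card {i. phi x i ~= 0} <= N"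
  "!!x i. x : K ==> phi x i ~= 0 ==> dist x (z i) <= C * rad Z eps x"
  "!!x y. x : K ==> y : K ==> dist x y < eps/16 ==> l1 M (phi x) (phi y) <= 64 * real N/rad Z eps x * dist x y"
 using assms unfolding coords_def by blast+

lemma whitney_exist:
 fixes Z :: "'a::metric_space set"
 assumes "AN_dim_finite TYPE('a)" and "Z ~= {}"
 shows "EX N C. 0 < C & (ALL eps>0. EX (w :: nat \<times> 'a set => 'a => real) z. whitney Z N C eps w z)"
 unfolding whitney_def by (rule whitney_partition[OF assms])

lemma coords_exist:
 assumes "0 < eps" "Z ~= {}" "compact K" "finite P" "P <= Z" and wh: "whitney Z N C eps w zz"
 shows "EX M z phi lab. coords Z K P N C eps M z phi lab"
 unfolding coords_def
 by (rule partition_coordinates[where w=w and zz=zz, OF assms(1-5)]) (use wh[unfolded whitney_def] in blast)+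

text \<open>\<open>N\<close> and \<open>C\<close> come from the Assouad-Nagata data before
  \<open>eps\<close> is chosen, and the number of labels enters no constant. So \<open>K1\<close>
  and \<open>K2\<close> are uniform in \<open>eps\<close>, in the chain and in the slack, although
  the labels depend on all of them.\<close>

lemma main_filling:
 fixes Z :: "'a::metric_space set"
 assumes Y: "lip_connected_const Z n c" and AN: "AN_dim_finite TYPE('a)" and Z: "Z ~= {}" and mn: "m <= n"
 shows "EX K1 K2. 0 <= K1 & 0 <= K2 & (ALL eps bet dlt. 0 < eps --> 0 < dlt --> (ALL sig:kys bet. lip_simplex (UNIV :: 'a set) (Suc m) sig) \<longrightarrow>
   (ALL rho:kys (sbd (Suc m) bet). lip_simplex Z m rho & lipl m eps (Sx m) rho) \<longrightarrow>
   (EX gam. (ALL sig:kys gam. lip_simplex Z (Suc m) sig) & sbd (Suc m) gam = sbd (Suc m) bet &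
    fmass (Suc m) gam <= ennreal K1 * fmass (Suc m) bet + ennreal (K2 * eps^Suc m * fn (sbd (Suc m) bet) + dlt)))"
proof -
 obtain N C where C: "0 < C" and part: "!!eps. 0 < eps ==> EX (w :: nat \<times> 'a set => 'a => real) z. whitney Z N C eps w z"
  using whitney_exist[OF AN Z] by blast
 define C2 where "C2 = 64 * real N"
 have C20: "0 <= C2" by (simp add: C2_def)
 have "0 <= c1c C C2" unfolding c1c_def using C C20 by (intro add_nonneg_nonneg mult_nonneg_nonneg) auto
 hence K1: "0 <= kA c n m N C C2" unfolding kA_def by (rule push_const_nonneg)
 have "0 <= dconst c (aq c n (Suc m)) m" using aq_ge2[of c n "Suc m"] by (intro dconst_nonneg) simp
 hence K2: "0 <= kB c n m N C C2" unfolding kB_def using K1 dcount_nonneg[of m] by (intro add_nonneg_nonneg mult_nonneg_nonneg zero_le_power) auto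
 have key: "EX gam. (ALL sig:kys gam. lip_simplex Z (Suc m) sig) & sbd (Suc m) gam = sbd (Suc m) bet &
   fmass (Suc m) gam <= ennreal (kA c n m N C C2) * fmass (Suc m) bet + ennreal (kB c n m N C C2 * eps^Suc m * fn (sbd (Suc m) bet) + dlt)"
  if e: "0 < eps" and del: "0 < dlt" and b: "ALL sig:kys bet. lip_simplex (UNIV :: 'a set) (Suc m) sig"
   and al: "ALL rho:kys (sbd (Suc m) bet). lip_simplex Z m rho & lipl m eps (Sx m) rho" for eps bet dlt
 proof -
  define alp where "alp = sbd (Suc m) bet"
  define K where "K = (UN sig:kys bet. sig ` Sx (Suc m)) Un (UN rho:kys alp. rho ` Sx m)"
  define P where "P = (UN rho:kys alp. (%j. rho (vtx j)) ` {..m})"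
  have cs: "compact (sig ` Sx q)" if ls: "lip_simplex S q sig" for S q and sig :: "pt => 'a"
  proof -
   obtain L where "lipl q L (Sx q) sig" using ls by (auto simp: lip_simplex_iff)
   thus ?thesis by (intro compact_continuous_image lipl_continuous compact_simplex)
  qed
  have "compact (UN sig:kys bet. sig ` Sx (Suc m))" using b cs by (intro compact_UN) auto
  moreover have "compact (UN rho:kys alp. rho ` Sx m)" using al cs unfolding alp_def by (intro compact_UN) auto
  ultimately have K: "compact K" unfolding K_def by (rule compact_Un)
  have P: "finite P" "P <= Z"
  proof -
   show "finite P" unfolding P_def by simp
   show "P <= Z"
   proof
    fix x assume "x : P"
    then obtain rho j where "rho : kys alp" "j <= m" "x = rho (vtx j)" unfolding P_def by auto
    thus "x : Z" using al vtx_simplex[of j m] unfolding alp_def lip_simplex_def by blast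
   qed
  qed
  obtain w :: "nat \<times> 'a set => 'a => real" and zz where W: "whitney Z N C eps w zz" using part[OF e] by blast
  obtain M z phi lab where co: "coords Z K P N C eps M z phi lab" using coords_exist[OF e Z K P W] by blast
  have "EX gam. (ALL sig:kys gam. lip_simplex Z (Suc m) sig) & sbd (Suc m) gam = alp &
   fmass (Suc m) gam <= ennreal (kA c n m N C C2) * fmass (Suc m) bet + ennreal (kB c n m N C C2 * eps^Suc m * fn alp + dlt)"
  proof (rule core_filling[where phi=phi and K=K and P=P and lab=lab and M=M and z=z, OF Y mn e C C20 coordsD[OF co, folded C2_def] _ _ alp_def _ _ del])
   fix sig assume s: "sig : kys bet"
   show "lip_simplex UNIV (Suc m) sig" using b s by blast
   show "sig ` Sx (Suc m) <= K" unfolding K_def using s by blast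
  next
   fix rho assume r: "rho : kys alp"
   show "good Z eps P m rho" unfolding good_def P_def using al r unfolding alp_def by blast
   show "rho ` Sx m <= K" unfolding K_def using r by blast
  qed
  thus ?thesis unfolding alp_def .
 qed
 show ?thesis by (intro exI[of _ "kA c n m N C C2"] exI[of _ "kB c n m N C C2"] conjI K1 K2 allI impI key)
qed

lemma lip_simplex_mono: "lip_simplex S k sig ==> S <= T ==> lip_simplex T k sig"
 unfolding lip_simplex_def by blast

lemma lookup_zero_imp: "lkp c = (%_. 0) ==> c = 0"
 by (intro poly_mapping_eqI) simp

lemma kys_extend_SG: "tau : kys (frag_extend (%sig. SG sig c) a) ==> EX sig:kys a. EX l:kys c. tau = sg sig l"
proof -
 assume "tau : kys (frag_extend (%sig. SG sig c) a)"
 then obtain sig where s: "sig : kys a" "tau : kys (SG sig c)" using keys_frag_extend[of "%sig. SG sig c" a] by blast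
 then obtain l where "l : kys c" "tau = sg sig l" unfolding SG_def using keys_frag_extend[of "%l. frag_of (sg sig l)" c] by auto
 thus ?thesis using s(1) by blast
qed

lemma fn_SG: "fn (SG f c) <= fn c"
 unfolding SG_def using fn_extend[of c "%l. frag_of (sg f l)" 1] by simp

text \<open>Subdividing the cycle \<open>M\<close>-fold lowers its Lipschitz constant to
  \<open>eps = O(1/M)\<close>, at the cost of \<open>O(M^m)\<close> simplices and of the massless
  chain \<open>T\<close>. The error \<open>eps^(m + 1)\<close> per simplex then totals
  \<open>X/M\<close>, which can be made smaller than any given \<open>dlt\<close>.\<close>

lemma filling_comparison:
 fixes Z :: "'a::metric_space set"
 assumes Y: "lip_connected_const Z n c" and AN: "AN_dim_finite TYPE('a)" and Z: "Z ~= {}" and mn: "m <= n"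
 shows "EX K>=0. ALL alp. lip_cycle Z m alp --> filling_volume Z m alp <= ennreal K * filling_volume (UNIV :: 'a set) m alp"
proof -
 obtain K1 K2 where K1: "0 <= K1" and K2: "0 <= K2" and main0: "ALL eps bet dlt. 0 < eps --> 0 < dlt --> (ALL sig:kys bet. lip_simplex (UNIV :: 'a set) (Suc m) sig) \<longrightarrow>
   (ALL rho:kys (sbd (Suc m) bet). lip_simplex Z m rho & lipl m eps (Sx m) rho) \<longrightarrow>
   (EX gam. (ALL sig:kys gam. lip_simplex Z (Suc m) sig) & sbd (Suc m) gam = sbd (Suc m) bet &
    fmass (Suc m) gam <= ennreal K1 * fmass (Suc m) bet + ennreal (K2 * eps^Suc m * fn (sbd (Suc m) bet) + dlt))"
  using main_filling[OF Y AN Z mn] by (elim exE conjE) (rule that)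
 note main = main0[THEN spec, THEN spec, THEN spec, THEN mp, THEN mp, THEN mp, THEN mp]
 have claim: "filling_volume Z m alp <= ennreal K1 * mass (Suc m) bet"
  if cyc: "lip_cycle Z m alp" and bc: "lip_chain (UNIV :: 'a set) (Suc m) bet" and bd: "boundary (Suc m) bet = alp" for alp bet
 proof -
  define a where "a = toF alp"
  define b where "b = toF bet"
  have la: "lkp a = alp" unfolding a_def using cyc by (intro lkp_toF) (simp add: lip_cycle_def lip_chain_def)
  have lb: "lkp b = bet" unfolding b_def using bc by (intro lkp_toF) (simp add: lip_chain_def)
  have ka: "lip_simplex Z m rho" if "rho : kys a" for rho using that cyc unfolding supp_lkp[symmetric] la by (simp add: lip_cycle_def lip_chain_def)
  have kb: "lip_simplex UNIV (Suc m) sig" if "sig : kys b" for sig using that bc unfolding supp_lkp[symmetric] lb by (simp add: lip_chain_def)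
  have "lkp (sbd (Suc m) b) = lkp a" unfolding boundary_lkp[symmetric] lb la bd ..
  hence sb: "sbd (Suc m) b = a" by (simp only: lookup_inject)
  have sa: "sbd m a = 0"
  proof (cases m)
   case 0 thus ?thesis by (simp add: sbd_zero)
  next
   case (Suc q)
   have "lkp (sbd (Suc q) a) = (%_. 0)" unfolding boundary_lkp[symmetric] la using cyc Suc by (simp add: lip_cycle_def)
   thus ?thesis unfolding Suc by (rule lookup_zero_imp)
  qed
  have "EX L. lipl m L (Sx m) rho" if "rho : kys a" for rho using ka[OF that] by (auto simp: lip_simplex_iff)
  then obtain Lr where Lr: "!!rho. rho : kys a ==> lipl m (Lr rho) (Sx m) rho" by metis
  define L where "L = (SUM rho:kys a. Lr rho) + 1"
  have Lr0: "0 <= Lr rho" if "rho : kys a" for rho using Lr[OF that] by (simp add: lipl_def)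
  have L0: "0 < L" unfolding L_def using Lr0 by (intro add_nonneg_pos sum_nonneg) auto
  have LL: "lipl m L (Sx m) rho" if r: "rho : kys a" for rho
  proof -
   have "Lr rho <= (SUM rho:kys a. Lr rho)" using r Lr0 by (intro member_le_sum) auto
   thus ?thesis unfolding L_def by (intro lipl_mono[OF Lr[OF r] order_refl]) simp
  qed
  show ?thesis
  proof (rule ennreal_le_epsilon)
   fix dlt :: real assume del: "0 < dlt"
   define X where "X = K2*(L*(real (Suc m)*2))^Suc m*(sd_const (Suc m) * fn a)"
   have X0: "0 <= X" unfolding X_def using K2 L0 sd_const_pos[of "Suc m"] by (intro mult_nonneg_nonneg zero_le_power) auto
   obtain M' :: nat where M': "2 * X/dlt < real M'" using reals_Archimedean2 by blast
   define M where "M = Suc M'"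
   have M0: "0 < M" by (simp add: M_def)
   have XM: "X/real M <= dlt/2"
   proof -
    have "2 * X/dlt <= real M" using M' by (simp add: M_def)
    thus ?thesis using del M0 by (simp add: field_simps)
   qed
   define eps where "eps = L*(real (Suc m)*2/real M)"
   have e: "0 < eps" unfolding eps_def using L0 M0 by (intro mult_pos_pos divide_pos_pos) auto
   define a1 where "a1 = frag_extend (SDs M m) a"
   define T where "T = frag_extend (Ts M m) a"
   have sT: "sbd (Suc m) T = a - a1"
   proof -
    have "sbd (Suc m) T = frag_extend (%rho. sbd (Suc m) (Ts M m rho)) a" unfolding T_def sbd_def by (rule frag_extend_extend)
    also have "... = frag_extend (%rho. frag_of rho - SDs M m rho - frag_extend (Ts M (m - 1)) (sface m rho)) a"
     by (intro frag_extend_eq sbd_Ts[OF M0]) (use ka in \<open>auto simp: lip_simplex_def\<close>)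
    also have "... = a - a1 - frag_extend (Ts M (m - 1)) (sbd m a)"
     unfolding frag_extend_fun_diff frag_extend_id sbd_def frag_extend_extend a1_def ..
    finally show ?thesis by (simp add: sa)
   qed
   have kT: "lip_simplex Z (Suc m) tau & simplex_volume (Suc m) tau = 0" if tT: "tau : kys T" for tau
   proof -
    obtain rho l where r: "rho : kys a" and l: "l : kys (Tl M (Suc m) (iot m))" and t: "tau = sg rho l"
     using tT kys_extend_SG[of tau "Tl M (Suc m) (iot m)" a] unfolding T_def Ts_def by blast
    have len: "length l = Suc (Suc m)" and ls: "set l <= Sx m" using Tl_simplex[OF M0 length_iot set_iot l] by auto
    have s: "lip_simplex Z (Suc m) tau" unfolding t by (rule sg_lip_simplex[OF ka[OF r] ls len])
    then obtain L' where L': "lipl (Suc m) L' (Sx (Suc m)) tau" by (auto simp: lip_simplex_iff)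
    have "tau ` Sx (Suc m) <= rho ` Sx m" using aff_simplex[OF ls len] len by (auto simp: t sg_def)
    hence "simplex_volume (Suc m) tau = 0" by (rule simplex_volume_degenerate[OF LL[OF r] L'])
    thus ?thesis using s by blast
   qed
   have mT: "fmass (Suc m) T = 0" unfolding fmass_def using kT by (intro sum.neutral) auto
   have ka1: "lip_simplex Z m tau & lipl m eps (Sx m) tau" if tT: "tau : kys a1" for tau
   proof -
    obtain rho l where r: "rho : kys a" and l: "l : kys (Sd M (Suc m) (iot m))" and t: "tau = sg rho l"
     using tT kys_extend_SG[of tau "Sd M (Suc m) (iot m)" a] unfolding a1_def SDs_def by blast
    have len: "length l = Suc m" by (rule Sd_length[OF length_iot l])
    have ls: "set l <= Sx m" and D: "!!x y. x : set l ==> y : set l ==> l1 m x y <= real (Suc m)*2/real M"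
     using Sd_simplex[OF M0 length_iot set_iot l] by blast+
    have "lipl m eps (Sx m) tau" unfolding t eps_def by (rule sg_lipl[OF LL[OF r] aff_simplex[OF ls len] len _ D]) simp_all
    thus ?thesis unfolding t using sg_lip_simplex[OF ka[OF r] ls len] by blast
   qed
   \<comment> \<open>\<open>b2\<close> fills the subdivided cycle with mass at most that of
     \<open>b\<close>; adding \<open>T\<close> to the new filling brings the original cycle
     back.\<close>
   define b2 where "b2 = b - T"
   have sb2: "sbd (Suc m) b2 = a1" unfolding b2_def sbd_diff sb sT by simp
   have kb2: "ALL sig:kys b2. lip_simplex UNIV (Suc m) sig"
   proof
    fix sig assume "sig : kys b2"
    hence "sig : kys b \<or> sig : kys T" unfolding b2_def using keys_diff[of b T] by blast
    thus "lip_simplex UNIV (Suc m) sig" using kb kT lip_simplex_mono[of Z "Suc m" sig UNIV] by blast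
   qed
   have "EX gam. (ALL sig:kys gam. lip_simplex Z (Suc m) sig) & sbd (Suc m) gam = sbd (Suc m) b2 &
    fmass (Suc m) gam <= ennreal K1 * fmass (Suc m) b2 + ennreal (K2 * eps^Suc m * fn (sbd (Suc m) b2) + dlt/2)"
    using del by (intro main[OF e _ kb2]) (auto simp: sb2 ka1)
   then obtain g where g: "!!sig. sig : kys g ==> lip_simplex Z (Suc m) sig" "sbd (Suc m) g = a1"
    "fmass (Suc m) g <= ennreal K1 * fmass (Suc m) b2 + ennreal (K2 * eps^Suc m * fn a1 + dlt/2)" unfolding sb2 by blast
   have "filling_volume Z m (lkp a) <= fmass (Suc m) (g + T)"
   proof (rule filling_volume_le)
    show "sbd (Suc m) (g + T) = a" unfolding sbd_add g(2) sT by simp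
    fix sig assume "sig : kys (g + T)"
    thus "lip_simplex Z (Suc m) sig" using g(1) kT Poly_Mapping.keys_add[of g T] by blast
   qed
   also have "... <= fmass (Suc m) g + fmass (Suc m) T" by (rule fmass_add)
   also have "... = fmass (Suc m) g" by (simp add: mT)
   also have "... <= ennreal K1 * fmass (Suc m) b2 + ennreal (K2 * eps^Suc m * fn a1 + dlt/2)" by (rule g(3))
   also have "... <= ennreal K1 * mass (Suc m) bet + ennreal dlt"
   proof (intro add_mono mult_left_mono ennreal_leI)
    have "fmass (Suc m) b2 <= fmass (Suc m) b + fmass (Suc m) T" unfolding b2_def by (rule fmass_diff)
    thus "fmass (Suc m) b2 <= mass (Suc m) bet" unfolding mT lb[symmetric] mass_lkp by simp
    have "fn a1 <= (sd_const (Suc m) * real M^m) * fn a"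
     unfolding a1_def by (rule fn_extend) (use order_trans[OF fn_SG Sd_fn[OF M0 length_iot]] in \<open>simp add: SDs_def del: Sd.simps sd_const.simps\<close>)
    hence le: "K2 * eps^Suc m * fn a1 <= K2 * eps^Suc m*((sd_const (Suc m) * real M^m) * fn a)" using K2 e by (intro mult_left_mono) auto
    \<comment> \<open>Against the \<open>M^m\<close> simplices of the subdivision, the power
      \<open>M^(m + 1)\<close> in the denominator leaves one factor \<open>M\<close> to
      spare.\<close>
    have ee: "eps^Suc m = (L*(real (Suc m)*2))^Suc m/real M^Suc m" unfolding eps_def power_divide[symmetric] by simp
    have "K2 * eps^Suc m*((sd_const (Suc m) * real M^m) * fn a) = X/real M"
     unfolding X_def ee using M0 by (simp add: field_simps del: sd_const.simps of_nat_Suc)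
    thus "K2 * eps^Suc m * fn a1 + dlt/2 <= dlt" using le XM by linarith
   qed simp
   finally show "filling_volume Z m alp <= ennreal K1 * mass (Suc m) bet + ennreal dlt" unfolding la .
  qed
 qed
 show ?thesis
 proof (intro exI[of _ "K1 + 1"] conjI allI impI)
  show "0 <= K1 + 1" using K1 by simp
  fix alp :: "'a chain" assume cyc: "lip_cycle Z m alp"
  \<comment> \<open>The infimum over fillings is handled by dividing by the constant, which
    therefore has to be positive even if \<open>K1 = 0\<close>.\<close>
  let ?K = "K1 + 1"
  have Kp: "0 < ?K" using K1 by simp
  have one: "ennreal ?K*(ennreal (1/?K) * x) = x" for x using Kp by (simp add: mult.assoc[symmetric] ennreal_mult[symmetric])
  have "ennreal (1/?K) * filling_volume Z m alp <= filling_volume UNIV m alp"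
   unfolding filling_volume_def[of UNIV]
  proof (rule Inf_greatest)
   fix x assume "x : {mass (Suc m) bet |bet. lip_chain (UNIV :: 'a set) (Suc m) bet & boundary (Suc m) bet = alp}"
   then obtain bet where x: "x = mass (Suc m) bet" "lip_chain (UNIV :: 'a set) (Suc m) bet" "boundary (Suc m) bet = alp" by blast
   have "filling_volume Z m alp <= ennreal K1 * x" unfolding x(1) by (rule claim[OF cyc x(2,3)])
   also have "... <= ennreal ?K * x" by (intro mult_right_mono ennreal_leI) auto
   finally have "ennreal (1/?K) * filling_volume Z m alp <= ennreal (1/?K)*(ennreal ?K * x)" by (rule mult_left_mono) simp
   thus "ennreal (1/?K) * filling_volume Z m alp <= x" using one[of x] by (simp only: mult.left_commute)
  qed
  hence "ennreal ?K*(ennreal (1/?K) * filling_volume Z m alp) <= ennreal ?K * filling_volume UNIV m alp" by (rule mult_left_mono) simp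
  thus "filling_volume Z m alp <= ennreal ?K * filling_volume UNIV m alp" unfolding one .
 qed
qed

lemma undistorted_of_lip_connected:
 fixes Z :: "'a::metric_space set"
 assumes Y: "lip_connected Z n" and AN: "AN_dim_finite TYPE('a)" and Z: "Z ~= {}"
 shows "undistorted_up_to Z n"
proof -
 obtain c where c: "lip_connected_const Z n c" using Y by (auto simp: lip_connected_def)
 have "EX K>=0. ALL alp. lip_cycle Z m alp --> filling_volume Z m alp <= ennreal K * filling_volume (UNIV :: 'a set) m alp" if "m <= n" for m
  by (rule filling_comparison[OF c AN Z that])
 then obtain K where K: "!!m. m <= n ==> 0 <= K m"
  "!!m alp. m <= n ==> lip_cycle Z m alp ==> filling_volume Z m alp <= ennreal (K m) * filling_volume (UNIV :: 'a set) m alp" by metis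
 define C where "C = (SUM m<=n. K m)"
 have C0: "0 <= C" unfolding C_def using K(1) by (intro sum_nonneg) auto
 have "filling_volume Z m alp <= ennreal C * filling_volume (UNIV :: 'a set) m alp" if m: "m <= n" and cyc: "lip_cycle Z m alp" for m alp
 proof -
  have "K m <= C" unfolding C_def using m K(1) by (intro member_le_sum) auto
  hence "ennreal (K m) * filling_volume (UNIV :: 'a set) m alp <= ennreal C * filling_volume (UNIV :: 'a set) m alp" by (intro mult_right_mono ennreal_leI) auto
  thus ?thesis using K(2)[OF m cyc] order_trans by blast
 qed
 thus ?thesis unfolding undistorted_up_to_def using C0 by blast
qed

theorem theorem1p3:
  fixes Z :: "'a::metric_space set" and n :: nat
  assumes "closed Z" and "Z \<noteq> {}"
    and "geodesic_space TYPE('a)"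
    and "AN_dim_finite TYPE('a)"
    and "lip_connected Z n \<or>
         (lip_connected (UNIV::'a set) n \<and>
          (\<exists>c. \<forall>p\<in>- Z. lip_connected_const (frontier (connected_component_set (- Z) p)) n c))"
  shows "undistorted_up_to Z n"
proof -
 have "lip_connected Z n"
  using assms(5)
 proof
  assume h: "lip_connected (UNIV::'a set) n & (EX c. ALL p:- Z. lip_connected_const (frontier (connected_component_set (- Z) p)) n c)"
  then obtain c where "ALL p:- Z. lip_connected_const (frontier (connected_component_set (- Z) p)) n c" by blast
  with h show ?thesis by (intro lip_connected_of_complement[OF assms(1,3)]) auto
 qed
 thus ?thesis using undistorted_of_lip_connected assms(2,4) by blast
qed

end
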